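(* Let $f\in\mathcal S(G)^{\mathrm{Int}(K)}$ and $N\in\mathbb N$. Then, for every $(m,n)\in E$, $\mathcal G_{\tau_{m,n}}f_{m,n}$ admits a Schwartz extension $u^N_{m,n}$ from $\Sigma^n_{\mathcal D}$ to $\mathbb R^2$ such that $\|u^N_{m,n}\|_{(N)}$ is rapidly decaying in $(m,n)$.
   Context: Group. $G=U_2\ltimes\mathbb C^2$ is the set of pairs $(k,z)$ with product $(k,z)(k',z')=(kk',z+kz')$; $K=U_2$ has normalized Haar measure $dk$. A function $f$ on $G$ is $K$-central if $f(lkl^{-1},lz)=f(k,z)$ for all $l,k\in U_2$, $z\in\mathbb C^2$. $\mathcal S(G)$ is the space of smooth functions on $G$ all of whose left-invariant derivatives decay faster than any power of $|z|$, uniformly in $k$; $\mathcal S(G)^{\mathrm{Int}(K)}$ is its subspace of $K$-central functions. Representations. For an integer $n\ge0$, $V_n$ is the space of holomorphic homogeneous polynomials of degree $n$ on $\mathbb C^2$, with the representation $[\tau_n(k)p](z)=p(k^{-1}z)$ of $SU_2$ and the inner product making $e_n^j(z)=\binom nj^{1/2}z_1^jz_2^{n-j}$, $j=0,\dots,n$, orthonormal. $\mathrm{End}(V_n)$ is identified with matrices in this basis, with indices $0,\dots,n$; $E_{jj}$ has its only nonzero entry, $1$, in position $(j,j)$. Let $E=\{(m,n)\in\mathbb Z^2:n\ge0,\ n-m\in2\mathbb Z\}$; for $(m,n)\in E$ let $\tau_{m,n}$ be the representation of $U_2$ on $V_n$ with $\tau_{m,n}(e^{i\theta}k')=e^{-im\theta}\tau_n(k')$,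 $k'\in SU_2$, and $\chi_{m,n}$ its character. The $\tau_{m,n}$-component of $f$ is $f_{m,n}(k,z)=(n+1)\int_Kf(kl^{-1},z)\overline{\chi_{m,n}(l)}\,dl$, so that $f=\sum_{(m,n)\in E}f_{m,n}$. Transform. Let $\langle z,\zeta\rangle=\mathrm{Re}(z_1\bar\zeta_1+z_2\bar\zeta_2)$, $\sigma$ the normalized surface measure on the unit sphere $S^3\subset\mathbb C^2$, and for $\zeta\in S^3$ let $k_\zeta=\begin{bmatrix}\bar\zeta_2&\zeta_1\\-\bar\zeta_1&\zeta_2\end{bmatrix}$. For $\xi\ge0$, $j=0,\dots,n$ put $\Phi_{\xi,j}(z)=(n+1)\int_{S^3}e^{-i\sqrt\xi\langle z,\zeta\rangle}\tau_n(k_\zeta)E_{jj}\tau_n(k_\zeta)^*\,d\sigma(\zeta)$. Let $\Sigma^n_{\mathcal D}=\{(\xi,(-n+2j)\xi):\xi\ge0,\ 0\le j\le n\}\subset\mathbb R^2$. For $f$ $K$-central with $f=f_{m,n}$ set $A_{m,n}f(z)=\int_Kf(k,z)\tau_{m,n}(k)\,dk\in\mathrm{End}(V_n)$ and $$\mathcal G_{\tau_{m,n}}f\big(\xi,(-n+2j)\xi\big)=\frac1{n+1}\int_{\mathbb C^2}\mathrm{tr}\big(A_{m,n}f(z)\,\Phi_{\xi,j}(-z)\big)\,dz,$$ a function on $\Sigma^n_{\mathcal D}$. A Schwartz extension is a function in $\mathcal S(\mathbb R^2)$ whose restriction to $\Sigma^n_{\mathcal D}$ is the given function. Norm. On $\mathcal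 S(\mathbb R^2)$, $\|u\|_{(N)}=\max_{|\alpha|\le N}\sup_\xi(1+|\xi|^2)^N|\partial^\alpha u(\xi)|$. "Rapidly decaying in $(m,n)$" means bounded by $C_k(1+|m|+n)^{-k}$ for every $k\in\mathbb N$. *)

theory Defs
  imports "HOL-Analysis.Analysis"
begin

section \<open>Smooth and Schwartz functions\<close>

definition dir_deriv :: "'a::euclidean_space \<Rightarrow> ('a \<Rightarrow> complex) \<Rightarrow> 'a \<Rightarrow> complex" where
  "dir_deriv v F = (\<lambda>x. frechet_derivative F (at x) v)"

fun Ck :: "nat \<Rightarrow> ('a::euclidean_space \<Rightarrow> complex) \<Rightarrow> bool" where
  "Ck 0 F \<longleftrightarrow> continuous_on UNIV F"
| "Ck (Suc r) F \<longleftrightarrow> (\<forall>x. F differentiable (at x)) \<and> (\<forall>v. Ck r (dir_deriv v F))"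

definition smooth :: "('a::euclidean_space \<Rightarrow> complex) \<Rightarrow> bool" where
  "smooth F \<longleftrightarrow> (\<forall>r. Ck r F)"

definition partial_deriv :: "nat \<times> nat \<Rightarrow> (real \<times> real \<Rightarrow> complex) \<Rightarrow> real \<times> real \<Rightarrow> complex" where
  "partial_deriv \<alpha> u = (dir_deriv (1, 0) ^^ fst \<alpha>) ((dir_deriv (0, 1) ^^ snd \<alpha>) u)"

definition schwartz_R2 :: "(real \<times> real \<Rightarrow> complex) set" where
  "schwartz_R2 = {u. smooth u \<and>
     (\<forall>\<alpha> N. bdd_above (range (\<lambda>x. (1 + (norm x)\<^sup>2) ^ N * cmod (partial_deriv \<alpha> u x))))}"

definition schwartz_norm :: "nat \<Rightarrow> (real \<times> real \<Rightarrow> complex) \<Rightarrow> real" where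
  "schwartz_norm N u =
     Max ((\<lambda>\<alpha>. SUP x. (1 + (norm x)\<^sup>2) ^ N * cmod (partial_deriv \<alpha> u x)) ` {\<alpha>. fst \<alpha> + snd \<alpha> \<le> N})"


section \<open>The groups\<close>

definition conj_transpose :: "complex^2^2 \<Rightarrow> complex^2^2" where
  "conj_transpose A = map_matrix cnj (transpose A)"

definition U2 :: "(complex^2^2) set" where
  "U2 = {k. k ** conj_transpose k = mat 1 \<and> conj_transpose k ** k = mat 1}"

definition SU2 :: "(complex^2^2) set" where
  "SU2 = {k \<in> U2. det k = 1}"

definition skew_hermitian :: "(complex^2^2) set" where
  "skew_hermitian = {A. conj_transpose A = - A}"

definition normalized_haar_U2 :: "(complex^2^2) measure \<Rightarrow> bool" where
  "normalized_haar_U2 \<mu> \<longleftrightarrow>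
     sets \<mu> = sets (restrict_space borel U2) \<and> emeasure \<mu> U2 = 1 \<and>
     (\<forall>k\<in>U2. distr \<mu> \<mu> (\<lambda>l. k ** l) = \<mu>)"

text \<open>Existence and uniqueness: \<open>normalized_haar_U2_haar_U2\<close> and \<open>normalized_haar_U2_unique\<close> below.\<close>

definition haar_U2 :: "(complex^2^2) measure" where
  "haar_U2 = (THE \<mu>. normalized_haar_U2 \<mu>)"


section \<open>Schwartz functions on the motion group\<close>

text \<open>
  A function on \<open>G = U\<^sub>2 \<ltimes> \<complex>\<^sup>2\<close> is a function on the ambient space \<open>M\<^sub>2(\<complex>) \<times> \<complex>\<^sup>2\<close> of which only the
  values at points \<open>(k, z)\<close> with \<open>k \<in> U2\<close> matter. Since \<open>G\<close> is a closed embedded submanifold, \<open>f\<close> is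
  smooth on \<open>G\<close> iff it agrees on \<open>G\<close> with some smooth function \<open>F\<close> on the ambient space. The Lie
  algebra consists of the pairs \<open>(A, w)\<close> with \<open>A\<close> skew-Hermitian, and by the product rule
  \<open>(k, z) (k', z') = (k k', z + k z')\<close> the corresponding left-invariant vector field has the value
  \<open>(k A, k w)\<close> at \<open>(k, z)\<close>. This vector is tangent to \<open>G\<close>, so the restriction to \<open>G\<close> of
  \<open>left_deriv X F\<close>, and hence of all iterated derivatives, does not depend on the choice of \<open>F\<close>.
\<close>

type_synonym motion = "(complex^2^2) \<times> (complex^2)"

definition left_deriv :: "motion \<Rightarrow> (motion \<Rightarrow> complex) \<Rightarrow> motion \<Rightarrow> complex" where
  "left_deriv X F = (\<lambda>(k, z). frechet_derivative F (at (k, z)) (k ** fst X, k *v snd X))"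

definition schwartz_G :: "(motion \<Rightarrow> complex) set" where
  "schwartz_G = {f. \<exists>F. smooth F \<and> (\<forall>k\<in>U2. \<forall>z. F (k, z) = f (k, z)) \<and>
     (\<forall>Xs N. set Xs \<subseteq> skew_hermitian \<times> UNIV \<longrightarrow>
        (\<exists>C. \<forall>k\<in>U2. \<forall>z. (1 + norm z) ^ N * cmod (foldr left_deriv Xs F (k, z)) \<le> C))}"

definition K_central :: "(motion \<Rightarrow> complex) \<Rightarrow> bool" where
  "K_central f \<longleftrightarrow> (\<forall>l\<in>U2. \<forall>k\<in>U2. \<forall>z. f (l ** k ** matrix_inv l, l *v z) = f (k, z))"

definition schwartz_G_central :: "(motion \<Rightarrow> complex) set" where
  "schwartz_G_central = {f \<in> schwartz_G. K_central f}"


section \<open>Representations\<close>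

definition hom_polys :: "nat \<Rightarrow> (complex^2 \<Rightarrow> complex) set" where
  "hom_polys n = {p. \<exists>c. p = (\<lambda>z. \<Sum>j\<le>n. c j * (z$1) ^ j * (z$2) ^ (n - j))}"

definition basis_V :: "nat \<Rightarrow> nat \<Rightarrow> complex^2 \<Rightarrow> complex" where
  "basis_V n j z = of_real (sqrt (real (n choose j))) * (z$1) ^ j * (z$2) ^ (n - j)"

definition coord_V :: "nat \<Rightarrow> (complex^2 \<Rightarrow> complex) \<Rightarrow> nat \<Rightarrow> complex" where
  "coord_V n p = (THE c. (\<forall>j>n. c j = 0) \<and> p = (\<lambda>z. \<Sum>j\<le>n. c j * basis_V n j z))"

definition tau_act :: "complex^2^2 \<Rightarrow> (complex^2 \<Rightarrow> complex) \<Rightarrow> complex^2 \<Rightarrow> complex" where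
  "tau_act k p = (\<lambda>z. p (matrix_inv k *v z))"

text \<open>
  Elements of \<open>End(hom_polys n)\<close> are matrices in the orthonormal basis \<open>basis_V n 0, \<dots>, basis_V n n\<close>,
  represented by functions \<open>nat \<Rightarrow> nat \<Rightarrow> complex\<close> of which only the entries with both
  indices \<open>\<le> n\<close> are used.
\<close>

type_synonym cmatrix = "nat \<Rightarrow> nat \<Rightarrow> complex"

definition mprod :: "nat \<Rightarrow> cmatrix \<Rightarrow> cmatrix \<Rightarrow> cmatrix" where
  "mprod n A B = (\<lambda>a b. \<Sum>l\<le>n. A a l * B l b)"

definition madjoint :: "cmatrix \<Rightarrow> cmatrix" where
  "madjoint A = (\<lambda>a b. cnj (A b a))"

definition mtrace :: "nat \<Rightarrow> cmatrix \<Rightarrow> complex" where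
  "mtrace n A = (\<Sum>a\<le>n. A a a)"

definition E_diag :: "nat \<Rightarrow> cmatrix" where
  "E_diag j = (\<lambda>a b. if a = j \<and> b = j then 1 else 0)"

definition tau :: "nat \<Rightarrow> complex^2^2 \<Rightarrow> cmatrix" where
  "tau n k = (\<lambda>i j. coord_V n (tau_act k (basis_V n j)) i)"

definition E_index :: "(int \<times> nat) set" where
  "E_index = {(m, n). even (int n - m)}"

text \<open>
  For \<open>(m, n) \<in> E_index\<close> the right-hand side does not depend on the decomposition
  \<open>u = e\<^sup>i\<^sup>\<theta> k'\<close>; see \<open>tau_U2_eq\<close> below.
\<close>

definition tau_U2 :: "int \<Rightarrow> nat \<Rightarrow> complex^2^2 \<Rightarrow> cmatrix" where
  "tau_U2 m n u = (THE M. \<exists>\<theta>. \<exists>k'\<in>SU2. u = mat (cis \<theta>) ** k' \<and>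
     M = (\<lambda>i j. cis (- real_of_int m * \<theta>) * tau n k' i j))"

definition chi :: "int \<Rightarrow> nat \<Rightarrow> complex^2^2 \<Rightarrow> complex" where
  "chi m n k = mtrace n (tau_U2 m n k)"

definition K_component :: "int \<Rightarrow> nat \<Rightarrow> (motion \<Rightarrow> complex) \<Rightarrow> motion \<Rightarrow> complex" where
  "K_component m n f = (\<lambda>(k, z).
     of_nat (n + 1) * (\<integral>l. f (k ** matrix_inv l, z) * cnj (chi m n l) \<partial>haar_U2))"


section \<open>The spherical transform\<close>

text \<open>
  The normalized surface measure, via polar coordinates: the measure of \<open>B \<subseteq> S\<^sup>3\<close> is the proportion
  of the unit ball that is occupied by the cone \<open>{z. z / |z| \<in> B}\<close>.
\<close>

definition sphere_measure :: "(complex^2) measure" where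
  "sphere_measure = distr (uniform_measure lborel (cball 0 1)) borel (\<lambda>z. z /\<^sub>R norm z)"

definition k_sph :: "complex^2 \<Rightarrow> complex^2^2" where
  "k_sph \<zeta> = vector [vector [cnj (\<zeta>$2), \<zeta>$1], vector [- cnj (\<zeta>$1), \<zeta>$2]]"

text \<open>The inner product \<open>z \<bullet> \<zeta>\<close> of \<open>complex^2\<close> is \<open>Re (z\<^sub>1 cnj \<zeta>\<^sub>1 + z\<^sub>2 cnj \<zeta>\<^sub>2)\<close>.\<close>

definition Phi :: "nat \<Rightarrow> real \<Rightarrow> nat \<Rightarrow> complex^2 \<Rightarrow> cmatrix" where
  "Phi n \<xi> j z = (\<lambda>a b. of_nat (n + 1) *
     (\<integral>\<zeta>. cis (- (sqrt \<xi> * (z \<bullet> \<zeta>))) *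
        mprod n (mprod n (tau n (k_sph \<zeta>)) (E_diag j)) (madjoint (tau n (k_sph \<zeta>))) a b
      \<partial>sphere_measure))"

definition A_transform :: "int \<Rightarrow> nat \<Rightarrow> (motion \<Rightarrow> complex) \<Rightarrow> complex^2 \<Rightarrow> cmatrix" where
  "A_transform m n f z = (\<lambda>a b. \<integral>k. f (k, z) * tau_U2 m n k a b \<partial>haar_U2)"

text \<open>The value of the transform of \<open>f\<close> at the point \<open>(\<xi>, (- n + 2 j) \<xi>)\<close>.\<close>

definition G_transform :: "int \<Rightarrow> nat \<Rightarrow> (motion \<Rightarrow> complex) \<Rightarrow> real \<Rightarrow> nat \<Rightarrow> complex" where
  "G_transform m n f \<xi> j = (1 / of_nat (n + 1)) *
     (\<integral>z. mtrace n (mprod n (A_transform m n f z) (Phi n \<xi> j (- z))) \<partial>lborel)"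

text \<open>
  Functions on \<open>{(\<xi>, (- n + 2 j) \<xi>) | \<xi> \<ge> 0, j \<le> n}\<close> are given in the parameters \<open>\<xi>\<close> and \<open>j\<close>;
  at \<open>\<xi> = 0\<close> all \<open>j\<close> describe the same point, where \<open>G_transform\<close> is independent of \<open>j\<close> because
  \<open>Phi n 0 j z\<close> is the identity by Schur's lemma.
\<close>

definition schwartz_extension ::
    "nat \<Rightarrow> (real \<Rightarrow> nat \<Rightarrow> complex) \<Rightarrow> (real \<times> real \<Rightarrow> complex) \<Rightarrow> bool" where
  "schwartz_extension n g u \<longleftrightarrow> u \<in> schwartz_R2 \<and>
     (\<forall>\<xi>\<ge>0. \<forall>j\<le>n. u (\<xi>, (- real n + 2 * real j) * \<xi>) = g \<xi> j)"

definition rapidly_decaying :: "(int \<Rightarrow> nat \<Rightarrow> real) \<Rightarrow> bool" where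
  "rapidly_decaying a \<longleftrightarrow>
     (\<forall>k::nat. \<exists>C. \<forall>(m, n)\<in>E_index. \<bar>a m n\<bar> \<le> C / (1 + \<bar>real_of_int m\<bar> + real n) ^ k)"


section \<open>Well-definedness\<close>

subsection \<open>The representations\<close>


lemma mat2_eq_iff: "A = B \<longleftrightarrow> A$1$1 = B$1$1 \<and> A$1$2 = B$1$2 \<and> A$2$1 = B$2$1 \<and> A$2$2 = B$2$2"
  for A B :: "complex^2^2"
  by (auto simp: vec_eq_iff forall_2)

lemma mmul2_nth: "(A ** B) $ i $ j = A$i$1 * B$1$j + A$i$2 * B$2$j" for A B :: "complex^2^2"
  by (simp add: matrix_matrix_mult_def sum_2)

lemma mvec2_nth: "(A *v z) $ i = A$i$1 * z$1 + A$i$2 * z$2" for A :: "complex^2^2"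
  by (simp add: matrix_vector_mult_def sum_2)

lemma mat2_nth: "mat c $ i $ j = (if i = j then c else 0)"
  by (simp add: mat_def)

lemma mat_mult_commute: "mat c ** A = A ** mat c" for A :: "complex^2^2"
  by (simp add: mat2_eq_iff mmul2_nth mat2_nth)

lemma mat_mult_mat: "(mat c :: complex^2^2) ** mat d = mat (c * d)"
  by (simp add: mat2_eq_iff mmul2_nth mat2_nth)

lemma conj_transpose_nth: "conj_transpose A $ i $ j = cnj (A $ j $ i)"
  by (simp add: conj_transpose_def transpose_def map_matrix_def)

lemma conj_transpose_mult: "conj_transpose (A ** B) = conj_transpose B ** conj_transpose A"
  by (simp add: mat2_eq_iff mmul2_nth conj_transpose_nth mult.commute)

lemma conj_transpose_conj_transpose: "conj_transpose (conj_transpose A) = A"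
  by (simp add: mat2_eq_iff conj_transpose_nth)

lemma conj_transpose_mat: "conj_transpose (mat c) = mat (cnj c)"
  by (simp add: mat2_eq_iff conj_transpose_nth mat2_nth)

lemma U2_I: "k ** conj_transpose k = mat 1 \<Longrightarrow> k \<in> U2"
  by (simp add: U2_def matrix_left_right_inverse)

lemma U2_one: "mat 1 \<in> U2"
  by (simp add: U2_def conj_transpose_mat)

lemma U2_mult: assumes "k \<in> U2" "l \<in> U2" shows "k ** l \<in> U2"
proof (rule U2_I)
  have "(k ** l) ** conj_transpose (k ** l) = k ** (l ** conj_transpose l) ** conj_transpose k"
    by (simp add: conj_transpose_mult matrix_mul_assoc)
  then show "(k ** l) ** conj_transpose (k ** l) = mat 1"
    using assms by (simp add: U2_def)
qed

lemma U2_conj_transpose: "k \<in> U2 \<Longrightarrow> conj_transpose k \<in> U2"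
  by (auto simp: U2_def conj_transpose_conj_transpose)

lemma U2_matrix_inv: assumes "k \<in> U2" shows "matrix_inv k = conj_transpose k"
  unfolding matrix_inv_def
proof (rule some_equality)
  show "k ** conj_transpose k = mat 1 \<and> conj_transpose k ** k = mat 1"
    using assms by (simp add: U2_def)
  fix B assume B: "k ** B = mat 1 \<and> B ** k = mat 1"
  have "B = (B ** k) ** conj_transpose k"
    using assms by (simp add: U2_def flip: matrix_mul_assoc)
  then show "B = conj_transpose k" using B by simp
qed

lemma U2_det: assumes "k \<in> U2" shows "cmod (det k) = 1"
proof -
  have "det (conj_transpose k) = cnj (det k)"
    by (simp add: det_2 conj_transpose_nth mult.commute)
  moreover have "det k * det (conj_transpose k) = 1"
    using assms by (simp add: U2_def flip: det_mul)
  ultimately have "(complex_of_real ((cmod (det k))\<^sup>2)) = 1"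
    by (simp only: complex_norm_square)
  then have "(cmod (det k))\<^sup>2 = 1"
    using of_real_eq_1_iff by blast
  then show ?thesis
    by (metis abs_norm_cancel abs_square_eq_1)
qed

lemma mat_cis_U2: "mat (cis \<theta>) \<in> U2"
  by (rule U2_I) (simp add: conj_transpose_mat mat_mult_mat cis_cnj cis_mult)

lemma det_mat_mult: "det (mat c ** A) = c\<^sup>2 * det A" for A :: "complex^2^2"
  by (simp add: det_2 mmul2_nth mat2_nth power2_eq_square algebra_simps)

lemma U2_decomposition:
  assumes "u \<in> U2" shows "\<exists>\<theta>. \<exists>k\<in>SU2. u = mat (cis \<theta>) ** k"
proof -
  define \<theta> where "\<theta> = Arg (det u) / 2"
  have "det u \<noteq> 0" using U2_det[OF assms] by auto
  then have d: "det u = cis (2 * \<theta>)"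
    using cis_Arg[of "det u"] U2_det[OF assms] by (simp add: \<theta>_def sgn_div_norm)
  define k where "k = mat (cis (- \<theta>)) ** u"
  have "(cis (-\<theta>))\<^sup>2 * det u = 1"
    by (simp add: d power2_eq_square cis_mult)
  then have "k \<in> SU2"
    using assms by (simp add: SU2_def k_def U2_mult mat_cis_U2 det_mat_mult)
  moreover have "u = mat (cis \<theta>) ** k"
    by (simp add: k_def matrix_mul_assoc mat_mult_mat cis_mult)
  ultimately show ?thesis by blast
qed

lemma V_iff_coords: "p \<in> hom_polys n \<longleftrightarrow> (\<exists>c. (\<forall>j>n. c j = 0) \<and> p = (\<lambda>z. \<Sum>j\<le>n. c j * basis_V n j z))"
proof
  assume "p \<in> hom_polys n"
  then obtain c where c: "p = (\<lambda>z. \<Sum>j\<le>n. c j * (z$1) ^ j * (z$2) ^ (n - j))"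
    by (auto simp: hom_polys_def)
  have "p = (\<lambda>z. \<Sum>j\<le>n. (if j \<le> n then c j / of_real (sqrt (real (n choose j))) else 0) * basis_V n j z)"
    unfolding c by (intro ext sum.cong) (auto simp: basis_V_def)
  then show "\<exists>c. (\<forall>j>n. c j = 0) \<and> p = (\<lambda>z. \<Sum>j\<le>n. c j * basis_V n j z)"
    by (intro exI[of _ "\<lambda>j. if j \<le> n then c j / of_real (sqrt (real (n choose j))) else 0"]) auto
next
  assume "\<exists>c. (\<forall>j>n. c j = 0) \<and> p = (\<lambda>z. \<Sum>j\<le>n. c j * basis_V n j z)"
  then obtain c where "p = (\<lambda>z. \<Sum>j\<le>n. c j * basis_V n j z)" by blast
  then have "p = (\<lambda>z. \<Sum>j\<le>n. (c j * of_real (sqrt (real (n choose j)))) * (z$1) ^ j * (z$2) ^ (n - j))"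
    by (simp add: basis_V_def mult.assoc)
  then show "p \<in> hom_polys n"
    unfolding hom_polys_def by (auto intro!: exI[of _ "\<lambda>j. c j * of_real (sqrt (real (n choose j)))"])
qed

lemma coord_V_unique:
  assumes "\<forall>j>n. c j = 0" "\<forall>j>n. d j = 0"
    and "(\<lambda>z. \<Sum>j\<le>n. c j * basis_V n j z) = (\<lambda>z. \<Sum>j\<le>n. d j * basis_V n j z)"
  shows "c = d"
proof -
  have "(\<Sum>j\<le>n. ((c j - d j) * of_real (sqrt (real (n choose j)))) * x ^ j) = 0" for x
    using fun_cong[OF assms(3), of "vector [x, 1]"]
    by (simp add: basis_V_def algebra_simps sum_subtractf)
  then have "\<forall>j\<le>n. (c j - d j) * of_real (sqrt (real (n choose j))) = 0"
    using polyfun_eq_0[of "\<lambda>j. (c j - d j) * of_real (sqrt (real (n choose j)))" n] by blast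
  then have "c j = d j" for j
    using assms(1,2) by (cases "j \<le> n") auto
  then show ?thesis by blast
qed

lemma coord_V_eq:
  assumes "\<forall>j>n. c j = 0" "p = (\<lambda>z. \<Sum>j\<le>n. c j * basis_V n j z)"
  shows "coord_V n p = c"
  unfolding coord_V_def using assms coord_V_unique[of n _ c] by (intro the_equality) auto

lemma coord_V_expand: assumes "p \<in> hom_polys n"
  shows "\<forall>j>n. coord_V n p j = 0" "p = (\<lambda>z. \<Sum>j\<le>n. coord_V n p j * basis_V n j z)"
  using assms coord_V_eq[of n _ p] unfolding V_iff_coords by metis+

lemma V_1: "(\<lambda>z. 1) \<in> hom_polys 0"
  unfolding hom_polys_def by (auto intro!: exI[of _ "\<lambda>_. 1"])

lemma V_add: "p \<in> hom_polys n \<Longrightarrow> q \<in> hom_polys n \<Longrightarrow> (\<lambda>z. p z + q z) \<in> hom_polys n"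
  unfolding hom_polys_def
  by clarify (rule_tac x = "\<lambda>j. c j + ca j" in exI, simp add: algebra_simps sum.distrib)

lemma V_scale: "p \<in> hom_polys n \<Longrightarrow> (\<lambda>z. a * p z) \<in> hom_polys n"
  unfolding hom_polys_def by clarify (rule_tac x = "\<lambda>j. a * c j" in exI, simp add: sum_distrib_left mult_ac)

lemma V_z1: assumes "p \<in> hom_polys n" shows "(\<lambda>z. z$1 * p z) \<in> hom_polys (Suc n)"
proof -
  obtain c where c: "p = (\<lambda>z. \<Sum>j\<le>n. c j * (z$1) ^ j * (z$2) ^ (n - j))"
    using assms by (auto simp: hom_polys_def)
  have "(\<lambda>z. z$1 * p z) = (\<lambda>z. \<Sum>j\<le>Suc n. (case j of 0 \<Rightarrow> 0 | Suc i \<Rightarrow> c i) * (z$1) ^ j * (z$2) ^ (Suc n - j))"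
    unfolding c by (subst sum.atMost_Suc_shift) (simp add: sum_distrib_left mult_ac)
  then show ?thesis unfolding hom_polys_def by blast
qed

lemma V_z2: assumes "p \<in> hom_polys n" shows "(\<lambda>z. z$2 * p z) \<in> hom_polys (Suc n)"
proof -
  obtain c where c: "p = (\<lambda>z. \<Sum>j\<le>n. c j * (z$1) ^ j * (z$2) ^ (n - j))"
    using assms by (auto simp: hom_polys_def)
  have "(\<lambda>z. z$2 * p z) = (\<lambda>z. \<Sum>j\<le>Suc n. (if j \<le> n then c j else 0) * (z$1) ^ j * (z$2) ^ (Suc n - j))"
    unfolding c by (auto simp: sum_distrib_left mult_ac Suc_diff_le intro!: ext sum.cong)
  then show ?thesis unfolding hom_polys_def by (blast intro: exI[of _ "\<lambda>j. if j \<le> n then c j else 0"])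
qed

lemma V_linear_power:
  assumes "p \<in> hom_polys n" shows "(\<lambda>z. (a * z$1 + b * z$2) ^ r * p z) \<in> hom_polys (r + n)"
proof (induction r)
  case (Suc r)
  let ?q = "\<lambda>z. (a * z$1 + b * z$2) ^ r * p z"
  have "(\<lambda>z. a * (z$1 * ?q z) + b * (z$2 * ?q z)) \<in> hom_polys (Suc (r + n))"
    by (intro V_add V_scale V_z1 V_z2 Suc)
  then show ?case by (simp add: algebra_simps)
qed (use assms in simp)

lemma tau_act_basis_V: assumes "j \<le> n" shows "tau_act k (basis_V n j) \<in> hom_polys n"
proof -
  let ?h = "matrix_inv k"
  have "(\<lambda>z. of_real (sqrt (real (n choose j))) *
      ((?h$1$1 * z$1 + ?h$1$2 * z$2) ^ j * ((?h$2$1 * z$1 + ?h$2$2 * z$2) ^ (n - j) * 1))) \<in> hom_polys (j + (n - j + 0))"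
    by (intro V_scale V_linear_power V_1)
  then show ?thesis
    using assms by (simp add: tau_act_def basis_V_def mvec2_nth mult.assoc)
qed

lemma tau_expand:
  assumes "j \<le> n"
  shows "tau_act k (basis_V n j) = (\<lambda>z. \<Sum>i\<le>n. tau n k i j * basis_V n i z)"
  using coord_V_expand(2)[OF tau_act_basis_V[OF assms]] by (simp add: tau_def)

lemma basis_V_zero: "n < j \<Longrightarrow> basis_V n j = (\<lambda>z. 0)"
  by (auto simp: basis_V_def binomial_eq_0)

lemma tau_act_V: "tau_act k (basis_V n j) \<in> hom_polys n"
proof (cases "j \<le> n")
  case False
  then have "tau_act k (basis_V n j) = (\<lambda>z. 0 * 1 * basis_V n n z)"
    by (simp add: basis_V_zero tau_act_def)
  also have "\<dots> \<in> hom_polys n"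
    unfolding hom_polys_def by (auto intro!: exI[of _ "\<lambda>_. 0"])
  finally show ?thesis .
qed (rule tau_act_basis_V)

lemma tau_sign:
  assumes "s = 1 \<or> s = -1" "k \<in> U2"
  shows "tau n (mat s ** k) i j = s ^ n * tau n k i j"
proof -
  have s: "cnj s = s" "s * s = 1" using assms(1) by auto
  have "mat s \<in> U2" by (rule U2_I) (simp add: conj_transpose_mat mat_mult_mat s)
  then have inv: "matrix_inv (mat s ** k) = mat s ** matrix_inv k"
    using assms(2) by (simp add: U2_matrix_inv U2_mult conj_transpose_mult conj_transpose_mat s mat_mult_commute)
  have hom: "basis_V n j (mat s *v w) = s ^ n * basis_V n j w" for w
  proof (cases "j \<le> n")
    case True
    then have "s ^ n = s ^ j * s ^ (n - j)" by (simp flip: power_add)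
    then show ?thesis
      by (simp add: basis_V_def mvec2_nth mat2_nth power_mult_distrib)
  qed (simp add: basis_V_zero)
  let ?c = "coord_V n (tau_act k (basis_V n j))"
  have "tau_act (mat s ** k) (basis_V n j) = (\<lambda>z. s ^ n * tau_act k (basis_V n j) z)"
    by (simp add: tau_act_def inv hom flip: matrix_vector_mul_assoc)
  also have "\<dots> = (\<lambda>z. \<Sum>i\<le>n. (s ^ n * ?c i) * basis_V n i z)"
    by (subst coord_V_expand(2)[OF tau_act_V]) (simp add: sum_distrib_left mult.assoc)
  finally have "coord_V n (tau_act (mat s ** k) (basis_V n j)) = (\<lambda>i. s ^ n * ?c i)"
    using coord_V_expand(1)[OF tau_act_V] by (intro coord_V_eq) auto
  then show ?thesis by (simp add: tau_def)
qed

lemma tau_U2_eq: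
  assumes "(m, n) \<in> E_index" "k \<in> SU2"
  shows "tau_U2 m n (mat (cis \<theta>) ** k) = (\<lambda>i j. cis (- real_of_int m * \<theta>) * tau n k i j)"
  unfolding tau_U2_def
proof (rule the_equality)
  show "\<exists>\<theta>'. \<exists>k'\<in>SU2. mat (cis \<theta>) ** k = mat (cis \<theta>') ** k' \<and>
      (\<lambda>i j. cis (- real_of_int m * \<theta>) * tau n k i j) = (\<lambda>i j. cis (- real_of_int m * \<theta>') * tau n k' i j)"
    using assms(2) by blast
next
  fix M assume "\<exists>\<theta>'. \<exists>k'\<in>SU2. mat (cis \<theta>) ** k = mat (cis \<theta>') ** k' \<and>
      M = (\<lambda>i j. cis (- real_of_int m * \<theta>') * tau n k' i j)"
  then obtain \<theta>' k' where k': "k' \<in> SU2" "mat (cis \<theta>) ** k = mat (cis \<theta>') ** k'"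
    and M: "M = (\<lambda>i j. cis (- real_of_int m * \<theta>') * tau n k' i j)" by blast
  define s where "s = cis (\<theta> - \<theta>')"
  have "mat (cis (-\<theta>')) ** (mat (cis \<theta>) ** k) = mat (cis (-\<theta>')) ** (mat (cis \<theta>') ** k')"
    using k' by simp
  then have sk: "k' = mat s ** k"
    by (simp add: matrix_mul_assoc mat_mult_mat cis_mult s_def)
  then have "s\<^sup>2 = 1"
    using k'(1) assms(2) by (simp add: SU2_def det_mat_mult)
  then have s: "s = 1 \<or> s = -1"
    by (simp add: power2_eq_1_iff)
  have "cis (- real_of_int m * \<theta>') = cis (- real_of_int m * \<theta>) * s powi m"
    by (simp add: s_def cis_power_int cis_mult algebra_simps)
  moreover have "s powi m * s ^ n = 1"
  proof -
    have "s powi m * s ^ n = s powi (m + int n)"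
      using s by (subst power_int_add) auto
    also have "\<dots> = 1"
      using s assms(1) by (auto simp: E_index_def)
    finally show ?thesis .
  qed
  ultimately have "cis (- real_of_int m * \<theta>') * tau n k' i j = cis (- real_of_int m * \<theta>) * tau n k i j" for i j
    using assms(2) s by (simp add: sk tau_sign SU2_def)
  then show "M = (\<lambda>i j. cis (- real_of_int m * \<theta>) * tau n k i j)"
    by (simp add: M)
qed


subsection \<open>Haar measure\<close>


lemma closed_U2: "closed U2"
proof -
  have "U2 = {k. k ** conj_transpose k = mat 1}"
    using U2_I by (auto simp: U2_def)
  also have "\<dots> = {k::complex^2^2. \<forall>i j. k$i$1 * cnj (k$j$1) + k$i$2 * cnj (k$j$2) = mat 1 $ i $ j}"
    by (simp add: vec_eq_iff mmul2_nth conj_transpose_nth)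
  also have "closed \<dots>"
    by (intro closed_Collect_all closed_Collect_eq continuous_intros)
  finally show ?thesis .
qed

lemma U2_borel [measurable]: "U2 \<in> sets borel"
  using closed_U2 by (rule borel_closed)

lemma measurable_U2I:
  assumes "f \<in> borel_measurable M" "\<And>x. x \<in> space M \<Longrightarrow> f x \<in> U2"
  shows "f \<in> measurable M (restrict_space borel U2)"
  using assms by (intro measurable_restrict_space2) auto

lemma measurable_mult_U2:
  "(\<lambda>(k, l). k ** l) \<in> restrict_space borel U2 \<Otimes>\<^sub>M restrict_space borel U2 \<rightarrow>\<^sub>M restrict_space borel U2"
proof (rule measurable_U2I)
  have "continuous_on UNIV (\<lambda>p. fst p ** snd p :: complex^2^2)"
    unfolding matrix_matrix_mult_def by (intro continuous_intros)
  then have "(\<lambda>p. fst p ** snd p :: complex^2^2) \<in> borel_measurable (borel \<Otimes>\<^sub>M borel)"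
    unfolding borel_prod by (rule borel_measurable_continuous_onI)
  moreover have "(\<lambda>p. p) \<in> restrict_space borel U2 \<Otimes>\<^sub>M restrict_space borel U2 \<rightarrow>\<^sub>M borel \<Otimes>\<^sub>M (borel :: (complex^2^2) measure)"
    unfolding measurable_pair_iff comp_def
    by (auto intro!: measurable_compose[OF measurable_fst] measurable_compose[OF measurable_snd] measurable_restrict_space1)
  ultimately show "(\<lambda>(k, l). k ** l) \<in> borel_measurable (restrict_space borel U2 \<Otimes>\<^sub>M restrict_space borel U2)"
    by (auto simp: split_beta' intro: measurable_compose)
qed (auto simp: space_pair_measure space_restrict_space U2_mult)

lemma measurable_conj_transpose_U2:
  "conj_transpose \<in> restrict_space borel U2 \<rightarrow>\<^sub>M restrict_space borel U2"
proof (rule measurable_U2I)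
  have "continuous_on UNIV conj_transpose"
    unfolding conj_transpose_def map_matrix_def transpose_def by (intro continuous_intros)
  then show "conj_transpose \<in> borel_measurable (restrict_space borel U2)"
    by (intro measurable_restrict_space1 borel_measurable_continuous_onI)
qed (auto simp: space_restrict_space U2_conj_transpose)

lemma normalized_haar_U2_inverse:
  assumes \<mu>: "normalized_haar_U2 \<mu>" and \<nu>: "normalized_haar_U2 \<nu>"
    and A [measurable]: "A \<in> sets (restrict_space borel U2)"
  shows "emeasure \<mu> A = (\<integral>\<^sup>+y. indicator A (conj_transpose y) \<partial>\<nu>)"
proof -
  let ?B = "restrict_space borel U2 :: (complex^2^2) measure"
  have sets [measurable_cong]: "sets \<mu> = sets ?B" "sets \<nu> = sets ?B"
    using \<mu> \<nu> by (auto simp: normalized_haar_U2_def)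
  have space: "space \<mu> = U2" "space \<nu> = U2"
    using sets[THEN sets_eq_imp_space_eq] by (auto simp: space_restrict_space)
  interpret \<mu>: finite_measure \<mu>
    using \<mu> by (intro finite_measureI) (simp add: space normalized_haar_U2_def)
  interpret \<nu>: finite_measure \<nu>
    using \<nu> by (intro finite_measureI) (simp add: space normalized_haar_U2_def)
  interpret pair_sigma_finite \<mu> \<nu> ..
  note [measurable] = measurable_mult_U2 measurable_conj_transpose_U2
    define g where "g = (\<lambda>x y. indicator A (conj_transpose y ** x) :: ennreal)"
    have cm: "conj_transpose y ** x \<in> U2" if "x \<in> U2" "y \<in> U2" for x y
      using that by (simp add: U2_mult U2_conj_transpose)
    have m: "(\<lambda>p. conj_transpose (snd p) ** fst p) \<in> ?B \<Otimes>\<^sub>M ?B \<rightarrow>\<^sub>M ?B"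
      using measurable_compose[OF _ measurable_mult_U2, of "\<lambda>p. (conj_transpose (snd p), fst p)" "?B \<Otimes>\<^sub>M ?B"]
      by simp
    have m1: "(\<lambda>x. k ** x) \<in> ?B \<rightarrow>\<^sub>M ?B" if "k \<in> U2" for k
      using measurable_compose[OF _ measurable_mult_U2, of "\<lambda>x. (k, x)" ?B] that
      by (simp add: space_restrict_space)
    have [measurable]: "case_prod g \<in> borel_measurable (\<mu> \<Otimes>\<^sub>M \<nu>)"
      using m unfolding g_def by (simp add: split_beta' cong: measurable_cong_sets sets_pair_measure_cong)
    have 1: "(\<integral>\<^sup>+x. g x y \<partial>\<mu>) = emeasure \<mu> A" if "y \<in> U2" for y
    proof -
      have y: "conj_transpose y \<in> U2" using that by (rule U2_conj_transpose)
      have "(\<integral>\<^sup>+x. indicator A x \<partial>distr \<mu> \<mu> (\<lambda>l. conj_transpose y ** l)) = (\<integral>\<^sup>+x. g x y \<partial>\<mu>)"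
        unfolding g_def using m1[OF y] sets
        by (intro nn_integral_distr) (auto cong: measurable_cong_sets)
      then show ?thesis
        using \<mu> y sets by (simp add: normalized_haar_U2_def)
    qed
    have 2: "(\<integral>\<^sup>+y. g x y \<partial>\<nu>) = (\<integral>\<^sup>+y. indicator A (conj_transpose y) \<partial>\<nu>)" if x: "x \<in> U2" for x
    proof -
      have m2: "(\<lambda>y. conj_transpose y ** x) \<in> ?B \<rightarrow>\<^sub>M ?B"
        using measurable_compose[OF _ measurable_mult_U2, of "\<lambda>y. (conj_transpose y, x)" ?B] x
        by (simp add: space_restrict_space)
      have "(\<integral>\<^sup>+y. g x y \<partial>\<nu>) = (\<integral>\<^sup>+y. g x y \<partial>distr \<nu> \<nu> (\<lambda>l. x ** l))"
        using \<nu> x by (simp add: normalized_haar_U2_def)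
      also have "\<dots> = (\<integral>\<^sup>+y. g x (x ** y) \<partial>\<nu>)"
        using m1[OF x] m2 sets unfolding g_def by (intro nn_integral_distr) (auto cong: measurable_cong_sets)
      also have "\<dots> = (\<integral>\<^sup>+y. indicator A (conj_transpose y) \<partial>\<nu>)"
        using x by (intro nn_integral_cong)
          (simp add: g_def conj_transpose_mult U2_def flip: matrix_mul_assoc)
      finally show ?thesis .
    qed
    have "emeasure \<mu> A = (\<integral>\<^sup>+y. emeasure \<mu> A \<partial>\<nu>)"
      using \<nu> by (simp add: space normalized_haar_U2_def)
    also have "\<dots> = (\<integral>\<^sup>+y. (\<integral>\<^sup>+x. g x y \<partial>\<mu>) \<partial>\<nu>)"
      by (intro nn_integral_cong) (simp add: 1 space)
    also have "\<dots> = (\<integral>\<^sup>+x. (\<integral>\<^sup>+y. g x y \<partial>\<nu>) \<partial>\<mu>)"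
      by (rule Fubini') measurable
    also have "\<dots> = (\<integral>\<^sup>+x. (\<integral>\<^sup>+y. indicator A (conj_transpose y) \<partial>\<nu>) \<partial>\<mu>)"
    proof (rule nn_integral_cong)
      fix x assume "x \<in> space \<mu>"
      then show "(\<integral>\<^sup>+y. g x y \<partial>\<nu>) = (\<integral>\<^sup>+y. indicator A (conj_transpose y) \<partial>\<nu>)"
        by (simp add: 2 space)
    qed
    also have "\<dots> = (\<integral>\<^sup>+y. indicator A (conj_transpose y) \<partial>\<nu>)"
      using \<mu> by (simp add: space normalized_haar_U2_def)
    finally show ?thesis .
qed

lemma normalized_haar_U2_unique:
  assumes \<mu>: "normalized_haar_U2 \<mu>" and \<nu>: "normalized_haar_U2 \<nu>"
  shows "\<mu> = \<nu>"
proof (rule measure_eqI)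
  show "sets \<mu> = sets \<nu>"
    using \<mu> \<nu> by (simp add: normalized_haar_U2_def)
  show "emeasure \<mu> A = emeasure \<nu> A" if "A \<in> sets \<mu>" for A
    using that \<mu> normalized_haar_U2_inverse[OF \<mu> \<nu>] normalized_haar_U2_inverse[OF \<nu> \<nu>]
    by (simp add: normalized_haar_U2_def)
qed



lemma lborel_distr_isometry:
  fixes T :: "'a::euclidean_space \<Rightarrow> 'a"
  assumes T: "orthogonal_transformation T"
  shows "distr lborel borel T = lborel"
proof (rule measure_eqI)
  fix A assume "A \<in> sets (distr lborel borel T)"
  then have A [measurable]: "A \<in> sets borel" by simp
  let ?\<nu> = "distr lborel borel T" and ?B = "ball 0 1 :: 'a set"
  have T_meas [measurable]: "T \<in> borel_measurable borel"
    using T by (intro borel_measurable_continuous_onI linear_continuous_on)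
      (simp add: linear_conv_bounded_linear orthogonal_transformation_def)
  have T_add: "T (x + y) = T x + T y" and T_neg: "T (- x) = - T x" for x y
    using T by (simp_all add: orthogonal_transformation_def linear_add linear_neg)
  have shift: "(\<integral>\<^sup>+x. f (x + a) \<partial>lborel) = (\<integral>\<^sup>+x. f x \<partial>lborel)"
    if [measurable]: "f \<in> borel_measurable borel" for f :: "'a \<Rightarrow> ennreal" and a
  proof -
    have "(\<integral>\<^sup>+x. f x \<partial>lborel) = (\<integral>\<^sup>+x. f x \<partial>distr lborel borel ((+) a))"
      by (simp add: lborel_distr_plus)
    also have "\<dots> = (\<integral>\<^sup>+x. f (a + x) \<partial>lborel)"
      by (intro nn_integral_distr) auto
    finally show ?thesis by (simp add: add.commute)
  qed
  have refl: "(\<integral>\<^sup>+x. f (- x) \<partial>lborel) = (\<integral>\<^sup>+x. f x \<partial>lborel)"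
    if [measurable]: "f \<in> borel_measurable borel" for f :: "'a \<Rightarrow> ennreal"
  proof -
    have "(\<integral>\<^sup>+x. f x \<partial>lborel) = (\<integral>\<^sup>+x. f x \<partial>distr lborel borel (\<lambda>x. 0 + (-1) *\<^sub>R x))"
      using lborel_affine[of "-1" "0::'a"] by (simp add: density_1)
    also have "\<dots> = (\<integral>\<^sup>+x. f (0 + (-1) *\<^sub>R x) \<partial>lborel)"
      by (intro nn_integral_distr) auto
    finally show ?thesis by simp
  qed
  have surj: "\<exists>b. a = T b" for a
    using orthogonal_transformation_surj[OF T] by (auto simp: surj_def)
  have \<nu>: "(\<integral>\<^sup>+x. f x \<partial>?\<nu>) = (\<integral>\<^sup>+x. f (T x) \<partial>lborel)"
    if [measurable]: "f \<in> borel_measurable borel" for f :: "'a \<Rightarrow> ennreal"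
    by (intro nn_integral_distr) auto
  have swap: "(\<integral>\<^sup>+x. indicator X x \<partial>lborel) * (\<integral>\<^sup>+y. indicator Y (T y) \<partial>lborel) =
      (\<integral>\<^sup>+y. (\<integral>\<^sup>+x. indicator X x * indicator Y (T y - x) \<partial>lborel) \<partial>lborel)"
    if [measurable]: "X \<in> sets borel" "Y \<in> sets borel" for X Y :: "'a set"
  proof -
    have "(\<integral>\<^sup>+y. indicator Y (T y - x) \<partial>lborel) = (\<integral>\<^sup>+y. indicator Y (T y) \<partial>lborel)" for x
    proof -
      obtain b where b: "- x = T b" using surj by blast
      have "(\<integral>\<^sup>+y. indicator Y (T y - x) \<partial>lborel) = (\<integral>\<^sup>+y. indicator Y (T (y + b)) \<partial>lborel)"
        by (simp add: T_add flip: b)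
      also have "\<dots> = (\<integral>\<^sup>+y. indicator Y (T y) \<partial>lborel)"
        by (rule shift[of "\<lambda>y. indicator Y (T y)"]) measurable
      finally show ?thesis .
    qed
    then have "(\<integral>\<^sup>+x. indicator X x \<partial>lborel) * (\<integral>\<^sup>+y. indicator Y (T y) \<partial>lborel) =
        (\<integral>\<^sup>+x. (\<integral>\<^sup>+y. indicator X x * indicator Y (T y - x) \<partial>lborel) \<partial>lborel)"
      by (simp add: nn_integral_cmult nn_integral_multc)
    also have "\<dots> = (\<integral>\<^sup>+y. (\<integral>\<^sup>+x. indicator X x * indicator Y (T y - x) \<partial>lborel) \<partial>lborel)"
      by (rule lborel_pair.Fubini') measurable
    finally show ?thesis .
  qed
  have "(\<integral>\<^sup>+x. indicator A x \<partial>lborel) * (\<integral>\<^sup>+y. indicator ?B (T y) \<partial>lborel) =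
      (\<integral>\<^sup>+y. (\<integral>\<^sup>+x. indicator A x * indicator ?B (T y - x) \<partial>lborel) \<partial>lborel)"
    by (rule swap) auto
  also have "\<dots> = (\<integral>\<^sup>+y. (\<integral>\<^sup>+x. indicator ?B x * indicator A (T y - x) \<partial>lborel) \<partial>lborel)"
  proof (rule nn_integral_cong)
    fix y
    let ?f = "\<lambda>x. indicator A x * indicator ?B (T y - x) :: ennreal"
    have [measurable]: "?B \<in> sets borel" by simp
    have [measurable]: "?f \<in> borel_measurable borel"
      by (intro borel_measurable_times_ennreal measurable_compose[OF _ borel_measurable_indicator, of _ _ borel ?B]) auto
    have "(\<integral>\<^sup>+x. ?f x \<partial>lborel) = (\<integral>\<^sup>+x. ?f (x + T y) \<partial>lborel)"
      by (rule shift[symmetric]) measurable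
    also have "\<dots> = (\<integral>\<^sup>+x. ?f (- x + T y) \<partial>lborel)"
      by (rule refl[symmetric]) measurable
    finally show "(\<integral>\<^sup>+x. ?f x \<partial>lborel) = (\<integral>\<^sup>+x. indicator ?B x * indicator A (T y - x) \<partial>lborel)"
      by (simp add: mult.commute)
  qed
  also have "\<dots> = (\<integral>\<^sup>+x. indicator ?B x \<partial>lborel) * (\<integral>\<^sup>+y. indicator A (T y) \<partial>lborel)"
    by (rule swap[symmetric]) auto
  also have "(\<integral>\<^sup>+y. indicator A (T y) \<partial>lborel) = emeasure ?\<nu> A"
    using \<nu>[of "indicator A"] by simp
  also have "(\<integral>\<^sup>+y. indicator ?B (T y) \<partial>lborel) = (\<integral>\<^sup>+y. indicator ?B y \<partial>lborel)"
    by (simp add: indicator_def orthogonal_transformation_norm[OF T] dist_norm)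
  finally have "emeasure lborel ?B * emeasure ?\<nu> A = emeasure lborel ?B * emeasure lborel A"
    by (simp add: mult.commute)
  moreover have "emeasure lborel ?B \<noteq> 0"
  proof
    assume "emeasure lborel ?B = 0"
    then have "?B \<in> null_sets lborel" by (simp add: null_sets_def)
    then have "negligible ?B" by (simp add: negligible_iff_null_sets null_sets_completionI)
    then show False using open_not_negligible[of ?B] by simp
  qed
  moreover have "emeasure lborel ?B \<noteq> \<infinity>"
    using emeasure_lborel_ball_finite by (metis less_irrefl infinity_ennreal_def)
  ultimately show "emeasure ?\<nu> A = emeasure lborel A"
    by (simp add: ennreal_mult_cancel_left)
qed simp

definition unit_ball_measure :: "'a::euclidean_space measure" where
  "unit_ball_measure = uniform_measure lborel (cball 0 1)"

lemma sets_unit_ball_measure [measurable_cong]: "sets unit_ball_measure = sets borel"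
  by (simp add: unit_ball_measure_def)

lemma space_unit_ball_measure [simp]: "space unit_ball_measure = UNIV"
  by (simp add: unit_ball_measure_def)

lemma emeasure_cball_pos_finite: "emeasure lborel (cball 0 1 :: 'a::euclidean_space set) \<noteq> 0"
  "emeasure lborel (cball 0 1 :: 'a::euclidean_space set) \<noteq> \<infinity>"
proof
  assume "emeasure lborel (cball 0 1 :: 'a set) = 0"
  then have "(cball 0 1 :: 'a set) \<in> null_sets lborel" by (simp add: null_sets_def)
  then have "negligible (cball 0 1 :: 'a set)" by (simp add: negligible_iff_null_sets null_sets_completionI)
  then have "negligible (ball 0 1 :: 'a set)" using negligible_subset ball_subset_cball by blast
  then show False using open_not_negligible[of "ball 0 1 :: 'a set"] by simp
next
  show "emeasure lborel (cball 0 1 :: 'a set) \<noteq> \<infinity>"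
    using emeasure_lborel_cball_finite by (metis less_irrefl infinity_ennreal_def)
qed

lemma emeasure_unit_ball_measure: "emeasure unit_ball_measure (UNIV :: 'a::euclidean_space set) = 1"
  using emeasure_cball_pos_finite[where 'a='a]
  by (simp add: unit_ball_measure_def emeasure_uniform_measure ennreal_divide_self top.not_eq_extremum)

lemma AE_unit_ball_measure: "AE x in unit_ball_measure. x \<noteq> (0 :: 'a::euclidean_space)"
proof -
  have "AE x in lborel. x \<noteq> (0::'a)" by (rule AE_lborel_singleton)
  then show ?thesis
    unfolding unit_ball_measure_def by (intro AE_uniform_measureI) auto
qed

lemma unit_ball_measure_isometry:
  fixes T :: "'a::euclidean_space \<Rightarrow> 'a" and f :: "'a \<Rightarrow> ennreal"
  assumes T: "orthogonal_transformation T" and [measurable]: "f \<in> borel_measurable borel"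
  shows "(\<integral>\<^sup>+x. f (T x) \<partial>unit_ball_measure) = (\<integral>\<^sup>+x. f x \<partial>unit_ball_measure)"
proof -
  have [measurable]: "T \<in> borel_measurable borel"
    using T by (intro borel_measurable_continuous_onI linear_continuous_on)
      (simp add: linear_conv_bounded_linear orthogonal_transformation_def)
  let ?c = "emeasure lborel (cball 0 1 :: 'a set)"
  have "(\<integral>\<^sup>+x. f x * indicator (cball 0 1) x \<partial>lborel) = (\<integral>\<^sup>+x. f x * indicator (cball 0 1) x \<partial>distr lborel borel T)"
    by (simp add: lborel_distr_isometry[OF T])
  also have "\<dots> = (\<integral>\<^sup>+x. f (T x) * indicator (cball 0 1) (T x) \<partial>lborel)"
    by (intro nn_integral_distr borel_measurable_times_ennreal borel_measurable_indicator) auto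
  also have "\<dots> = (\<integral>\<^sup>+x. f (T x) * indicator (cball 0 1) x \<partial>lborel)"
    by (simp add: indicator_def orthogonal_transformation_norm[OF T] dist_norm)
  finally show ?thesis
    by (simp add: unit_ball_measure_def nn_integral_uniform_measure)
qed



lemma norm_vec2: "(norm z)\<^sup>2 = (cmod (z$1))\<^sup>2 + (cmod (z$2))\<^sup>2" for z :: "complex^2"
  by (simp add: norm_vec_def L2_set_def sum_2)

lemma SU2_entries:
  assumes "k \<in> SU2" shows "k$1$1 = cnj (k$2$2)" "k$2$1 = - cnj (k$1$2)"
proof -
  define B :: "complex^2^2" where "B = vector [vector [k$2$2, - (k$1$2)], vector [- (k$2$1), k$1$1]]"
  have d: "k$1$1 * k$2$2 - k$1$2 * k$2$1 = 1" and k: "conj_transpose k ** k = mat 1"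
    using assms by (simp_all add: SU2_def U2_def det_2)
  have "k ** B = mat 1"
    using d by (simp add: mat2_eq_iff mmul2_nth mat2_nth B_def algebra_simps)
  then have "conj_transpose k = B"
    by (metis k matrix_mul_assoc matrix_mul_lid matrix_mul_rid)
  then have "conj_transpose k $ 1 $ 1 = k$2$2" "conj_transpose k $ 1 $ 2 = - (k$1$2)"
    by (simp_all add: B_def)
  then show "k$1$1 = cnj (k$2$2)" "k$2$1 = - cnj (k$1$2)"
    by (simp_all add: conj_transpose_nth) (metis complex_cnj_cnj complex_cnj_minus)+
qed

lemma k_sph_SU2: assumes "norm \<zeta> = 1" shows "k_sph \<zeta> \<in> SU2"
proof -
  have "\<zeta>$1 * cnj (\<zeta>$1) + \<zeta>$2 * cnj (\<zeta>$2) = of_real ((norm \<zeta>)\<^sup>2)"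
    by (simp add: norm_vec2 flip: complex_norm_square)
  then have *: "\<zeta>$1 * cnj (\<zeta>$1) + \<zeta>$2 * cnj (\<zeta>$2) = 1" using assms by simp
  have "k_sph \<zeta> ** conj_transpose (k_sph \<zeta>) = mat 1"
    using * by (simp add: mat2_eq_iff mmul2_nth mat2_nth conj_transpose_nth k_sph_def algebra_simps)
  moreover have "det (k_sph \<zeta>) = 1"
    using * by (simp add: det_2 k_sph_def algebra_simps)
  ultimately show ?thesis by (simp add: SU2_def U2_I)
qed

lemma SU2_mult_k_sph: "k \<in> SU2 \<Longrightarrow> k ** k_sph \<zeta> = k_sph (k *v \<zeta>)"
  using SU2_entries[of k]
  by (simp add: mat2_eq_iff mmul2_nth mvec2_nth k_sph_def algebra_simps)

lemma U2_orthogonal_transformation: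
  assumes "k \<in> U2" shows "orthogonal_transformation (\<lambda>z. k *v z)"
proof -
  have "norm (k *v z) = norm z" for z :: "complex^2"
  proof -
    have ip: "complex_of_real ((norm w)\<^sup>2) = cnj (w$1) * w$1 + cnj (w$2) * w$2" for w :: "complex^2"
      unfolding norm_vec2 of_real_add complex_norm_square by (simp add: mult.commute)
    have k: "conj_transpose k ** k = mat 1" using assms by (simp add: U2_def)
    have e: "cnj (k$1$1) * k$1$1 + cnj (k$2$1) * k$2$1 = 1" "cnj (k$1$1) * k$1$2 + cnj (k$2$1) * k$2$2 = 0"
       "cnj (k$1$2) * k$1$1 + cnj (k$2$2) * k$2$1 = 0" "cnj (k$1$2) * k$1$2 + cnj (k$2$2) * k$2$2 = 1"
      using k by (simp_all add: mat2_eq_iff mmul2_nth mat2_nth conj_transpose_nth)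
    have "complex_of_real ((norm (k *v z))\<^sup>2) =
        (cnj (k$1$1) * k$1$1 + cnj (k$2$1) * k$2$1) * (cnj (z$1) * z$1)
      + (cnj (k$1$1) * k$1$2 + cnj (k$2$1) * k$2$2) * (cnj (z$1) * z$2)
      + (cnj (k$1$2) * k$1$1 + cnj (k$2$2) * k$2$1) * (cnj (z$2) * z$1)
      + (cnj (k$1$2) * k$1$2 + cnj (k$2$2) * k$2$2) * (cnj (z$2) * z$2)"
      unfolding ip by (simp add: mvec2_nth algebra_simps)
    also have "\<dots> = complex_of_real ((norm z)\<^sup>2)"
      unfolding e ip by simp
    finally have "(norm (k *v z))\<^sup>2 = (norm z)\<^sup>2" by (simp only: of_real_eq_iff)
    then show ?thesis by (simp add: power2_eq_iff_nonneg)
  qed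
  moreover have "linear (\<lambda>z. k *v z)"
    by (rule linearI) (simp_all add: vec_eq_iff forall_2 mvec2_nth algebra_simps)
  ultimately show ?thesis by (simp add: orthogonal_transformation)
qed

text \<open>
  The explicit model of Haar measure is the image of the uniform distribution on the product of the
  unit balls of \<open>\<complex>\<close> and \<open>\<complex>\<^sup>2\<close>, projected radially to \<open>S\<^sup>1 \<times> S\<^sup>3\<close>, under \<open>(c, \<zeta>) \<mapsto> c k\<^sub>\<zeta>\<close>.
\<close>

definition haar_param :: "complex \<Rightarrow> complex^2 \<Rightarrow> complex^2^2" where
  "haar_param w \<zeta> = (if w \<noteq> 0 \<and> \<zeta> \<noteq> 0 then mat (sgn w) ** k_sph (\<zeta> /\<^sub>R norm \<zeta>) else mat 1)"

lemma mat_unit_U2: assumes "cmod c = 1" shows "mat c \<in> U2"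
proof -
  have "c * cnj c = 1" using assms by (simp flip: complex_norm_square)
  then show ?thesis by (intro U2_I) (simp add: conj_transpose_mat mat_mult_mat)
qed

lemma haar_param_U2: "haar_param w \<zeta> \<in> U2"
proof -
  have "k_sph (\<zeta> /\<^sub>R norm \<zeta>) \<in> U2" if "\<zeta> \<noteq> 0"
    using k_sph_SU2[of "\<zeta> /\<^sub>R norm \<zeta>"] that by (simp add: SU2_def)
  then show ?thesis
    by (simp add: haar_param_def U2_mult mat_unit_U2 U2_one norm_sgn)
qed

lemma continuous_on_k_sph: "continuous_on UNIV k_sph"
proof -
  have eq: "k_sph = (\<lambda>\<zeta>. \<chi> i j. if i = 1 then (if j = 1 then cnj (\<zeta>$2) else \<zeta>$1)
      else (if j = 1 then - cnj (\<zeta>$1) else \<zeta>$2))"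
    by (intro ext) (simp add: mat2_eq_iff k_sph_def)
  have "continuous_on UNIV (\<lambda>\<zeta>::complex^2. if i = 1 then (if j = 1 then cnj (\<zeta>$2) else \<zeta>$1)
      else (if j = 1 then - cnj (\<zeta>$1) else \<zeta>$2))" for i j :: 2
    by (cases "i = 1"; cases "j = 1") (auto intro!: continuous_intros)
  then show ?thesis
    unfolding eq by (intro continuous_on_vec_lambda)
qed

lemma measurable_haar_param:
  "(\<lambda>(w, \<zeta>). haar_param w \<zeta>) \<in> unit_ball_measure \<Otimes>\<^sub>M unit_ball_measure \<rightarrow>\<^sub>M restrict_space borel U2"
proof (rule measurable_U2I)
  have c: "continuous_on UNIV (\<lambda>p. fst p ** snd p :: complex^2^2)"
    unfolding matrix_matrix_mult_def by (intro continuous_intros)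
  have mult: "(\<lambda>p. fst p ** snd p :: complex^2^2) \<in> borel_measurable (borel \<Otimes>\<^sub>M borel)"
    using c unfolding borel_prod by (rule borel_measurable_continuous_onI)
  have [measurable]: "k_sph \<in> borel_measurable borel"
    by (intro borel_measurable_continuous_onI continuous_on_k_sph)
  have "continuous_on UNIV (mat :: complex \<Rightarrow> complex^2^2)"
    unfolding mat_def
  proof (intro continuous_on_vec_lambda)
    show "continuous_on UNIV (\<lambda>x::complex. if i = j then x else 0)" for i j :: 2
      by (cases "i = j") auto
  qed
  then have [measurable]: "(mat :: complex \<Rightarrow> complex^2^2) \<in> borel_measurable borel"
    by (rule borel_measurable_continuous_onI)
  have [measurable]: "(sgn :: complex \<Rightarrow> complex) \<in> borel_measurable borel"
    unfolding sgn_div_norm by measurable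
  have "(\<lambda>p. fst p ** snd p) \<circ> (\<lambda>(w, \<zeta>). (mat (sgn w), k_sph (\<zeta> /\<^sub>R norm \<zeta>)))
      \<in> borel_measurable ((borel :: complex measure) \<Otimes>\<^sub>M borel)"
    by (rule measurable_comp[OF _ mult]) measurable
  then have [measurable]: "(\<lambda>p. mat (sgn (fst p)) ** k_sph (snd p /\<^sub>R norm (snd p)))
      \<in> borel_measurable ((borel :: complex measure) \<Otimes>\<^sub>M borel)"
    by (simp add: comp_def split_beta')
  have "(\<lambda>(w, \<zeta>). haar_param w \<zeta>) \<in> borel_measurable ((borel :: complex measure) \<Otimes>\<^sub>M borel)"
    unfolding haar_param_def split_beta' by measurable
  then show "(\<lambda>(w, \<zeta>). haar_param w \<zeta>) \<in> borel_measurable (unit_ball_measure \<Otimes>\<^sub>M unit_ball_measure)"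
    by (simp cong: measurable_cong_sets sets_pair_measure_cong add: sets_unit_ball_measure)
qed (auto simp: haar_param_U2)

lemma mult_haar_param:
  assumes "k \<in> SU2" "cmod c = 1" "w \<noteq> 0" "\<zeta> \<noteq> 0"
  shows "(mat c ** k) ** haar_param w \<zeta> = haar_param (c * w) (k *v \<zeta>)"
proof -
  have n: "norm (k *v \<zeta>) = norm \<zeta>"
    using assms(1) U2_orthogonal_transformation[of k] orthogonal_transformation_norm
    by (auto simp: SU2_def)
  have "c \<noteq> 0" "k *v \<zeta> \<noteq> 0" using assms n by auto
  moreover have "sgn (c * w) = c * sgn w"
    using assms(2) by (simp add: sgn_div_norm norm_mult)
  moreover have "(k *v \<zeta>) /\<^sub>R norm \<zeta> = k *v (\<zeta> /\<^sub>R norm \<zeta>)"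
    by (simp add: vec_eq_iff forall_2 mvec2_nth algebra_simps)
  ultimately show ?thesis
    using assms
    by (simp add: haar_param_def n flip: SU2_mult_k_sph)
       (metis mat_mult_commute mat_mult_mat matrix_mul_assoc)
qed

definition haar_explicit :: "(complex^2^2) measure" where
  "haar_explicit = distr (unit_ball_measure \<Otimes>\<^sub>M unit_ball_measure) (restrict_space borel U2)
     (\<lambda>(w, \<zeta>). haar_param w \<zeta>)"

lemma normalized_haar_U2_explicit: "normalized_haar_U2 haar_explicit"
  unfolding normalized_haar_U2_def
proof (intro conjI ballI)
  let ?B = "restrict_space borel U2 :: (complex^2^2) measure"
  let ?P = "unit_ball_measure \<Otimes>\<^sub>M unit_ball_measure :: (complex \<times> (complex^2)) measure"
  interpret b1: finite_measure "unit_ball_measure :: complex measure"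
    by (rule finite_measureI) (simp add: emeasure_unit_ball_measure)
  interpret b2: finite_measure "unit_ball_measure :: (complex^2) measure"
    by (rule finite_measureI) (simp add: emeasure_unit_ball_measure)
  interpret pair_sigma_finite "unit_ball_measure :: complex measure" "unit_ball_measure :: (complex^2) measure" ..
  note [measurable] = measurable_haar_param
  show sets: "sets haar_explicit = sets ?B"
    by (simp add: haar_explicit_def)
  have int: "(\<integral>\<^sup>+x. f x \<partial>haar_explicit) = (\<integral>\<^sup>+w. (\<integral>\<^sup>+\<zeta>. f (haar_param w \<zeta>) \<partial>unit_ball_measure) \<partial>unit_ball_measure)"
    if [measurable]: "f \<in> borel_measurable ?B" for f :: "complex^2^2 \<Rightarrow> ennreal"
  proof -
    have "(\<integral>\<^sup>+x. f x \<partial>haar_explicit) = (\<integral>\<^sup>+p. f (case p of (w, \<zeta>) \<Rightarrow> haar_param w \<zeta>) \<partial>?P)"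
      unfolding haar_explicit_def by (rule nn_integral_distr) measurable
    also have "\<dots> = (\<integral>\<^sup>+w. (\<integral>\<^sup>+\<zeta>. f (case (w, \<zeta>) of (w, \<zeta>) \<Rightarrow> haar_param w \<zeta>) \<partial>unit_ball_measure) \<partial>unit_ball_measure)"
      by (rule b2.nn_integral_fst[symmetric]) measurable
    finally show ?thesis by simp
  qed
  have "U2 \<in> sets ?B" by (simp add: sets_restrict_space_iff)
  then show "emeasure haar_explicit U2 = 1"
    using int[of "indicator U2"] sets
    by (simp add: haar_param_U2 emeasure_unit_ball_measure)
  fix k assume k: "k \<in> U2"
  obtain \<theta> k' where k': "k' \<in> SU2" and kk: "k = mat (cis \<theta>) ** k'"
    using U2_decomposition[OF k] by blast
  have mk: "(\<lambda>x. k ** x) \<in> ?B \<rightarrow>\<^sub>M ?B"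
    using measurable_compose[OF _ measurable_mult_U2, of "\<lambda>x. (k, x)" ?B] k
    by (simp add: space_restrict_space)
  have T1: "orthogonal_transformation (\<lambda>w. cis \<theta> * w)"
    unfolding orthogonal_transformation
    by (auto intro!: linearI simp: norm_mult algebra_simps)
  have T2: "orthogonal_transformation (\<lambda>z. k' *v z)"
    using k' by (intro U2_orthogonal_transformation) (simp add: SU2_def)
  show "distr haar_explicit haar_explicit (\<lambda>l. k ** l) = haar_explicit"
  proof (rule measure_eqI)
    fix A assume "A \<in> sets (distr haar_explicit haar_explicit (\<lambda>l. k ** l))"
    then have A [measurable]: "A \<in> sets ?B" by (simp add: sets)
    have mk': "(\<lambda>x. indicator A (k ** x) :: ennreal) \<in> borel_measurable ?B"
      using mk by (rule measurable_compose) measurable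
    have mh: "case_prod haar_param \<in> borel \<Otimes>\<^sub>M borel \<rightarrow>\<^sub>M ?B"
      using measurable_haar_param by (simp cong: measurable_cong_sets sets_pair_measure_cong add: sets_unit_ball_measure)
    have mh2: "(\<lambda>\<zeta>. indicator A (haar_param w \<zeta>) :: ennreal) \<in> borel_measurable borel" for w
      using measurable_compose[OF measurable_compose[OF _ mh, of "\<lambda>\<zeta>. (w, \<zeta>)" borel], of "indicator A"] by simp
    have mh1: "(\<lambda>w. \<integral>\<^sup>+\<zeta>. indicator A (haar_param w \<zeta>) \<partial>unit_ball_measure) \<in> borel_measurable borel"
    proof -
      have "(\<lambda>w. \<integral>\<^sup>+\<zeta>. indicator A (haar_param w \<zeta>) \<partial>unit_ball_measure) \<in> borel_measurable unit_ball_measure"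
        by measurable
      then show ?thesis by (simp cong: measurable_cong_sets add: sets_unit_ball_measure)
    qed
    have "emeasure (distr haar_explicit haar_explicit (\<lambda>l. k ** l)) A =
        (\<integral>\<^sup>+x. indicator A x \<partial>distr haar_explicit haar_explicit (\<lambda>l. k ** l))"
      by (simp add: sets)
    also have "\<dots> = (\<integral>\<^sup>+x. indicator A (k ** x) \<partial>haar_explicit)"
      using mk by (intro nn_integral_distr) (auto simp: sets cong: measurable_cong_sets)
    also have "\<dots> = (\<integral>\<^sup>+w. (\<integral>\<^sup>+\<zeta>. indicator A (k ** haar_param w \<zeta>) \<partial>unit_ball_measure) \<partial>unit_ball_measure)"
      by (rule int[OF mk'])
    also have "\<dots> = (\<integral>\<^sup>+w. (\<integral>\<^sup>+\<zeta>. indicator A (haar_param (cis \<theta> * w) (k' *v \<zeta>)) \<partial>unit_ball_measure) \<partial>unit_ball_measure)"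
    proof (rule nn_integral_cong_AE, rule AE_mp[OF AE_unit_ball_measure], intro AE_I2 impI)
      fix w :: complex assume "w \<noteq> 0"
      show "(\<integral>\<^sup>+\<zeta>. indicator A (k ** haar_param w \<zeta>) \<partial>unit_ball_measure) =
          (\<integral>\<^sup>+\<zeta>. indicator A (haar_param (cis \<theta> * w) (k' *v \<zeta>)) \<partial>unit_ball_measure)"
      proof (rule nn_integral_cong_AE, rule AE_mp[OF AE_unit_ball_measure], intro AE_I2 impI)
        fix \<zeta> :: "complex^2" assume "\<zeta> \<noteq> 0"
        then show "indicator A (k ** haar_param w \<zeta>) = indicator A (haar_param (cis \<theta> * w) (k' *v \<zeta>))"
          using mult_haar_param[OF k' _ \<open>w \<noteq> 0\<close>, of "cis \<theta>"] by (simp add: kk)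
      qed
    qed
    also have "\<dots> = (\<integral>\<^sup>+w. (\<integral>\<^sup>+\<zeta>. indicator A (haar_param (cis \<theta> * w) \<zeta>) \<partial>unit_ball_measure) \<partial>unit_ball_measure)"
      by (intro nn_integral_cong unit_ball_measure_isometry[OF T2] mh2)
    also have "\<dots> = (\<integral>\<^sup>+w. (\<integral>\<^sup>+\<zeta>. indicator A (haar_param w \<zeta>) \<partial>unit_ball_measure) \<partial>unit_ball_measure)"
      by (rule unit_ball_measure_isometry[OF T1 mh1])
    also have "\<dots> = (\<integral>\<^sup>+x. indicator A x \<partial>haar_explicit)"
      by (rule int[symmetric]) measurable
    also have "\<dots> = emeasure haar_explicit A"
      by (simp add: sets)
    finally show "emeasure (distr haar_explicit haar_explicit (\<lambda>l. k ** l)) A = emeasure haar_explicit A" .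
  qed (simp add: sets)
qed

lemma normalized_haar_U2_haar_U2: "normalized_haar_U2 haar_U2"
  unfolding haar_U2_def
  by (rule theI[of _ haar_explicit]) (auto intro: normalized_haar_U2_explicit normalized_haar_U2_unique)

end

theory Submission
  imports Defs
begin

text \<open>
  Proof idea. Let \<open>A z\<close> be the matrix function of the \<open>(m, n)\<close>-component of \<open>f\<close>. Since \<open>f\<close> is central,
  \<open>A (k z) = \<tau> k (A z) (\<tau> k)\<^sup>*\<close> for \<open>k \<in> U\<^sub>2\<close>, and rotating \<open>\<zeta>\<close> to \<open>e\<^sub>2\<close> shows that the transform at
  \<open>(\<xi>, (2 j - n) \<xi>)\<close> is \<open>h\<^sub>j \<xi> = \<integral> cos (sqrt \<xi> Re z\<^sub>2) (A z)\<^sub>j\<^sub>j dz\<close>, a smooth function of \<open>\<xi>\<close>. Its derivatives decay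
  rapidly in \<open>(m, n)\<close> because the Casimir element of \<open>U\<^sub>2\<close> acts on \<open>A\<close> by a scalar that grows quadratically in
  \<open>m\<close> and \<open>n\<close>, and rapidly in \<open>\<xi>\<close> because the Laplacian in \<open>z\<close> multiplies \<open>h\<^sub>j\<close> by \<open>- \<xi>\<close>. The \<open>k\<close>-th derivative
  of \<open>h\<^sub>j\<close> at \<open>0\<close> is a multiple of the diagonal entry \<open>(j, j)\<close> of \<open>\<integral> |z\<^sub>2|\<^sup>2\<^sup>k A z dz\<close>; commuting this matrix \<open>k + 1\<close> times
  with the raising operator replaces \<open>k + 1\<close> factors \<open>z\<^sub>2\<close> by \<open>z\<^sub>1\<close> and gives \<open>0\<close>, so the \<open>(k + 1)\<close>-st differences in \<open>j\<close> vanish.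
  Hence the \<open>N\<close>-th order Taylor parts of the \<open>h\<^sub>j\<close> at \<open>0\<close> fit together to one polynomial on \<open>\<real>\<^sup>2\<close>, cut off at
  scale \<open>1\<close>. The remainders vanish to order \<open>N\<close> at \<open>0\<close>; away from the ball of radius \<open>\<epsilon>\<close> they are extended separately in
  disjoint cones around the half-lines, with bounds independent of \<open>\<epsilon>\<close>, and inside it by Lagrange interpolation in \<open>j\<close>, which is
  smooth because of the vanishing differences and has norm tending to \<open>0\<close> with \<open>\<epsilon>\<close>. The bounds grow polynomially in \<open>n\<close>,
  which the rapid decay absorbs.
\<close>

subsection \<open>Smooth functions of one real variable\<close>

text \<open>The obstacle is uniformity in \<open>n\<close>: powers of \<open>n\<close> can be
  absorbed, but interpolation at \<open>n + 1\<close> nodes has constants beyond control.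
  High-degree interpolation is therefore confined to a neighbourhood of the origin whose scale is
  chosen last. There the uncontrolled constant meets a positive power of \<open>\<epsilon>\<close>,
  and \<open>\<epsilon>\<close> may depend on all other data, so this part can be given any norm
  \<open>e > 0\<close>; the choice is \<open>exp (- (1 + |m| + n))\<close>, which itself decays
  rapidly. The other two parts need constants that are polynomial in \<open>n\<close> and free of
  \<open>\<epsilon>\<close>. For the Taylor part, the vanishing differences bring the degree in the
  slope down to \<open>k \<le> N\<close>. On the cones, the remainders vanish to order
  \<open>N + 1\<close>, which outweighs the factor \<open>1 / t\<close> that each of
  \<open>N\<close> derivatives costs, and a cutoff at scale \<open>\<epsilon>\<close> costs no more
  than that. Both orders are tied to \<open>N\<close>, and so is the extension. On the group side,
  the matrix function of a component is the transform of all of \<open>f\<close> times a fixed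
  matrix commuting with the representation, so Schur orthogonality is not invoked.\<close>

definition dv :: "(real \<Rightarrow> complex) \<Rightarrow> real \<Rightarrow> complex" where
  "dv f t = vector_derivative f (at t)"

text \<open>The derivative is two-sided at each point instead of taken within \<open>S\<close>, so
  \<open>(dv ^^ k) f\<close> does not depend on \<open>S\<close>. For open \<open>S\<close> its
  values on \<open>S\<close> are determined by \<open>f\<close> on \<open>S\<close>, which is
  \<open>dvn_cong\<close>.\<close>

definition sm :: "real set \<Rightarrow> (real \<Rightarrow> complex) \<Rightarrow> bool" where
  "sm S f \<longleftrightarrow> (\<forall>k. \<forall>t\<in>S. (dv ^^ k) f differentiable at t)"

lemma sm_derivative:
  "sm S f \<Longrightarrow> t \<in> S \<Longrightarrow> ((dv ^^ k) f has_vector_derivative (dv ^^ Suc k) f t) (at t)"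
  unfolding sm_def funpow.simps comp_def dv_def[of "(dv ^^ k) f"]
  by (subst vector_derivative_works[symmetric]) auto

lemma sm_derivative0: "sm S f \<Longrightarrow> t \<in> S \<Longrightarrow> (f has_vector_derivative dv f t) (at t)"
  using sm_derivative[of S f t 0] by simp

lemma dvn_dv: "(dv ^^ k) (dv f) = (dv ^^ Suc k) f"
  by (simp add: funpow_swap1)

lemma sm_dvn: "sm S f \<Longrightarrow> sm S ((dv ^^ k) f)"
  by (simp add: sm_def flip: funpow_add[THEN fun_cong, unfolded comp_def])

lemma sm_dv: "sm S f \<Longrightarrow> sm S (dv f)"
  using sm_dvn[of S f 1] by simp

lemma sm_subset: "sm T f \<Longrightarrow> S \<subseteq> T \<Longrightarrow> sm S f"
  by (auto simp: sm_def)

lemma continuous_on_dvn: "sm S f \<Longrightarrow> continuous_on S ((dv ^^ k) f)"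
  by (meson continuous_at_imp_continuous_on has_vector_derivative_continuous sm_derivative)

lemma dvn_cong:
  assumes "open S" "\<And>t. t \<in> S \<Longrightarrow> f t = g t" "t \<in> S"
  shows "(dv ^^ k) f t = (dv ^^ k) g t"
  using assms(3)
proof (induction k arbitrary: t)
  case (Suc k)
  have "eventually (\<lambda>x. x \<in> S) (nhds t)"
    using assms(1) Suc.prems by (rule eventually_nhds_in_open)
  then have "eventually (\<lambda>x. x \<in> UNIV \<longrightarrow> (dv ^^ k) f x = (dv ^^ k) g x) (nhds t)"
    by eventually_elim (use Suc.IH in auto)
  then have "vector_derivative ((dv ^^ k) f) (at t) = vector_derivative ((dv ^^ k) g) (at t)"
    by (rule vector_derivative_cong_eq) auto
  then show ?case by (simp add: dv_def[of "(dv ^^ k) f"] dv_def[of "(dv ^^ k) g"])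
qed (use assms in auto)

lemma dv_cong:
  assumes "open S" "\<And>t. t \<in> S \<Longrightarrow> f t = g t" "t \<in> S"
  shows "dv f t = dv g t"
  using dvn_cong[OF assms, where k = 1] by simp

text \<open>Coinduction: a class closed under differentiation consists of smooth functions. The
  class may supply any \<open>f'\<close> that agrees with the derivative on \<open>S\<close>;
  openness of \<open>S\<close> carries this agreement through all further derivatives.\<close>

lemma sm_coinduct:
  assumes S: "open S"
    and step: "\<And>f. P f \<Longrightarrow> \<exists>f'. P f' \<and> (\<forall>t\<in>S. (f has_vector_derivative f' t) (at t))"
    and "P f"
  shows "sm S f"
proof -
  have *: "P f \<Longrightarrow> \<exists>g. P g \<and> (\<forall>t\<in>S. (dv ^^ k) f t = g t)" for k f
  proof (induction k arbitrary: f)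
    case (Suc k)
    obtain f' where f': "P f'" "\<forall>t\<in>S. (f has_vector_derivative f' t) (at t)"
      using step[OF Suc.prems] by blast
    then have "\<forall>t\<in>S. dv f t = f' t"
      by (simp add: dv_def vector_derivative_at)
    then have "\<forall>t\<in>S. (dv ^^ k) (dv f) t = (dv ^^ k) f' t"
      using dvn_cong[OF S] by blast
    then show ?case
      using Suc.IH[OF f'(1)] by (metis dvn_dv)
  qed auto
  show ?thesis
    unfolding sm_def
  proof (intro allI ballI)
    fix k t assume t: "t \<in> S"
    obtain g where g: "P g" "\<forall>t\<in>S. (dv ^^ k) f t = g t"
      using *[OF \<open>P f\<close>] by blast
    obtain g' where "(g has_vector_derivative g' t) (at t)"
      using step[OF g(1)] t by blast
    then have "((dv ^^ k) f has_vector_derivative g' t) (at t)"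
      using has_vector_derivative_transform_within_open[OF _ S t] g(2) by metis
    then show "(dv ^^ k) f differentiable at t"
      using differentiableI_vector by blast
  qed
qed

text \<open>The class is the set of all \<open>D k\<close>. A guessed formula for all derivatives
  yields smoothness and is confirmed at once, with only the step from \<open>k\<close> to
  \<open>k + 1\<close> to check.\<close>

lemma sm_tower:
  assumes S: "open S" and D: "\<And>k t. t \<in> S \<Longrightarrow> (D k has_vector_derivative D (Suc k) t) (at t)"
  shows "sm S (D 0)" "t \<in> S \<Longrightarrow> (dv ^^ k) (D 0) t = D k t"
proof -
  show "sm S (D 0)"
    by (rule sm_coinduct[OF S, of "\<lambda>f. \<exists>k. f = D k"]) (use D in blast)+
  show "t \<in> S \<Longrightarrow> (dv ^^ k) (D 0) t = D k t"
  proof (induction k arbitrary: t)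
    case (Suc k)
    have "dv ((dv ^^ k) (D 0)) t = dv (D k) t"
      by (rule dv_cong[OF S]) (use Suc in auto)
    also have "\<dots> = D (Suc k) t"
      using D[OF Suc.prems] by (simp add: dv_def vector_derivative_at)
    finally show ?case by simp
  qed simp
qed

lemma
  assumes "open S" "sm S f" "sm S g"
  shows sm_add: "sm S (\<lambda>t. f t + g t)"
    and dvn_add: "t \<in> S \<Longrightarrow> (dv ^^ k) (\<lambda>t. f t + g t) t = (dv ^^ k) f t + (dv ^^ k) g t"
proof -
  have "((\<lambda>t. (dv ^^ k) f t + (dv ^^ k) g t) has_vector_derivative (dv ^^ Suc k) f t + (dv ^^ Suc k) g t) (at t)"
    if "t \<in> S" for k t
    by (intro has_vector_derivative_add sm_derivative[OF assms(2) that] sm_derivative[OF assms(3) that])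
  from sm_tower[of S "\<lambda>k t. (dv ^^ k) f t + (dv ^^ k) g t", OF assms(1) this]
  show "sm S (\<lambda>t. f t + g t)" "t \<in> S \<Longrightarrow> (dv ^^ k) (\<lambda>t. f t + g t) t = (dv ^^ k) f t + (dv ^^ k) g t"
    by simp_all
qed

lemma
  assumes "open S" "sm S f"
  shows sm_cmult: "sm S (\<lambda>t. c * f t)"
    and dvn_cmult: "t \<in> S \<Longrightarrow> (dv ^^ k) (\<lambda>t. c * f t) t = c * (dv ^^ k) f t"
proof -
  have "((\<lambda>t. c * (dv ^^ k) f t) has_vector_derivative c * (dv ^^ Suc k) f t) (at t)"
    if "t \<in> S" for k t
    by (intro has_vector_derivative_mult_right sm_derivative[OF assms(2) that])
  from sm_tower[of S "\<lambda>k t. c * (dv ^^ k) f t", OF assms(1) this]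
  show "sm S (\<lambda>t. c * f t)" "t \<in> S \<Longrightarrow> (dv ^^ k) (\<lambda>t. c * f t) t = c * (dv ^^ k) f t"
    by simp_all
qed

lemma
  assumes "open S"
  shows sm_const: "sm S (\<lambda>t. c)"
    and dvn_const: "t \<in> S \<Longrightarrow> (dv ^^ k) (\<lambda>t. c) t = (if k = 0 then c else 0)"
proof -
  have "((\<lambda>t. if k = 0 then c else 0) has_vector_derivative (if Suc k = 0 then c else 0)) (at t)" for k and t :: real
    by auto
  from sm_tower[of S "\<lambda>k t. if k = 0 then c else 0", OF assms this]
  show "sm S (\<lambda>t. c)" "t \<in> S \<Longrightarrow> (dv ^^ k) (\<lambda>t. c) t = (if k = 0 then c else 0)"
    by (simp_all only: if_True refl)
qed

lemma
  assumes "open S" "\<And>i. i \<in> I \<Longrightarrow> sm S (f i)"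
  shows sm_sum: "sm S (\<lambda>t. \<Sum>i\<in>I. f i t)"
    and dvn_sum: "t \<in> S \<Longrightarrow> (dv ^^ k) (\<lambda>t. \<Sum>i\<in>I. f i t) t = (\<Sum>i\<in>I. (dv ^^ k) (f i) t)"
proof -
  have "((\<lambda>t. \<Sum>i\<in>I. (dv ^^ k) (f i) t) has_vector_derivative (\<Sum>i\<in>I. (dv ^^ Suc k) (f i) t)) (at t)"
    if "t \<in> S" for k t
    by (intro has_vector_derivative_sum sm_derivative[OF assms(2) that])
  from sm_tower[of S "\<lambda>k t. \<Sum>i\<in>I. (dv ^^ k) (f i) t", OF assms(1) this]
  show "sm S (\<lambda>t. \<Sum>i\<in>I. f i t)" "t \<in> S \<Longrightarrow> (dv ^^ k) (\<lambda>t. \<Sum>i\<in>I. f i t) t = (\<Sum>i\<in>I. (dv ^^ k) (f i) t)"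
    by simp_all
qed

lemma
  assumes "sm UNIV f"
  shows sm_affine: "sm UNIV (\<lambda>t. f (a * t + b))"
    and dvn_affine: "(dv ^^ k) (\<lambda>t. f (a * t + b)) t = of_real (a ^ k) * (dv ^^ k) f (a * t + b)"
proof -
  have "((\<lambda>t. of_real (a ^ k) * (dv ^^ k) f (a * t + b)) has_vector_derivative
      of_real (a ^ Suc k) * (dv ^^ Suc k) f (a * t + b)) (at t)" for k t
  proof -
    have "((\<lambda>t. (dv ^^ k) f (a * t + b)) has_vector_derivative a *\<^sub>R (dv ^^ Suc k) f (a * t + b)) (at t)"
    proof -
      have "((\<lambda>t. a * t + b) has_vector_derivative a) (at t)"
        unfolding has_real_derivative_iff_has_vector_derivative[symmetric]
        by (auto intro!: derivative_eq_intros)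
      from vector_diff_chain_at[OF this sm_derivative[OF assms, of "a * t + b" k]]
      show ?thesis by (simp add: comp_def)
    qed
    from has_vector_derivative_mult_right[OF this, of "of_real (a ^ k)"]
    show ?thesis by (simp add: scaleR_conv_of_real mult_ac)
  qed
  from sm_tower[of UNIV "\<lambda>k t. of_real (a ^ k) * (dv ^^ k) f (a * t + b)", OF _ this]
  show "sm UNIV (\<lambda>t. f (a * t + b))" "(dv ^^ k) (\<lambda>t. f (a * t + b)) t = of_real (a ^ k) * (dv ^^ k) f (a * t + b)"
    by simp_all
qed

text \<open>A class that contains the products and is closed under the product rule; it gives
  smoothness of products without the general Leibniz formula.\<close>

inductive sums_of_products :: "real set \<Rightarrow> (real \<Rightarrow> complex) \<Rightarrow> bool" for S where
  "sm S f \<Longrightarrow> sm S g \<Longrightarrow> sums_of_products S (\<lambda>t. f t * g t)"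
| "sums_of_products S f \<Longrightarrow> sums_of_products S g \<Longrightarrow> sums_of_products S (\<lambda>t. f t + g t)"

lemma product_derivative:
  assumes "sm S f" "sm S g" "t \<in> S"
  shows "((\<lambda>t. f t * g t) has_vector_derivative f t * dv g t + dv f t * g t) (at t)"
  using has_vector_derivative_mult[OF sm_derivative0[OF assms(1,3)] sm_derivative0[OF assms(2,3)]] by simp

lemma sm_mult:
  assumes "open S" "sm S f" "sm S g"
  shows "sm S (\<lambda>t. f t * g t)"
proof (rule sm_coinduct[OF assms(1), of "sums_of_products S"])
  show "sums_of_products S (\<lambda>t. f t * g t)" using assms sums_of_products.intros by blast
  show "\<exists>f'. sums_of_products S f' \<and> (\<forall>t\<in>S. (f has_vector_derivative f' t) (at t))"
    if "sums_of_products S f" for f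
    using that
  proof induction
    case (1 f g)
    then have "sums_of_products S (\<lambda>t. f t * dv g t + dv f t * g t)"
      by (intro sums_of_products.intros sm_dv)
    then show ?case using product_derivative[OF 1] by blast
  next
    case (2 f g)
    then obtain f' g' where "sums_of_products S f'" "\<forall>t\<in>S. (f has_vector_derivative f' t) (at t)"
      "sums_of_products S g'" "\<forall>t\<in>S. (g has_vector_derivative g' t) (at t)" by blast
    then show ?case
      by (intro exI[of _ "\<lambda>t. f' t + g' t"]) (auto intro: sums_of_products.intros has_vector_derivative_add)
  qed
qed

lemma dv_mult:
  assumes "sm S f" "sm S g" "t \<in> S"
  shows "dv (\<lambda>t. f t * g t) t = f t * dv g t + dv f t * g t"
  using product_derivative[OF assms] by (simp add: dv_def vector_derivative_at)

lemma sm_of_real: "sm UNIV of_real"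
proof -
  define D :: "nat \<Rightarrow> real \<Rightarrow> complex" where "D = (\<lambda>k t. if k = 0 then of_real t else if k = 1 then 1 else 0)"
  have "(D k has_vector_derivative D (Suc k) t) (at t)" for k t
    unfolding D_def has_vector_derivative_def
    by (auto intro!: derivative_eq_intros simp: scaleR_conv_of_real)
  from sm_tower(1)[of UNIV D, OF _ this] show ?thesis by (simp add: D_def)
qed

lemma sm_pow: "open S \<Longrightarrow> sm S f \<Longrightarrow> sm S (\<lambda>t. f t ^ n)"
  by (induction n) (auto intro: sm_const sm_mult)

lemma
  assumes "sm UNIV f"
  shows sm_times_id: "sm UNIV (\<lambda>t. of_real t * f t)"
    and dvn_times_id: "(dv ^^ k) (\<lambda>t. of_real t * f t) t = of_real t * (dv ^^ k) f t + of_nat k * (dv ^^ (k - 1)) f t"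
proof -
  define D where "D = (\<lambda>k t. of_real t * (dv ^^ k) f t + of_nat k * (dv ^^ (k - 1)) f t)"
  have "(D k has_vector_derivative D (Suc k) t) (at t)" for k t
  proof -
    have 1: "((\<lambda>t. of_real t * (dv ^^ k) f t) has_vector_derivative of_real t * (dv ^^ Suc k) f t + 1 * (dv ^^ k) f t) (at t)"
      by (intro has_vector_derivative_mult sm_derivative[OF assms])
        (auto simp: has_vector_derivative_def scaleR_conv_of_real intro!: derivative_eq_intros)
    have 2: "((\<lambda>t. of_nat k * (dv ^^ (k - 1)) f t) has_vector_derivative of_nat k * (dv ^^ k) f t) (at t)"
      using has_vector_derivative_mult_right[OF sm_derivative[OF assms, of t "k - 1"], of "of_nat k"]
      by (cases k) auto
    show ?thesis
      using has_vector_derivative_add[OF 1 2] by (simp add: D_def algebra_simps)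
  qed
  from sm_tower[of UNIV D, OF _ this]
  show "sm UNIV (\<lambda>t. of_real t * f t)"
     "(dv ^^ k) (\<lambda>t. of_real t * f t) t = of_real t * (dv ^^ k) f t + of_nat k * (dv ^^ (k - 1)) f t"
    by (simp_all add: D_def)
qed

text \<open>The derivative of \<open>f / g ^ k\<close> is a sum of such terms with exponents
  \<open>k\<close> and \<open>k + 1\<close>, so the class supports the coinduction for
  \<open>1 / g\<close>.\<close>

inductive quotient_class :: "real set \<Rightarrow> (real \<Rightarrow> complex) \<Rightarrow> (real \<Rightarrow> complex) \<Rightarrow> bool" for S g where
  "sm S f \<Longrightarrow> quotient_class S g (\<lambda>t. f t * inverse (g t) ^ k)"
| "quotient_class S g f \<Longrightarrow> quotient_class S g h \<Longrightarrow> quotient_class S g (\<lambda>t. f t + h t)"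

lemma sm_inverse:
  assumes S: "open S" and g: "sm S g" and nz: "\<And>t. t \<in> S \<Longrightarrow> g t \<noteq> 0"
  shows "sm S (\<lambda>t. inverse (g t))"
proof (rule sm_coinduct[OF S, of "quotient_class S g"])
  show "quotient_class S g (\<lambda>t. inverse (g t))"
    using quotient_class.intros(1)[OF sm_const[OF S, of 1], of g 1] by simp
  show "\<exists>f'. quotient_class S g f' \<and> (\<forall>t\<in>S. (f has_vector_derivative f' t) (at t))"
    if "quotient_class S g f" for f
    using that
  proof induction
    case (1 f k)
    have "((\<lambda>t. f t * inverse (g t) ^ k) has_vector_derivative
        (dv f t * inverse (g t) ^ k + (- of_nat k * (f t * dv g t)) * inverse (g t) ^ (k + 1))) (at t)" if t: "t \<in> S" for t
    proof -
      have i: "((\<lambda>x. inverse x ^ k) has_field_derivative - of_nat k * inverse (g t) ^ (k + 1)) (at (g t))"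
        using DERIV_power[OF DERIV_inverse[OF nz[OF t]], of k] by (cases k) (simp_all add: algebra_simps)
      have gi: "((\<lambda>t. inverse (g t) ^ k) has_vector_derivative dv g t * (- of_nat k * inverse (g t) ^ (k + 1))) (at t)"
        using field_vector_diff_chain_at[OF sm_derivative0[OF g t] i] by (simp add: comp_def)
      show ?thesis
        using has_vector_derivative_mult[OF sm_derivative0[OF 1 t] gi] by (simp add: algebra_simps)
    qed
    moreover have "quotient_class S g (\<lambda>t. dv f t * inverse (g t) ^ k + (- of_nat k * (f t * dv g t)) * inverse (g t) ^ (k + 1))"
      by (intro quotient_class.intros sm_dv sm_cmult sm_mult S g 1)
    ultimately show ?case by blast
  next
    case (2 f h)
    then obtain f' h' where "quotient_class S g f'" "\<forall>t\<in>S. (f has_vector_derivative f' t) (at t)"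
      "quotient_class S g h'" "\<forall>t\<in>S. (h has_vector_derivative h' t) (at t)" by blast
    then show ?case
      by (intro exI[of _ "\<lambda>t. f' t + h' t"]) (auto intro: quotient_class.intros has_vector_derivative_add)
  qed
qed

lemma bounded_dvn_of_support:
  assumes f: "sm UNIV f" and 0: "\<And>t. R < \<bar>t\<bar> \<Longrightarrow> f t = 0"
  shows "\<exists>C\<ge>0. \<forall>t. cmod ((dv ^^ k) f t) \<le> C"
proof -
  have "compact ((dv ^^ k) f ` {-R..R})"
    using continuous_on_dvn[OF f] by (intro compact_continuous_image) (auto intro: continuous_on_subset)
  then obtain C where C: "C > 0" "\<forall>x\<in>(dv ^^ k) f ` {-R..R}. cmod x \<le> C"
    using compact_imp_bounded bounded_pos by metis
  have "cmod ((dv ^^ k) f t) \<le> C" for t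
  proof (cases "\<bar>t\<bar> \<le> R")
    case True
    then have "t \<in> {-R..R}" by auto
    then show ?thesis using C by blast
  next
    case False
    have o: "open {t. R < \<bar>t\<bar>}"
      by (intro open_Collect_less continuous_intros)
    have "(dv ^^ k) f t = (dv ^^ k) (\<lambda>t. 0) t"
      by (rule dvn_cong[OF o]) (use 0 False in auto)
    then show ?thesis using C by (simp add: dvn_const[of UNIV])
  qed
  then show ?thesis using C by (intro exI[of _ C]) auto
qed

subsection \<open>Cutoff functions\<close>

lemma power_le_fact_exp: "0 \<le> x \<Longrightarrow> x ^ n \<le> fact n * exp (x::real)"
proof -
  assume x: "0 \<le> x"
  have "x ^ n /\<^sub>R fact n \<le> exp x"
    unfolding exp_def using x
    by (intro sum_le_suminf[OF summable_exp_generic, of "{n}", simplified]) auto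
  then show ?thesis by (simp add: field_simps)
qed

lemma has_vector_derivative_quadratic:
  fixes f :: "real \<Rightarrow> complex"
  assumes "\<And>t. cmod (f t) \<le> C * t\<^sup>2"
  shows "(f has_vector_derivative 0) (at 0)"
proof -
  have f0: "f 0 = 0" using assms[of 0] by simp
  have "((\<lambda>t. f t /\<^sub>R \<bar>t\<bar>) \<longlongrightarrow> 0) (at 0)"
  proof (rule Lim_null_comparison)
    show "\<forall>\<^sub>F t in at 0. norm (f t /\<^sub>R \<bar>t\<bar>) \<le> C * \<bar>t\<bar>"
      unfolding eventually_at_filter
    proof (intro always_eventually allI impI)
      fix t :: real assume "t \<noteq> 0"
      then have "cmod (f t) \<le> C * \<bar>t\<bar> * \<bar>t\<bar>"
        using assms[of t] by (simp add: power2_eq_square)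
      then show "norm (f t /\<^sub>R \<bar>t\<bar>) \<le> C * \<bar>t\<bar>"
        using \<open>t \<noteq> 0\<close> by (simp add: field_simps)
    qed
    show "((\<lambda>t. C * \<bar>t\<bar>) \<longlongrightarrow> 0) (at 0)" by (auto intro!: tendsto_eq_intros)
  qed
  then show ?thesis
    by (simp add: has_vector_derivative_def has_derivative_at f0 tendsto_norm_zero_iff
        flip: tendsto_norm_zero_iff[of "\<lambda>t. f t /\<^sub>R \<bar>t\<bar>"]) (simp add: divide_inverse mult.commute)
qed

text \<open>\<open>flat_exp 1\<close> is the classical flat function \<open>exp (- 1 / t)\<close>.
  Allowing all polynomials in \<open>1 / t\<close> as a factor makes the family closed under
  differentiation.\<close>

definition flat_exp :: "real poly \<Rightarrow> real \<Rightarrow> complex" where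
  "flat_exp p t = (if t > 0 then of_real (poly p (inverse t) * exp (- inverse t)) else 0)"

text \<open>With \<open>y = 1 / t\<close>, a power \<open>y ^ (i + 2)\<close> is at most a constant
  times \<open>exp y\<close>; the two surplus powers leave the factor \<open>t^2\<close>.\<close>

lemma flat_exp_quadratic: "\<exists>C. \<forall>t. cmod (flat_exp p t) \<le> C * t\<^sup>2"
proof -
  define C where "C = (\<Sum>i\<le>degree p. \<bar>coeff p i\<bar> * fact (i + 2))"
  have "cmod (flat_exp p t) \<le> C * t\<^sup>2" for t
  proof (cases "t > 0")
    case True
    define y where "y = inverse t"
    have y: "y > 0" using True by (simp add: y_def)
    have "\<bar>poly p y\<bar> * y\<^sup>2 \<le> (\<Sum>i\<le>degree p. \<bar>coeff p i\<bar> * y ^ i) * y\<^sup>2"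
      unfolding poly_altdef using y
      by (intro mult_right_mono order.trans[OF sum_abs]) (auto simp: abs_mult)
    also have "\<dots> = (\<Sum>i\<le>degree p. \<bar>coeff p i\<bar> * y ^ (i + 2))"
      by (simp add: sum_distrib_left sum_distrib_right power_add mult_ac power2_eq_square)
    also have "\<dots> \<le> (\<Sum>i\<le>degree p. \<bar>coeff p i\<bar> * (fact (i + 2) * exp y))"
      using y by (intro sum_mono mult_left_mono power_le_fact_exp) auto
    also have "\<dots> = C * exp y" unfolding C_def sum_distrib_right by (simp add: mult_ac)
    finally have "\<bar>poly p y\<bar> * exp (- y) \<le> C * inverse (y\<^sup>2)"
      using y by (simp add: exp_minus field_simps)
    then show ?thesis
      using True by (simp add: flat_exp_def norm_mult abs_mult y_def power_inverse)
  next
    case False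
    have "0 \<le> C" by (auto simp: C_def intro!: sum_nonneg)
    then show ?thesis using False by (simp add: flat_exp_def)
  qed
  then show ?thesis by blast
qed

text \<open>In the variable \<open>y = 1 / t\<close> differentiation in \<open>t\<close> is
  \<open>- y^2\<close> times differentiation in \<open>y\<close>, which sends
  \<open>p y * exp (- y)\<close> to \<open>y^2 * (p - p') y * exp (- y)\<close>. At 0 the quadratic
  bound gives the derivative 0.\<close>

lemma flat_exp_derivative:
  "(flat_exp p has_vector_derivative flat_exp ([:0, 0, 1:] * (p - pderiv p)) t) (at t)"
proof -
  consider "t > 0" | "t < 0" | "t = 0" by linarith
  then show ?thesis
  proof cases
    case 1
    have "((\<lambda>t. poly p (inverse t) * exp (- inverse t)) has_real_derivative
        poly ([:0, 0, 1:] * (p - pderiv p)) (inverse t) * exp (- inverse t)) (at t)"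
      using 1 by (auto intro!: derivative_eq_intros DERIV_chain2[OF poly_DERIV] simp: field_simps power2_eq_square)
    then have "((\<lambda>t. complex_of_real (poly p (inverse t) * exp (- inverse t))) has_vector_derivative
        of_real (poly ([:0, 0, 1:] * (p - pderiv p)) (inverse t) * exp (- inverse t))) (at t)"
      by (intro has_vector_derivative_of_real) (simp add: has_real_derivative_iff_has_vector_derivative)
    then have "(flat_exp p has_vector_derivative
        of_real (poly ([:0, 0, 1:] * (p - pderiv p)) (inverse t) * exp (- inverse t))) (at t)"
      by (rule has_vector_derivative_transform_within_open[of _ _ _ "{0<..}"]) (use 1 in \<open>auto simp: flat_exp_def\<close>)
    then show ?thesis using 1 by (simp only: flat_exp_def if_True)
  next
    case 2
    have "((\<lambda>t. 0) has_vector_derivative 0) (at t)" by simp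
    then have "(flat_exp p has_vector_derivative 0) (at t)"
      by (rule has_vector_derivative_transform_within_open[of _ _ _ "{..<0}"]) (use 2 in \<open>auto simp: flat_exp_def\<close>)
    then show ?thesis using 2 by (simp add: flat_exp_def)
  next
    case 3
    obtain C where "\<forall>t. cmod (flat_exp p t) \<le> C * t\<^sup>2" using flat_exp_quadratic by blast
    then show ?thesis using has_vector_derivative_quadratic[of "flat_exp p" C] 3
      by (simp add: flat_exp_def)
  qed
qed

lemma sm_flat_exp: "sm UNIV (flat_exp p)"
  by (rule sm_coinduct[of UNIV "\<lambda>f. \<exists>p. f = flat_exp p"]) (use flat_exp_derivative in blast)+

text \<open>The quotient of \<open>e t\<close> by \<open>e t + e (1 - t)\<close> with
  \<open>e = flat_exp 1\<close>; the denominator never vanishes because \<open>t\<close> and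
  \<open>1 - t\<close> cannot both be nonpositive.\<close>

lemma ex_smooth_step: "\<exists>f. sm UNIV f \<and> (\<forall>t\<le>0. f t = 0) \<and> (\<forall>t\<ge>1. f t = 1)"
proof -
  let ?e = "flat_exp 1"
  have nz: "?e t + ?e (1 - t) \<noteq> 0" for t
  proof -
    have "?e t + ?e (1 - t) = of_real ((if t > 0 then exp (- inverse t) else 0) + (if 1 - t > 0 then exp (- inverse (1 - t)) else 0))"
      by (simp add: flat_exp_def)
    moreover have "(if t > 0 then exp (- inverse t) else 0) + (if 1 - t > 0 then exp (- inverse (1 - t)) else 0) > (0::real)"
      by (cases "t > 0"; cases "1 - t > 0") (auto intro: add_pos_pos)
    ultimately show ?thesis by (metis of_real_eq_0_iff less_irrefl)
  qed
  have "sm UNIV (\<lambda>t. ?e ((-1) * t + 1))" by (intro sm_affine sm_flat_exp)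
  then have e1: "sm UNIV (\<lambda>t. ?e (1 - t))" by simp
  have "sm UNIV (\<lambda>t. ?e t * inverse (?e t + ?e (1 - t)))"
    by (intro sm_mult sm_inverse sm_add sm_flat_exp e1 nz open_UNIV)
  moreover have "\<forall>t\<le>0. ?e t * inverse (?e t + ?e (1 - t)) = 0" by (simp add: flat_exp_def)
  moreover have "\<forall>t\<ge>1. ?e t * inverse (?e t + ?e (1 - t)) = 1"
    using nz by (auto simp: flat_exp_def split: if_splits)
  ultimately show ?thesis by blast
qed

definition smooth_step :: "real \<Rightarrow> complex" where
  "smooth_step = (SOME f. sm UNIV f \<and> (\<forall>t\<le>0. f t = 0) \<and> (\<forall>t\<ge>1. f t = 1))"

lemma smooth_step: "sm UNIV smooth_step" "t \<le> 0 \<Longrightarrow> smooth_step t = 0" "t \<ge> 1 \<Longrightarrow> smooth_step t = 1"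
  using someI_ex[OF ex_smooth_step] unfolding smooth_step_def[symmetric] by blast+

definition cutoff :: "real \<Rightarrow> complex" where
  "cutoff t = smooth_step (1 * t + 2) * smooth_step ((-1) * t + 2)"

lemma sm_cutoff: "sm UNIV cutoff"
  unfolding cutoff_def[abs_def] by (intro sm_mult sm_affine smooth_step open_UNIV)

lemma cutoff_1: "\<bar>t\<bar> \<le> 1 \<Longrightarrow> cutoff t = 1"
  by (simp add: cutoff_def smooth_step)

lemma cutoff_0: "2 \<le> \<bar>t\<bar> \<Longrightarrow> cutoff t = 0"
  by (auto simp: cutoff_def smooth_step abs_real_def split: if_splits)

subsection \<open>Smooth functions on Euclidean spaces\<close>

lemma smooth_coinduct:
  fixes F :: "'a::euclidean_space \<Rightarrow> complex"
  assumes step: "\<And>F. P F \<Longrightarrow> (\<forall>x. F differentiable (at x)) \<and> (\<forall>v. P (dir_deriv v F))" and "P F"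
  shows "smooth F"
proof -
  have "P F \<Longrightarrow> Ck r F" for r F
  proof (induction r arbitrary: F)
    case 0
    then show ?case
      using step by (auto intro!: differentiable_imp_continuous_on simp: differentiable_on_def
        intro: differentiable_at_withinI)
  next
    case (Suc r)
    then show ?case using step by simp
  qed
  then show ?thesis using \<open>P F\<close> by (simp add: smooth_def)
qed

lemma smooth_differentiable: "smooth F \<Longrightarrow> F differentiable (at x)"
  unfolding smooth_def by (drule spec[of _ "Suc 0"]) simp

lemma smooth_dir_deriv: assumes "smooth F" shows "smooth (dir_deriv v F)"
  unfolding smooth_def
proof
  fix r
  have "Ck (Suc r) F" using assms by (simp only: smooth_def)
  then show "Ck r (dir_deriv v F)" by simp
qed

lemma smooth_continuous: assumes "smooth F" shows "continuous_on S F"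
proof -
  have "Ck 0 F" using assms by (simp only: smooth_def)
  then show ?thesis by (auto intro: continuous_on_subset)
qed

lemma smooth_has_derivative: "smooth F \<Longrightarrow> (F has_derivative (\<lambda>v. dir_deriv v F x)) (at x)"
  using smooth_differentiable[of F x] frechet_derivative_works[of F "at x"] by (simp add: dir_deriv_def)

lemma dir_deriv_eq: "(F has_derivative D) (at x) \<Longrightarrow> dir_deriv v F x = D v"
  by (simp add: dir_deriv_def flip: frechet_derivative_at)

lemma dir_deriv_add:
  "smooth F \<Longrightarrow> smooth G \<Longrightarrow> dir_deriv v (\<lambda>x. F x + G x) = (\<lambda>x. dir_deriv v F x + dir_deriv v G x)"
  by (intro ext dir_deriv_eq has_derivative_add smooth_has_derivative)

lemma dir_deriv_cmult:
  "smooth F \<Longrightarrow> dir_deriv v (\<lambda>x. c * F x) = (\<lambda>x. c * dir_deriv v F x)"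
  by (intro ext dir_deriv_eq has_derivative_mult_right smooth_has_derivative)

text \<open>A directional derivative of a member of a natural class is in general a linear
  combination of members with coefficients depending on the direction, so the coinduction is run for
  the span.\<close>

inductive lin_span :: "(('a::euclidean_space \<Rightarrow> complex) \<Rightarrow> bool) \<Rightarrow> ('a \<Rightarrow> complex) \<Rightarrow> bool" for P where
  lin_span_base: "P F \<Longrightarrow> lin_span P F"
| lin_span_add: "lin_span P F \<Longrightarrow> lin_span P G \<Longrightarrow> lin_span P (\<lambda>x. F x + G x)"
| lin_span_cmult: "lin_span P F \<Longrightarrow> lin_span P (\<lambda>x. c * F x)"

lemma smooth_lin_span:
  fixes F :: "'a::euclidean_space \<Rightarrow> complex"
  assumes step: "\<And>F. P F \<Longrightarrow> (\<forall>x. F differentiable (at x)) \<and> (\<forall>v. lin_span P (dir_deriv v F))"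
    and "lin_span P F"
  shows "smooth F"
proof (rule smooth_coinduct[of "lin_span P"])
  show "lin_span P F" by fact
  fix F assume "lin_span P F"
  then show "(\<forall>x. F differentiable at x) \<and> (\<forall>v. lin_span P (dir_deriv v F))"
  proof induction
    case (lin_span_base F)
    then show ?case by (rule step)
  next
    case (lin_span_add F G)
    have "dir_deriv v (\<lambda>x. F x + G x) = (\<lambda>x. dir_deriv v F x + dir_deriv v G x)" for v
    proof (intro ext dir_deriv_eq)
      fix x show "((\<lambda>x. F x + G x) has_derivative (\<lambda>v. dir_deriv v F x + dir_deriv v G x)) (at x)"
        unfolding dir_deriv_def using lin_span_add frechet_derivative_works by (intro has_derivative_add) blast+
    qed
    then show ?case using lin_span_add by (auto intro: lin_span.intros)
  next
    case (lin_span_cmult F c)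
    have "dir_deriv v (\<lambda>x. c * F x) = (\<lambda>x. c * dir_deriv v F x)" for v
    proof (intro ext dir_deriv_eq)
      fix x show "((\<lambda>x. c * F x) has_derivative (\<lambda>v. c * dir_deriv v F x)) (at x)"
        unfolding dir_deriv_def using lin_span_cmult frechet_derivative_works by (intro has_derivative_mult_right) blast
    qed
    then show ?case using lin_span_cmult by (auto intro: lin_span.intros)
  qed
qed

lemma smooth_lin_span_smooth: "lin_span smooth F \<Longrightarrow> smooth F"
  by (rule smooth_lin_span[of smooth], intro conjI allI)
    (rule smooth_differentiable, assumption, rule lin_span_base, rule smooth_dir_deriv)

lemma smooth_add: "smooth F \<Longrightarrow> smooth G \<Longrightarrow> smooth (\<lambda>x. F x + G x)"
  by (rule smooth_lin_span_smooth, rule lin_span_add; rule lin_span_base)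

lemma smooth_cmult: "smooth F \<Longrightarrow> smooth (\<lambda>x. c * F x)"
  by (rule smooth_lin_span_smooth, rule lin_span_cmult, rule lin_span_base)

lemma smooth_const: "smooth (\<lambda>x. c)"
proof (rule smooth_coinduct[of "\<lambda>H. \<exists>c. H = (\<lambda>x. c)"])
  fix H :: "'a \<Rightarrow> complex" assume "\<exists>c. H = (\<lambda>x. c)"
  then obtain c where H: "H = (\<lambda>x. c)" by blast
  have "dir_deriv v H = (\<lambda>x. 0)" for v
    unfolding H by (intro ext dir_deriv_eq[of _ "\<lambda>_. 0"]) simp
  then show "(\<forall>x. H differentiable at x) \<and> (\<forall>v. \<exists>c. dir_deriv v H = (\<lambda>x. c))"
    using H by (metis differentiable_const)
qed blast

lemma smooth_sum: "(\<And>i. i \<in> I \<Longrightarrow> smooth (F i)) \<Longrightarrow> smooth (\<lambda>x. \<Sum>i\<in>I. F i x)"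
  by (induction I rule: infinite_finite_induct) (simp_all add: smooth_add smooth_const)

section \<open>Iterated partial derivatives and Schwartz bounds on the plane\<close>

lemma fold_dir_deriv_add:
  "smooth F \<Longrightarrow> smooth G \<Longrightarrow>
    fold dir_deriv ds (\<lambda>x. F x + G x) = (\<lambda>x. fold dir_deriv ds F x + fold dir_deriv ds G x)"
  by (induction ds arbitrary: F G) (auto simp: dir_deriv_add smooth_dir_deriv)

lemma fold_dir_deriv_cmult:
  "smooth F \<Longrightarrow> fold dir_deriv ds (\<lambda>x. c * F x) = (\<lambda>x. c * fold dir_deriv ds F x)"
  by (induction ds arbitrary: F) (auto simp: dir_deriv_cmult smooth_dir_deriv)

definition axis_list :: "nat \<times> nat \<Rightarrow> (real \<times> real) list" where
  "axis_list \<alpha> = replicate (snd \<alpha>) (0, 1) @ replicate (fst \<alpha>) (1, 0)"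

lemma partial_deriv_fold: "partial_deriv \<alpha> u = fold dir_deriv (axis_list \<alpha>) u"
  by (simp add: partial_deriv_def axis_list_def fold_replicate)

lemma length_axis_list: "length (axis_list \<alpha>) = fst \<alpha> + snd \<alpha>"
  and set_axis_list: "set (axis_list \<alpha>) \<subseteq> {(1, 0), (0, 1)}"
  by (auto simp: axis_list_def)

text \<open>A pointwise form of \<open>schwartz_norm N u \<le> C\<close> that does not presuppose that the suprema are finite.\<close>

definition sbd :: "nat \<Rightarrow> real \<Rightarrow> (real \<times> real \<Rightarrow> complex) \<Rightarrow> bool" where
  "sbd N C u \<longleftrightarrow> (\<forall>\<alpha> x. fst \<alpha> + snd \<alpha> \<le> N \<longrightarrow> (1 + (norm x)\<^sup>2) ^ N * cmod (partial_deriv \<alpha> u x) \<le> C)"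

lemma sbdD: "sbd N C u \<Longrightarrow> fst \<alpha> + snd \<alpha> \<le> N \<Longrightarrow> (1 + (norm x)\<^sup>2) ^ N * cmod (partial_deriv \<alpha> u x) \<le> C"
  unfolding sbd_def by (erule allE[of _ \<alpha>], erule allE[of _ x], erule mp)

lemma sbd_mono: "sbd N C u \<Longrightarrow> C \<le> C' \<Longrightarrow> sbd N C' u"
  unfolding sbd_def by (meson order.trans)

lemma sbd_add:
  assumes "smooth u" "smooth v" "sbd N C u" "sbd N D v"
  shows "sbd N (C + D) (\<lambda>x. u x + v x)"
  unfolding sbd_def
proof (intro allI impI)
  fix \<alpha> :: "nat \<times> nat" and x :: "real \<times> real" assume a: "fst \<alpha> + snd \<alpha> \<le> N"
  let ?w = "(1 + (norm x)\<^sup>2) ^ N"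
  have "?w * cmod (partial_deriv \<alpha> (\<lambda>x. u x + v x) x) \<le> ?w * (cmod (partial_deriv \<alpha> u x) + cmod (partial_deriv \<alpha> v x))"
    unfolding partial_deriv_fold fold_dir_deriv_add[OF assms(1,2)]
    by (intro mult_left_mono norm_triangle_ineq) auto
  also have "\<dots> \<le> C + D"
    unfolding distrib_left by (intro add_mono sbdD[OF assms(3) a] sbdD[OF assms(4) a])
  finally show "?w * cmod (partial_deriv \<alpha> (\<lambda>x. u x + v x) x) \<le> C + D" .
qed

lemma partial_deriv_0: "partial_deriv \<alpha> (\<lambda>x. 0) = (\<lambda>x. 0)"
  using fold_dir_deriv_cmult[OF smooth_const[of 0], of "axis_list \<alpha>" 0] by (simp add: partial_deriv_fold)

lemma sbd_sum:
  assumes "finite I" "\<And>i. i \<in> I \<Longrightarrow> smooth (u i)" "\<And>i. i \<in> I \<Longrightarrow> sbd N (C i) (u i)"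
  shows "sbd N (\<Sum>i\<in>I. C i) (\<lambda>x. \<Sum>i\<in>I. u i x)"
  using assms
proof (induction I rule: finite_induct)
  case empty
  then show ?case by (simp add: sbd_def partial_deriv_0)
next
  case (insert i I)
  then show ?case using sbd_add[of "u i" "\<lambda>x. \<Sum>i\<in>I. u i x" N] smooth_sum[of I u] by simp
qed

lemma sbd_cmult:
  assumes "smooth u" "sbd N C u" shows "sbd N (cmod c * C) (\<lambda>x. c * u x)"
  unfolding sbd_def partial_deriv_fold fold_dir_deriv_cmult[OF assms(1)]
proof (intro allI impI)
  fix \<alpha> :: "nat \<times> nat" and x :: "real \<times> real" assume "fst \<alpha> + snd \<alpha> \<le> N"
  then have "(1 + (norm x)\<^sup>2) ^ N * cmod (fold dir_deriv (axis_list \<alpha>) u x) \<le> C"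
    using sbdD[OF assms(2)] by (simp only: partial_deriv_fold)
  from mult_left_mono[OF this, of "cmod c"]
  show "(1 + (norm x)\<^sup>2) ^ N * cmod (c * fold dir_deriv (axis_list \<alpha>) u x) \<le> cmod c * C"
    by (simp add: norm_mult mult_ac)
qed

text \<open>\<open>schwartz_R2\<close> lets the weight exponent and the order of differentiation
  vary independently, while \<open>sbd\<close> ties both to one number. The tied bound at level
  \<open>N + fst \<alpha> + snd \<alpha>\<close> dominates the pair
  \<open>(\<alpha>, N)\<close>.\<close>

lemma schwartz_R2_iff: "u \<in> schwartz_R2 \<longleftrightarrow> smooth u \<and> (\<forall>N. \<exists>C. sbd N C u)"
proof safe
  assume u: "u \<in> schwartz_R2"
  then show "smooth u" by (simp add: schwartz_R2_def)
  fix N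
  let ?A = "{\<alpha> :: nat \<times> nat. fst \<alpha> + snd \<alpha> \<le> N}"
  have fin: "finite ?A"
    by (rule finite_subset[of _ "{..N} \<times> {..N}"]) auto
  have "\<exists>C. \<forall>x. (1 + (norm x)\<^sup>2) ^ N * cmod (partial_deriv \<alpha> u x) \<le> C" for \<alpha>
    using u unfolding schwartz_R2_def bdd_above_def mem_Collect_eq by blast
  then obtain c where c: "\<And>\<alpha> x. (1 + (norm x)\<^sup>2) ^ N * cmod (partial_deriv \<alpha> u x) \<le> c \<alpha>" by metis
  have "sbd N (Max (c ` ?A)) u"
    unfolding sbd_def using fin by (intro allI impI order.trans[OF c Max_ge]) auto
  then show "\<exists>C. sbd N C u" by blast
next
  assume u: "smooth u" "\<forall>N. \<exists>C. sbd N C u"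
  have "bdd_above (range (\<lambda>x. (1 + (norm x)\<^sup>2) ^ N * cmod (partial_deriv \<alpha> u x)))" for \<alpha> N
  proof -
    define M where "M = N + fst \<alpha> + snd \<alpha>"
    obtain C where C: "sbd M C u" using u by blast
    have "(1 + (norm x)\<^sup>2) ^ N * cmod (partial_deriv \<alpha> u x) \<le> C" for x
    proof -
      have "(1 + (norm x)\<^sup>2) ^ N * cmod (partial_deriv \<alpha> u x) \<le> (1 + (norm x)\<^sup>2) ^ M * cmod (partial_deriv \<alpha> u x)"
        by (intro mult_right_mono power_increasing) (auto simp: M_def)
      also have "\<dots> \<le> C" by (rule sbdD[OF C]) (simp add: M_def)
      finally show ?thesis .
    qed
    then show ?thesis unfolding bdd_above_def by blast
  qed
  then show "u \<in> schwartz_R2" using u(1) by (simp add: schwartz_R2_def del: split_paired_All)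
qed

lemma schwartz_add: "u \<in> schwartz_R2 \<Longrightarrow> v \<in> schwartz_R2 \<Longrightarrow> (\<lambda>x. u x + v x) \<in> schwartz_R2"
  unfolding schwartz_R2_iff by (blast intro: smooth_add sbd_add)

lemma schwartz_cmult: "u \<in> schwartz_R2 \<Longrightarrow> (\<lambda>x. c * u x) \<in> schwartz_R2"
  unfolding schwartz_R2_iff by (blast intro: smooth_cmult sbd_cmult)

lemma schwartz_0: "(\<lambda>x. 0) \<in> schwartz_R2"
  unfolding schwartz_R2_iff sbd_def partial_deriv_0 by (intro conjI smooth_const allI exI[of _ 0]) simp

lemma schwartz_sum:
  "finite I \<Longrightarrow> (\<And>i. i \<in> I \<Longrightarrow> u i \<in> schwartz_R2) \<Longrightarrow> (\<lambda>x. \<Sum>i\<in>I. u i x) \<in> schwartz_R2"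
  by (induction I rule: finite_induct) (simp_all add: schwartz_add schwartz_0)

lemma schwartz_norm_le: assumes "sbd N C u" shows "schwartz_norm N u \<le> C"
  unfolding schwartz_norm_def
proof (rule Max.boundedI)
  have "finite {\<alpha> :: nat \<times> nat. fst \<alpha> + snd \<alpha> \<le> N}"
    by (rule finite_subset[of _ "{..N} \<times> {..N}"]) auto
  then show "finite ((\<lambda>\<alpha>. SUP x. (1 + (norm x)\<^sup>2) ^ N * cmod (partial_deriv \<alpha> u x)) ` {\<alpha>. fst \<alpha> + snd \<alpha> \<le> N})"
    by simp
  show "(\<lambda>\<alpha>. SUP x. (1 + (norm x)\<^sup>2) ^ N * cmod (partial_deriv \<alpha> u x)) ` {\<alpha>. fst \<alpha> + snd \<alpha> \<le> N} \<noteq> {}"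
  proof -
    have "(0, 0) \<in> {\<alpha> :: nat \<times> nat. fst \<alpha> + snd \<alpha> \<le> N}" by simp
    then show ?thesis by blast
  qed
  fix a assume "a \<in> (\<lambda>\<alpha>. SUP x. (1 + (norm x)\<^sup>2) ^ N * cmod (partial_deriv \<alpha> u x)) ` {\<alpha>. fst \<alpha> + snd \<alpha> \<le> N}"
  then obtain \<alpha> where \<alpha>: "fst \<alpha> + snd \<alpha> \<le> N" "a = (SUP x. (1 + (norm x)\<^sup>2) ^ N * cmod (partial_deriv \<alpha> u x))"
    by blast
  show "a \<le> C"
    unfolding \<alpha>(2) by (intro cSUP_least sbdD[OF assms \<alpha>(1)]) simp
qed

lemma schwartz_norm_nonneg: assumes "u \<in> schwartz_R2" shows "0 \<le> schwartz_norm N u"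
proof -
  let ?f = "\<lambda>\<alpha>. SUP x. (1 + (norm x)\<^sup>2) ^ N * cmod (partial_deriv \<alpha> u x)"
  have "finite {\<alpha> :: nat \<times> nat. fst \<alpha> + snd \<alpha> \<le> N}"
    by (rule finite_subset[of _ "{..N} \<times> {..N}"]) auto
  then have "?f (0, 0) \<le> schwartz_norm N u"
    unfolding schwartz_norm_def by (intro Max_ge) auto
  moreover have "bdd_above (range (\<lambda>x. (1 + (norm x)\<^sup>2) ^ N * cmod (partial_deriv (0, 0) u x)))"
    using assms by (simp add: schwartz_R2_def)
  then have "0 \<le> ?f (0, 0)"
    by (intro cSUP_upper2[where x = 0]) auto
  ultimately show ?thesis by simp
qed

section \<open>Functions of product form on the plane\<close>

definition tens :: "(real \<Rightarrow> complex) \<Rightarrow> (real \<Rightarrow> complex) \<Rightarrow> real \<times> real \<Rightarrow> complex" where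
  "tens P Q = (\<lambda>p. P (fst p) * Q (snd p))"

lemma tens_derivative:
  assumes "sm UNIV P" "sm UNIV Q"
  shows "(tens P Q has_derivative (\<lambda>v. of_real (fst v) * tens (dv P) Q x + of_real (snd v) * tens P (dv Q) x)) (at x)"
proof -
  have fs: "(fst has_derivative fst) (at x)" "(snd has_derivative snd) (at x)"
    by (rule bounded_linear_imp_has_derivative[OF bounded_linear_fst]
        bounded_linear_imp_has_derivative[OF bounded_linear_snd])+
  have P: "((\<lambda>x. P (fst x)) has_derivative (\<lambda>v. fst v *\<^sub>R dv P (fst x))) (at x)"
    using diff_chain_at[OF fs(1) sm_derivative0[OF assms(1), of "fst x", unfolded has_vector_derivative_def]]
    by (simp add: comp_def)
  have Q: "((\<lambda>x. Q (snd x)) has_derivative (\<lambda>v. snd v *\<^sub>R dv Q (snd x))) (at x)"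
    using diff_chain_at[OF fs(2) sm_derivative0[OF assms(2), of "snd x", unfolded has_vector_derivative_def]]
    by (simp add: comp_def)
  have eq: "(\<lambda>v. P (fst x) * (snd v *\<^sub>R dv Q (snd x)) + fst v *\<^sub>R dv P (fst x) * Q (snd x)) =
      (\<lambda>v. of_real (fst v) * tens (dv P) Q x + of_real (snd v) * tens P (dv Q) x)"
    by (intro ext) (simp add: tens_def scaleR_conv_of_real)
  have "((\<lambda>p. P (fst p) * Q (snd p)) has_derivative
      (\<lambda>v. P (fst x) * (snd v *\<^sub>R dv Q (snd x)) + fst v *\<^sub>R dv P (fst x) * Q (snd x))) (at x)"
    by (rule has_derivative_mult[OF P Q])
  then show ?thesis unfolding eq tens_def[of P Q] .
qed

lemma dir_deriv_tens:
  assumes "sm UNIV P" "sm UNIV Q"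
  shows "dir_deriv v (tens P Q) = (\<lambda>x. of_real (fst v) * tens (dv P) Q x + of_real (snd v) * tens P (dv Q) x)"
  by (intro ext dir_deriv_eq tens_derivative assms)

lemma smooth_tens: assumes "sm UNIV P" "sm UNIV Q" shows "smooth (tens P Q)"
proof -
  define C where "C = (\<lambda>F. \<exists>P Q. sm UNIV P \<and> sm UNIV Q \<and> F = tens P Q)"
  have C: "C (tens P Q)" if "sm UNIV P" "sm UNIV Q" for P Q
    unfolding C_def using that by blast
  show ?thesis
  proof (rule smooth_lin_span[of C])
    show "lin_span C (tens P Q)" by (rule lin_span_base[of C, OF C[OF assms]])
    fix F assume "C F"
    then obtain P Q where *: "sm UNIV P" "sm UNIV Q" "F = tens P Q" unfolding C_def by blast
    have "lin_span C (dir_deriv v F)" for v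
      unfolding *(3) dir_deriv_tens[OF *(1,2)]
      by (rule lin_span_add; rule lin_span_cmult; rule lin_span_base; rule C) (use * sm_dv in auto)
    moreover have "F differentiable at x" for x
      unfolding *(3) by (rule differentiableI[OF tens_derivative[OF *(1,2)]])
    ultimately show "(\<forall>x. F differentiable at x) \<and> (\<forall>v. lin_span C (dir_deriv v F))" by blast
  qed
qed

lemma partial_deriv_tens:
  assumes "sm UNIV P" "sm UNIV Q"
  shows "partial_deriv (a, b) (tens P Q) = tens ((dv ^^ a) P) ((dv ^^ b) Q)"
proof -
  have "(dir_deriv (0, 1) ^^ b) (tens P Q) = tens P ((dv ^^ b) Q)" for b
    by (induction b) (simp_all add: dir_deriv_tens assms sm_dvn)
  moreover have "(dir_deriv (1, 0) ^^ a) (tens P ((dv ^^ b) Q)) = tens ((dv ^^ a) P) ((dv ^^ b) Q)" for a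
    by (induction a) (simp_all add: dir_deriv_tens assms sm_dvn)
  ultimately show ?thesis by (simp add: partial_deriv_def)
qed

text \<open>Derivative bounds for a profile varying on the scale \<open>1 / \<sigma>\<close>.\<close>

definition bu :: "nat \<Rightarrow> real \<Rightarrow> real \<Rightarrow> (real \<Rightarrow> complex) \<Rightarrow> bool" where
  "bu K \<sigma> A f \<longleftrightarrow> (\<forall>k\<le>K. \<forall>t. cmod ((dv ^^ k) f t) \<le> A * \<sigma> ^ k)"

lemma buD: "bu K \<sigma> A f \<Longrightarrow> k \<le> K \<Longrightarrow> cmod ((dv ^^ k) f t) \<le> A * \<sigma> ^ k"
  by (simp add: bu_def)

lemma bu_nonneg: "bu K \<sigma> A f \<Longrightarrow> 0 \<le> A"
  using order.trans[OF norm_ge_zero buD[of K \<sigma> A f 0 0]] by simp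

lemma dvn_outside_support:
  assumes "\<And>x. R < \<bar>x\<bar> \<Longrightarrow> f x = 0" "R < \<bar>t\<bar>"
  shows "(dv ^^ k) f t = 0"
proof -
  have o: "open {t. R < \<bar>t\<bar>}" by (intro open_Collect_less continuous_intros)
  have "(dv ^^ k) f t = (dv ^^ k) (\<lambda>t. 0) t"
    by (rule dvn_cong[OF o]) (use assms in auto)
  then show ?thesis by (simp add: dvn_const[of UNIV])
qed

text \<open>The support lies in a rectangle, where the weight is at most
  \<open>(1 + R^2 + S^2) ^ N\<close>; differentiating \<open>a + b \<le> N\<close> times costs
  \<open>\<sigma> ^ (a + b)\<close>, at most \<open>\<sigma> ^ N\<close> because
  \<open>1 \<le> \<sigma>\<close>.\<close>

lemma sbd_tens:
  assumes "sm UNIV P" "sm UNIV Q" "1 \<le> \<sigma>"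
    and P: "bu N \<sigma> A P" "\<And>x. R < \<bar>x\<bar> \<Longrightarrow> P x = 0"
    and Q: "bu N \<sigma> B Q" "\<And>x. S < \<bar>x\<bar> \<Longrightarrow> Q x = 0"
  shows "sbd N ((1 + R\<^sup>2 + S\<^sup>2) ^ N * (A * B * \<sigma> ^ N)) (tens P Q)"
  unfolding sbd_def
proof (intro allI impI)
  fix \<alpha> :: "nat \<times> nat" and p :: "real \<times> real" assume \<alpha>: "fst \<alpha> + snd \<alpha> \<le> N"
  obtain x y where p: "p = (x, y)" by (cases p)
  obtain a b where ab: "\<alpha> = (a, b)" by (cases \<alpha>)
  have AB: "0 \<le> A" "0 \<le> B" using bu_nonneg P(1) Q(1) by blast+
  have pd: "partial_deriv \<alpha> (tens P Q) p = (dv ^^ a) P x * (dv ^^ b) Q y"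
    unfolding ab p partial_deriv_tens[OF assms(1,2)] by (simp add: tens_def)
  have C: "0 \<le> (1 + R\<^sup>2 + S\<^sup>2) ^ N * (A * B * \<sigma> ^ N)" using AB assms(3) by simp
  show "(1 + (norm p)\<^sup>2) ^ N * cmod (partial_deriv \<alpha> (tens P Q) p) \<le> (1 + R\<^sup>2 + S\<^sup>2) ^ N * (A * B * \<sigma> ^ N)"
  proof (cases "\<bar>x\<bar> \<le> R \<and> \<bar>y\<bar> \<le> S")
    case True
    then have "x\<^sup>2 \<le> R\<^sup>2" "y\<^sup>2 \<le> S\<^sup>2" by (metis abs_ge_zero power2_abs power_mono)+
    then have w: "(1 + (norm p)\<^sup>2) ^ N \<le> (1 + R\<^sup>2 + S\<^sup>2) ^ N"
      by (intro power_mono) (auto simp: p norm_Pair)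
    have "cmod ((dv ^^ a) P x * (dv ^^ b) Q y) \<le> (A * \<sigma> ^ a) * (B * \<sigma> ^ b)"
      unfolding norm_mult using \<alpha> AB assms(3) by (intro mult_mono buD[OF P(1)] buD[OF Q(1)]) (auto simp: ab)
    also have "\<dots> = A * B * \<sigma> ^ (a + b)" by (simp add: power_add)
    also have "\<dots> \<le> A * B * \<sigma> ^ N"
      using AB assms(3) \<alpha> by (intro mult_left_mono power_increasing) (auto simp: ab)
    finally show ?thesis unfolding pd using w by (intro mult_mono) auto
  next
    case False
    then have "(dv ^^ a) P x * (dv ^^ b) Q y = 0"
      using dvn_outside_support[of R P x a] dvn_outside_support[of S Q y b] P(2) Q(2) by auto
    then have "cmod (partial_deriv \<alpha> (tens P Q) p) = 0" by (simp only: pd norm_zero)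
    then show ?thesis using C by simp
  qed
qed

lemma bu_order_mono: "bu K \<sigma> A f \<Longrightarrow> J \<le> K \<Longrightarrow> bu J \<sigma> A f"
  unfolding bu_def by auto

text \<open>The Leibniz rule as an induction on the order: each differentiation doubles the number
  of products, whence the factor \<open>2 ^ K\<close>.\<close>

lemma bu_mult:
  assumes "sm UNIV f" "sm UNIV g" "bu K \<sigma> A f" "bu K \<sigma> B g" "0 \<le> \<sigma>"
  shows "bu K \<sigma> (2 ^ K * (A * B)) (\<lambda>t. f t * g t)"
proof -
  \<comment> \<open>The functions and constants are quantified inside, since the induction
    hypothesis is applied to the pairs \<open>f\<close>, \<open>dv g\<close> and
    \<open>dv f\<close>, \<open>g\<close>, where one constant carries an extra
    \<open>\<sigma>\<close>.\<close>
  have "\<forall>f g A B. sm UNIV f \<longrightarrow> sm UNIV g \<longrightarrow> bu k \<sigma> A f \<longrightarrow> bu k \<sigma> B g \<longrightarrow>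
      (\<forall>t. cmod ((dv ^^ k) (\<lambda>t. f t * g t) t) \<le> 2 ^ k * (A * B) * \<sigma> ^ k)" for k
  proof (induction k)
    case 0
    show ?case
    proof (intro allI impI)
      fix f g A B and t :: real assume *: "bu 0 \<sigma> A f" "bu 0 \<sigma> B g"
      then show "cmod ((dv ^^ 0) (\<lambda>t. f t * g t) t) \<le> 2 ^ 0 * (A * B) * \<sigma> ^ 0"
        using buD[OF *(1), of 0 t] buD[OF *(2), of 0 t] bu_nonneg[OF *(1)] by (simp add: norm_mult mult_mono)
    qed
  next
    case (Suc k)
    show ?case
    proof (intro allI impI)
      fix f g A B and t :: real
      assume s: "sm UNIV f" "sm UNIV g" and b: "bu (Suc k) \<sigma> A f" "bu (Suc k) \<sigma> B g"
      have b': "bu k \<sigma> (A * \<sigma>) (dv f)" "bu k \<sigma> (B * \<sigma>) (dv g)"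
        using b unfolding bu_def dvn_dv by (metis Suc_le_mono mult.assoc power_Suc)+
      have b0: "bu k \<sigma> A f" "bu k \<sigma> B g" using b bu_order_mono by fastforce+
      have "(dv ^^ Suc k) (\<lambda>t. f t * g t) t = (dv ^^ k) (\<lambda>t. f t * dv g t + dv f t * g t) t"
        unfolding dvn_dv[symmetric] using dv_mult[OF s] by (intro dvn_cong[of UNIV]) auto
      also have "\<dots> = (dv ^^ k) (\<lambda>t. f t * dv g t) t + (dv ^^ k) (\<lambda>t. dv f t * g t) t"
        by (intro dvn_add[of UNIV]) (auto intro!: sm_mult s sm_dv)
      finally have "cmod ((dv ^^ Suc k) (\<lambda>t. f t * g t) t) \<le>
          cmod ((dv ^^ k) (\<lambda>t. f t * dv g t) t) + cmod ((dv ^^ k) (\<lambda>t. dv f t * g t) t)"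
        by (simp only: norm_triangle_ineq)
      also have "\<dots> \<le> 2 ^ k * (A * (B * \<sigma>)) * \<sigma> ^ k + 2 ^ k * (A * \<sigma> * B) * \<sigma> ^ k"
        using Suc.IH s sm_dv b' b0 by (intro add_mono) blast+
      finally show "cmod ((dv ^^ Suc k) (\<lambda>t. f t * g t) t) \<le> 2 ^ Suc k * (A * B) * \<sigma> ^ Suc k"
        by (simp add: algebra_simps)
    qed
  qed
  then have *: "cmod ((dv ^^ k) (\<lambda>t. f t * g t) t) \<le> 2 ^ k * (A * B) * \<sigma> ^ k" if "k \<le> K" for k t
    using assms bu_order_mono[OF assms(3) that] bu_order_mono[OF assms(4) that] by blast
  show ?thesis
    unfolding bu_def
  proof (intro allI impI)
    fix k t assume k: "k \<le> K"
    have "0 \<le> A * B" using bu_nonneg assms(3,4) by simp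
    then have "2 ^ k * (A * B) * \<sigma> ^ k \<le> 2 ^ K * (A * B) * \<sigma> ^ k"
      using k assms(5) by (intro mult_right_mono power_increasing) auto
    then show "cmod ((dv ^^ k) (\<lambda>t. f t * g t) t) \<le> 2 ^ K * (A * B) * \<sigma> ^ k"
      using *[OF k, of t] by linarith
  qed
qed

lemma bu_affine:
  assumes "sm UNIV f" "bu K 1 A f" "\<bar>a\<bar> \<le> \<sigma>"
  shows "bu K \<sigma> A (\<lambda>t. f (a * t + b))"
  unfolding bu_def dvn_affine[OF assms(1)]
proof (intro allI impI)
  fix k t assume "k \<le> K"
  then have "cmod ((dv ^^ k) f (a * t + b)) \<le> A" using buD[OF assms(2), of k] by simp
  moreover have "\<bar>a\<bar> ^ k \<le> \<sigma> ^ k" using assms(3) by (intro power_mono) auto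
  ultimately have "\<bar>a\<bar> ^ k * cmod ((dv ^^ k) f (a * t + b)) \<le> \<sigma> ^ k * A" by (intro mult_mono) (use assms(3) in auto)
  then show "cmod (of_real (a ^ k) * (dv ^^ k) f (a * t + b)) \<le> A * \<sigma> ^ k"
    by (simp add: norm_mult norm_power power_abs mult.commute)
qed

lemma bu_cmult:
  assumes "sm UNIV f" "bu K \<sigma> A f" shows "bu K \<sigma> (cmod c * A) (\<lambda>t. c * f t)"
  unfolding bu_def
proof (intro allI impI)
  fix k t assume "k \<le> K"
  then show "cmod ((dv ^^ k) (\<lambda>t. c * f t) t) \<le> cmod c * A * \<sigma> ^ k"
    using mult_left_mono[OF buD[OF assms(2), of k t], of "cmod c"] dvn_cmult[OF open_UNIV assms(1), of t k c]
    by (simp add: norm_mult mult.assoc)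
qed

lemma ex_bu:
  assumes "sm UNIV f" "\<And>t. R < \<bar>t\<bar> \<Longrightarrow> f t = 0"
  shows "\<exists>A. bu K 1 A f"
proof -
  have "\<forall>k. \<exists>C\<ge>0. \<forall>t. cmod ((dv ^^ k) f t) \<le> C"
    using bounded_dvn_of_support[of f R] assms by blast
  then obtain c where c: "\<And>k. 0 \<le> c k" "\<And>k t. cmod ((dv ^^ k) f t) \<le> c k" by metis
  have "cmod ((dv ^^ k) f t) \<le> (\<Sum>k\<le>K. c k) * 1 ^ k" if "k \<le> K" for k t
    unfolding power_one mult_1_right by (rule order.trans[OF c(2)], rule member_le_sum) (use that c in auto)
  then show ?thesis unfolding bu_def by blast
qed

lemma bu_mono: "bu K \<sigma> A f \<Longrightarrow> A \<le> A' \<Longrightarrow> 0 \<le> \<sigma> \<Longrightarrow> bu K \<sigma> A' f"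
  unfolding bu_def by (meson mult_right_mono order.trans zero_le_power)

subsection \<open>Weighted bounds on the half-line\<close>

text \<open>A symbol-type estimate: vanishing of order \<open>q\<close> at 0, a decay factor of
  order \<open>L\<close> at infinity, and a factor \<open>1 / t\<close> for each derivative. The
  exponent is an integer because \<open>q - k\<close> can be negative. For \<open>q = 0\<close> and
  \<open>L = 0\<close> the estimate is invariant under dilations, the source of all later bounds
  that do not see the scale of a cutoff.\<close>

definition bd :: "nat \<Rightarrow> int \<Rightarrow> nat \<Rightarrow> real \<Rightarrow> (real \<Rightarrow> complex) \<Rightarrow> bool" where
  "bd K q L B f \<longleftrightarrow> (\<forall>k\<le>K. \<forall>t>0. cmod ((dv ^^ k) f t) \<le> B * t powi (q - int k) / (1 + t) ^ L)"

lemma bdD: "bd K q L B f \<Longrightarrow> k \<le> K \<Longrightarrow> t > 0 \<Longrightarrow> cmod ((dv ^^ k) f t) \<le> B * t powi (q - int k) / (1 + t) ^ L"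
  by (simp add: bd_def)

lemma bd_nonneg: assumes "bd K q L B f" shows "0 \<le> B"
proof -
  have "0 \<le> B / 2 ^ L" using order.trans[OF norm_ge_zero bdD[OF assms, of 0 1]] by simp
  then show ?thesis by (metis divide_nonneg_neg divide_neg_pos not_le zero_less_numeral zero_less_power)
qed

lemma bd_Suc:
  "bd (Suc K) q L B f \<longleftrightarrow> (\<forall>t>0. cmod (f t) \<le> B * t powi q / (1 + t) ^ L) \<and> bd K (q - 1) L B (dv f)"
  (is "_ \<longleftrightarrow> ?R")
proof
  assume b: "bd (Suc K) q L B f"
  show ?R
  proof
    show "\<forall>t>0. cmod (f t) \<le> B * t powi q / (1 + t) ^ L" using bdD[OF b, of 0] by simp
    show "bd K (q - 1) L B (dv f)"
      unfolding bd_def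
    proof (intro allI impI)
      fix k t assume "k \<le> K" "(0::real) < t"
      then show "cmod ((dv ^^ k) (dv f) t) \<le> B * t powi (q - 1 - int k) / (1 + t) ^ L"
        using bdD[OF b, of "Suc k" t] unfolding dvn_dv by (simp add: algebra_simps)
    qed
  qed
next
  assume r: ?R
  show "bd (Suc K) q L B f"
    unfolding bd_def
  proof (intro allI impI)
    fix k t assume k: "k \<le> Suc K" "(0::real) < t"
    show "cmod ((dv ^^ k) f t) \<le> B * t powi (q - int k) / (1 + t) ^ L"
    proof (cases k)
      case 0
      then show ?thesis using r k by simp
    next
      case (Suc j)
      then show ?thesis
        using bdD[OF conjunct2[OF r], of j t] k unfolding dvn_dv by (simp add: algebra_simps)
    qed
  qed
qed

lemma bd_order_mono: "bd K q L B f \<Longrightarrow> J \<le> K \<Longrightarrow> bd J q L B f"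
  unfolding bd_def by auto

lemma bd_cong: "(\<And>t. t > 0 \<Longrightarrow> f t = g t) \<Longrightarrow> bd K q L B f \<Longrightarrow> bd K q L B g"
  unfolding bd_def using dvn_cong[of "{0<..}" f g] by simp

lemma bd_add:
  assumes "sm {0<..} f" "sm {0<..} g" "bd K q L B f" "bd K q L C g"
  shows "bd K q L (B + C) (\<lambda>t. f t + g t)"
  unfolding bd_def
proof (intro allI impI)
  fix k t assume k: "k \<le> K" "(0::real) < t"
  have "cmod ((dv ^^ k) (\<lambda>t. f t + g t) t) \<le> cmod ((dv ^^ k) f t) + cmod ((dv ^^ k) g t)"
    using dvn_add[of "{0<..}" f g t k] assms k by (simp add: norm_triangle_ineq)
  also have "\<dots> \<le> B * t powi (q - int k) / (1 + t) ^ L + C * t powi (q - int k) / (1 + t) ^ L"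
    using assms k by (intro add_mono bdD)
  finally show "cmod ((dv ^^ k) (\<lambda>t. f t + g t) t) \<le> (B + C) * t powi (q - int k) / (1 + t) ^ L"
    by (simp add: algebra_simps add_divide_distrib)
qed

text \<open>Orders of vanishing and of decay add: both terms of the product rule have total order
  \<open>q + r - 1\<close>.\<close>

lemma bd_mult:
  assumes "sm {0<..} f" "sm {0<..} g" "bd K q L B f" "bd K r M C g"
  shows "bd K (q + r) (L + M) (2 ^ K * (B * C)) (\<lambda>t. f t * g t)"
  using assms
proof (induction K arbitrary: f g q r)
  case 0
  show ?case
    unfolding bd_def
  proof (intro allI impI)
    fix k t assume k: "k \<le> (0::nat)" "(0::real) < t"
    have "cmod (f t * g t) \<le> (B * t powi q / (1 + t) ^ L) * (C * t powi r / (1 + t) ^ M)"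
      unfolding norm_mult using bdD[OF 0(3), of 0 t] bdD[OF 0(4), of 0 t] k bd_nonneg[OF 0(3)]
      by (intro mult_mono) auto
    then show "cmod ((dv ^^ k) (\<lambda>t. f t * g t) t) \<le> 2 ^ 0 * (B * C) * t powi (q + r - int k) / (1 + t) ^ (L + M)"
      using k by (simp add: power_int_add power_add mult_ac)
  qed
next
  case (Suc K)
  have BC: "0 \<le> B * C" using Suc.prems bd_nonneg by (metis mult_nonneg_nonneg)
  have f: "bd K q L B f" "bd K (q - 1) L B (dv f)"
    and g: "bd K r M C g" "bd K (r - 1) M C (dv g)"
    using Suc.prems(3,4) bd_order_mono[of "Suc K" _ _ _ _ K] by (auto simp: bd_Suc)
  have o: "open {0::real<..}" by simp
  have s1: "bd K (q + (r - 1)) (L + M) (2 ^ K * (B * C)) (\<lambda>t. f t * dv g t)"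
    by (intro Suc.IH f g sm_dv Suc.prems)
  have s2: "bd K ((q - 1) + r) (L + M) (2 ^ K * (B * C)) (\<lambda>t. dv f t * g t)"
    by (intro Suc.IH f g sm_dv Suc.prems)
  have "bd K (q + r - 1) (L + M) (2 ^ K * (B * C) + 2 ^ K * (B * C)) (\<lambda>t. f t * dv g t + dv f t * g t)"
    using s1 s2 by (intro bd_add sm_mult[OF o] sm_dv Suc.prems) (simp_all add: algebra_simps)
  then have "bd K (q + r - 1) (L + M) (2 ^ Suc K * (B * C)) (dv (\<lambda>t. f t * g t))"
    unfolding power_Suc mult_2 mult.assoc distrib_right
    by (rule bd_cong[rotated]) (use dv_mult[OF Suc.prems(1,2)] in simp)
  moreover have "cmod (f t * g t) \<le> 2 ^ Suc K * (B * C) * t powi (q + r) / (1 + t) ^ (L + M)" if t: "t > 0" for t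
  proof -
    have "cmod (f t * g t) \<le> (B * t powi q / (1 + t) ^ L) * (C * t powi r / (1 + t) ^ M)"
      unfolding norm_mult using bdD[OF f(1), of 0 t] bdD[OF g(1), of 0 t] t bd_nonneg[OF f(1)]
      by (intro mult_mono) auto
    also have "\<dots> = 1 * (B * C) * t powi (q + r) / (1 + t) ^ (L + M)"
      using t by (simp add: power_int_add power_add mult_ac)
    also have "\<dots> \<le> 2 ^ Suc K * (B * C) * t powi (q + r) / (1 + t) ^ (L + M)"
      using t BC one_le_power[of "2::real" "Suc K"] by (intro divide_right_mono mult_right_mono) auto
    finally show ?thesis .
  qed
  ultimately show ?case by (simp add: bd_Suc)
qed

text \<open>A named factor, so that division by \<open>t\<close> is a product to which
  \<open>bd_mult\<close> applies; it lowers the order of vanishing by one.\<close>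

definition recip :: "real \<Rightarrow> complex" where
  "recip t = inverse (of_real t)"

lemma
  shows sm_recip: "sm {0<..} recip"
    and dvn_recip: "t > 0 \<Longrightarrow> (dv ^^ k) recip t = of_real ((-1) ^ k * fact k * inverse t ^ Suc k)"
proof -
  define D :: "nat \<Rightarrow> real \<Rightarrow> complex" where "D = (\<lambda>k t. of_real ((-1) ^ k * fact k * inverse t ^ Suc k))"
  have "(D k has_vector_derivative D (Suc k) t) (at t)" if t: "t \<in> {0<..}" for k t
  proof -
    have "((\<lambda>t. inverse t ^ Suc k) has_real_derivative (- (real (Suc k)) * inverse t ^ Suc (Suc k))) (at t)"
      using DERIV_power[OF DERIV_inverse, of t "Suc k"] t by (simp add: algebra_simps)
    from DERIV_cmult[OF this, of "(-1) ^ k * fact k"]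
    have "((\<lambda>t. (-1) ^ k * fact k * inverse t ^ Suc k) has_real_derivative
        ((-1) ^ Suc k * fact (Suc k) * inverse t ^ Suc (Suc k))) (at t)"
      by (simp add: algebra_simps)
    then show ?thesis
      unfolding D_def by (intro has_vector_derivative_of_real) (simp only: has_real_derivative_iff_has_vector_derivative)
  qed
  from sm_tower[of "{0<..}" D, OF _ this]
  have "sm {0<..} (D 0)" "t > 0 \<Longrightarrow> (dv ^^ k) (D 0) t = D k t" by auto
  moreover have "D 0 = recip" by (auto simp: D_def recip_def)
  ultimately show "sm {0<..} recip" "t > 0 \<Longrightarrow> (dv ^^ k) recip t = of_real ((-1) ^ k * fact k * inverse t ^ Suc k)"
    by (simp_all add: D_def)
qed

lemma bd_recip: "bd K (-1) 0 (fact K) recip"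
  unfolding bd_def
proof (intro allI impI)
  fix k t assume k: "k \<le> K" "(0::real) < t"
  have "cmod ((dv ^^ k) recip t) = fact k * inverse t ^ Suc k"
    using k by (simp add: dvn_recip norm_mult norm_power norm_inverse del: of_real_mult)
      (simp add: abs_mult power_abs)
  also have "inverse t ^ Suc k = t powi (-1 - int k)"
    using k by (simp add: power_int_minus power_int_diff power_inverse field_simps)
  finally show "cmod ((dv ^^ k) recip t) \<le> fact K * t powi (-1 - int k) / (1 + t) ^ 0"
    using k fact_mono[of k K, where 'a = real] by (simp add: mult_right_mono)
qed

lemma bd_over:
  assumes "sm {0<..} f" "bd K q L B f"
  shows "bd K (q - 1) L (2 ^ K * (fact K * B)) (\<lambda>t. recip t * f t)"
  using bd_mult[OF sm_recip assms(1) bd_recip assms(2)] by (simp add: algebra_simps)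

subsection \<open>Functions concentrated on a cone\<close>

text \<open>A profile in the first coordinate times a profile in the slope
  \<open>snd p / fst p\<close>. If \<open>\<phi>\<close> is supported in a short interval, the
  function lives in a narrow cone around a half-line.\<close>

definition cone_fun :: "(real \<Rightarrow> complex) \<Rightarrow> (real \<Rightarrow> complex) \<Rightarrow> real \<times> real \<Rightarrow> complex" where
  "cone_fun r \<phi> = (\<lambda>p. if fst p > 0 then r (fst p) * \<phi> (snd p / fst p) else 0)"

text \<open>Vanishing near 0 makes the continuation of \<open>cone_fun\<close> by zero across the
  second axis smooth. The size of \<open>\<delta>\<close> does not enter the bound
  \<open>sbd_cone_fun\<close>.\<close>

definition off_zero :: "(real \<Rightarrow> complex) \<Rightarrow> bool" where
  "off_zero r \<longleftrightarrow> sm {0<..} r \<and> (\<exists>\<delta>>0. \<forall>t. 0 < t \<and> t < \<delta> \<longrightarrow> r t = 0)"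

lemma off_zero_sm: "off_zero r \<Longrightarrow> sm {0<..} r"
  by (simp add: off_zero_def)

lemma off_zero_dv: assumes "off_zero r" shows "off_zero (dv r)"
proof -
  obtain \<delta> where \<delta>: "\<delta> > 0" "\<And>t. 0 < t \<and> t < \<delta> \<Longrightarrow> r t = 0" using assms by (auto simp: off_zero_def)
  have "dv r t = 0" if "0 < t \<and> t < \<delta>" for t
  proof -
    have "dv r t = dv (\<lambda>t. 0) t"
      by (rule dv_cong[of "{0<..<\<delta>}"]) (use that \<delta> in auto)
    then show ?thesis using dvn_const[of UNIV t 1 0] by simp
  qed
  then show ?thesis using assms \<delta>(1) by (auto simp: off_zero_def intro: sm_dv)
qed

lemma off_zero_over: "off_zero r \<Longrightarrow> off_zero (\<lambda>t. recip t * r t)"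
  unfolding off_zero_def using sm_mult[OF _ sm_recip] by fastforce

text \<open>The slope \<open>y / x\<close> has gradient \<open>(- y / x, 1)\<close> divided by
  \<open>x\<close>. Hence differentiation in \<open>x\<close> produces the profile pairs
  \<open>r'\<close>, \<open>\<phi>\<close> and \<open>r / x\<close>,
  \<open>- \<theta> \<phi>'\<close>, and differentiation in \<open>y\<close> the pair
  \<open>r / x\<close>, \<open>\<phi>'\<close>: the class is stable, and \<open>r'\<close> and
  \<open>r / x\<close> both lose one order of vanishing.\<close>

lemma cone_fun_derivative:
  assumes r: "off_zero r" and \<phi>: "sm UNIV \<phi>"
  shows "(cone_fun r \<phi> has_derivative (\<lambda>v. of_real (fst v) * (cone_fun (dv r) \<phi> p + cone_fun (\<lambda>t. recip t * r t) (\<lambda>\<theta>. (-1) * (of_real \<theta> * dv \<phi> \<theta>)) p)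
      + of_real (snd v) * cone_fun (\<lambda>t. recip t * r t) (dv \<phi>) p)) (at p)" (is "(_ has_derivative ?D) _")
proof (cases "fst p > 0")
  case True
  define x y where "x = fst p" and "y = snd p"
  have x: "x > 0" using True by (simp add: x_def)
  have fs: "(fst has_derivative fst) (at p)" "(snd has_derivative snd) (at p)"
    by (rule bounded_linear_imp_has_derivative[OF bounded_linear_fst]
        bounded_linear_imp_has_derivative[OF bounded_linear_snd])+
  have R: "((\<lambda>p. r (fst p)) has_derivative (\<lambda>v. fst v *\<^sub>R dv r x)) (at p)"
    using diff_chain_at[OF fs(1) sm_derivative0[OF off_zero_sm[OF r], of "fst p", unfolded has_vector_derivative_def]] True
    by (simp add: comp_def x_def)
  have q: "((\<lambda>p. snd p / fst p) has_derivative (\<lambda>v. (snd v * x - y * fst v) / (x * x))) (at p)"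
    using has_derivative_divide'[OF fs(2,1)] x by (simp add: x_def y_def)
  have Ph: "((\<lambda>p. \<phi> (snd p / fst p)) has_derivative (\<lambda>v. ((snd v * x - y * fst v) / (x * x)) *\<^sub>R dv \<phi> (y / x))) (at p)"
    using diff_chain_at[OF q sm_derivative0[OF \<phi>, of "snd p / fst p", unfolded has_vector_derivative_def]]
    by (simp add: comp_def x_def y_def)
  have eq: "(\<lambda>v. r (fst p) * (((snd v * x - y * fst v) / (x * x)) *\<^sub>R dv \<phi> (y / x)) + fst v *\<^sub>R dv r x * \<phi> (snd p / fst p)) = ?D"
  proof
    fix v :: "real \<times> real"
    show "r (fst p) * (((snd v * x - y * fst v) / (x * x)) *\<^sub>R dv \<phi> (y / x)) + fst v *\<^sub>R dv r x * \<phi> (snd p / fst p) = ?D v"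
      using x unfolding cone_fun_def recip_def x_def[symmetric] y_def[symmetric]
      by (simp add: scaleR_conv_of_real field_simps)
  qed
  have "((\<lambda>p. r (fst p) * \<phi> (snd p / fst p)) has_derivative ?D) (at p)"
    using has_derivative_mult[OF R Ph] unfolding eq .
  then show ?thesis
  proof (rule has_derivative_transform_within_open[of _ _ _ _ "{p. 0 < fst p}"])
    show "open {p :: real \<times> real. 0 < fst p}"
      by (intro open_Collect_less continuous_intros)
  qed (use True in \<open>auto simp: cone_fun_def\<close>)
next
  case False
  obtain \<delta> where \<delta>: "\<delta> > 0" "\<And>t. 0 < t \<and> t < \<delta> \<Longrightarrow> r t = 0" using r by (auto simp: off_zero_def)
  have D0: "?D = (\<lambda>v. 0)" using False by (simp add: cone_fun_def)
  have "((\<lambda>p. 0) has_derivative ?D) (at p)" unfolding D0 by simp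
  then show ?thesis
  proof (rule has_derivative_transform_within_open[of _ _ _ _ "{p. fst p < \<delta>}"])
    show "open {p :: real \<times> real. fst p < \<delta>}"
      by (intro open_Collect_less continuous_intros)
  qed (use False \<delta> in \<open>auto simp: cone_fun_def\<close>)
qed

lemma dir_deriv_cone_fun:
  assumes "off_zero r" "sm UNIV \<phi>"
  shows "dir_deriv v (cone_fun r \<phi>) = (\<lambda>p. of_real (fst v) * (cone_fun (dv r) \<phi> p + cone_fun (\<lambda>t. recip t * r t) (\<lambda>\<theta>. (-1) * (of_real \<theta> * dv \<phi> \<theta>)) p)
      + of_real (snd v) * cone_fun (\<lambda>t. recip t * r t) (dv \<phi>) p)"
  by (rule ext, rule dir_deriv_eq, rule cone_fun_derivative[OF assms])

lemma sm_neg_times_dv: "sm UNIV \<phi> \<Longrightarrow> sm UNIV (\<lambda>\<theta>. (-1) * (of_real \<theta> * dv \<phi> \<theta>))"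
  by (intro sm_cmult sm_times_id sm_dv open_UNIV)

lemma smooth_cone_fun: assumes "off_zero r" "sm UNIV \<phi>" shows "smooth (cone_fun r \<phi>)"
proof -
  define C where "C = (\<lambda>F. \<exists>r \<phi>. off_zero r \<and> sm UNIV \<phi> \<and> F = cone_fun r \<phi>)"
  have C: "C (cone_fun r \<phi>)" if "off_zero r" "sm UNIV \<phi>" for r \<phi>
    unfolding C_def using that by blast
  show ?thesis
  proof (rule smooth_lin_span[of C])
    show "lin_span C (cone_fun r \<phi>)" by (rule lin_span_base[of C, OF C[OF assms]])
    fix F assume "C F"
    then obtain r \<phi> where *: "off_zero r" "sm UNIV \<phi>" "F = cone_fun r \<phi>" unfolding C_def by blast
    have "lin_span C (dir_deriv v F)" for v
      unfolding *(3) dir_deriv_cone_fun[OF *(1,2)]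
      apply (rule lin_span_add)
       apply (rule lin_span_cmult)
       apply (rule lin_span_add)
        apply (rule lin_span_base, rule C[OF off_zero_dv[OF *(1)] *(2)])
       apply (rule lin_span_base, rule C[OF off_zero_over[OF *(1)] sm_neg_times_dv[OF *(2)]])
      apply (rule lin_span_cmult)
      apply (rule lin_span_base, rule C[OF off_zero_over[OF *(1)] sm_dv[OF *(2)]])
      done
    moreover have "F differentiable at x" for x
      unfolding *(3) by (rule differentiableI[OF cone_fun_derivative[OF *(1,2)]])
    ultimately show "(\<forall>x. F differentiable at x) \<and> (\<forall>v. lin_span C (dir_deriv v F))" by blast
  qed
qed

lemma dir_deriv_cone_fun_axes:
  assumes "off_zero r" "sm UNIV \<phi>"
  shows "dir_deriv (1, 0) (cone_fun r \<phi>) = (\<lambda>p. cone_fun (dv r) \<phi> p + cone_fun (\<lambda>t. recip t * r t) (\<lambda>\<theta>. (-1) * (of_real \<theta> * dv \<phi> \<theta>)) p)"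
    and "dir_deriv (0, 1) (cone_fun r \<phi>) = cone_fun (\<lambda>t. recip t * r t) (dv \<phi>)"
  unfolding dir_deriv_cone_fun[OF assms] by simp_all

text \<open>The recursion mirrors one differentiation in \<open>x\<close>: the summand 1 belongs to
  \<open>r'\<close>; the other is the constant \<open>2 ^ K * fact K\<close> of
  \<open>bd_over\<close> for \<open>r / x\<close>, times the factor \<open>K + 1\<close> from the
  derivatives of \<open>\<theta> \<phi>'\<close>.\<close>

primrec cone_fun_const :: "nat \<Rightarrow> real" where
  "cone_fun_const 0 = 1"
| "cone_fun_const (Suc K) = cone_fun_const K * (1 + 2 ^ K * fact K * real (Suc K))"

lemma cone_fun_const_ge_1: "1 \<le> cone_fun_const K"
proof (induction K)
  case (Suc K)
  have "1 * 1 \<le> cone_fun_const K * (1 + 2 ^ K * fact K * real (Suc K))"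
    using Suc by (intro mult_mono) auto
  then show ?case by simp
qed simp

lemma cone_fun_const_mono: "J \<le> K \<Longrightarrow> cone_fun_const J \<le> cone_fun_const K"
proof (rule lift_Suc_mono_le[of cone_fun_const])
  fix n
  have "cone_fun_const n * 1 \<le> cone_fun_const n * (1 + 2 ^ n * fact n * real (Suc n))"
    using cone_fun_const_ge_1[of n] by (intro mult_left_mono) auto
  then show "cone_fun_const n \<le> cone_fun_const (Suc n)" by simp
qed

text \<open>Induction on the list of directions over all profiles. One derivative lowers
  \<open>q\<close> by one and costs at most one factor \<open>R\<close>, which bounds
  \<open>\<theta>\<close> on the support of \<open>\<phi>\<close>.\<close>

lemma cone_fun_bound:
  assumes R: "1 \<le> R" and "set ds \<subseteq> {(1, 0), (0, 1)}" and x: "fst p > 0"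
    and "off_zero r" "sm UNIV \<phi>" "bd (length ds) q L B r"
    and "\<And>k \<theta>. k \<le> length ds \<Longrightarrow> cmod ((dv ^^ k) \<phi> \<theta>) \<le> D" "\<And>\<theta>. R < \<bar>\<theta>\<bar> \<Longrightarrow> \<phi> \<theta> = 0"
  shows "cmod (fold dir_deriv ds (cone_fun r \<phi>) p) \<le>
    cone_fun_const (length ds) * R ^ length ds * (B * D) * (fst p powi (q - int (length ds)) / (1 + fst p) ^ L)"
  using assms(2-)
proof (induction ds arbitrary: r \<phi> q B D)
  case Nil
  have "cmod (r (fst p)) \<le> B * fst p powi q / (1 + fst p) ^ L"
    using bdD[OF Nil(5), of 0 "fst p"] x by simp
  moreover have "cmod (\<phi> (snd p / fst p)) \<le> D" using Nil(6)[of 0] by simp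
  ultimately have "cmod (r (fst p) * \<phi> (snd p / fst p)) \<le> (B * fst p powi q / (1 + fst p) ^ L) * D"
    unfolding norm_mult using bd_nonneg[OF Nil(5)] x by (intro mult_mono) auto
  then show ?case using x by (simp add: cone_fun_def mult_ac)
next
  case (Cons d ds)
  let ?K = "length ds"
  let ?r = "\<lambda>t. recip t * r t" and ?\<phi> = "\<lambda>\<theta>. (-1) * (of_real \<theta> * dv \<phi> \<theta>)"
  let ?w = "fst p powi (q - int (Suc ?K)) / (1 + fst p) ^ L"
  have ds: "set ds \<subseteq> {(1, 0), (0, 1)}" and d: "d = (1, 0) \<or> d = (0, 1)" using Cons.prems(1) by auto
  have r: "bd ?K (q - 1) L B (dv r)" "bd ?K q L B r" and B: "0 \<le> B"
    using Cons.prems(5) bd_order_mono[OF Cons.prems(5), of ?K] bd_nonneg[OF Cons.prems(5)] by (simp_all add: bd_Suc)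
  have ov: "bd ?K (q - 1) L (2 ^ ?K * (fact ?K * B)) ?r"
    by (rule bd_over[OF off_zero_sm[OF Cons.prems(3)] r(2)])
  have \<phi>: "cmod ((dv ^^ k) \<phi> \<theta>) \<le> D" if "k \<le> Suc ?K" for k \<theta> using Cons.prems(6) that by simp
  have D: "0 \<le> D" using order.trans[OF norm_ge_zero \<phi>[of 0 0]] by simp
  have \<phi>1: "cmod ((dv ^^ k) (dv \<phi>) \<theta>) \<le> D" if "k \<le> ?K" for k \<theta>
    using \<phi>[of "Suc k" \<theta>] that by (simp only: dvn_dv Suc_le_mono)
  have out1: "dv \<phi> \<theta> = 0" if "R < \<bar>\<theta>\<bar>" for \<theta>
    using dvn_outside_support[of R \<phi> \<theta> 1] Cons.prems(7) that by simp
  have \<phi>2: "cmod ((dv ^^ k) ?\<phi> \<theta>) \<le> real (Suc ?K) * R * D" if k: "k \<le> ?K" for k \<theta>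
  proof -
    have "(dv ^^ k) ?\<phi> \<theta> = (-1) * (of_real \<theta> * (dv ^^ k) (dv \<phi>) \<theta> + of_nat k * (dv ^^ (k - 1)) (dv \<phi>) \<theta>)"
      using dvn_cmult[OF open_UNIV sm_times_id[OF sm_dv[OF Cons.prems(4)]], of \<theta> k "-1"]
        dvn_times_id[OF sm_dv[OF Cons.prems(4)], of k \<theta>] by simp
    then have "cmod ((dv ^^ k) ?\<phi> \<theta>) \<le> cmod (of_real \<theta> * (dv ^^ k) (dv \<phi>) \<theta>) + cmod (of_nat k * (dv ^^ (k - 1)) (dv \<phi>) \<theta>)"
      by (simp only: mult_minus1 norm_minus_cancel norm_triangle_ineq)
    also have "cmod (of_real \<theta> * (dv ^^ k) (dv \<phi>) \<theta>) \<le> R * D"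
    proof (cases "R < \<bar>\<theta>\<bar>")
      case True
      then show ?thesis using dvn_outside_support[of R "dv \<phi>" \<theta> k] out1 R D by simp
    next
      case False
      then show ?thesis unfolding norm_mult using \<phi>1[OF k, of \<theta>] R by (intro mult_mono) auto
    qed
    also have "cmod (of_nat k * (dv ^^ (k - 1)) (dv \<phi>) \<theta>) \<le> real ?K * (R * D)"
    proof -
      have "cmod ((dv ^^ (k - 1)) (dv \<phi>) \<theta>) \<le> 1 * D" using \<phi>1[of "k - 1" \<theta>] k by simp
      also have "\<dots> \<le> R * D" using R D by (intro mult_right_mono)
      finally show ?thesis unfolding norm_mult using k R D by (intro mult_mono) auto
    qed
    finally show ?thesis by (simp add: algebra_simps)
  qed
  have w: "fst p powi (q - 1 - int ?K) / (1 + fst p) ^ L = ?w" by (simp add: algebra_simps)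
  have c0: "0 \<le> cone_fun_const ?K" using cone_fun_const_ge_1[of ?K] by simp
  have w0: "0 \<le> ?w" using x by simp
  have RR: "R ^ ?K \<le> R ^ Suc ?K" using R by (simp add: power_increasing)
  note nn = c0 w0 B D R
  show ?case using d
  proof
    assume d: "d = (1, 0)"
    have A1: "cmod (fold dir_deriv ds (cone_fun (dv r) \<phi>) p) \<le> cone_fun_const ?K * R ^ ?K * (B * D) * ?w"
      using Cons.IH[OF ds x off_zero_dv[OF Cons.prems(3)] Cons.prems(4) r(1), of D] \<phi> Cons.prems(7) by (simp only: w)
    have A2: "cmod (fold dir_deriv ds (cone_fun ?r ?\<phi>) p) \<le> cone_fun_const ?K * R ^ ?K * ((2 ^ ?K * (fact ?K * B)) * (real (Suc ?K) * R * D)) * ?w"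
      using Cons.IH[OF ds x off_zero_over[OF Cons.prems(3)] sm_neg_times_dv[OF Cons.prems(4)] ov \<phi>2] out1
      by (simp only: w) simp
    have "cmod (fold dir_deriv (d # ds) (cone_fun r \<phi>) p) \<le> cmod (fold dir_deriv ds (cone_fun (dv r) \<phi>) p) + cmod (fold dir_deriv ds (cone_fun ?r ?\<phi>) p)"
      unfolding d fold_simps dir_deriv_cone_fun_axes[OF Cons.prems(3,4)]
        fold_dir_deriv_add[OF smooth_cone_fun[OF off_zero_dv[OF Cons.prems(3)] Cons.prems(4)]
          smooth_cone_fun[OF off_zero_over[OF Cons.prems(3)] sm_neg_times_dv[OF Cons.prems(4)]]]
      by (rule norm_triangle_ineq)
    also have "\<dots> \<le> cone_fun_const ?K * R ^ Suc ?K * (B * D) * ?w + cone_fun_const ?K * R ^ ?K * ((2 ^ ?K * (fact ?K * B)) * (real (Suc ?K) * R * D)) * ?w"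
    proof (rule add_mono[OF order.trans[OF A1] A2])
      show "cone_fun_const ?K * R ^ ?K * (B * D) * ?w \<le> cone_fun_const ?K * R ^ Suc ?K * (B * D) * ?w"
        using nn RR by (intro mult_right_mono mult_left_mono) auto
    qed
    also have "\<dots> = cone_fun_const (Suc ?K) * R ^ Suc ?K * (B * D) * ?w"
      by (simp add: algebra_simps)
    finally show ?thesis by simp
  next
    assume d: "d = (0, 1)"
    have "cmod (fold dir_deriv ds (cone_fun ?r (dv \<phi>)) p) \<le> cone_fun_const ?K * R ^ ?K * ((2 ^ ?K * (fact ?K * B)) * D) * ?w"
      using Cons.IH[OF ds x off_zero_over[OF Cons.prems(3)] sm_dv[OF Cons.prems(4)] ov \<phi>1] out1
      by (simp only: w)
    also have "\<dots> = cone_fun_const ?K * (2 ^ ?K * fact ?K) * R ^ ?K * (B * D) * ?w" by simp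
    also have "\<dots> \<le> cone_fun_const (Suc ?K) * R ^ Suc ?K * (B * D) * ?w"
    proof -
      have "2 ^ ?K * fact ?K * 1 \<le> (2 ^ ?K * fact ?K * real (Suc ?K) :: real)" by (intro mult_left_mono) auto
      then have "2 ^ ?K * fact ?K \<le> (1 + 2 ^ ?K * fact ?K * real (Suc ?K) :: real)" by linarith
      then have "cone_fun_const ?K * (2 ^ ?K * fact ?K) \<le> cone_fun_const (Suc ?K)"
        unfolding cone_fun_const.simps by (rule mult_left_mono[OF _ c0])
      then show ?thesis using nn RR cone_fun_const_ge_1[of "Suc ?K"] by (intro mult_right_mono mult_mono) auto
    qed
    finally show ?thesis
      unfolding d fold_simps dir_deriv_cone_fun_axes[OF Cons.prems(3,4)] by simp
  qed
qed

lemma cone_fun_zero: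
  assumes "set ds \<subseteq> {(1, 0), (0, 1)}" "off_zero r" "sm UNIV \<phi>" "\<And>\<theta>. R < \<bar>\<theta>\<bar> \<Longrightarrow> \<phi> \<theta> = 0"
    and "fst p \<le> 0 \<or> R * fst p < \<bar>snd p\<bar>"
  shows "fold dir_deriv ds (cone_fun r \<phi>) p = 0"
  using assms
proof (induction ds arbitrary: r \<phi>)
  case Nil
  then show ?case by (auto simp: cone_fun_def field_simps)
next
  case (Cons d ds)
  have out1: "dv \<phi> \<theta> = 0" if "R < \<bar>\<theta>\<bar>" for \<theta>
    using dvn_outside_support[of R \<phi> \<theta> 1] Cons.prems(4) that by simp
  have 1: "fold dir_deriv ds (cone_fun (dv r) \<phi>) p = 0"
    using Cons by (intro Cons.IH off_zero_dv) auto
  have 2: "fold dir_deriv ds (cone_fun (\<lambda>t. recip t * r t) (\<lambda>\<theta>. (-1) * (of_real \<theta> * dv \<phi> \<theta>))) p = 0"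
    using Cons out1 by (intro Cons.IH off_zero_over sm_neg_times_dv) auto
  have 3: "fold dir_deriv ds (cone_fun (\<lambda>t. recip t * r t) (dv \<phi>)) p = 0"
    using Cons out1 by (intro Cons.IH off_zero_over sm_dv) auto
  have "d = (1, 0) \<or> d = (0, 1)" using Cons.prems(1) by auto
  then show ?case
    using 1 2 3 by (elim disjE) (simp_all only: fold_simps dir_deriv_cone_fun_axes[OF Cons.prems(2,3)]
      fold_dir_deriv_add[OF smooth_cone_fun[OF off_zero_dv[OF Cons.prems(2)] Cons.prems(3)]
          smooth_cone_fun[OF off_zero_over[OF Cons.prems(2)] sm_neg_times_dv[OF Cons.prems(3)]]] add_0_left)
qed

text \<open>In the cone the weight is at most a constant times
  \<open>(R * (1 + x)) ^ (2 * N)\<close>. Of the decay exponent, \<open>2 * N\<close> pays for this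
  weight and \<open>q\<close> for the growth of \<open>x ^ (q - K)\<close>; the condition
  \<open>N \<le> q\<close> keeps that exponent nonnegative. The power \<open>R ^ (3 * N)\<close>
  consists of \<open>2 * N\<close> factors from the weight and \<open>N\<close> from the
  derivatives.\<close>

lemma sbd_cone_fun:
  assumes R: "1 \<le> R" and r: "off_zero r" "bd N (int q) (2 * N + q) B r" "N \<le> q"
    and \<phi>: "sm UNIV \<phi>" "\<And>k \<theta>. k \<le> N \<Longrightarrow> cmod ((dv ^^ k) \<phi> \<theta>) \<le> D" "\<And>\<theta>. R < \<bar>\<theta>\<bar> \<Longrightarrow> \<phi> \<theta> = 0"
  shows "sbd N (2 ^ N * cone_fun_const N * R ^ (3 * N) * (B * D)) (cone_fun r \<phi>)"
  unfolding sbd_def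
proof (intro allI impI)
  fix \<alpha> :: "nat \<times> nat" and p :: "real \<times> real" assume \<alpha>: "fst \<alpha> + snd \<alpha> \<le> N"
  define K where "K = length (axis_list \<alpha>)"
  have K: "K \<le> N" using \<alpha> by (simp add: K_def length_axis_list)
  have BD: "0 \<le> B" "0 \<le> D" using bd_nonneg[OF r(2)] order.trans[OF norm_ge_zero \<phi>(2)[of 0 0]] by simp_all
  have c: "0 \<le> cone_fun_const J" for J using cone_fun_const_ge_1[of J] by simp
  show "(1 + (norm p)\<^sup>2) ^ N * cmod (partial_deriv \<alpha> (cone_fun r \<phi>) p) \<le> 2 ^ N * cone_fun_const N * R ^ (3 * N) * (B * D)"
  proof (cases "fst p \<le> 0 \<or> R * fst p < \<bar>snd p\<bar>")
    case True
    then have "partial_deriv \<alpha> (cone_fun r \<phi>) p = 0"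
      unfolding partial_deriv_fold by (intro cone_fun_zero[OF set_axis_list r(1) \<phi>(1,3)])
    moreover have "0 \<le> 2 ^ N * cone_fun_const N * R ^ (3 * N) * (B * D)" using BD c R by simp
    ultimately show ?thesis by simp
  next
    case False
    define x where "x = fst p"
    have x: "x > 0" "\<bar>snd p\<bar> \<le> R * x" using False by (auto simp: x_def)
    have "(norm p)\<^sup>2 = x\<^sup>2 + (snd p)\<^sup>2" by (simp add: norm_prod_def x_def)
    also have "(snd p)\<^sup>2 \<le> (R * x)\<^sup>2" using x(2) by (metis abs_ge_zero power2_abs power_mono)
    finally have "1 + (norm p)\<^sup>2 \<le> 1 + x\<^sup>2 + R\<^sup>2 * x\<^sup>2" by (simp add: power_mult_distrib)
    also have "\<dots> \<le> R\<^sup>2 * (1 + x)\<^sup>2 + R\<^sup>2 * (1 + x)\<^sup>2"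
    proof (rule add_mono)
      have "1 * (1 + x\<^sup>2) \<le> R\<^sup>2 * (1 + x)\<^sup>2"
        using R x by (intro mult_mono) (auto simp: power2_sum one_le_power)
      then show "1 + x\<^sup>2 \<le> R\<^sup>2 * (1 + x)\<^sup>2" by simp
      show "R\<^sup>2 * x\<^sup>2 \<le> R\<^sup>2 * (1 + x)\<^sup>2" using x by (intro mult_left_mono power_mono) auto
    qed
    finally have "1 + (norm p)\<^sup>2 \<le> 2 * (R\<^sup>2 * (1 + x)\<^sup>2)" by simp
    then have "(1 + (norm p)\<^sup>2) ^ N \<le> (2 * (R\<^sup>2 * (1 + x)\<^sup>2)) ^ N" by (intro power_mono) auto
    also have "\<dots> = 2 ^ N * R ^ (2 * N) * (1 + x) ^ (2 * N)" by (simp add: power_mult_distrib power_mult)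
    finally have w: "(1 + (norm p)\<^sup>2) ^ N \<le> 2 ^ N * R ^ (2 * N) * (1 + x) ^ (2 * N)" .
    have "cmod (partial_deriv \<alpha> (cone_fun r \<phi>) p) \<le>
        cone_fun_const K * R ^ K * (B * D) * (x powi (int q - int K) / (1 + x) ^ (2 * N + q))"
      unfolding partial_deriv_fold K_def x_def
      by (rule cone_fun_bound[OF R set_axis_list _ r(1) \<phi>(1) bd_order_mono[OF r(2)] \<phi>(2) \<phi>(3)])
        (use x K in \<open>auto simp: x_def K_def\<close>)
    also have "\<dots> \<le> cone_fun_const N * R ^ N * (B * D) * (1 / (1 + x) ^ (2 * N))"
    proof -
      have "x powi (int q - int K) = x ^ (q - K)" using K r(3) by (simp flip: of_nat_diff)
      also have "\<dots> \<le> (1 + x) ^ (q - K)" using x by (intro power_mono) auto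
      also have "\<dots> \<le> (1 + x) ^ q" using x by (intro power_increasing) auto
      finally have "x powi (int q - int K) / (1 + x) ^ (2 * N + q) \<le> 1 / (1 + x) ^ (2 * N)"
        using x by (simp add: power_add field_simps)
      moreover have "cone_fun_const K * R ^ K * (B * D) \<le> cone_fun_const N * R ^ N * (B * D)"
        using c[of K] c[of N] R BD by (intro mult_right_mono[OF mult_mono[OF cone_fun_const_mono[OF K] power_increasing[OF K R]]]) auto
      moreover have "0 \<le> cone_fun_const N * R ^ N * (B * D)" "0 \<le> x powi (int q - int K) / (1 + x) ^ (2 * N + q)"
        using c[of N] R BD x by simp_all
      ultimately show ?thesis by (metis mult_mono)
    qed
    finally have m: "cmod (partial_deriv \<alpha> (cone_fun r \<phi>) p) \<le> cone_fun_const N * R ^ N * (B * D) * (1 / (1 + x) ^ (2 * N))" .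
    have "(1 + (norm p)\<^sup>2) ^ N * cmod (partial_deriv \<alpha> (cone_fun r \<phi>) p) \<le>
        (2 ^ N * R ^ (2 * N) * (1 + x) ^ (2 * N)) * (cone_fun_const N * R ^ N * (B * D) * (1 / (1 + x) ^ (2 * N)))"
      using w m x R by (intro mult_mono) auto
    also have "\<dots> = 2 ^ N * cone_fun_const N * (R ^ (2 * N) * R ^ N) * (B * D)"
      using x by (simp add: field_simps)
    also have "R ^ (2 * N) * R ^ N = R ^ (3 * N)" by (simp flip: power_add)
    finally show ?thesis .
  qed
qed

text \<open>Where the profile does not vanish, \<open>1 / t\<close> is at most
  \<open>1 / \<delta>\<close>, so a higher order of vanishing is bought with a constant. This serves
  membership in \<open>schwartz_R2\<close>, where constants may depend on
  \<open>\<delta>\<close>.\<close>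

lemma bd_raise:
  assumes "bd K (q - 1) L B r" "\<And>t. 0 < t \<and> t < \<delta> \<Longrightarrow> r t = 0" "\<delta> > 0"
  shows "bd K q L (B / \<delta>) r"
  unfolding bd_def
proof (intro allI impI)
  fix k t assume k: "k \<le> K" "(0::real) < t"
  have B: "0 \<le> B" using bd_nonneg[OF assms(1)] .
  show "cmod ((dv ^^ k) r t) \<le> B / \<delta> * t powi (q - int k) / (1 + t) ^ L"
  proof (cases "t < \<delta>")
    case True
    have "(dv ^^ k) r t = (dv ^^ k) (\<lambda>t. 0) t"
      by (rule dvn_cong[of "{0<..<\<delta>}"]) (use assms True k in auto)
    also have "\<dots> = 0" by (simp add: dvn_const[of UNIV])
    finally show ?thesis using B assms(3) k by simp
  next
    case False
    have "t powi (q - 1 - int k) = t powi (q - int k) / t" using k by (simp add: power_int_diff)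
    also have "\<dots> \<le> t powi (q - int k) / \<delta>" using False assms(3) k by (intro divide_left_mono) auto
    finally have "B * t powi (q - 1 - int k) / (1 + t) ^ L \<le> B * (t powi (q - int k) / \<delta>) / (1 + t) ^ L"
      using B k by (intro divide_right_mono mult_left_mono) auto
    then show ?thesis using bdD[OF assms(1) k] by simp
  qed
qed

lemma bd_raise_n:
  assumes "bd K (q - int n) L B r" "\<And>t. 0 < t \<and> t < \<delta> \<Longrightarrow> r t = 0" "\<delta> > 0"
  shows "bd K q L (B / \<delta> ^ n) r"
  using assms(1)
proof (induction n arbitrary: B)
  case (Suc n)
  have "bd K (q - int n) L (B / \<delta>) r"
    by (rule bd_raise[OF _ assms(2,3)]) (use Suc.prems in \<open>simp add: algebra_simps\<close>)
  from Suc.IH[OF this] show ?case by (simp add: divide_divide_eq_left)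
qed simp

lemma schwartz_cone_fun:
  assumes r: "off_zero r" and dec: "\<And>K L. \<exists>B. bd K 0 L B r"
    and \<phi>: "sm UNIV \<phi>" "\<And>\<theta>. R < \<bar>\<theta>\<bar> \<Longrightarrow> \<phi> \<theta> = 0"
  shows "cone_fun r \<phi> \<in> schwartz_R2"
  unfolding schwartz_R2_iff
proof (intro conjI allI)
  show "smooth (cone_fun r \<phi>)" by (rule smooth_cone_fun[OF r \<phi>(1)])
  fix N
  obtain \<delta> where \<delta>: "\<delta> > 0" "\<And>t. 0 < t \<and> t < \<delta> \<Longrightarrow> r t = 0" using r by (auto simp: off_zero_def)
  obtain B where B: "bd N 0 (2 * N + N) B r" using dec by blast
  have B': "bd N (int N) (2 * N + N) (B / \<delta> ^ N) r"
    by (rule bd_raise_n[OF _ \<delta>(2,1)]) (use B in simp_all)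
  have "\<forall>k. \<exists>C\<ge>0. \<forall>\<theta>. cmod ((dv ^^ k) \<phi> \<theta>) \<le> C"
    using bounded_dvn_of_support[of \<phi> R] \<phi> by blast
  then obtain c where c: "\<And>k. 0 \<le> c k" "\<And>k \<theta>. cmod ((dv ^^ k) \<phi> \<theta>) \<le> c k" by metis
  have D: "cmod ((dv ^^ k) \<phi> \<theta>) \<le> (\<Sum>k\<le>N. c k)" if "k \<le> N" for k \<theta>
    by (rule order.trans[OF c(2)], rule member_le_sum) (use that c in auto)
  have out: "\<phi> \<theta> = 0" if "max 1 R < \<bar>\<theta>\<bar>" for \<theta> using \<phi>(2) that by simp
  show "\<exists>C. sbd N C (cone_fun r \<phi>)"
    using sbd_cone_fun[OF max.cobounded1 r B' order_refl \<phi>(1) D out] by blast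
qed

subsection \<open>Interpolation at equally spaced nodes\<close>

definition fdiff :: "(nat \<Rightarrow> complex) \<Rightarrow> nat \<Rightarrow> complex" where
  "fdiff y i = y (Suc i) - y i"

lemma newton_forward: "y j = (\<Sum>p\<le>j. of_nat (j choose p) * (fdiff ^^ p) y 0)"
proof (induction j arbitrary: y)
  case (Suc j)
  have "y (Suc j) = y j + fdiff y j" by (simp add: fdiff_def)
  also have "\<dots> = (\<Sum>p\<le>j. of_nat (j choose p) * (fdiff ^^ p) y 0) + (\<Sum>p\<le>j. of_nat (j choose p) * (fdiff ^^ p) (fdiff y) 0)"
    using Suc.IH[of y] Suc.IH[of "fdiff y"] by simp
  also have "(\<Sum>p\<le>j. of_nat (j choose p) * (fdiff ^^ p) y 0) = (\<Sum>p\<le>Suc j. of_nat (j choose p) * (fdiff ^^ p) y 0)"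
    by simp
  also have "\<dots> = y 0 + (\<Sum>p\<le>j. of_nat (j choose Suc p) * (fdiff ^^ Suc p) y 0)"
    by (subst sum.atMost_Suc_shift) simp
  also have "(\<Sum>p\<le>j. of_nat (j choose p) * (fdiff ^^ p) (fdiff y) 0) = (\<Sum>p\<le>j. of_nat (j choose p) * (fdiff ^^ Suc p) y 0)"
    by (simp add: funpow_swap1)
  also have "y 0 + (\<Sum>p\<le>j. of_nat (j choose Suc p) * (fdiff ^^ Suc p) y 0) + \<dots> =
      y 0 + (\<Sum>p\<le>j. of_nat (Suc j choose Suc p) * (fdiff ^^ Suc p) y 0)"
    by (simp add: algebra_simps sum.distrib)
  also have "\<dots> = (\<Sum>p\<le>Suc j. of_nat (Suc j choose p) * (fdiff ^^ p) y 0)"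
    by (subst sum.atMost_Suc_shift) simp
  finally show ?case .
qed simp

lemma fdiff_bound:
  assumes "\<And>j. j \<le> n \<Longrightarrow> cmod (y j) \<le> B"
  shows "i + p \<le> n \<Longrightarrow> cmod ((fdiff ^^ p) y i) \<le> 2 ^ p * B"
proof (induction p arbitrary: i)
  case (Suc p)
  have "cmod ((fdiff ^^ Suc p) y i) \<le> cmod ((fdiff ^^ p) y (Suc i)) + cmod ((fdiff ^^ p) y i)"
    by (simp add: fdiff_def norm_triangle_ineq4)
  also have "\<dots> \<le> 2 ^ p * B + 2 ^ p * B" using Suc by (intro add_mono) auto
  finally show ?case by (simp add: mult_ac)
qed (use assms in simp)

lemma fdiff_vanish:
  assumes "\<And>i. i + k \<le> n \<Longrightarrow> (fdiff ^^ k) y i = 0"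
  shows "i + (d + k) \<le> n \<Longrightarrow> (fdiff ^^ (d + k)) y i = 0"
  by (induction d arbitrary: i) (use assms in \<open>auto simp: fdiff_def\<close>)

text \<open>\<open>newton_poly n p\<close> takes the value \<open>j choose p\<close> at \<open>2 j - n\<close>.\<close>

primrec newton_poly :: "nat \<Rightarrow> nat \<Rightarrow> real poly" where
  "newton_poly n 0 = 1"
| "newton_poly n (Suc p) = smult (1 / real (Suc p)) ([:real n / 2 - real p, 1 / 2:] * newton_poly n p)"

lemma poly_newton_poly: "poly (newton_poly n p) (2 * real j - real n) = real (j choose p)"
proof -
  have "poly (newton_poly n p) (2 * real j - real n) = real j gchoose p"
  proof (induction p)
    case (Suc p)
    have "poly (newton_poly n (Suc p)) (2 * real j - real n) = (real j - real p) / real (Suc p) * (real j gchoose p)"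
      by (simp add: Suc) (simp add: field_simps)
    also have "\<dots> = real j gchoose Suc p"
      by (simp add: gbinomial_prod_rev)
    finally show ?case .
  qed simp
  then show ?thesis by (simp add: binomial_gbinomial)
qed

lemma degree_newton_poly: "degree (newton_poly n p) \<le> p"
proof (induction p)
  case (Suc p)
  have "degree ([:real n / 2 - real p, 1 / 2:] * newton_poly n p) \<le> 1 + p"
    using degree_mult_le[of "[:real n / 2 - real p, 1 / 2:]" "newton_poly n p"] Suc by simp
  then show ?case using degree_smult_le le_trans by fastforce
qed simp

text \<open>The absolute coefficients of the linear factor add up to at most
  \<open>(p + 1) * (n + 1)\<close>, and the division by \<open>p + 1\<close> leaves one factor
  \<open>n + 1\<close> per step: polynomial growth in \<open>n\<close> for fixed
  \<open>p\<close>.\<close>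

lemma coeff_newton_poly: "\<bar>coeff (newton_poly n p) i\<bar> \<le> real (Suc n) ^ p"
proof (induction p arbitrary: i)
  case 0
  then show ?case by (cases i) auto
next
  case (Suc p)
  define Q where "Q = newton_poly n p"
  have Q: "\<bar>coeff Q i\<bar> \<le> real (Suc n) ^ p" for i using Suc by (simp add: Q_def)
  have "coeff ([:real n / 2 - real p, 1 / 2:] * Q) i = (real n / 2 - real p) * coeff Q i + 1 / 2 * (case i of 0 \<Rightarrow> 0 | Suc i \<Rightarrow> coeff Q i)"
    by (cases i) (simp_all add: algebra_simps)
  also have "\<bar>\<dots>\<bar> \<le> \<bar>real n / 2 - real p\<bar> * real (Suc n) ^ p + 1 / 2 * real (Suc n) ^ p"
    using Q by (intro order.trans[OF abs_triangle_ineq] add_mono)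
      (auto simp: abs_mult intro!: mult_left_mono split: nat.split)
  also have "\<dots> = (\<bar>real n / 2 - real p\<bar> + 1 / 2) * real (Suc n) ^ p" by (simp only: distrib_right)
  also have "\<dots> \<le> (real (Suc p) * real (Suc n)) * real (Suc n) ^ p"
  proof (intro mult_right_mono)
    have "\<bar>real n / 2 - real p\<bar> \<le> real n / 2 + real p" by linarith
    moreover have "real (Suc p) * real (Suc n) = 1 + real n + real p + real p * real n" by (simp add: algebra_simps)
    moreover have "0 \<le> real p * real n" by simp
    ultimately show "\<bar>real n / 2 - real p\<bar> + 1 / 2 \<le> real (Suc p) * real (Suc n)" by linarith
  qed simp
  finally show ?case
    by (simp add: Q_def[symmetric] field_simps abs_mult)
qed

text \<open>Vanishing differences of order \<open>k + 1\<close> stop Newton's forward series at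
  \<open>k\<close>. The values then lie on a polynomial of degree at most \<open>k\<close> in the
  slope, however many nodes there are, and its coefficients grow like \<open>n ^ k\<close>.\<close>

lemma interpolate_low_degree:
  assumes van: "\<And>i. i + Suc k \<le> n \<Longrightarrow> (fdiff ^^ Suc k) y i = 0"
    and B: "\<And>j. j \<le> n \<Longrightarrow> cmod (y j) \<le> B"
  shows "\<exists>c. (\<forall>j\<le>n. y j = (\<Sum>i\<le>k. c i * of_real (2 * real j - real n) ^ i)) \<and>
    (\<forall>i\<le>k. cmod (c i) \<le> real (Suc k) * (2 ^ k * B * real (Suc n) ^ k))"
proof -
  \<comment> \<open>A difference of order above \<open>n\<close> at 0 involves values
    \<open>y j\<close> with \<open>j > n\<close>, on which there is no hypothesis; it is replaced by
    0.\<close>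
  define d where "d p = (if p \<le> n then (fdiff ^^ p) y 0 else 0)" for p
  define c where "c i = (\<Sum>p\<le>k. d p * of_real (coeff (newton_poly n p) i))" for i
  have B0: "0 \<le> B" using order.trans[OF norm_ge_zero B[of 0]] by simp
  have d0: "d p = 0" if "k < p" for p
  proof (cases "p \<le> n")
    case True
    then show ?thesis using fdiff_vanish[of "Suc k" n y 0 "p - Suc k", OF van] that by (simp add: d_def)
  qed (simp add: d_def)
  have val: "y j = (\<Sum>i\<le>k. c i * of_real (2 * real j - real n) ^ i)" if j: "j \<le> n" for j
  proof -
    have "y j = (\<Sum>p\<le>j. of_nat (j choose p) * (fdiff ^^ p) y 0)" by (rule newton_forward)
    also have "\<dots> = (\<Sum>p\<le>j. of_nat (j choose p) * d p)" using j by (intro sum.cong) (auto simp: d_def)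
    also have "\<dots> = (\<Sum>p\<le>max j k. of_nat (j choose p) * d p)"
      by (intro sum.mono_neutral_left) (auto simp: binomial_eq_0)
    also have "\<dots> = (\<Sum>p\<le>k. of_nat (j choose p) * d p)"
      by (intro sum.mono_neutral_right) (auto simp: d0)
    also have "\<dots> = (\<Sum>p\<le>k. \<Sum>i\<le>k. d p * of_real (coeff (newton_poly n p) i) * of_real (2 * real j - real n) ^ i)"
    proof (intro sum.cong refl)
      fix p assume "p \<in> {..k}"
      then have p: "p \<le> k" by simp
      have "real (j choose p) = (\<Sum>i\<le>degree (newton_poly n p). coeff (newton_poly n p) i * (2 * real j - real n) ^ i)"
        using poly_newton_poly[of n p j] by (simp only: poly_altdef)
      also have "\<dots> = (\<Sum>i\<le>k. coeff (newton_poly n p) i * (2 * real j - real n) ^ i)"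
        using degree_newton_poly[of n p] p by (intro sum.mono_neutral_left) (auto simp: coeff_eq_0)
      finally have "complex_of_real (real (j choose p)) = of_real (\<Sum>i\<le>k. coeff (newton_poly n p) i * (2 * real j - real n) ^ i)" by simp
      then show "of_nat (j choose p) * d p = (\<Sum>i\<le>k. d p * of_real (coeff (newton_poly n p) i) * of_real (2 * real j - real n) ^ i)"
        unfolding of_real_of_nat_eq by (simp add: sum_distrib_left mult_ac)
    qed
    also have "\<dots> = (\<Sum>i\<le>k. c i * of_real (2 * real j - real n) ^ i)"
      unfolding c_def sum_distrib_right by (rule sum.swap)
    finally show ?thesis .
  qed
  have "cmod (c i) \<le> real (Suc k) * (2 ^ k * B * real (Suc n) ^ k)" for i
  proof -
    have "cmod (c i) \<le> (\<Sum>p\<le>k. cmod (d p * of_real (coeff (newton_poly n p) i)))"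
      unfolding c_def by (rule norm_sum)
    also have "\<dots> \<le> (\<Sum>p\<le>k. 2 ^ k * B * real (Suc n) ^ k)"
    proof (rule sum_mono)
      fix p assume "p \<in> {..k}"
      then have p: "p \<le> k" by simp
      have "cmod (d p) \<le> 2 ^ p * B"
        using fdiff_bound[of n y B 0 p] B B0 by (auto simp: d_def)
      also have "\<dots> \<le> 2 ^ k * B" using p B0 by (intro mult_right_mono power_increasing) auto
      finally have 1: "cmod (d p) \<le> 2 ^ k * B" .
      have "\<bar>coeff (newton_poly n p) i\<bar> \<le> real (Suc n) ^ p" by (rule coeff_newton_poly)
      also have "\<dots> \<le> real (Suc n) ^ k" using p by (intro power_increasing) auto
      finally show "cmod (d p * of_real (coeff (newton_poly n p) i)) \<le> 2 ^ k * B * real (Suc n) ^ k"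
        unfolding norm_mult norm_of_real using 1 B0 by (intro mult_mono) auto
    qed
    also have "\<dots> = real (Suc k) * (2 ^ k * B * real (Suc n) ^ k)" by simp
    finally show ?thesis .
  qed
  then show ?thesis using val by blast
qed

text \<open>\<open>L p i\<close> is the coefficient of degree \<open>p\<close> of the
  \<open>i\<close>-th Lagrange polynomial, so \<open>L\<close> inverts the Vandermonde matrix from
  both sides. The second identity holds because interpolation reproduces the powers of degree at
  most \<open>n\<close>.\<close>

lemma lagrange_coefficients:
  fixes x :: "nat \<Rightarrow> complex"
  assumes inj: "inj_on x {..n}"
  shows "\<exists>L. (\<forall>i\<le>n. \<forall>j\<le>n. (\<Sum>p\<le>n. L p i * x j ^ p) = (if i = j then 1 else 0)) \<and>
    (\<forall>l\<le>n. \<forall>p\<le>n. (\<Sum>i\<le>n. L p i * x i ^ l) = (if p = l then 1 else 0))"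
proof -
  define \<l> where "\<l> i = (\<Prod>k\<in>{..n} - {i}. smult (1 / (x i - x k)) [:- x k, 1:])" for i
  have val: "poly (\<l> i) (x j) = (if i = j then 1 else 0)" if "i \<le> n" "j \<le> n" for i j
  proof (cases "i = j")
    case True
    have "(\<Prod>k\<in>{..n} - {i}. 1 / (x i - x k) * (x i - x k)) = 1"
      using that inj by (intro prod.neutral) (auto simp: inj_on_def)
    moreover have "poly (smult (1 / a) [:- b, 1:]) c = 1 / a * (c - b)" for a b c :: complex by (simp add: diff_divide_distrib)
    ultimately show ?thesis using True by (simp only: \<l>_def poly_prod if_True simp_thms)
  next
    case False
    then have "j \<in> {..n} - {i}" using that by auto
    then have "(\<Prod>k\<in>{..n} - {i}. poly (smult (1 / (x i - x k)) [:- x k, 1:]) (x j)) = 0"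
      by (intro prod_zero) auto
    then show ?thesis using False by (simp add: \<l>_def poly_prod)
  qed
  have deg: "degree (\<l> i) \<le> n" if "i \<le> n" for i
  proof -
    have "degree (\<l> i) \<le> sum (degree \<circ> (\<lambda>k. smult (1 / (x i - x k)) [:- x k, 1:])) ({..n} - {i})"
      unfolding \<l>_def by (rule degree_prod_sum_le) simp
    also have "\<dots> \<le> (\<Sum>k\<in>{..n} - {i}. 1)" by (intro sum_mono) auto
    also have "\<dots> = n" using that by simp
    finally show ?thesis .
  qed
  have 1: "(\<Sum>p\<le>n. coeff (\<l> i) p * x j ^ p) = (if i = j then 1 else 0)" if "i \<le> n" "j \<le> n" for i j
  proof -
    have "(\<Sum>p\<le>n. coeff (\<l> i) p * x j ^ p) = poly (\<l> i) (x j)"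
      unfolding poly_altdef using deg[OF that(1)] by (intro sum.mono_neutral_right) (auto simp: coeff_eq_0)
    then show ?thesis using val that by simp
  qed
  have 2: "(\<Sum>i\<le>n. coeff (\<l> i) p * x i ^ l) = (if p = l then 1 else 0)" if "l \<le> n" for l p
  proof -
    have "(\<Sum>i\<le>n. smult (x i ^ l) (\<l> i)) = monom 1 l"
    proof (rule poly_eqI_degree[of "x ` {..n}"])
      show "poly (\<Sum>i\<le>n. smult (x i ^ l) (\<l> i)) t = poly (monom 1 l) t" if t: "t \<in> x ` {..n}" for t
      proof -
        obtain j where j: "j \<le> n" "t = x j" using t by auto
        have "(\<Sum>i\<le>n. x i ^ l * poly (\<l> i) (x j)) = (\<Sum>i\<le>n. if i = j then x j ^ l else 0)"
          using j by (intro sum.cong) (auto simp: val)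
        then show ?thesis using j by (simp add: poly_sum poly_monom)
      qed
      have c: "card (x ` {..n}) = Suc n" using inj by (simp add: card_image)
      have "degree (\<Sum>i\<le>n. smult (x i ^ l) (\<l> i)) \<le> n"
        using deg by (intro degree_sum_le) (auto intro: order.trans[OF degree_smult_le])
      then show "degree (\<Sum>i\<le>n. smult (x i ^ l) (\<l> i)) < card (x ` {..n})" using c by simp
      show "degree (monom (1::complex) l) < card (x ` {..n})" using c that by (simp add: degree_monom_eq)
    qed
    from arg_cong[OF this, of "\<lambda>q. coeff q p"]
    show ?thesis by (simp add: coeff_sum mult.commute eq_commute)
  qed
  show ?thesis using 1 2 by (intro exI[of _ "\<lambda>p i. coeff (\<l> i) p"]) auto
qed

subsection \<open>Division by powers of the variable and Taylor remainders\<close>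

text \<open>The quotient at \<open>x\<close> is the integral of \<open>f' (t * x)\<close> over
  \<open>t\<close> in the unit interval. Its derivatives, with a factor \<open>t ^ k\<close> and the
  derivative of order \<open>k + 1\<close>, form the tower \<open>D\<close>.\<close>

lemma hadamard_division:
  assumes f: "sm UNIV f" and f0: "f 0 = 0"
  shows "\<exists>g. sm UNIV g \<and> (\<forall>t. f t = of_real t * g t)"
proof -
  define D where "D k x = integral {0..1} (\<lambda>t. of_real (t ^ k) * (dv ^^ Suc k) f (t * x))" for k x
  have ch: "((\<lambda>x. (dv ^^ k) f (t * x)) has_vector_derivative of_real t * (dv ^^ Suc k) f (t * x)) (at x)" for k t x
  proof -
    have "((\<lambda>x. t * x) has_vector_derivative t) (at x)"
      unfolding has_real_derivative_iff_has_vector_derivative[symmetric] by (auto intro!: derivative_eq_intros)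
    from vector_diff_chain_at[OF this sm_derivative[OF f, of "t * x" k]]
    show ?thesis by (simp add: comp_def scaleR_conv_of_real)
  qed
  have cont: "continuous_on UNIV ((dv ^^ k) f)" for k by (rule continuous_on_dvn[OF f])
  have cont2: "continuous_on S (\<lambda>p. (dv ^^ k) f (u p))" if "continuous_on S u" for k and u :: "'b::topological_space \<Rightarrow> real" and S
    using continuous_on_compose2[OF cont that] by simp
  have "(D k has_vector_derivative D (Suc k) x) (at x)" for k x
  proof -
    have "((\<lambda>x. integral (cbox 0 1) (\<lambda>t. of_real (t ^ k) * (dv ^^ Suc k) f (t * x))) has_vector_derivative
        integral (cbox 0 1) (\<lambda>t. of_real (t ^ Suc k) * (dv ^^ Suc (Suc k)) f (t * x))) (at x within UNIV)"
    proof (rule leibniz_rule_vector_derivative)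
      show "((\<lambda>x. of_real (t ^ k) * (dv ^^ Suc k) f (t * x)) has_vector_derivative
          of_real (t ^ Suc k) * (dv ^^ Suc (Suc k)) f (t * x)) (at x within UNIV)" for x t
        using has_vector_derivative_mult_right[OF ch[of "Suc k" t x], of "of_real (t ^ k)"] by (simp add: mult_ac)
      show "(\<lambda>t. of_real (t ^ k) * (dv ^^ Suc k) f (t * x)) integrable_on cbox 0 1" for x
        by (intro integrable_continuous continuous_intros cont2)
      show "continuous_on (UNIV \<times> cbox 0 1) (\<lambda>(x, t). of_real (t ^ Suc k) * (dv ^^ Suc (Suc k)) f (t * x))"
        unfolding case_prod_beta by (intro continuous_intros cont2)
    qed auto
    then show ?thesis by (simp add: D_def[abs_def] del: funpow.simps)
  qed
  then have "sm UNIV (D 0)" by (intro sm_tower(1)[of UNIV D]) auto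
  moreover have "f x = of_real x * D 0 x" for x
  proof -
    have "((\<lambda>t. f (t * x)) has_vector_derivative of_real x * dv f (t * x)) (at t within {0..1})" for t
      using has_vector_derivative_at_within[OF ch[of 0 x t]] by (simp add: mult.commute[of x])
    then have "((\<lambda>t. of_real x * dv f (t * x)) has_integral f (1 * x) - f (0 * x)) {0..1}"
      by (rule fundamental_theorem_of_calculus[rotated]) simp
    from integral_unique[OF this] have "f x = integral {0..1} (\<lambda>t. of_real x * dv f (t * x))"
      by (simp only: mult_1_left mult_zero_left f0 diff_0_right)
    also have "\<dots> = of_real x * D 0 x" by (simp add: D_def)
    finally show ?thesis .
  qed
  ultimately show ?thesis by blast
qed

text \<open>If \<open>f\<close> is \<open>t\<close> times \<open>g\<close>, the derivative of order
  \<open>k + 1\<close> of \<open>f\<close> at 0 is \<open>k + 1\<close> times that of order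
  \<open>k\<close> of \<open>g\<close>; so \<open>g\<close> inherits the vanishing and one factor is
  peeled off at a time.\<close>

lemma hadamard_division_power:
  assumes "sm UNIV f" "\<And>k. k < p \<Longrightarrow> (dv ^^ k) f 0 = 0"
  shows "\<exists>g. sm UNIV g \<and> (\<forall>t. f t = of_real t ^ p * g t)"
  using assms
proof (induction p arbitrary: f)
  case (Suc p)
  obtain g where g: "sm UNIV g" "\<And>t. f t = of_real t * g t"
    using hadamard_division[of f] Suc.prems(1) Suc.prems(2)[of 0] by auto
  then have f: "f = (\<lambda>t. of_real t * g t)" by auto
  have "(dv ^^ k) g 0 = 0" if "k < p" for k
  proof -
    have "of_nat (Suc k) * (dv ^^ k) g 0 = 0"
      using Suc.prems(2)[of "Suc k"] that unfolding f dvn_times_id[OF g(1)] by (simp del: of_nat_Suc)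
    then show ?thesis using of_nat_neq_0 mult_eq_0_iff by blast
  qed
  then obtain h where "sm UNIV h" "\<forall>t. g t = of_real t ^ p * h t"
    using Suc.IH[OF g(1)] by blast
  then show ?case using g(2) by (auto simp: mult.assoc)
qed auto

text \<open>Descent from order \<open>N + 1\<close>: the mean value inequality on
  \<open>{0..t}\<close> turns a bound \<open>B * s ^ d\<close> for one derivative into
  \<open>B * t ^ (d + 1)\<close> for the one below it.\<close>

lemma taylor_remainder:
  assumes f: "sm UNIV f" and 0: "\<And>k. k \<le> N \<Longrightarrow> (dv ^^ k) f 0 = 0"
    and B: "\<And>t. 0 \<le> t \<Longrightarrow> t \<le> 1 \<Longrightarrow> cmod ((dv ^^ Suc N) f t) \<le> B"
  shows "d \<le> Suc N \<Longrightarrow> 0 \<le> t \<Longrightarrow> t \<le> 1 \<Longrightarrow> cmod ((dv ^^ (Suc N - d)) f t) \<le> B * t ^ d"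
proof (induction d arbitrary: t)
  case (Suc d)
  define k where "k = N - d"
  have k: "Suc N - Suc d = k" "Suc N - d = Suc k" "k \<le> N" using Suc.prems by (auto simp: k_def)
  have B0: "0 \<le> B" using order.trans[OF norm_ge_zero B[of 0]] by simp
  have "cmod ((dv ^^ k) f t - (dv ^^ k) f 0) \<le> (B * t ^ d) * norm (t - 0)"
  proof (rule differentiable_bound[of "{0..t}"])
    fix s assume s: "s \<in> {0..t}"
    show "((dv ^^ k) f has_derivative (\<lambda>h. h *\<^sub>R (dv ^^ Suc k) f s)) (at s within {0..t})"
      using sm_derivative[OF f, of s k] unfolding has_vector_derivative_def by (rule has_derivative_at_withinI) simp
    have "cmod ((dv ^^ Suc k) f s) \<le> B * s ^ d" using Suc.IH[of s] Suc.prems s k by simp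
    also have "\<dots> \<le> B * t ^ d" using s B0 by (intro mult_left_mono power_mono) auto
    finally have "norm (h *\<^sub>R (dv ^^ Suc k) f s) \<le> (B * t ^ d) * norm h" for h :: real
      by (simp add: mult.commute mult_left_mono del: funpow.simps)
    then show "onorm (\<lambda>h. h *\<^sub>R (dv ^^ Suc k) f s) \<le> B * t ^ d" by (rule onorm_le)
  qed (use Suc.prems in auto)
  then show ?case using 0[OF k(3)] Suc.prems unfolding k(1) by (simp add: mult_ac)
qed (use B in simp)

subsection \<open>Extension from finitely many half-lines\<close>

definition slope :: "nat \<Rightarrow> nat \<Rightarrow> real" where
  "slope n j = 2 * real j - real n"

lemma abs_slope: "j \<le> n \<Longrightarrow> \<bar>slope n j\<bar> \<le> real n"
  by (auto simp: slope_def abs_le_iff)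

text \<open>Monomials made compactly supported, out of which the polynomial pieces are built;
  \<open>cpow 0\<close> is \<open>cutoff\<close>.\<close>

definition cpow :: "nat \<Rightarrow> real \<Rightarrow> complex" where
  "cpow i t = cutoff t * of_real t ^ i"

lemma sm_cpow: "sm UNIV (cpow i)"
  unfolding cpow_def[abs_def] by (intro sm_mult sm_cutoff sm_pow sm_of_real open_UNIV)

lemma cpow_0: "2 \<le> \<bar>t\<bar> \<Longrightarrow> cpow i t = 0"
  by (simp add: cpow_def cutoff_0)

lemma ex_bu_cpow: "\<exists>A. bu K 1 A (cpow i)"
  using ex_bu[OF sm_cpow, of 2] cpow_0 by force

lemma ex_bu_cpow_uniform: "\<exists>E\<ge>0. \<forall>i\<le>N. bu K 1 E (cpow i)"
proof -
  obtain A where A: "\<And>i. bu K 1 (A i) (cpow i)" using ex_bu_cpow by metis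
  have "bu K 1 (\<Sum>i\<le>N. A i) (cpow i)" if "i \<le> N" for i
    by (rule bu_mono[OF A]) (use that bu_nonneg[OF A] in \<open>auto intro: member_le_sum\<close>)
  moreover have "0 \<le> (\<Sum>i\<le>N. A i)" using bu_nonneg[OF A] by (simp add: sum_nonneg)
  ultimately show ?thesis by blast
qed

lemma schwartz_tens:
  assumes "sm UNIV P" "sm UNIV Q" "\<And>x. R < \<bar>x\<bar> \<Longrightarrow> P x = 0" "\<And>x. S < \<bar>x\<bar> \<Longrightarrow> Q x = 0"
  shows "tens P Q \<in> schwartz_R2"
  unfolding schwartz_R2_iff
proof (intro conjI allI)
  fix N
  obtain A B where "bu N 1 A P" "bu N 1 B Q" using ex_bu[OF assms(1,3)] ex_bu[OF assms(2,4)] by blast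
  then show "\<exists>C. sbd N C (tens P Q)"
    using sbd_tens[OF assms(1,2) order_refl _ assms(3) _ assms(4)] by blast
qed (rule smooth_tens[OF assms(1,2)])

definition taylor :: "nat \<Rightarrow> (real \<Rightarrow> complex) \<Rightarrow> real \<Rightarrow> complex" where
  "taylor N f t = (\<Sum>k\<le>N. ((dv ^^ k) f 0 / fact k) * of_real t ^ k)"

lemma dvn_monomial:
  "(dv ^^ k) (\<lambda>t. of_real t ^ i) t = (if k \<le> i then fact i / fact (i - k) * of_real t ^ (i - k) else 0)"
proof -
  define D :: "nat \<Rightarrow> real \<Rightarrow> complex" where
    "D = (\<lambda>k t. if k \<le> i then fact i / fact (i - k) * of_real t ^ (i - k) else 0)"
  have "(D k has_vector_derivative D (Suc k) t) (at t)" for k t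
  proof (cases "Suc k \<le> i")
    case True
    define d where "d = i - Suc k"
    have d: "i - k = Suc d" "i - Suc k = d" "k \<le> i" using True by (auto simp: d_def)
    have "((\<lambda>t. t ^ Suc d) has_real_derivative real (Suc d) * t ^ d) (at t)"
      using DERIV_pow[of "Suc d" t] by simp
    then have "((\<lambda>t. complex_of_real (t ^ Suc d)) has_vector_derivative of_real (real (Suc d) * t ^ d)) (at t)"
      by (intro has_vector_derivative_of_real) (simp only: has_real_derivative_iff_has_vector_derivative)
    from has_vector_derivative_mult_right[OF this, of "fact i / fact (Suc d)"]
    show ?thesis using True d by (simp add: D_def field_simps del: power_Suc of_nat_Suc)
  next
    case False
    show ?thesis
    proof (cases "k = i")
      case True
      then have "D k = (\<lambda>t. fact i)" "D (Suc k) = (\<lambda>t. 0)" by (auto simp: D_def)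
      then show ?thesis by simp
    next
      case False
      then have "D k = (\<lambda>t. 0)" "D (Suc k) = (\<lambda>t. 0)" using \<open>\<not> Suc k \<le> i\<close> by (auto simp: D_def)
      then show ?thesis by simp
    qed
  qed
  from sm_tower(2)[of UNIV D, OF _ this, of t k] show ?thesis by (simp add: D_def)
qed

lemma
  shows sm_taylor: "sm UNIV (taylor N f)"
    and dvn_taylor_0: "(dv ^^ k) (taylor N f) 0 = (if k \<le> N then (dv ^^ k) f 0 else 0)"
    and dvn_taylor_high: "N < k \<Longrightarrow> (dv ^^ k) (taylor N f) t = 0"
proof -
  have m: "sm UNIV (\<lambda>t. ((dv ^^ i) f 0 / fact i) * of_real t ^ i)" for i
    by (intro sm_cmult sm_pow sm_of_real open_UNIV)
  then show "sm UNIV (taylor N f)"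
    unfolding taylor_def[abs_def] by (intro sm_sum) auto
  have d: "(dv ^^ k) (taylor N f) t = (\<Sum>i\<le>N. ((dv ^^ i) f 0 / fact i) * (if k \<le> i then fact i / fact (i - k) * of_real t ^ (i - k) else 0))" for k t
  proof -
    have "(dv ^^ k) (\<lambda>t. c * of_real t ^ i) t = c * (if k \<le> i then fact i / fact (i - k) * of_real t ^ (i - k) else 0)" for c i
      using dvn_cmult[OF open_UNIV sm_pow[OF open_UNIV sm_of_real] UNIV_I, of k c i t] by (simp only: dvn_monomial)
    moreover have "(dv ^^ k) (taylor N f) t = (\<Sum>i\<le>N. (dv ^^ k) (\<lambda>t. ((dv ^^ i) f 0 / fact i) * of_real t ^ i) t)"
      unfolding taylor_def[abs_def] by (rule dvn_sum[of UNIV]) (simp_all only: open_UNIV UNIV_I m)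
    ultimately show ?thesis by (simp only:)
  qed
  show "N < k \<Longrightarrow> (dv ^^ k) (taylor N f) t = 0" unfolding d by (intro sum.neutral) auto
  have "(dv ^^ k) (taylor N f) 0 = (\<Sum>i\<le>N. if i = k then (dv ^^ k) f 0 else 0)"
    unfolding d by (intro sum.cong) (auto simp: power_0_left)
  then show "(dv ^^ k) (taylor N f) 0 = (if k \<le> N then (dv ^^ k) f 0 else 0)" by simp
qed

text \<open>The \<open>k\<close>-th derivatives at 0 are a polynomial of degree at most
  \<open>k\<close> in the slope \<open>s\<close>. On the half-line of slope \<open>s\<close> one has
  \<open>s ^ i * t ^ k = t ^ (k - i) * (s * t) ^ i\<close>, and \<open>i \<le> k\<close> makes the
  right side a monomial in the two coordinates. So one polynomial on the plane restricts to all
  Taylor parts.\<close>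

lemma taylor_part:
  "\<exists>C\<ge>0. \<forall>n h B. (\<forall>k\<le>N. \<forall>i. i + Suc k \<le> n \<longrightarrow> (fdiff ^^ Suc k) (\<lambda>j. (dv ^^ k) (h j) 0) i = 0) \<longrightarrow>
    (\<forall>k\<le>N. \<forall>j\<le>n. cmod ((dv ^^ k) (h j) 0) \<le> B) \<longrightarrow>
    (\<exists>u\<in>schwartz_R2. sbd N (C * real (Suc n) ^ (4 * N) * B) u \<and>
      (\<forall>j\<le>n. \<forall>t. u (t, slope n j * t) = cutoff t * taylor N (h j) t))"
proof -
  obtain E where E: "0 \<le> E" "\<And>i. i \<le> N \<Longrightarrow> bu N 1 E (cpow i)" using ex_bu_cpow_uniform by blast
  define K0 where "K0 = real (Suc N) * 2 ^ N * 8 ^ N * 9 ^ N * (E * E)"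
  define C where "C = (\<Sum>k\<le>N. \<Sum>i\<le>k. K0)"
  have K0: "0 \<le> K0" using E by (simp add: K0_def)
  have "\<exists>u\<in>schwartz_R2. sbd N (C * real (Suc n) ^ (4 * N) * B) u \<and>
      (\<forall>j\<le>n. \<forall>t. u (t, slope n j * t) = cutoff t * taylor N (h j) t)"
    if van: "\<And>k i. k \<le> N \<Longrightarrow> i + Suc k \<le> n \<Longrightarrow> (fdiff ^^ Suc k) (\<lambda>j. (dv ^^ k) (h j) 0) i = 0"
      and B: "\<And>k j. k \<le> N \<Longrightarrow> j \<le> n \<Longrightarrow> cmod ((dv ^^ k) (h j) 0) \<le> B" for n h B
  proof -
    have B0: "0 \<le> B" using order.trans[OF norm_ge_zero B[of 0 0]] by simp
    have "\<exists>c. (\<forall>j\<le>n. (dv ^^ k) (h j) 0 = (\<Sum>i\<le>k. c i * of_real (slope n j) ^ i)) \<and>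
        (\<forall>i\<le>k. cmod (c i) \<le> real (Suc k) * (2 ^ k * B * real (Suc n) ^ k))" if "k \<le> N" for k
      unfolding slope_def using interpolate_low_degree[of k n "\<lambda>j. (dv ^^ k) (h j) 0" B] van B that by blast
    then have "\<forall>k. \<exists>c. k \<le> N \<longrightarrow> (\<forall>j\<le>n. (dv ^^ k) (h j) 0 = (\<Sum>i\<le>k. c i * of_real (slope n j) ^ i)) \<and>
        (\<forall>i\<le>k. cmod (c i) \<le> real (Suc k) * (2 ^ k * B * real (Suc n) ^ k))" by blast
    from choice[OF this] obtain c where c0: "\<forall>k. k \<le> N \<longrightarrow> (\<forall>j\<le>n. (dv ^^ k) (h j) 0 = (\<Sum>i\<le>k. c k i * of_real (slope n j) ^ i)) \<and>
        (\<forall>i\<le>k. cmod (c k i) \<le> real (Suc k) * (2 ^ k * B * real (Suc n) ^ k))" by blast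
    have c: "\<And>k j. k \<le> N \<Longrightarrow> j \<le> n \<Longrightarrow> (dv ^^ k) (h j) 0 = (\<Sum>i\<le>k. c k i * of_real (slope n j) ^ i)"
      "\<And>k i. k \<le> N \<Longrightarrow> i \<le> k \<Longrightarrow> cmod (c k i) \<le> real (Suc k) * (2 ^ k * B * real (Suc n) ^ k)"
      using c0 by blast+
    \<comment> \<open>The scale of the cutoff in the second coordinate: where
      \<open>cutoff t\<close> is nonzero, \<open>slope n j * t\<close> is at most
      \<open>2 * n\<close> in absolute value, hence at most \<open>a\<close>, and this cutoff equals
      1 on every half-line.\<close>
    define a where "a = 2 * real (Suc n)"
    have a: "1 \<le> a" "0 < a" by (auto simp: a_def)
    define U where "U k i = (\<lambda>p. (c k i / fact k * of_real (a ^ i)) * tens (cpow (k - i)) (\<lambda>y. cpow i (1 / a * y + 0)) p)" for k i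
    have smQ: "sm UNIV (\<lambda>y. cpow i (1 / a * y + 0))" for i by (rule sm_affine[OF sm_cpow])
    have supP: "cpow i x = 0" if "2 < \<bar>x\<bar>" for i x using cpow_0[of x i] that by simp
    have supQ: "cpow i (1 / a * y + 0) = 0" if "2 * a < \<bar>y\<bar>" for i y
      using that a by (intro cpow_0) (simp add: field_simps)
    have Us: "U k i \<in> schwartz_R2" for k i
      unfolding U_def by (intro schwartz_cmult schwartz_tens[OF sm_cpow smQ supP supQ])
    have smU: "smooth (U k i)" for k i using Us schwartz_R2_iff by blast
    have Ub: "sbd N (K0 * real (Suc n) ^ (4 * N) * B) (U k i)" if k: "k \<le> N" and i: "i \<le> k" for k i
    proof -
      have t: "sbd N ((1 + 2\<^sup>2 + (2 * a)\<^sup>2) ^ N * (E * E * 1 ^ N)) (tens (cpow (k - i)) (\<lambda>y. cpow i (1 / a * y + 0)))"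
        by (rule sbd_tens[OF sm_cpow smQ order_refl E(2) supP bu_affine[OF sm_cpow E(2)] supQ]) (use k i a in auto)
      have w: "(1 + 2\<^sup>2 + (2 * a)\<^sup>2) ^ N \<le> (9 * a\<^sup>2) ^ N"
        using a one_le_power[OF a(1), of 2] by (intro power_mono) (auto simp: power2_eq_square)
      have "cmod (c k i / fact k * of_real (a ^ i)) \<le> (real (Suc N) * (2 ^ N * B * real (Suc n) ^ N)) * a ^ N"
      proof -
        have "cmod (c k i / fact k) \<le> cmod (c k i) / 1"
          unfolding norm_divide by (intro divide_left_mono) (auto simp: norm_fact fact_ge_1)
        also have "\<dots> \<le> real (Suc k) * (2 ^ k * B * real (Suc n) ^ k)" using c(2)[OF k i] by simp
        also have "\<dots> \<le> real (Suc N) * (2 ^ N * B * real (Suc n) ^ N)"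
          using k B0 by (intro mult_mono power_increasing) auto
        finally have 1: "cmod (c k i / fact k) \<le> real (Suc N) * (2 ^ N * B * real (Suc n) ^ N)" .
        have "a ^ i \<le> a ^ N" using a k i by (intro power_increasing) auto
        moreover have "cmod (of_real (a ^ i)) = a ^ i" unfolding norm_of_real using a by simp
        ultimately show ?thesis unfolding norm_mult using mult_mono[OF 1, of "a ^ i" "a ^ N"] a B0 by simp
      qed
      then have "cmod (c k i / fact k * of_real (a ^ i)) * ((1 + 2\<^sup>2 + (2 * a)\<^sup>2) ^ N * (E * E * 1 ^ N))
          \<le> ((real (Suc N) * (2 ^ N * B * real (Suc n) ^ N)) * a ^ N) * ((9 * a\<^sup>2) ^ N * (E * E * 1 ^ N))"
        using w E B0 a by (intro mult_mono[OF _ mult_right_mono]) auto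
      also have "\<dots> = K0 * real (Suc n) ^ (4 * N) * B"
      proof -
        \<comment> \<open>One power \<open>N\<close> comes from the coefficients
          \<open>c k i\<close>, one from \<open>a ^ i\<close>, and two from the weight on a support
          of height \<open>2 * a\<close>.\<close>
        have "real (Suc n) ^ (4 * N) = real (Suc n) ^ N * real (Suc n) ^ N * (real (Suc n) ^ N * real (Suc n) ^ N)"
        proof -
          have "4 * N = N + N + (N + N)" by simp
          then show ?thesis by (simp only: power_add)
        qed
        moreover have "(8::real) ^ N = 2 ^ N * (2 ^ N * 2 ^ N)" by (simp flip: power_mult_distrib)
        ultimately show ?thesis
          unfolding K0_def a_def power2_eq_square power_mult_distrib by (simp add: mult_ac)
      qed
      finally show ?thesis
        unfolding U_def using sbd_cmult[OF smooth_tens[OF sm_cpow smQ] t] sbd_mono by blast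
    qed
    define u where "u = (\<lambda>p. \<Sum>k\<le>N. \<Sum>i\<le>k. U k i p)"
    have "u \<in> schwartz_R2" unfolding u_def by (intro schwartz_sum Us) auto
    moreover have "sbd N (\<Sum>k\<le>N. \<Sum>i\<le>k. K0 * real (Suc n) ^ (4 * N) * B) u"
      unfolding u_def by (intro sbd_sum smooth_sum smU Ub) auto
    then have "sbd N (C * real (Suc n) ^ (4 * N) * B) u"
      by (simp only: C_def sum_distrib_right)
    moreover have "u (t, slope n j * t) = cutoff t * taylor N (h j) t" if j: "j \<le> n" for j t
    proof (cases "2 \<le> \<bar>t\<bar>")
      case True
      then have "U k i (t, s) = 0" for k i s by (simp add: U_def tens_def cpow_0)
      then show ?thesis using True by (simp add: u_def cutoff_0)
    next
      case False
      have "\<bar>slope n j * t\<bar> \<le> real n * 2" unfolding abs_mult using abs_slope[OF j] False by (intro mult_mono) auto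
      then have "\<bar>slope n j * t / a\<bar> \<le> 1" using a by (simp add: a_def)
      then have cut: "cutoff (slope n j * t / a) = 1" by (rule cutoff_1)
      have "U k i (t, slope n j * t) = cutoff t * (c k i / fact k * of_real (slope n j) ^ i * of_real t ^ k)"
        if "i \<le> k" for k i
      proof -
        have "of_real t ^ k = of_real t ^ (k - i) * (of_real t ^ i :: complex)" using that by (simp flip: power_add)
        then show ?thesis
          using a by (simp add: U_def tens_def cpow_def cut power_divide power_mult_distrib)
      qed
      then have "u (t, slope n j * t) = (\<Sum>k\<le>N. \<Sum>i\<le>k. cutoff t * (c k i / fact k * of_real (slope n j) ^ i * of_real t ^ k))"
        by (simp add: u_def)
      also have "\<dots> = (\<Sum>k\<le>N. cutoff t * ((dv ^^ k) (h j) 0 / fact k * of_real t ^ k))"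
        using c(1) j by (intro sum.cong) (auto simp: sum_distrib_left sum_distrib_right sum_divide_distrib intro!: sum.cong)
      finally show ?thesis by (simp add: taylor_def sum_distrib_left)
    qed
    ultimately show ?thesis by blast
  qed
  moreover have "0 \<le> C" using K0 by (auto simp: C_def intro!: sum_nonneg)
  ultimately show ?thesis by (intro exI[of _ C]) auto
qed

text \<open>For \<open>t < 1\<close> the cutoff is 1 and the Taylor estimate gives
  \<open>t ^ (N + 1 - k)\<close>; for \<open>t \<ge> 1\<close> the decay of \<open>h\<close> and the
  compact support of the Taylor part suffice. The weight \<open>3 * N + 1\<close> is
  \<open>2 * N + (N + 1)\<close>, the decay that \<open>sbd_cone_fun\<close> requires for
  \<open>q = N + 1\<close>.\<close>

lemma remainder_bd:
  assumes h: "sm UNIV h" and E: "\<And>i. i \<le> N \<Longrightarrow> bu (Suc N) 1 E (cpow i)" and "0 \<le> E"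
    and B: "\<And>k t. k \<le> Suc N \<Longrightarrow> 0 \<le> t \<Longrightarrow> (1 + t) ^ (3 * N + 1) * cmod ((dv ^^ k) h t) \<le> B"
  shows "bd N (int (Suc N)) (3 * N + 1) ((2 ^ (3 * N + 1) + 1 + real (Suc N) * E * 3 ^ (3 * N + 1)) * B) (\<lambda>t. h t - cutoff t * taylor N h t)"
  unfolding bd_def
proof (intro allI impI)
  fix k t assume k: "k \<le> N" and t: "(0::real) < t"
  let ?L = "3 * N + 1" and ?r = "\<lambda>t. h t - cutoff t * taylor N h t"
  let ?C = "(2 ^ ?L + 1 + real (Suc N) * E * 3 ^ ?L) * B"
  have B': "cmod ((dv ^^ k) h t) \<le> B" if "k \<le> Suc N" "0 \<le> t" for k t
  proof -
    have "1 * cmod ((dv ^^ k) h t) \<le> (1 + t) ^ ?L * cmod ((dv ^^ k) h t)"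
      using that by (intro mult_right_mono one_le_power) auto
    then show ?thesis using B[OF that] by simp
  qed
  have B0: "0 \<le> B" using order.trans[OF norm_ge_zero B'[of 0 0]] by simp
  have C0: "0 \<le> real (Suc N) * E * 3 ^ ?L" using \<open>0 \<le> E\<close> by simp
  have pw: "t powi (int (Suc N) - int k) = t ^ (Suc N - k)"
  proof -
    have "int (Suc N) - int k = int (Suc N - k)" using k by (simp add: of_nat_diff)
    then show ?thesis by (simp only: power_int_of_nat)
  qed
  have smh: "sm UNIV (\<lambda>t. (-1) * taylor N h t)" by (intro sm_cmult sm_taylor open_UNIV)
  have smc: "sm UNIV (\<lambda>t. cutoff t * taylor N h t)" by (intro sm_mult sm_cutoff sm_taylor open_UNIV)
  show "cmod ((dv ^^ k) ?r t) \<le> ?C * t powi (int (Suc N) - int k) / (1 + t) ^ ?L"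
  proof (cases "t < 1")
    case True
    define w where "w = (\<lambda>t. h t + (-1) * taylor N h t)"
    have w: "sm UNIV w" unfolding w_def by (intro sm_add h smh open_UNIV)
    have dw: "(dv ^^ i) w s = (dv ^^ i) h s - (dv ^^ i) (taylor N h) s" for i s
      unfolding w_def using dvn_add[OF open_UNIV h smh, of s i] dvn_cmult[OF open_UNIV sm_taylor, of s i "-1" N h]
      by (simp del: funpow.simps)
    have "(dv ^^ k) ?r t = (dv ^^ k) w t"
      by (rule dvn_cong[of "{-1<..<1}"]) (use True t in \<open>auto simp: w_def cutoff_1\<close>)
    also have "cmod ((dv ^^ k) w t) \<le> B * t ^ (Suc N - k)"
    proof -
      have "cmod ((dv ^^ (Suc N - (Suc N - k))) w t) \<le> B * t ^ (Suc N - k)"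
      proof (rule taylor_remainder[OF w])
        show "(dv ^^ i) w 0 = 0" if "i \<le> N" for i using that by (simp add: dw dvn_taylor_0)
        show "cmod ((dv ^^ Suc N) w s) \<le> B" if "0 \<le> s" for s
          using B'[of "Suc N" s] that dvn_taylor_high[of N "Suc N" h s] by (simp add: dw del: funpow.simps)
      qed (use t True in auto)
      then show ?thesis using k by simp
    qed
    also have "\<dots> = B * t ^ (Suc N - k) * 1" by simp
    also have "\<dots> \<le> B * t ^ (Suc N - k) * (2 ^ ?L / (1 + t) ^ ?L)"
    proof (rule mult_left_mono)
      have "(1 + t) ^ ?L \<le> 2 ^ ?L" using t True by (intro power_mono) auto
      then show "1 \<le> 2 ^ ?L / (1 + t) ^ ?L" using t by (simp add: le_divide_eq_1)
    qed (use B0 t in simp)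
    also have "\<dots> = (2 ^ ?L * B) * t ^ (Suc N - k) / (1 + t) ^ ?L" by simp
    also have "\<dots> \<le> ?C * t ^ (Suc N - k) / (1 + t) ^ ?L"
      using B0 C0 t by (intro divide_right_mono mult_right_mono) auto
    finally show ?thesis unfolding pw .
  next
    case False
    have T: "cmod ((dv ^^ k) (\<lambda>t. cutoff t * taylor N h t) t) \<le> real (Suc N) * E * 3 ^ ?L * B / (1 + t) ^ ?L"
    proof (cases "2 < t")
      case True
      have "(dv ^^ k) (\<lambda>t. cutoff t * taylor N h t) t = 0"
        by (rule dvn_outside_support[of 2]) (use True in \<open>auto simp: cutoff_0\<close>)
      then show ?thesis using C0 B0 t by simp
    next
      case False
      have "(\<lambda>t. cutoff t * taylor N h t) = (\<lambda>t. \<Sum>i\<le>N. ((dv ^^ i) h 0 / fact i) * cpow i t)"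
        by (simp add: taylor_def sum_distrib_left cpow_def mult_ac)
      moreover have "(dv ^^ k) (\<lambda>t. \<Sum>i\<le>N. ((dv ^^ i) h 0 / fact i) * cpow i t) t =
          (\<Sum>i\<le>N. (dv ^^ k) (\<lambda>t. ((dv ^^ i) h 0 / fact i) * cpow i t) t)"
        by (rule dvn_sum[of UNIV]) (simp_all only: open_UNIV UNIV_I sm_cmult[OF open_UNIV sm_cpow])
      ultimately have "(dv ^^ k) (\<lambda>t. cutoff t * taylor N h t) t = (\<Sum>i\<le>N. ((dv ^^ i) h 0 / fact i) * (dv ^^ k) (cpow i) t)"
        by (simp only: dvn_cmult[OF open_UNIV sm_cpow UNIV_I])
      also have "cmod \<dots> \<le> (\<Sum>i\<le>N. B * E)"
      proof (rule order.trans[OF norm_sum], rule sum_mono)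
        fix i assume "i \<in> {..N}"
        then have i: "i \<le> N" by simp
        have "cmod ((dv ^^ i) h 0 / fact i) \<le> cmod ((dv ^^ i) h 0) / 1"
          unfolding norm_divide by (intro divide_left_mono) (auto simp: norm_fact fact_ge_1)
        then have "cmod ((dv ^^ i) h 0 / fact i) \<le> B" using B'[of i 0] i by simp
        moreover have "cmod ((dv ^^ k) (cpow i) t) \<le> E" using buD[OF E[OF i], of k t] k by simp
        ultimately show "cmod ((dv ^^ i) h 0 / fact i * (dv ^^ k) (cpow i) t) \<le> B * E"
          unfolding norm_mult using B0 by (intro mult_mono) auto
      qed
      also have "\<dots> = real (Suc N) * E * B * 1" by simp
      also have "\<dots> \<le> real (Suc N) * E * B * (3 ^ ?L / (1 + t) ^ ?L)"
      proof (rule mult_left_mono)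
        have "(1 + t) ^ ?L \<le> 3 ^ ?L" using t False by (intro power_mono) auto
        then show "1 \<le> 3 ^ ?L / (1 + t) ^ ?L" using t by (simp add: le_divide_eq_1)
      qed (use B0 \<open>0 \<le> E\<close> in simp)
      finally show ?thesis by (simp add: mult_ac)
    qed
    have H: "cmod ((dv ^^ k) h t) \<le> B / (1 + t) ^ ?L"
      using B[of k t] k t by (simp add: field_simps del: power_Suc)
    have "(dv ^^ k) ?r t = (dv ^^ k) h t + (dv ^^ k) (\<lambda>t. (-1) * (cutoff t * taylor N h t)) t"
      using dvn_add[OF open_UNIV h sm_cmult[OF open_UNIV smc, of "-1"], of t k] by simp
    also have "\<dots> = (dv ^^ k) h t - (dv ^^ k) (\<lambda>t. cutoff t * taylor N h t) t"
      using dvn_cmult[OF open_UNIV smc, of t k "-1"] by simp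
    finally have "cmod ((dv ^^ k) ?r t) \<le> cmod ((dv ^^ k) h t) + cmod ((dv ^^ k) (\<lambda>t. cutoff t * taylor N h t) t)"
      by (simp only: norm_triangle_ineq4)
    also have "\<dots> \<le> B / (1 + t) ^ ?L + real (Suc N) * E * 3 ^ ?L * B / (1 + t) ^ ?L"
      by (rule add_mono[OF H T])
    also have "\<dots> = ((1 + real (Suc N) * E * 3 ^ ?L) * B) / (1 + t) ^ ?L"
      by (simp only: add_divide_distrib distrib_right mult_1_left)
    also have "\<dots> \<le> (?C * t ^ (Suc N - k)) / (1 + t) ^ ?L"
    proof (rule divide_right_mono)
      have "((1 + real (Suc N) * E * 3 ^ ?L) * B) * 1 \<le> ?C * t ^ (Suc N - k)"
        using B0 C0 False by (intro mult_mono one_le_power) auto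
      then show "(1 + real (Suc N) * E * 3 ^ ?L) * B \<le> ?C * t ^ (Suc N - k)" by simp
    qed (use t in simp)
    finally show ?thesis unfolding pw .
  qed
qed

text \<open>A \<open>k\<close>-th derivative of the cutoff has size
  \<open>(1 / \<epsilon>) ^ k\<close>, but only where \<open>t \<le> 2 * \<epsilon>\<close>, and
  there \<open>1 / \<epsilon>\<close> is at most \<open>2 / t\<close>. Hence a bound of order 0 with
  a constant free of \<open>\<epsilon>\<close>.\<close>

lemma bd_one_minus_cutoff:
  assumes E: "bu K 1 E cutoff" and \<epsilon>: "0 < \<epsilon>"
  shows "bd K 0 0 (1 + 2 ^ K * E) (\<lambda>t. 1 - cutoff (t / \<epsilon>))"
  unfolding bd_def
proof (intro allI impI)
  fix k t assume k: "k \<le> K" and t: "(0::real) < t"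
  have E0: "0 \<le> E" using bu_nonneg[OF E] .
  have c: "sm UNIV (\<lambda>t. cutoff (1 / \<epsilon> * t + 0))" by (rule sm_affine[OF sm_cutoff])
  have "(dv ^^ k) (\<lambda>t. 1 - cutoff (t / \<epsilon>)) t = (dv ^^ k) (\<lambda>t. 1 + (-1) * cutoff (1 / \<epsilon> * t + 0)) t" by simp
  also have "\<dots> = (if k = 0 then 1 else 0) + (dv ^^ k) (\<lambda>t. (-1) * cutoff (1 / \<epsilon> * t + 0)) t"
    using dvn_add[OF open_UNIV sm_const[OF open_UNIV] sm_cmult[OF open_UNIV c], of t k 1 "-1"]
    by (simp add: dvn_const[of UNIV])
  also have "(dv ^^ k) (\<lambda>t. (-1) * cutoff (1 / \<epsilon> * t + 0)) t = - (of_real ((1 / \<epsilon>) ^ k) * (dv ^^ k) cutoff (1 / \<epsilon> * t + 0))"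
    unfolding dvn_cmult[OF open_UNIV c UNIV_I] dvn_affine[OF sm_cutoff] by simp
  finally have "cmod ((dv ^^ k) (\<lambda>t. 1 - cutoff (t / \<epsilon>)) t) \<le>
      (if k = 0 then 1 else 0) + cmod (of_real ((1 / \<epsilon>) ^ k) * (dv ^^ k) cutoff (1 / \<epsilon> * t + 0))"
    by (auto intro: order.trans[OF norm_triangle_ineq4])
  also have "\<dots> \<le> inverse t ^ k + inverse t ^ k * (2 ^ K * E)"
  proof (rule add_mono)
    show "(if k = 0 then 1 else 0) \<le> inverse t ^ k" using t by auto
    show "cmod (of_real ((1 / \<epsilon>) ^ k) * (dv ^^ k) cutoff (1 / \<epsilon> * t + 0)) \<le> inverse t ^ k * (2 ^ K * E)"
    proof (cases "2 < t / \<epsilon>")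
      case True
      have "(dv ^^ k) cutoff (1 / \<epsilon> * t + 0) = 0"
        by (rule dvn_outside_support[of 2]) (use True t \<epsilon> cutoff_0 in \<open>auto simp: abs_of_pos\<close>)
      then show ?thesis using E0 t by simp
    next
      case False
      then have "1 / \<epsilon> \<le> 2 * inverse t" using t \<epsilon> by (simp add: field_simps)
      then have "(1 / \<epsilon>) ^ k \<le> (2 * inverse t) ^ k" using \<epsilon> by (intro power_mono) auto
      also have "\<dots> = inverse t ^ k * 2 ^ k" by (simp add: power_mult_distrib)
      also have "\<dots> \<le> inverse t ^ k * 2 ^ K" using k t by (intro mult_left_mono power_increasing) auto
      finally have 1: "(1 / \<epsilon>) ^ k \<le> inverse t ^ k * 2 ^ K" .
      have "cmod ((dv ^^ k) cutoff (1 / \<epsilon> * t + 0)) \<le> E" using buD[OF E k] by simp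
      then have "(1 / \<epsilon>) ^ k * cmod ((dv ^^ k) cutoff (1 / \<epsilon> * t + 0)) \<le> (inverse t ^ k * 2 ^ K) * E"
        using 1 t by (intro mult_mono) auto
      then show ?thesis using \<epsilon> by (simp add: norm_mult norm_power mult_ac norm_divide power_one_over)
    qed
  qed
  also have "\<dots> = (1 + 2 ^ K * E) * t powi (0 - int k) / (1 + t) ^ 0"
    by (simp add: power_int_minus power_inverse algebra_simps)
  finally show "cmod ((dv ^^ k) (\<lambda>t. 1 - cutoff (t / \<epsilon>)) t) \<le> (1 + 2 ^ K * E) * t powi (0 - int k) / (1 + t) ^ 0" .
qed

text \<open>The estimate of order 0 wants a factor \<open>1 / t\<close> for each derivative; it is
  supplied by one further power of \<open>1 + t\<close>, which exceeds \<open>t\<close>.\<close>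

lemma ex_bd_of_rapid_decay:
  assumes "\<And>k L. \<exists>C. \<forall>t>0. (1 + t) ^ L * cmod ((dv ^^ k) r t) \<le> C"
  shows "\<exists>B. bd K 0 L B r"
proof -
  have "\<forall>k. \<exists>C. \<forall>t>0. (1 + t) ^ (L + k) * cmod ((dv ^^ k) r t) \<le> C" using assms by blast
  then obtain C where C: "\<And>k t. 0 < t \<Longrightarrow> (1 + t) ^ (L + k) * cmod ((dv ^^ k) r t) \<le> C k" by metis
  have C0: "0 \<le> C k" for k using order.trans[OF _ C[of 1 k]] by simp
  have "bd K 0 L (\<Sum>k\<le>K. C k) r"
    unfolding bd_def
  proof (intro allI impI)
    fix k t assume k: "k \<le> K" and t: "(0::real) < t"
    have "C k \<le> (\<Sum>k\<le>K. C k)" by (rule member_le_sum) (use k C0 in auto)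
    then have "cmod ((dv ^^ k) r t) \<le> (\<Sum>k\<le>K. C k) * (inverse ((1 + t) ^ k) / (1 + t) ^ L)"
      using C[OF t, of k] t by (simp add: field_simps power_add)
    also have "\<dots> \<le> (\<Sum>k\<le>K. C k) * (inverse (t ^ k) / (1 + t) ^ L)"
      using t C0 by (intro mult_left_mono divide_right_mono le_imp_inverse_le power_mono sum_nonneg) auto
    finally show "cmod ((dv ^^ k) r t) \<le> (\<Sum>k\<le>K. C k) * t powi (0 - int k) / (1 + t) ^ L"
      by (simp add: power_int_minus)
  qed
  then show ?thesis by blast
qed

text \<open>Each remainder is spread over a cone of its own. The factor
  \<open>1 - cutoff (t / \<epsilon>)\<close> makes the profile vanish near 0, so that the cone
  function is smooth, and by \<open>bd_one_minus_cutoff\<close> it costs no power of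
  \<open>1 / \<epsilon>\<close>; this is why \<open>C\<close> precedes \<open>\<epsilon>\<close> in
  the quantifiers. The exponent \<open>3 * N + 1\<close> is \<open>3 * N\<close> from the angular
  range \<open>n + 1\<close>, plus one for the number of cones.\<close>

lemma remainder_part:
  "\<exists>C\<ge>0. \<forall>n h B \<epsilon>. 0 < \<epsilon> \<longrightarrow> (\<forall>j. sm UNIV (h j)) \<longrightarrow>
    (\<forall>j\<le>n. \<forall>k L. \<exists>C. \<forall>t>0. (1 + t) ^ L * cmod ((dv ^^ k) (h j) t) \<le> C) \<longrightarrow>
    (\<forall>j\<le>n. \<forall>k\<le>Suc N. \<forall>t\<ge>0. (1 + t) ^ (3 * N + 1) * cmod ((dv ^^ k) (h j) t) \<le> B) \<longrightarrow>
    (\<exists>u\<in>schwartz_R2. sbd N (C * real (Suc n) ^ (3 * N + 1) * B) u \<and>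
      (\<forall>j\<le>n. \<forall>t\<ge>0. u (t, slope n j * t) = (1 - cutoff (t / \<epsilon>)) * (h j t - cutoff t * taylor N (h j) t)))"
proof -
  obtain E where E: "0 \<le> E" "\<And>i. i \<le> N \<Longrightarrow> bu (Suc N) 1 E (cpow i)" using ex_bu_cpow_uniform by blast
  have cp0: "cpow 0 = cutoff" by (auto simp: cpow_def)
  have Ec: "bu N 1 E cutoff" using bu_order_mono[OF E(2)[of 0], of N] cp0 by simp
  define c2 where "c2 = 2 ^ (3 * N + 1) + 1 + real (Suc N) * E * 3 ^ (3 * N + 1)"
  define c3 where "c3 = 1 + 2 ^ N * E"
  have c23: "0 \<le> c2" "0 \<le> c3" using E by (auto simp: c2_def c3_def)
  define C where "C = 2 ^ N * cone_fun_const N * (2 ^ N * (c2 * c3) * (E * 2 ^ N))"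
  have C0: "0 \<le> C" using c23 E cone_fun_const_ge_1[of N] by (simp add: C_def)
  have "\<exists>u\<in>schwartz_R2. sbd N (C * real (Suc n) ^ (3 * N + 1) * B) u \<and>
      (\<forall>j\<le>n. \<forall>t\<ge>0. u (t, slope n j * t) = (1 - cutoff (t / \<epsilon>)) * (h j t - cutoff t * taylor N (h j) t))"
    if \<epsilon>: "0 < \<epsilon>" and h: "\<And>j. sm UNIV (h j)"
      and dec: "\<And>j k L. j \<le> n \<Longrightarrow> \<exists>C. \<forall>t>0. (1 + t) ^ L * cmod ((dv ^^ k) (h j) t) \<le> C"
      and B: "\<And>j k t. j \<le> n \<Longrightarrow> k \<le> Suc N \<Longrightarrow> 0 \<le> t \<Longrightarrow> (1 + t) ^ (3 * N + 1) * cmod ((dv ^^ k) (h j) t) \<le> B"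
    for n h B \<epsilon>
  proof -
    define r where "r j = (\<lambda>t. h j t - cutoff t * taylor N (h j) t)" for j
    define \<kappa> where "\<kappa> = (\<lambda>t. 1 - cutoff (t / \<epsilon>))"
    \<comment> \<open>Slopes are 2 apart, and \<open>\<psi> j\<close> vanishes at distance 1 or more
      from \<open>slope n j\<close>: it is 1 at its own slope and 0 at all the others.\<close>
    define \<psi> where "\<psi> j = (\<lambda>\<theta>. cutoff (2 * \<theta> + (- 2 * slope n j)))" for j
    have smc: "sm UNIV (\<lambda>t. cutoff t * taylor N (h j) t)" for j by (intro sm_mult sm_cutoff sm_taylor open_UNIV)
    have r_eq: "r j = (\<lambda>t. h j t + (-1) * (cutoff t * taylor N (h j) t))" for j by (simp add: r_def)
    have smr: "sm UNIV (r j)" for j unfolding r_eq by (intro sm_add h sm_cmult smc open_UNIV)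
    have "\<kappa> = (\<lambda>t. 1 + (-1) * cutoff (1 / \<epsilon> * t + 0))" by (simp add: \<kappa>_def)
    then have sm\<kappa>: "sm UNIV \<kappa>" by (simp only: sm_add sm_const sm_cmult sm_affine sm_cutoff open_UNIV)
    have sm\<psi>: "sm UNIV (\<psi> j)" for j unfolding \<psi>_def by (rule sm_affine[OF sm_cutoff])
    have supp_\<psi>: "\<psi> j \<theta> = 0" if "j \<le> n" "real (Suc n) < \<bar>\<theta>\<bar>" for j \<theta>
      unfolding \<psi>_def using abs_slope[OF that(1)] that(2) by (intro cutoff_0) auto
    have b\<psi>: "cmod ((dv ^^ k) (\<psi> j) \<theta>) \<le> E * 2 ^ N" if "k \<le> N" for j k \<theta>
    proof -
      have "cmod ((dv ^^ k) (\<psi> j) \<theta>) \<le> E * 2 ^ k"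
        unfolding \<psi>_def by (rule buD[OF bu_affine[OF sm_cutoff Ec] that]) simp
      also have "\<dots> \<le> E * 2 ^ N" using E that by (intro mult_left_mono power_increasing) auto
      finally show ?thesis .
    qed
    have \<kappa>0: "\<kappa> t = 0" if "0 < t \<and> t < \<epsilon>" for t
      using that \<epsilon> by (simp add: \<kappa>_def cutoff_1 abs_of_pos)
    define q where "q j = (\<lambda>t. r j t * \<kappa> t)" for j
    have pos: "sm {0<..} f" if "sm UNIV f" for f using sm_subset[OF that] by simp
    have off: "off_zero (q j)" for j
      unfolding off_zero_def q_def using \<kappa>0 \<epsilon> by (intro conjI sm_mult pos smr sm\<kappa>) auto
    have bq: "bd N (int (Suc N)) (2 * N + Suc N) (2 ^ N * ((c2 * B) * c3)) (q j)" if j: "j \<le> n" for j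
    proof -
      have 1: "bd N (int (Suc N)) (3 * N + 1) (c2 * B) (r j)"
        unfolding r_def c2_def by (rule remainder_bd[OF h E(2) E(1) B[OF j]])
      have 2: "bd N 0 0 c3 \<kappa>" unfolding \<kappa>_def c3_def by (rule bd_one_minus_cutoff[OF Ec \<epsilon>])
      show ?thesis using bd_mult[OF pos[OF smr] pos[OF sm\<kappa>] 1 2] by (simp add: q_def)
    qed
    have decq: "\<exists>B. bd K 0 L B (q j)" if j: "j \<le> n" for j K L
    proof -
      have "\<exists>C. \<forall>t>0. (1 + t) ^ L * cmod ((dv ^^ k) (r j) t) \<le> C" for k L
      proof -
        obtain C1 where C1: "\<forall>t>0. (1 + t) ^ L * cmod ((dv ^^ k) (h j) t) \<le> C1" using dec[OF j] by blast
        obtain C2 where C2: "C2 \<ge> 0" "\<forall>t. cmod ((dv ^^ k) (\<lambda>t. cutoff t * taylor N (h j) t) t) \<le> C2"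
          using bounded_dvn_of_support[OF smc[of j], where R = 2 and k = k] cutoff_0 by force
        have "(1 + t) ^ L * cmod ((dv ^^ k) (r j) t) \<le> C1 + 3 ^ L * C2" if t: "t > 0" for t
        proof -
          let ?g = "\<lambda>t. cutoff t * taylor N (h j) t"
          have "(dv ^^ k) (r j) t = (dv ^^ k) (h j) t - (dv ^^ k) ?g t"
            unfolding r_eq using dvn_add[OF open_UNIV h[of j] sm_cmult[OF open_UNIV smc[of j], of "-1"] UNIV_I, where k = k and t = t]
              dvn_cmult[OF open_UNIV smc[of j] UNIV_I, where k = k and t = t and c = "-1"] by simp
          then have "cmod ((dv ^^ k) (r j) t) \<le> cmod ((dv ^^ k) (h j) t) + cmod ((dv ^^ k) ?g t)"
            by (simp only: norm_triangle_ineq4)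
          then have "(1 + t) ^ L * cmod ((dv ^^ k) (r j) t) \<le> (1 + t) ^ L * cmod ((dv ^^ k) (h j) t) + (1 + t) ^ L * cmod ((dv ^^ k) ?g t)"
            using t by (simp only: distrib_left[symmetric]) (intro mult_left_mono, auto)
          also have "(1 + t) ^ L * cmod ((dv ^^ k) ?g t) \<le> 3 ^ L * C2"
          proof (cases "2 < t")
            case True
            then have "(dv ^^ k) ?g t = 0" by (intro dvn_outside_support[of 2]) (auto simp: cutoff_0)
            then show ?thesis using C2 by simp
          next
            case False
            then show ?thesis using t C2 by (intro mult_mono power_mono) auto
          qed
          finally show ?thesis using C1 t by fastforce
        qed
        then show ?thesis by blast
      qed
      then obtain B1 where b1: "bd K 0 L B1 (r j)" using ex_bd_of_rapid_decay[of "r j" K L] by blast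
      obtain E' where "bu K 1 E' cutoff" using ex_bu_cpow[of K 0] cp0 by auto
      then have b2: "bd K 0 0 (1 + 2 ^ K * E') \<kappa>" unfolding \<kappa>_def by (rule bd_one_minus_cutoff[OF _ \<epsilon>])
      show ?thesis using bd_mult[OF pos[OF smr] pos[OF sm\<kappa>] b1 b2] unfolding q_def by auto
    qed
    define u where "u = (\<lambda>p. \<Sum>j\<le>n. cone_fun (q j) (\<psi> j) p)"
    have "u \<in> schwartz_R2"
      unfolding u_def by (intro schwartz_sum schwartz_cone_fun[OF off decq sm\<psi> supp_\<psi>]) auto
    moreover have "sbd N (\<Sum>j\<le>n. 2 ^ N * cone_fun_const N * real (Suc n) ^ (3 * N) * ((2 ^ N * ((c2 * B) * c3)) * (E * 2 ^ N))) u"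
      unfolding u_def
      by (intro sbd_sum smooth_cone_fun[OF off sm\<psi>] sbd_cone_fun[OF _ off bq _ sm\<psi> b\<psi> supp_\<psi>]) auto
    then have "sbd N (C * real (Suc n) ^ (3 * N + 1) * B) u"
      by (simp add: C_def mult_ac)
    moreover have "u (t, slope n i * t) = \<kappa> t * r i t" if i: "i \<le> n" and t: "0 \<le> t" for i t
    proof (cases "t = 0")
      case True
      then show ?thesis by (simp add: u_def cone_fun_def \<kappa>_def cutoff_1)
    next
      case False
      have "u (t, slope n i * t) = (\<Sum>j\<le>n. q j t * \<psi> j (slope n i))"
        using False t by (simp add: u_def cone_fun_def)
      also have "\<dots> = (\<Sum>j\<le>n. if j = i then q i t else 0)"
      proof (intro sum.cong refl)
        fix j assume "j \<in> {..n}"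
        show "q j t * \<psi> j (slope n i) = (if j = i then q i t else 0)"
        proof (cases "j = i")
          case False
          then have "1 \<le> \<bar>real i - real j\<bar>" by linarith
          then have "\<psi> j (slope n i) = 0" unfolding \<psi>_def slope_def by (intro cutoff_0) (auto simp: abs_if split: if_splits)
          then show ?thesis using False by simp
        qed (simp add: \<psi>_def cutoff_1)
      qed
      also have "\<dots> = q i t" using i by simp
      finally show ?thesis by (simp add: q_def mult.commute)
    qed
    ultimately show ?thesis unfolding \<kappa>_def r_def by blast
  qed
  then show ?thesis using C0 by (intro exI[of _ C]) auto
qed

text \<open>The interpolant is the sum of \<open>s p x * (y / x) ^ p\<close>, where
  \<open>s p\<close> combines the \<open>w i\<close> with the Lagrange coefficients
  \<open>L p i\<close>. Division by \<open>x ^ p\<close> is possible since \<open>s p\<close>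
  vanishes to order \<open>max (N + 1) p\<close> at 0: the orders up to \<open>N\<close> by
  flatness, an order \<open>k < p\<close> because the \<open>k\<close>-th derivatives of the
  \<open>w i\<close> are a polynomial of degree at most \<open>k\<close> in the node, which
  \<open>L p\<close> annihilates. The constants depend on \<open>n\<close> and \<open>w\<close>
  without control, and \<open>\<epsilon>\<close> is chosen after them.\<close>

lemma flat_part:
  assumes w: "\<And>j. sm UNIV (w j)" and flat: "\<And>j k. k \<le> N \<Longrightarrow> (dv ^^ k) (w j) 0 = 0"
    and van: "\<And>k i. i + Suc k \<le> n \<Longrightarrow> (fdiff ^^ Suc k) (\<lambda>j. (dv ^^ k) (w j) 0) i = 0"
    and e: "0 < e"
  shows "\<exists>\<epsilon>. 0 < \<epsilon> \<and> \<epsilon> \<le> 1 / 2 \<and> (\<exists>u\<in>schwartz_R2. sbd N e u \<and>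
    (\<forall>j\<le>n. \<forall>t. u (t, slope n j * t) = cutoff (t / \<epsilon>) * w j t))"
proof -
  define x where "x j = complex_of_real (slope n j)" for j
  have "inj_on x {..n}" by (auto simp: inj_on_def x_def slope_def)
  from lagrange_coefficients[OF this] obtain L where
    L1: "\<And>i j. i \<le> n \<Longrightarrow> j \<le> n \<Longrightarrow> (\<Sum>p\<le>n. L p i * x j ^ p) = (if i = j then 1 else 0)"
    and L2: "\<And>l p. l \<le> n \<Longrightarrow> p \<le> n \<Longrightarrow> (\<Sum>i\<le>n. L p i * x i ^ l) = (if p = l then 1 else 0)"
    by blast
  define M where "M p = max (Suc N) p" for p
  define s where "s p = (\<lambda>t. \<Sum>i\<le>n. L p i * w i t)" for p
  have sms: "sm UNIV (s p)" for p unfolding s_def by (intro sm_sum sm_cmult w open_UNIV)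
  have ds: "(dv ^^ k) (s p) 0 = (\<Sum>i\<le>n. L p i * (dv ^^ k) (w i) 0)" for k p
  proof -
    have "(dv ^^ k) (s p) 0 = (\<Sum>i\<le>n. (dv ^^ k) (\<lambda>t. L p i * w i t) 0)"
      unfolding s_def by (rule dvn_sum[of UNIV]) (simp_all only: open_UNIV UNIV_I sm_cmult[OF open_UNIV w])
    then show ?thesis by (simp only: dvn_cmult[OF open_UNIV w UNIV_I])
  qed
  have s0: "(dv ^^ k) (s p) 0 = 0" if p: "p \<le> n" and k: "k < M p" for k p
  proof (cases "k \<le> N")
    case True
    then show ?thesis by (simp add: ds flat)
  next
    case False
    then have kp: "k < p" using k by (auto simp: M_def)
    let ?y = "\<lambda>j. (dv ^^ k) (w j) 0"
    have "\<exists>c. (\<forall>j\<le>n. ?y j = (\<Sum>i\<le>k. c i * of_real (2 * real j - real n) ^ i)) \<and>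
        (\<forall>i\<le>k. cmod (c i) \<le> real (Suc k) * (2 ^ k * (\<Sum>j\<le>n. cmod (?y j)) * real (Suc n) ^ k))"
      by (rule interpolate_low_degree[OF van]) (auto intro: member_le_sum)
    then obtain c where c: "\<And>j. j \<le> n \<Longrightarrow> ?y j = (\<Sum>l\<le>k. c l * x j ^ l)"
      unfolding x_def slope_def by blast
    have "(dv ^^ k) (s p) 0 = (\<Sum>i\<le>n. L p i * (\<Sum>l\<le>k. c l * x i ^ l))"
      unfolding ds using c by (intro sum.cong) auto
    also have "\<dots> = (\<Sum>l\<le>k. c l * (\<Sum>i\<le>n. L p i * x i ^ l))"
      unfolding sum_distrib_left by (subst sum.swap) (simp add: mult_ac)
    also have "\<dots> = 0"
      using L2 kp p by (intro sum.neutral) auto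
    finally show ?thesis .
  qed
  have "\<forall>p. \<exists>b. p \<le> n \<longrightarrow> sm UNIV b \<and> (\<forall>t. s p t = of_real t ^ M p * b t)"
    using hadamard_division_power[OF sms s0] by blast
  from choice[OF this] obtain b where b: "\<And>p. p \<le> n \<Longrightarrow> sm UNIV (b p)" "\<And>p t. p \<le> n \<Longrightarrow> s p t = of_real t ^ M p * b p t" by blast
  \<comment> \<open>The quotient \<open>b p\<close> is merely smooth; cutting it off gives bounded
    derivatives and changes nothing for \<open>t\<close> up to 2 in absolute value, which covers the
    support of the factor at scale \<open>\<epsilon>\<close>.\<close>
  define b' where "b' p = (\<lambda>t. cutoff (1 / 2 * t + 0) * b p t)" for p
  have smb': "sm UNIV (b' p)" if "p \<le> n" for p
    unfolding b'_def by (intro sm_mult sm_affine[OF sm_cutoff] b(1)[OF that] open_UNIV)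
  have supb': "b' p t = 0" if "4 < \<bar>t\<bar>" for p t using that by (simp add: b'_def cutoff_0)
  have "\<forall>p. \<exists>A. p \<le> n \<longrightarrow> bu N 1 A (b' p)" using ex_bu[OF smb' supb'] by blast
  from choice[OF this] obtain A3 where A3: "\<And>p. p \<le> n \<Longrightarrow> bu N 1 (A3 p) (b' p)" by blast
  obtain A where A: "\<And>i. bu N 1 (A i) (cpow i)" using ex_bu_cpow by metis
  define a where "a = 2 * real (Suc n)"
  have a: "1 \<le> a" "0 < a" by (auto simp: a_def)
  define q where "q p = M p - p" for p
  have qp: "q p + p = M p" for p by (simp add: q_def M_def)
  define K where "K p = (1 + 4\<^sup>2 + (2 * a)\<^sup>2) ^ N * ((2 ^ N * (A (q p) * A3 p)) * (a ^ p * A p))" for p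
  have K0: "0 \<le> K p" if "p \<le> n" for p
    using bu_nonneg[OF A] bu_nonneg[OF A3[OF that]] a unfolding K_def by (intro mult_nonneg_nonneg) auto
  define S where "S = 1 + (\<Sum>p\<le>n. K p)"
  have S: "1 \<le> S" using sum_nonneg[of "{..n}" K] K0 by (simp add: S_def)
  \<comment> \<open>The norms of all summands add up to at most \<open>\<epsilon> * S\<close>. The
    bound \<open>1 / 2\<close> keeps the support inside the plateau of the cutoffs at scale 1, here
    and in the gluing.\<close>
  define \<epsilon> where "\<epsilon> = min (1 / 2) (e / S)"
  have \<epsilon>: "0 < \<epsilon>" "\<epsilon> \<le> 1 / 2" "\<epsilon> * S \<le> e" using e S by (auto simp: \<epsilon>_def min_def field_simps)
  \<comment> \<open>Powers of \<open>x\<close> and \<open>y\<close> are written at the scale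
    \<open>\<epsilon>\<close>, which brings out the factor
    \<open>\<epsilon> ^ (q p + p) = \<epsilon> ^ M p\<close>. It exceeds the loss
    \<open>(1 / \<epsilon>) ^ N\<close> caused by \<open>N\<close> derivatives by at least one power
    of \<open>\<epsilon>\<close>.\<close>
  define P where "P p = (\<lambda>t. of_real (\<epsilon> ^ q p) * (cpow (q p) (1 / \<epsilon> * t + 0) * b' p t))" for p
  define Q where "Q p = (\<lambda>t. of_real ((a * \<epsilon>) ^ p) * cpow p (1 / (a * \<epsilon>) * t + 0))" for p
  have smP: "sm UNIV (P p)" if "p \<le> n" for p
    unfolding P_def by (intro sm_cmult sm_mult sm_affine[OF sm_cpow] smb' that open_UNIV)
  have smQ: "sm UNIV (Q p)" for p
    unfolding Q_def by (intro sm_cmult sm_affine[OF sm_cpow] open_UNIV)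
  have supP: "P p t = 0" if "4 < \<bar>t\<bar>" for p t using supb'[OF that] by (simp add: P_def)
  have supQ: "Q p t = 0" if "2 * a < \<bar>t\<bar>" for p t
  proof -
    have "2 * (a * \<epsilon>) \<le> 2 * a * 1" using a \<epsilon> by (simp add: mult_left_le)
    then have "2 * (a * \<epsilon>) \<le> \<bar>t\<bar>" using that by linarith
    then have "2 \<le> \<bar>1 / (a * \<epsilon>) * t + 0\<bar>" using a \<epsilon> by (simp add: abs_mult field_simps)
    then show ?thesis by (simp add: Q_def cpow_0)
  qed
  have bP: "bu N (1 / \<epsilon>) (\<epsilon> ^ q p * (2 ^ N * (A (q p) * A3 p))) (P p)" if p: "p \<le> n" for p
  proof -
    have 1: "bu N (1 / \<epsilon>) (A (q p)) (\<lambda>t. cpow (q p) (1 / \<epsilon> * t + 0))"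
      by (rule bu_affine[OF sm_cpow A]) (use \<epsilon> in simp)
    have 2: "bu N (1 / \<epsilon>) (A3 p) (b' p)"
      using bu_affine[OF smb'[OF p] A3[OF p], of 1 "1 / \<epsilon>" 0] \<epsilon> by simp
    show ?thesis
      using bu_cmult[OF _ bu_mult[OF sm_affine[OF sm_cpow] smb'[OF p] 1 2], of "of_real (\<epsilon> ^ q p)"]
        sm_mult[OF open_UNIV sm_affine[OF sm_cpow] smb'[OF p], of "q p" "1 / \<epsilon>" 0] \<epsilon>
      by (simp add: P_def norm_power)
  qed
  have bQ: "bu N (1 / \<epsilon>) ((a * \<epsilon>) ^ p * A p) (Q p)" for p
  proof -
    have "1 / (a * \<epsilon>) \<le> 1 / \<epsilon>" using a \<epsilon> by (intro divide_left_mono) auto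
    then have "bu N (1 / \<epsilon>) (A p) (\<lambda>t. cpow p (1 / (a * \<epsilon>) * t + 0))"
      using a \<epsilon> by (intro bu_affine[OF sm_cpow A]) auto
    from bu_cmult[OF sm_affine[OF sm_cpow] this, of "of_real ((a * \<epsilon>) ^ p)"]
    show ?thesis using a \<epsilon> by (simp add: Q_def norm_power norm_mult)
  qed
  have sbT: "sbd N (\<epsilon> * K p) (tens (P p) (Q p))" if p: "p \<le> n" for p
  proof -
    have 1: "sbd N ((1 + 4\<^sup>2 + (2 * a)\<^sup>2) ^ N * ((\<epsilon> ^ q p * (2 ^ N * (A (q p) * A3 p))) * ((a * \<epsilon>) ^ p * A p) * (1 / \<epsilon>) ^ N)) (tens (P p) (Q p))"
      by (rule sbd_tens[OF smP[OF p] smQ _ bP[OF p] supP bQ supQ]) (use \<epsilon> in auto)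
    have "\<epsilon> ^ q p * \<epsilon> ^ p * (1 / \<epsilon>) ^ N \<le> \<epsilon>"
    proof -
      have "\<epsilon> ^ q p * \<epsilon> ^ p = \<epsilon> ^ (M p - N) * \<epsilon> ^ N"
        unfolding power_add[symmetric] qp by (simp add: M_def)
      then have "\<epsilon> ^ q p * \<epsilon> ^ p * (1 / \<epsilon>) ^ N = \<epsilon> ^ (M p - N)" using \<epsilon> by (simp add: power_divide)
      also have "\<dots> \<le> \<epsilon> ^ 1" using \<epsilon> by (intro power_decreasing) (auto simp: M_def)
      finally show ?thesis by simp
    qed
    from mult_right_mono[OF this K0[OF p]]
    have "(1 + 4\<^sup>2 + (2 * a)\<^sup>2) ^ N * ((\<epsilon> ^ q p * (2 ^ N * (A (q p) * A3 p))) * ((a * \<epsilon>) ^ p * A p) * (1 / \<epsilon>) ^ N) \<le> \<epsilon> * K p"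
      by (simp add: K_def power_mult_distrib mult_ac)
    then show ?thesis by (rule sbd_mono[OF 1])
  qed
  define u where "u = (\<lambda>z. \<Sum>p\<le>n. tens (P p) (Q p) z)"
  have "u \<in> schwartz_R2"
    unfolding u_def by (intro schwartz_sum schwartz_tens[OF smP smQ supP supQ]) auto
  moreover have "sbd N (\<Sum>p\<le>n. \<epsilon> * K p) u"
    unfolding u_def by (intro sbd_sum sbT smooth_tens smP smQ) auto
  then have "sbd N e u"
  proof (rule sbd_mono)
    have "(\<Sum>p\<le>n. \<epsilon> * K p) \<le> \<epsilon> * S" using \<epsilon> by (simp add: S_def distrib_left flip: sum_distrib_left)
    then show "(\<Sum>p\<le>n. \<epsilon> * K p) \<le> e" using \<epsilon>(3) by linarith
  qed
  moreover have "u (t, slope n j * t) = cutoff (t / \<epsilon>) * w j t" if j: "j \<le> n" for j t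
  proof (cases "2 \<le> \<bar>t / \<epsilon>\<bar>")
    case True
    then have "P p t = 0" for p by (simp add: P_def cpow_0)
    then show ?thesis using True by (simp add: u_def tens_def cutoff_0)
  next
    case False
    then have t: "\<bar>t\<bar> < 2 * \<epsilon>" using \<epsilon> by (simp add: field_simps)
    have c1: "cutoff (t / 2) = 1" using t \<epsilon> by (intro cutoff_1) auto
    have "\<bar>slope n j * t\<bar> \<le> real n * (2 * \<epsilon>)" unfolding abs_mult using abs_slope[OF j] t by (intro mult_mono) auto
    also have "\<dots> \<le> a * \<epsilon>" using \<epsilon> by (simp add: a_def)
    finally have c2: "cutoff (slope n j * t / (a * \<epsilon>)) = 1" using a \<epsilon> by (intro cutoff_1) (simp add: abs_mult field_simps)
    have "tens (P p) (Q p) (t, slope n j * t) = cutoff (t / \<epsilon>) * (s p t * x j ^ p)" if p: "p \<le> n" for p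
    proof -
      have "tens (P p) (Q p) (t, slope n j * t) =
          (of_real (\<epsilon> ^ q p) * (cutoff (t / \<epsilon>) * of_real (t / \<epsilon>) ^ q p * b p t)) * (of_real ((a * \<epsilon>) ^ p) * of_real (slope n j * t / (a * \<epsilon>)) ^ p)"
        by (simp add: tens_def P_def Q_def cpow_def b'_def c1 c2)
      also have "\<dots> = cutoff (t / \<epsilon>) * ((of_real (\<epsilon> ^ q p) * of_real (t / \<epsilon>) ^ q p) * b p t * (of_real ((a * \<epsilon>) ^ p) * of_real (slope n j * t / (a * \<epsilon>)) ^ p))"
        by (simp only: mult_ac)
      also have "of_real (\<epsilon> ^ q p) * of_real (t / \<epsilon>) ^ q p = complex_of_real t ^ q p"
        using \<epsilon> unfolding of_real_power[symmetric] of_real_mult[symmetric] power_mult_distrib[symmetric] by simp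
      also have "of_real ((a * \<epsilon>) ^ p) * of_real (slope n j * t / (a * \<epsilon>)) ^ p = complex_of_real t ^ p * x j ^ p"
        using \<epsilon> a unfolding of_real_power[symmetric] of_real_mult[symmetric] power_mult_distrib[symmetric] x_def by (simp add: mult.commute)
      also have "of_real t ^ q p * b p t * (of_real t ^ p * x j ^ p) = (of_real t ^ (q p + p) * b p t) * x j ^ p"
        by (simp add: power_add mult_ac)
      finally show ?thesis by (simp only: qp b(2)[OF p])
    qed
    then have "u (t, slope n j * t) = (\<Sum>p\<le>n. cutoff (t / \<epsilon>) * (s p t * x j ^ p))" by (simp add: u_def)
    also have "\<dots> = cutoff (t / \<epsilon>) * (\<Sum>i\<le>n. w i t * (\<Sum>p\<le>n. L p i * x j ^ p))"
      unfolding s_def sum_distrib_left sum_distrib_right by (subst sum.swap) (simp add: mult_ac)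
    also have "(\<Sum>i\<le>n. w i t * (\<Sum>p\<le>n. L p i * x j ^ p)) = (\<Sum>i\<le>n. if i = j then w j t else 0)"
      using L1 j by (intro sum.cong) auto
    finally show ?thesis using j by simp
  qed
  ultimately show ?thesis using \<epsilon> by blast
qed

text \<open>With \<open>T\<close> the Taylor part and \<open>c = cutoff (t / \<epsilon>)\<close>,
  the three pieces restrict to \<open>cutoff t * T\<close>,
  \<open>(1 - c) * (h - cutoff t * T)\<close> and \<open>c * (h - T)\<close>. They add up to
  \<open>h\<close> because \<open>cutoff t = 1\<close> wherever \<open>c\<close> is nonzero. The
  term \<open>e\<close> is the norm of the third piece.\<close>

lemma ray_extension:
  "\<exists>C\<ge>0. \<forall>n h B e. 0 < e \<longrightarrow> (\<forall>j. sm UNIV (h j)) \<longrightarrow>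
    (\<forall>j\<le>n. \<forall>k L. \<exists>C. \<forall>t>0. (1 + t) ^ L * cmod ((dv ^^ k) (h j) t) \<le> C) \<longrightarrow>
    (\<forall>j\<le>n. \<forall>k\<le>Suc N. \<forall>t\<ge>0. (1 + t) ^ (3 * N + 1) * cmod ((dv ^^ k) (h j) t) \<le> B) \<longrightarrow>
    (\<forall>k i. i + Suc k \<le> n \<longrightarrow> (fdiff ^^ Suc k) (\<lambda>j. (dv ^^ k) (h j) 0) i = 0) \<longrightarrow>
    (\<exists>u\<in>schwartz_R2. sbd N (C * real (Suc n) ^ (4 * N + 1) * B + e) u \<and>
      (\<forall>j\<le>n. \<forall>t\<ge>0. u (t, slope n j * t) = h j t))"
proof -
  obtain C1 where C1: "C1 \<ge> 0" and T1: "\<forall>n h B. (\<forall>k\<le>N. \<forall>i. i + Suc k \<le> n \<longrightarrow> (fdiff ^^ Suc k) (\<lambda>j. (dv ^^ k) (h j) 0) i = 0) \<longrightarrow>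
    (\<forall>k\<le>N. \<forall>j\<le>n. cmod ((dv ^^ k) (h j) 0) \<le> B) \<longrightarrow>
    (\<exists>u\<in>schwartz_R2. sbd N (C1 * real (Suc n) ^ (4 * N) * B) u \<and>
      (\<forall>j\<le>n. \<forall>t. u (t, slope n j * t) = cutoff t * taylor N (h j) t))"
    using taylor_part[of N] by blast
  obtain C2 where C2: "C2 \<ge> 0" and T2: "\<forall>n h B \<epsilon>. 0 < \<epsilon> \<longrightarrow> (\<forall>j. sm UNIV (h j)) \<longrightarrow>
    (\<forall>j\<le>n. \<forall>k L. \<exists>C. \<forall>t>0. (1 + t) ^ L * cmod ((dv ^^ k) (h j) t) \<le> C) \<longrightarrow>
    (\<forall>j\<le>n. \<forall>k\<le>Suc N. \<forall>t\<ge>0. (1 + t) ^ (3 * N + 1) * cmod ((dv ^^ k) (h j) t) \<le> B) \<longrightarrow>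
    (\<exists>u\<in>schwartz_R2. sbd N (C2 * real (Suc n) ^ (3 * N + 1) * B) u \<and>
      (\<forall>j\<le>n. \<forall>t\<ge>0. u (t, slope n j * t) = (1 - cutoff (t / \<epsilon>)) * (h j t - cutoff t * taylor N (h j) t)))"
    using remainder_part[of N] by blast
  have "\<exists>u\<in>schwartz_R2. sbd N ((C1 + C2) * real (Suc n) ^ (4 * N + 1) * B + e) u \<and>
      (\<forall>j\<le>n. \<forall>t\<ge>0. u (t, slope n j * t) = h j t)"
    if e: "0 < e" and h: "\<forall>j. sm UNIV (h j)"
      and dec: "\<forall>j\<le>n. \<forall>k L. \<exists>C. \<forall>t>0. (1 + t) ^ L * cmod ((dv ^^ k) (h j) t) \<le> C"
      and B: "\<forall>j\<le>n. \<forall>k\<le>Suc N. \<forall>t\<ge>0. (1 + t) ^ (3 * N + 1) * cmod ((dv ^^ k) (h j) t) \<le> B"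
      and van: "\<forall>k i. i + Suc k \<le> n \<longrightarrow> (fdiff ^^ Suc k) (\<lambda>j. (dv ^^ k) (h j) 0) i = 0"
    for n h B e
  proof -
    have Bz: "cmod ((dv ^^ k) (h j) 0) \<le> B" if "k \<le> N" "j \<le> n" for k j
      using B[rule_format, of j k 0] that by simp
    have B0: "0 \<le> B" using order.trans[OF norm_ge_zero Bz[of 0 0]] by simp
    obtain u1 where u1: "u1 \<in> schwartz_R2" "sbd N (C1 * real (Suc n) ^ (4 * N) * B) u1"
      "\<forall>j\<le>n. \<forall>t. u1 (t, slope n j * t) = cutoff t * taylor N (h j) t"
    proof -
      have v: "\<forall>k\<le>N. \<forall>i. i + Suc k \<le> n \<longrightarrow> (fdiff ^^ Suc k) (\<lambda>j. (dv ^^ k) (h j) 0) i = 0"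
        and b: "\<forall>k\<le>N. \<forall>j\<le>n. cmod ((dv ^^ k) (h j) 0) \<le> B" using van Bz by blast+
      show thesis using T1[THEN spec, THEN spec, THEN spec, THEN mp, THEN mp, OF v b] that by blast
    qed
    define w where "w j = (\<lambda>t. h j t + (-1) * taylor N (h j) t)" for j
    have smw: "sm UNIV (w j)" for j unfolding w_def by (intro sm_add sm_cmult sm_taylor open_UNIV h[rule_format])
    have dw: "(dv ^^ k) (w j) 0 = (if k \<le> N then 0 else (dv ^^ k) (h j) 0)" for k j
      unfolding w_def using dvn_add[OF open_UNIV h[rule_format, of j] sm_cmult[OF open_UNIV sm_taylor[of N "h j"], of "-1"] UNIV_I, where k = k and t = 0]
        dvn_cmult[OF open_UNIV sm_taylor[of N "h j"] UNIV_I, where k = k and t = 0 and c = "-1"] by (simp add: dvn_taylor_0)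
    have z: "(fdiff ^^ k) (\<lambda>j. 0) i = 0" for k i by (induction k arbitrary: i) (auto simp: fdiff_def)
    have vw: "(fdiff ^^ Suc k) (\<lambda>j. (dv ^^ k) (w j) 0) i = 0" if "i + Suc k \<le> n" for k i
      unfolding dw using van that z by (cases "k \<le> N") (simp_all del: funpow.simps)
    have fl: "(dv ^^ k) (w j) 0 = 0" if "k \<le> N" for j k using that by (simp add: dw)
    from flat_part[of w N n e, OF smw fl vw e] obtain \<epsilon> u3 where \<epsilon>: "0 < \<epsilon>" "\<epsilon> \<le> 1 / 2" and u3: "u3 \<in> schwartz_R2" "sbd N e u3"
      "\<forall>j\<le>n. \<forall>t. u3 (t, slope n j * t) = cutoff (t / \<epsilon>) * w j t"
      by blast
    obtain u2 where u2: "u2 \<in> schwartz_R2" "sbd N (C2 * real (Suc n) ^ (3 * N + 1) * B) u2"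
      "\<forall>j\<le>n. \<forall>t\<ge>0. u2 (t, slope n j * t) = (1 - cutoff (t / \<epsilon>)) * (h j t - cutoff t * taylor N (h j) t)"
      using T2[THEN spec, THEN spec, THEN spec, THEN spec, THEN mp, THEN mp, THEN mp, THEN mp, OF \<epsilon>(1) h dec B] by blast
    let ?u = "\<lambda>p. (u1 p + u2 p) + u3 p"
    have sm: "smooth u1" "smooth u2" "smooth u3" using u1 u2 u3 schwartz_R2_iff by blast+
    have "?u \<in> schwartz_R2" by (intro schwartz_add u1 u2 u3)
    moreover have "sbd N ((C1 + C2) * real (Suc n) ^ (4 * N + 1) * B + e) ?u"
    proof (rule sbd_mono[OF sbd_add[OF smooth_add[OF sm(1,2)] sm(3) sbd_add[OF sm(1,2) u1(2) u2(2)] u3(2)]])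
      have "C1 * real (Suc n) ^ (4 * N) * B \<le> C1 * real (Suc n) ^ (4 * N + 1) * B"
        "C2 * real (Suc n) ^ (3 * N + 1) * B \<le> C2 * real (Suc n) ^ (4 * N + 1) * B"
        using C1 C2 B0 by (intro mult_right_mono mult_left_mono power_increasing; simp)+
      then show "C1 * real (Suc n) ^ (4 * N) * B + C2 * real (Suc n) ^ (3 * N + 1) * B + e \<le> (C1 + C2) * real (Suc n) ^ (4 * N + 1) * B + e"
        by (simp only: distrib_right)
    qed
    moreover have "?u (t, slope n j * t) = h j t" if "j \<le> n" "0 \<le> t" for j t
    proof (cases "cutoff (t / \<epsilon>) = 0")
      case True
      then show ?thesis using u1(3) u2(3) u3(3) that by simp
    next
      case False
      then have "\<bar>t / \<epsilon>\<bar> < 2" using cutoff_0[of "t / \<epsilon>"] by linarith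
      then have "cutoff t = 1" using \<epsilon> by (intro cutoff_1) (simp add: field_simps)
      moreover have "u1 (t, slope n j * t) = cutoff t * taylor N (h j) t"
        "u2 (t, slope n j * t) = (1 - cutoff (t / \<epsilon>)) * (h j t - cutoff t * taylor N (h j) t)"
        "u3 (t, slope n j * t) = cutoff (t / \<epsilon>) * w j t" using u1(3) u2(3) u3(3) that by blast+
      ultimately show ?thesis by (simp only: w_def) (simp add: algebra_simps)
    qed
    ultimately show ?thesis by blast
  qed
  then show ?thesis using C1 C2 by (intro exI[of _ "C1 + C2"]) auto
qed

section \<open>Families of half-line data indexed by the representations\<close>

lemma exp_rapidly_decreasing: "0 < x \<Longrightarrow> exp (- x) \<le> fact k / x ^ k" for x :: real
  using power_le_fact_exp[of x k] by (simp add: exp_minus field_simps)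

text \<open>\<open>B m n\<close> is the least admissible constant in \<open>ray_extension\<close>.
  Its rapid decay absorbs the factor \<open>(n + 1) ^ (4 * N + 1)\<close>, and the free error is an
  exponential in \<open>1 + |m| + n\<close>.\<close>

theorem schwartz_extension_family:
  fixes h :: "int \<Rightarrow> nat \<Rightarrow> nat \<Rightarrow> real \<Rightarrow> complex"
  assumes h: "\<And>m n j. sm UNIV (h m n j)"
    and dec: "\<And>k p r. \<exists>C. \<forall>(m, n)\<in>E_index. \<forall>j\<le>n. \<forall>t\<ge>0.
      (1 + t) ^ p * cmod ((dv ^^ k) (h m n j) t) \<le> C / (1 + \<bar>real_of_int m\<bar> + real n) ^ r"
    and van: "\<And>m n k i. (m, n) \<in> E_index \<Longrightarrow> i + Suc k \<le> n \<Longrightarrow> (fdiff ^^ Suc k) (\<lambda>j. (dv ^^ k) (h m n j) 0) i = 0"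
  shows "\<exists>u. (\<forall>(m, n)\<in>E_index. u m n \<in> schwartz_R2 \<and> (\<forall>j\<le>n. \<forall>t\<ge>0. u m n (t, slope n j * t) = h m n j t)) \<and>
    rapidly_decaying (\<lambda>m n. schwartz_norm N (u m n))"
proof -
  let ?s = "\<lambda>(m::int) (n::nat). 1 + \<bar>real_of_int m\<bar> + real n"
  have s: "0 < ?s m n" for m n by (simp add: add_pos_nonneg)
  obtain C where C0: "C \<ge> 0" and ext: "\<forall>n h B e. 0 < e \<longrightarrow> (\<forall>j. sm UNIV (h j)) \<longrightarrow>
    (\<forall>j\<le>n. \<forall>k L. \<exists>C. \<forall>t>0. (1 + t) ^ L * cmod ((dv ^^ k) (h j) t) \<le> C) \<longrightarrow>
    (\<forall>j\<le>n. \<forall>k\<le>Suc N. \<forall>t\<ge>0. (1 + t) ^ (3 * N + 1) * cmod ((dv ^^ k) (h j) t) \<le> B) \<longrightarrow>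
    (\<forall>k i. i + Suc k \<le> n \<longrightarrow> (fdiff ^^ Suc k) (\<lambda>j. (dv ^^ k) (h j) 0) i = 0) \<longrightarrow>
    (\<exists>u\<in>schwartz_R2. sbd N (C * real (Suc n) ^ (4 * N + 1) * B + e) u \<and>
      (\<forall>j\<le>n. \<forall>t\<ge>0. u (t, slope n j * t) = h j t))"
    using ray_extension[of N] by blast
  define S where "S m n = {(1 + t) ^ (3 * N + 1) * cmod ((dv ^^ k) (h m n j) t) | j k t. j \<le> n \<and> k \<le> Suc N \<and> 0 \<le> t}" for m n
  define B where "B m n = Sup (S m n)" for m n
  have Sne: "S m n \<noteq> {}" for m n
  proof -
    have "(1 + 0) ^ (3 * N + 1) * cmod ((dv ^^ 0) (h m n 0) 0) \<in> S m n" unfolding S_def by blast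
    then show ?thesis by blast
  qed
  have Sb: "\<exists>D. \<forall>(m, n)\<in>E_index. \<forall>x\<in>S m n. x \<le> D / ?s m n ^ r" for r
  proof -
    have "\<forall>k. \<exists>D. \<forall>(m, n)\<in>E_index. \<forall>j\<le>n. \<forall>t\<ge>0.
        (1 + t) ^ (3 * N + 1) * cmod ((dv ^^ k) (h m n j) t) \<le> D / ?s m n ^ r"
      by (intro allI dec)
    from choice[OF this] obtain D where D: "\<forall>k. \<forall>(m, n)\<in>E_index. \<forall>j\<le>n. \<forall>t\<ge>0.
        (1 + t) ^ (3 * N + 1) * cmod ((dv ^^ k) (h m n j) t) \<le> D k / ?s m n ^ r" by blast
    have "x \<le> (\<Sum>k\<le>Suc N. \<bar>D k\<bar>) / ?s m n ^ r" if "(m, n) \<in> E_index" and x: "x \<in> S m n" for m n x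
    proof -
      obtain j k t where *: "x = (1 + t) ^ (3 * N + 1) * cmod ((dv ^^ k) (h m n j) t)" "j \<le> n" "k \<le> Suc N" "0 \<le> t"
        using x unfolding S_def by blast
      note D' = bspec[OF D[THEN spec, of k] that(1), unfolded prod.case]
      have "x \<le> D k / ?s m n ^ r" unfolding *(1) using D' *(2,4) by blast
      also have "\<dots> \<le> (\<Sum>k\<le>Suc N. \<bar>D k\<bar>) / ?s m n ^ r"
      proof (rule divide_right_mono)
        have "\<bar>D k\<bar> \<le> (\<Sum>k\<le>Suc N. \<bar>D k\<bar>)" using *(3) by (intro member_le_sum) auto
        then show "D k \<le> (\<Sum>k\<le>Suc N. \<bar>D k\<bar>)" by linarith
      qed (use s[of m n] in simp)
      finally show ?thesis .
    qed
    then show ?thesis by (intro exI[of _ "\<Sum>k\<le>Suc N. \<bar>D k\<bar>"]) auto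
  qed
  have up: "x \<le> B m n" if "(m, n) \<in> E_index" "x \<in> S m n" for m n x
  proof -
    obtain D where D: "\<forall>(m, n)\<in>E_index. \<forall>x\<in>S m n. x \<le> D / ?s m n ^ 0" using Sb by blast
    have "bdd_above (S m n)" unfolding bdd_above_def using bspec[OF D that(1), unfolded prod.case] by blast
    then show ?thesis unfolding B_def using that(2) by (rule cSup_upper[rotated])
  qed
  define Q where "Q m n u \<longleftrightarrow> u \<in> schwartz_R2 \<and> sbd N (C * real (Suc n) ^ (4 * N + 1) * B m n + exp (- ?s m n)) u \<and>
      (\<forall>j\<le>n. \<forall>t\<ge>0. u (t, slope n j * t) = h m n j t)" for m n u
  have "\<exists>u. Q m n u" if E: "(m, n) \<in> E_index" for m n
  proof -
    have "\<exists>C. \<forall>t>0. (1 + t) ^ L * cmod ((dv ^^ k) (h m n j) t) \<le> C" if "j \<le> n" for j k L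
    proof -
      obtain D where D: "\<forall>(m, n)\<in>E_index. \<forall>j\<le>n. \<forall>t\<ge>0. (1 + t) ^ L * cmod ((dv ^^ k) (h m n j) t) \<le> D / ?s m n ^ 0"
        using dec by blast
      have "\<forall>t\<ge>0. (1 + t) ^ L * cmod ((dv ^^ k) (h m n j) t) \<le> D"
        using bspec[OF D E, unfolded prod.case] that by simp
      then show ?thesis by (intro exI[of _ D]) auto
    qed
    moreover have "(1 + t) ^ (3 * N + 1) * cmod ((dv ^^ k) (h m n j) t) \<le> B m n" if "j \<le> n" "k \<le> Suc N" "0 \<le> t" for j k t
      by (rule up[OF E]) (unfold S_def, use that in blast)
    ultimately have "\<exists>u\<in>schwartz_R2. sbd N (C * real (Suc n) ^ (4 * N + 1) * B m n + exp (- ?s m n)) u \<and>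
        (\<forall>j\<le>n. \<forall>t\<ge>0. u (t, slope n j * t) = h m n j t)"
      using h van[OF E] by (intro ext[rule_format]) auto
    then show ?thesis unfolding Q_def by blast
  qed
  then obtain u where Q: "\<And>m n. (m, n) \<in> E_index \<Longrightarrow> Q m n (u m n)" by metis
  have u: "u m n \<in> schwartz_R2" "sbd N (C * real (Suc n) ^ (4 * N + 1) * B m n + exp (- ?s m n)) (u m n)"
    "\<And>j t. j \<le> n \<Longrightarrow> 0 \<le> t \<Longrightarrow> u m n (t, slope n j * t) = h m n j t" if "(m, n) \<in> E_index" for m n
    using Q[OF that] unfolding Q_def by blast+
  have "rapidly_decaying (\<lambda>m n. schwartz_norm N (u m n))"
    unfolding rapidly_decaying_def
  proof
    fix k
    \<comment> \<open>The surplus exponent \<open>4 * N + 1\<close> pays for the power of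
      \<open>n + 1\<close> in front of \<open>B m n\<close>.\<close>
    obtain D where D: "\<forall>(m, n)\<in>E_index. \<forall>x\<in>S m n. x \<le> D / ?s m n ^ (k + (4 * N + 1))" using Sb by blast
    have "\<bar>schwartz_norm N (u m n)\<bar> \<le> (C * \<bar>D\<bar> + fact k) / ?s m n ^ k" if E: "(m, n) \<in> E_index" for m n
    proof -
      have "B m n \<le> D / ?s m n ^ (k + (4 * N + 1))"
        unfolding B_def using bspec[OF D E, unfolded prod.case] by (intro cSup_least[OF Sne]) blast
      also have "\<dots> \<le> \<bar>D\<bar> / ?s m n ^ (k + (4 * N + 1))" using s[of m n] by (intro divide_right_mono) auto
      finally have "real (Suc n) ^ (4 * N + 1) * B m n \<le> ?s m n ^ (4 * N + 1) * (\<bar>D\<bar> / ?s m n ^ (k + (4 * N + 1)))"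
      proof (intro mult_mono power_mono)
        assume *: "B m n \<le> \<bar>D\<bar> / ?s m n ^ (k + (4 * N + 1))"
        show "B m n \<le> \<bar>D\<bar> / ?s m n ^ (k + (4 * N + 1))" by fact
        have "(1 + 0) ^ (3 * N + 1) * cmod ((dv ^^ 0) (h m n 0) 0) \<in> S m n" unfolding S_def by blast
        from up[OF E this] have "cmod (h m n 0 0) \<le> B m n" by simp
        then show "0 \<le> B m n" by (rule order.trans[OF norm_ge_zero])
      qed (use s[of m n] in auto)
      also have "\<dots> = \<bar>D\<bar> / ?s m n ^ k"
      proof -
        have "x ^ a * (d / x ^ (k + a)) = d / x ^ k" if "0 < x" for x d :: real and a using that by (simp add: power_add)
        then show ?thesis using s by blast
      qed
      finally have "C * (real (Suc n) ^ (4 * N + 1) * B m n) \<le> C * (\<bar>D\<bar> / ?s m n ^ k)" using C0 by (intro mult_left_mono)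
      moreover have "exp (- ?s m n) \<le> fact k / ?s m n ^ k" by (rule exp_rapidly_decreasing[OF s])
      moreover have "schwartz_norm N (u m n) \<le> C * real (Suc n) ^ (4 * N + 1) * B m n + exp (- ?s m n)"
        by (rule schwartz_norm_le[OF u(2)[OF E]])
      moreover have "0 \<le> schwartz_norm N (u m n)" by (rule schwartz_norm_nonneg[OF u(1)[OF E]])
      ultimately show ?thesis by (simp only: add_divide_distrib abs_of_nonneg times_divide_eq_right mult.assoc)
    qed
    then show "\<exists>C. \<forall>(m, n)\<in>E_index. \<bar>schwartz_norm N (u m n)\<bar> \<le> C / (1 + \<bar>real_of_int m\<bar> + real n) ^ k"
      by (intro exI[of _ "C * \<bar>D\<bar> + fact k"]) auto
  qed
  then show ?thesis using u by (intro exI[of _ u]) auto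
qed

subsection \<open>Matrix coefficients of the representations\<close>

definition pt :: "nat \<Rightarrow> complex^2" where
  "pt i = vector [of_nat i, 1]"

lemma pt_nth [simp]: "pt i $ 1 = of_nat i" "pt i $ 2 = 1"
  by (simp_all add: pt_def)

text \<open>Coordinates in \<open>hom_polys n\<close> are linear combinations of point evaluations.\<close>

lemma ex_coord_eval: "\<exists>W. \<forall>p\<in>hom_polys n. \<forall>a\<le>n. coord_V n p a = (\<Sum>i\<le>n. W a i * p (pt i))"
proof -
  have inj: "inj_on (\<lambda>i. complex_of_nat i) {..n}" by (simp add: inj_on_def)
  from lagrange_coefficients[OF inj] obtain L where
    L: "\<And>l a. l \<le> n \<Longrightarrow> a \<le> n \<Longrightarrow> (\<Sum>i\<le>n. L a i * of_nat i ^ l) = (if a = l then 1 else (0::complex))"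
    by blast
  let ?b = "\<lambda>j. complex_of_real (sqrt (real (n choose j)))"
  define W where "W a i = L a i / ?b a" for a i
  have "coord_V n p a = (\<Sum>i\<le>n. W a i * p (pt i))" if p: "p \<in> hom_polys n" and a: "a \<le> n" for p a
  proof -
    have v: "p (pt i) = (\<Sum>j\<le>n. coord_V n p j * ?b j * of_nat i ^ j)" for i
      by (subst coord_V_expand(2)[OF p]) (simp add: basis_V_def mult.assoc)
    have "(\<Sum>i\<le>n. L a i * p (pt i)) = (\<Sum>j\<le>n. coord_V n p j * ?b j * (\<Sum>i\<le>n. L a i * of_nat i ^ j))"
      unfolding v sum_distrib_left by (subst sum.swap) (simp add: mult_ac)
    also have "\<dots> = (\<Sum>j\<le>n. if a = j then coord_V n p a * ?b a else 0)"
      using L a by (intro sum.cong) auto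
    also have "\<dots> = coord_V n p a * ?b a" using a by simp
    finally have "(\<Sum>i\<le>n. L a i * p (pt i)) / ?b a = coord_V n p a"
      using a by simp
    then show ?thesis by (simp add: W_def sum_divide_distrib)
  qed
  then show ?thesis by blast
qed

definition coord_weight :: "nat \<Rightarrow> nat \<Rightarrow> nat \<Rightarrow> complex" where
  "coord_weight n = (SOME W. \<forall>p\<in>hom_polys n. \<forall>a\<le>n. coord_V n p a = (\<Sum>i\<le>n. W a i * p (pt i)))"

lemma coord_eval: "p \<in> hom_polys n \<Longrightarrow> a \<le> n \<Longrightarrow> coord_V n p a = (\<Sum>i\<le>n. coord_weight n a i * p (pt i))"
  using someI_ex[OF ex_coord_eval[of n]] unfolding coord_weight_def by blast

text \<open>Exhibits the entries as polynomials in those of \<open>conj_transpose k\<close>, from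
  which continuity and derivatives in \<open>k\<close> can be read off.\<close>

lemma tau_eval:
  assumes "k \<in> U2" "a \<le> n"
  shows "tau n k a b = (\<Sum>i\<le>n. coord_weight n a i * basis_V n b (conj_transpose k *v pt i))"
  unfolding tau_def using coord_eval[OF tau_act_V assms(2), of k b] U2_matrix_inv[OF assms(1)]
  by (simp add: tau_act_def)

lemma tau_outside: "n < a \<or> n < b \<Longrightarrow> tau n k a b = 0"
proof (elim disjE)
  assume "n < a"
  then show ?thesis using coord_V_expand(1)[OF tau_act_V, of n k b] by (simp add: tau_def)
next
  assume "n < b"
  then have "tau_act k (basis_V n b) = (\<lambda>z. \<Sum>j\<le>n. 0 * basis_V n j z)" by (simp add: tau_act_def basis_V_zero)
  then have "coord_V n (tau_act k (basis_V n b)) = (\<lambda>_. 0)" by (intro coord_V_eq) auto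
  then show ?thesis by (simp add: tau_def)
qed

lemma basis_V_unique:
  assumes "\<And>z. (\<Sum>j\<le>n. c j * basis_V n j z) = (\<Sum>j\<le>n. d j * basis_V n j z)" "j \<le> n"
  shows "c j = d j"
proof -
  have "(\<lambda>j. if j \<le> n then c j else 0) = (\<lambda>j. if j \<le> n then d j else 0)"
    by (rule coord_V_unique[of n]) (use assms(1) in auto)
  then show ?thesis using assms(2) by (auto dest: fun_cong[of _ _ j])
qed

section \<open>Multiplicativity and unitarity\<close>

lemma tau_mult:
  assumes "k \<in> U2" "l \<in> U2" "a \<le> n" "b \<le> n"
  shows "tau n (k ** l) a b = (\<Sum>c\<le>n. tau n k a c * tau n l c b)"
proof -
  have inv: "matrix_inv (k ** l) = matrix_inv l ** matrix_inv k"
    using assms by (simp add: U2_matrix_inv U2_mult conj_transpose_mult)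
  have "(\<Sum>i\<le>n. tau n (k ** l) i b * basis_V n i z) = (\<Sum>i\<le>n. (\<Sum>c\<le>n. tau n k i c * tau n l c b) * basis_V n i z)" for z
  proof -
    have "(\<Sum>i\<le>n. tau n (k ** l) i b * basis_V n i z) = tau_act (k ** l) (basis_V n b) z"
      using tau_expand[OF assms(4)] by simp
    also have "\<dots> = tau_act l (basis_V n b) (matrix_inv k *v z)"
      by (simp add: tau_act_def inv matrix_vector_mul_assoc)
    also have "\<dots> = (\<Sum>c\<le>n. tau n l c b * tau_act k (basis_V n c) z)"
      using tau_expand[OF assms(4), of l] by (simp add: tau_act_def)
    also have "\<dots> = (\<Sum>c\<le>n. tau n l c b * (\<Sum>i\<le>n. tau n k i c * basis_V n i z))"
      by (intro sum.cong refl) (simp add: tau_expand)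
    also have "\<dots> = (\<Sum>i\<le>n. (\<Sum>c\<le>n. tau n k i c * tau n l c b) * basis_V n i z)"
      unfolding sum_distrib_left sum_distrib_right by (subst sum.swap) (simp add: mult_ac)
    finally show ?thesis .
  qed
  from basis_V_unique[OF this assms(3)] show ?thesis .
qed

lemma tau_one:
  assumes "a \<le> n" "b \<le> n" shows "tau n (mat 1) a b = (if a = b then 1 else 0)"
proof -
  have i: "matrix_inv (mat 1 :: complex^2^2) = mat 1"
    by (simp add: U2_matrix_inv U2_one conj_transpose_mat)
  have "(\<Sum>i\<le>n. tau n (mat 1) i b * basis_V n i z) = (\<Sum>i\<le>n. (if i = b then 1 else 0) * basis_V n i z)" for z
  proof -
    have "(\<Sum>i\<le>n. tau n (mat 1) i b * basis_V n i z) = basis_V n b z"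
      using tau_expand[OF assms(2), of "mat 1"] by (simp add: tau_act_def i fun_eq_iff)
    also have "\<dots> = (\<Sum>i\<le>n. if i = b then basis_V n i z else 0)" using assms(2) by simp
    also have "\<dots> = (\<Sum>i\<le>n. (if i = b then 1 else 0) * basis_V n i z)" by (intro sum.cong) auto
    finally show ?thesis .
  qed
  from basis_V_unique[OF this assms(1)] show ?thesis .
qed

text \<open>The binomial theorem. The normalisation in \<open>basis_V\<close> is what makes the sum
  a function of the Hermitian product, hence invariant under \<open>U2\<close>.\<close>

lemma reproducing_kernel:
  "(\<Sum>j\<le>n. basis_V n j z * cnj (basis_V n j w)) = (z$1 * cnj (w$1) + z$2 * cnj (w$2)) ^ n"
proof -
  have "basis_V n j z * cnj (basis_V n j w) = of_nat (n choose j) * (z$1 * cnj (w$1)) ^ j * (z$2 * cnj (w$2)) ^ (n - j)" for j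
  proof -
    have "complex_of_real (sqrt (real (n choose j))) * of_real (sqrt (real (n choose j))) = of_nat (n choose j)"
      by (simp flip: of_real_mult)
    then show ?thesis
      by (simp add: basis_V_def power_mult_distrib)
  qed
  then show ?thesis by (simp add: binomial_ring)
qed

lemma U2_hermitian_product:
  assumes "k \<in> U2"
  shows "(k *v z)$1 * cnj ((k *v w)$1) + (k *v z)$2 * cnj ((k *v w)$2) = z$1 * cnj (w$1) + z$2 * cnj (w$2)"
proof -
  have k: "conj_transpose k ** k = mat 1" using assms by (simp add: U2_def)
  have e: "cnj (k$1$1) * k$1$1 + cnj (k$2$1) * k$2$1 = 1" "cnj (k$1$1) * k$1$2 + cnj (k$2$1) * k$2$2 = 0"
     "cnj (k$1$2) * k$1$1 + cnj (k$2$2) * k$2$1 = 0" "cnj (k$1$2) * k$1$2 + cnj (k$2$2) * k$2$2 = 1"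
    using k by (simp_all add: mat2_eq_iff mmul2_nth mat2_nth conj_transpose_nth)
  have "(k *v z)$1 * cnj ((k *v w)$1) + (k *v z)$2 * cnj ((k *v w)$2) =
      (cnj (k$1$1) * k$1$1 + cnj (k$2$1) * k$2$1) * (cnj (w$1) * z$1)
    + (cnj (k$1$1) * k$1$2 + cnj (k$2$1) * k$2$2) * (cnj (w$1) * z$2)
    + (cnj (k$1$2) * k$1$1 + cnj (k$2$2) * k$2$1) * (cnj (w$2) * z$1)
    + (cnj (k$1$2) * k$1$2 + cnj (k$2$2) * k$2$2) * (cnj (w$2) * z$2)"
    by (simp add: mvec2_nth algebra_simps)
  then show ?thesis unfolding e by (simp add: mult.commute)
qed

text \<open>Expanding the invariant kernel in the basis in both variables shows that
  \<open>tau\<close> times its adjoint has the kernel of the identity. Uniqueness of coordinates is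
  used in \<open>z\<close>, then in \<open>w\<close>.\<close>

lemma tau_unitary:
  assumes k: "k \<in> U2" and ab: "a \<le> n" "b \<le> n"
  shows "(\<Sum>j\<le>n. tau n k a j * cnj (tau n k b j)) = (if a = b then 1 else 0)"
proof -
  define G where "G a b = (\<Sum>j\<le>n. tau n k a j * cnj (tau n k b j))" for a b
  have inv: "basis_V n j (conj_transpose k *v z) = (\<Sum>a\<le>n. tau n k a j * basis_V n a z)" if "j \<le> n" for j z
    using tau_expand[OF that, of k] U2_matrix_inv[OF k] by (simp add: tau_act_def fun_eq_iff)
  have *: "(\<Sum>a\<le>n. (\<Sum>b\<le>n. G a b * cnj (basis_V n b w)) * basis_V n a z) = (\<Sum>a\<le>n. cnj (basis_V n a w) * basis_V n a z)" for z w
  proof -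
    have "(\<Sum>a\<le>n. cnj (basis_V n a w) * basis_V n a z) = (\<Sum>j\<le>n. basis_V n j z * cnj (basis_V n j w))"
      by (simp add: mult.commute)
    also have "\<dots> = (\<Sum>j\<le>n. basis_V n j (conj_transpose k *v z) * cnj (basis_V n j (conj_transpose k *v w)))"
      unfolding reproducing_kernel U2_hermitian_product[OF U2_conj_transpose[OF k]] ..
    also have "\<dots> = (\<Sum>j\<le>n. (\<Sum>a\<le>n. tau n k a j * basis_V n a z) * cnj (\<Sum>b\<le>n. tau n k b j * basis_V n b w))"
      by (intro sum.cong refl) (simp add: inv)
    also have "\<dots> = (\<Sum>j\<le>n. \<Sum>a\<le>n. \<Sum>b\<le>n. tau n k a j * cnj (tau n k b j) * cnj (basis_V n b w) * basis_V n a z)"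
      by (simp add: sum_product mult_ac)
    also have "\<dots> = (\<Sum>a\<le>n. \<Sum>j\<le>n. \<Sum>b\<le>n. tau n k a j * cnj (tau n k b j) * cnj (basis_V n b w) * basis_V n a z)"
      by (rule sum.swap)
    also have "\<dots> = (\<Sum>a\<le>n. \<Sum>b\<le>n. \<Sum>j\<le>n. tau n k a j * cnj (tau n k b j) * cnj (basis_V n b w) * basis_V n a z)"
      by (intro sum.cong refl sum.swap)
    also have "\<dots> = (\<Sum>a\<le>n. (\<Sum>b\<le>n. G a b * cnj (basis_V n b w)) * basis_V n a z)"
      by (simp add: G_def sum_distrib_right)
    finally show ?thesis by simp
  qed
  have "(\<Sum>b\<le>n. G a b * cnj (basis_V n b w)) = cnj (basis_V n a w)" for w
    using basis_V_unique[OF *[of w] ab(1)] .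
  then have "cnj (\<Sum>b\<le>n. G a b * cnj (basis_V n b w)) = basis_V n a w" for w by simp
  then have "(\<Sum>b\<le>n. cnj (G a b) * basis_V n b w) = (\<Sum>b\<le>n. (if b = a then 1 else 0) * basis_V n b w)" for w
    using ab(1) by (simp add: if_distrib[of "\<lambda>x. x * _"] cong: if_cong)
  from basis_V_unique[OF this ab(2)] have "cnj (G a b) = (if b = a then 1 else 0)" .
  from arg_cong[OF this, of cnj] have "G a b = cnj (if b = a then 1 else 0)" by (simp only: complex_cnj_cnj)
  then show ?thesis unfolding G_def[symmetric] by auto
qed

lemma basis_V_scale: "j \<le> n \<Longrightarrow> basis_V n j (mat c *v z) = c ^ n * basis_V n j z"
proof -
  assume "j \<le> n"
  then have "c ^ n = c ^ j * c ^ (n - j)" by (simp flip: power_add)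
  then show ?thesis by (simp add: basis_V_def mvec2_nth mat2_nth power_mult_distrib)
qed

lemma tau_scalar:
  assumes "cmod c = 1" "k \<in> U2"
  shows "tau n (mat c ** k) a b = cnj c ^ n * tau n k a b"
proof (cases "n < a \<or> n < b")
  case False
  then have ab: "a \<le> n" "b \<le> n" by auto
  have u: "mat c ** k \<in> U2" using assms by (intro U2_mult mat_unit_U2)
  have "conj_transpose (mat c ** k) *v z = mat (cnj c) *v (conj_transpose k *v z)" for z
    by (simp add: conj_transpose_mult conj_transpose_mat mat_mult_commute matrix_vector_mul_assoc)
  then show ?thesis
    unfolding tau_eval[OF u ab(1)] tau_eval[OF assms(2) ab(1)]
    by (simp add: basis_V_scale[OF ab(2)] sum_distrib_left mult_ac)
qed (simp add: tau_outside)

lemma det_U2_nonzero: "u \<in> U2 \<Longrightarrow> det u \<noteq> 0"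
  using U2_det[of u] by auto

locale admissible =
  fixes m :: int and n :: nat
  assumes mn: "(m, n) \<in> E_index"
begin

abbreviation "TU \<equiv> tau_U2 m n"

text \<open>A formula for the representation without a choice of the decomposition \<open>u = e\<^sup>i\<^sup>\<theta> k'\<close>.\<close>

lemma TU_det:
  assumes u: "u \<in> U2"
  shows "TU u a b = det u powi ((int n - m) div 2) * tau n u a b"
proof -
  obtain \<theta> k where k: "k \<in> SU2" and uk: "u = mat (cis \<theta>) ** k" using U2_decomposition[OF u] by blast
  have kU: "k \<in> U2" "det k = 1" using k by (auto simp: SU2_def)
  \<comment> \<open>The parity condition of \<open>E_index\<close> makes the half an integer. As
    \<open>det u\<close> is \<open>cis (2 * \<theta>)\<close>, it contributes
    \<open>cis ((n - m) * \<theta>)\<close>; homogeneity of degree \<open>n\<close> contributes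
    \<open>cis (- n * \<theta>)\<close>, and the phase \<open>cis (- m * \<theta>)\<close>
    remains.\<close>
  define s where "s = (int n - m) div 2"
  have s: "2 * s = int n - m" using mn by (auto simp: s_def E_index_def)
  have "det u = (cis \<theta>)\<^sup>2" by (simp add: uk det_mat_mult kU)
  also have "\<dots> = cis (2 * \<theta>)" by (simp add: power2_eq_square cis_mult)
  finally have "det u powi s = cis (of_int s * (2 * \<theta>))" by (simp add: cis_power_int)
  moreover have "cnj (cis \<theta>) ^ n = cis (real n * (- \<theta>))" unfolding cis_cnj Complex.DeMoivre ..
  ultimately have "det u powi s * tau n u a b = cis (of_int s * (2 * \<theta>) - real n * \<theta>) * tau n k a b"
    by (simp add: uk tau_scalar kU mult.assoc[symmetric] cis_mult)
  also have "of_int s * (2 * \<theta>) - real n * \<theta> = - real_of_int m * \<theta>"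
  proof -
    have "of_int s * (2 * \<theta>) = of_int (2 * s) * \<theta>" by simp
    then show ?thesis unfolding s by (simp add: algebra_simps)
  qed
  finally show ?thesis using tau_U2_eq[OF mn k, of \<theta>] by (simp add: uk[symmetric] s_def)
qed

lemma TU_outside: "u \<in> U2 \<Longrightarrow> n < a \<or> n < b \<Longrightarrow> TU u a b = 0"
  by (simp add: TU_det tau_outside)

lemma TU_mult:
  assumes "k \<in> U2" "l \<in> U2" "a \<le> n" "b \<le> n"
  shows "TU (k ** l) a b = (\<Sum>c\<le>n. TU k a c * TU l c b)"
  using assms by (simp add: TU_det U2_mult tau_mult det_mul power_int_mult_distrib sum_distrib_left mult_ac)

lemma TU_one: "a \<le> n \<Longrightarrow> b \<le> n \<Longrightarrow> TU (mat 1) a b = (if a = b then 1 else 0)"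
  by (simp add: TU_det U2_one tau_one)

lemma norm_det_powi: "u \<in> U2 \<Longrightarrow> cmod (det u powi s) = 1"
  by (simp add: norm_power_int U2_det)

lemma TU_unitary:
  assumes k: "k \<in> U2" and ab: "a \<le> n" "b \<le> n"
  shows "(\<Sum>j\<le>n. TU k a j * cnj (TU k b j)) = (if a = b then 1 else 0)"
proof -
  let ?d = "det k powi ((int n - m) div 2)"
  have "?d * cnj ?d = complex_of_real ((cmod ?d)\<^sup>2)" by (rule complex_norm_square[symmetric])
  then have d: "?d * cnj ?d = 1" by (simp only: norm_det_powi[OF k]) simp
  have dd: "(?d * x) * cnj (?d * y) = x * cnj y" for x y
  proof -
    have "(?d * x) * cnj (?d * y) = (?d * cnj ?d) * (x * cnj y)" by (simp only: complex_cnj_mult mult_ac)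
    then show ?thesis by (simp only: d mult_1_left)
  qed
  have "(\<Sum>j\<le>n. TU k a j * cnj (TU k b j)) = (\<Sum>j\<le>n. tau n k a j * cnj (tau n k b j))"
    unfolding TU_det[OF k] dd by (rule refl)
  then show ?thesis by (simp add: tau_unitary[OF assms])
qed

lemma norm_TU_le: assumes k: "k \<in> U2" shows "cmod (TU k a b) \<le> 1"
proof (cases "n < a \<or> n < b")
  case False
  then have ab: "a \<le> n" "b \<le> n" by auto
  have "(\<Sum>j\<le>n. complex_of_real ((cmod (TU k a j))\<^sup>2)) = 1"
    using TU_unitary[OF k ab(1) ab(1)] by (simp only: complex_norm_square if_True simp_thms)
  then have "(\<Sum>j\<le>n. (cmod (TU k a j))\<^sup>2) = 1" by (metis of_real_eq_1_iff of_real_sum)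
  moreover have "(cmod (TU k a b))\<^sup>2 \<le> (\<Sum>j\<le>n. (cmod (TU k a j))\<^sup>2)"
    using ab by (intro member_le_sum) auto
  ultimately show ?thesis by (simp add: abs_square_le_1)
qed (simp add: TU_outside k)

text \<open>By multiplicativity \<open>TU (conj_transpose k)\<close> is a left inverse of
  \<open>TU k\<close>, by unitarity the adjoint is a right inverse; so they coincide.\<close>

lemma TU_adjoint:
  assumes k: "k \<in> U2" and ab: "a \<le> n" "b \<le> n"
  shows "TU (conj_transpose k) a b = cnj (TU k b a)"
proof -
  have k': "conj_transpose k \<in> U2" "conj_transpose k ** k = mat 1"
    using U2_conj_transpose[OF k] k by (simp_all add: U2_def)
  have "TU (conj_transpose k) a b = (\<Sum>c\<le>n. TU (conj_transpose k) a c * (if c = b then 1 else 0))"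
    using ab by (simp add: if_distrib cong: if_cong)
  also have "\<dots> = (\<Sum>c\<le>n. TU (conj_transpose k) a c * (\<Sum>d\<le>n. TU k c d * cnj (TU k b d)))"
    using ab by (intro sum.cong refl) (simp add: TU_unitary[OF k])
  also have "\<dots> = (\<Sum>d\<le>n. (\<Sum>c\<le>n. TU (conj_transpose k) a c * TU k c d) * cnj (TU k b d))"
    unfolding sum_distrib_left sum_distrib_right by (subst sum.swap) (simp add: mult_ac)
  also have "\<dots> = (\<Sum>d\<le>n. (if a = d then 1 else 0) * cnj (TU k b d))"
    using ab by (intro sum.cong refl) (simp add: TU_mult[OF k'(1) k, symmetric] k'(2) TU_one)
  also have "\<dots> = (\<Sum>d\<le>n. if d = a then cnj (TU k b a) else 0)" by (intro sum.cong) auto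
  finally show ?thesis using ab by simp
qed

lemma continuous_on_TU: "continuous_on U2 (\<lambda>k. TU k a b)"
proof (cases "n < a \<or> n < b")
  case True
  then show ?thesis by (subst continuous_on_cong[OF refl, of _ _ "\<lambda>_. 0"]) (auto simp: TU_outside)
next
  case False
  then have ab: "a \<le> n" "b \<le> n" by auto
  have "continuous_on U2 (\<lambda>k::complex^2^2. det k)" unfolding det_2 by (intro continuous_intros)
  then have "continuous_on U2 (\<lambda>k. det k powi ((int n - m) div 2))"
    by (rule continuous_on_power_int) (use det_U2_nonzero in blast)
  moreover have "continuous_on U2 (\<lambda>k. \<Sum>i\<le>n. coord_weight n a i * basis_V n b (conj_transpose k *v pt i))"
    unfolding basis_V_def mvec2_nth conj_transpose_nth by (intro continuous_intros)
  ultimately have "continuous_on U2 (\<lambda>k. det k powi ((int n - m) div 2) *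
      (\<Sum>i\<le>n. coord_weight n a i * basis_V n b (conj_transpose k *v pt i)))"
    by (rule continuous_on_mult)
  then show ?thesis
    by (subst continuous_on_cong[OF refl, of _ _ "\<lambda>k. det k powi ((int n - m) div 2) *
      (\<Sum>i\<le>n. coord_weight n a i * basis_V n b (conj_transpose k *v pt i))"]) (auto simp: TU_det tau_eval ab)
qed

end

subsection \<open>Integration over \<open>U\<^sub>2\<close>\<close>

lemma sets_haar: "sets haar_U2 = sets (restrict_space borel U2)"
  and emeasure_haar: "emeasure haar_U2 U2 = 1"
  and haar_translate: "k \<in> U2 \<Longrightarrow> distr haar_U2 haar_U2 (\<lambda>l. k ** l) = haar_U2"
  using normalized_haar_U2_haar_U2 by (auto simp: normalized_haar_U2_def)

lemma space_haar: "space haar_U2 = U2"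
  using sets_eq_imp_space_eq[OF sets_haar] by (simp add: space_restrict_space)

lemma finite_measure_haar: "finite_measure haar_U2"
  by (rule finite_measureI) (simp add: space_haar emeasure_haar)

lemma measure_haar: "measure haar_U2 U2 = 1"
  by (simp add: measure_def emeasure_haar)

lemma measurable_haar_left: assumes "k \<in> U2" shows "(\<lambda>l. k ** l) \<in> haar_U2 \<rightarrow>\<^sub>M haar_U2"
proof -
  have "(\<lambda>l. k ** l) \<in> restrict_space borel U2 \<rightarrow>\<^sub>M restrict_space borel U2"
    using measurable_compose[OF _ measurable_mult_U2, of "\<lambda>x. (k, x)" "restrict_space borel U2"] assms
    by (simp add: space_restrict_space)
  then show ?thesis by (simp cong: measurable_cong_sets add: sets_haar)
qed

lemma measurable_haar_conj_transpose: "conj_transpose \<in> haar_U2 \<rightarrow>\<^sub>M haar_U2"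
  using measurable_conj_transpose_U2 by (simp cong: measurable_cong_sets add: sets_haar)

lemma haar_left:
  fixes g :: "complex^2^2 \<Rightarrow> complex"
  assumes "k \<in> U2" "g \<in> borel_measurable haar_U2"
  shows "(\<integral>l. g (k ** l) \<partial>haar_U2) = (\<integral>l. g l \<partial>haar_U2)"
  using integral_distr[OF measurable_haar_left[OF assms(1)] assms(2)] haar_translate[OF assms(1)] by simp

text \<open>\<open>normalized_haar_U2_inverse\<close> with the same measure in both places is
  invariance under inversion, which on \<open>U2\<close> is \<open>conj_transpose\<close>. Right
  invariance follows from this and left invariance.\<close>

lemma haar_inverse:
  fixes g :: "complex^2^2 \<Rightarrow> complex"
  assumes "g \<in> borel_measurable haar_U2"
  shows "(\<integral>l. g (conj_transpose l) \<partial>haar_U2) = (\<integral>l. g l \<partial>haar_U2)"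
proof -
  have "distr haar_U2 haar_U2 conj_transpose = haar_U2"
  proof (rule measure_eqI)
    fix A assume "A \<in> sets (distr haar_U2 haar_U2 conj_transpose)"
    then have A: "A \<in> sets haar_U2" by simp
    have "emeasure (distr haar_U2 haar_U2 conj_transpose) A = (\<integral>\<^sup>+x. indicator A x \<partial>distr haar_U2 haar_U2 conj_transpose)"
      using A by simp
    also have "\<dots> = (\<integral>\<^sup>+x. indicator A (conj_transpose x) \<partial>haar_U2)"
      using A by (intro nn_integral_distr measurable_haar_conj_transpose) simp
    also have "\<dots> = emeasure haar_U2 A"
      using normalized_haar_U2_inverse[OF normalized_haar_U2_haar_U2 normalized_haar_U2_haar_U2, of A] A
      by (simp add: sets_haar)
    finally show "emeasure (distr haar_U2 haar_U2 conj_transpose) A = emeasure haar_U2 A" .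
  qed simp
  then show ?thesis using integral_distr[OF measurable_haar_conj_transpose assms] by simp
qed

lemma haar_right:
  fixes g :: "complex^2^2 \<Rightarrow> complex"
  assumes k: "k \<in> U2" and g: "g \<in> borel_measurable haar_U2"
  shows "(\<integral>l. g (l ** k) \<partial>haar_U2) = (\<integral>l. g l \<partial>haar_U2)"
proof -
  let ?g = "\<lambda>l. g (conj_transpose l)"
  have m: "?g \<in> borel_measurable haar_U2" by (rule measurable_compose[OF measurable_haar_conj_transpose g])
  have k': "conj_transpose k \<in> U2" using k by (rule U2_conj_transpose)
  have m': "(\<lambda>l. ?g (conj_transpose k ** l)) \<in> borel_measurable haar_U2"
    by (rule measurable_compose[OF measurable_haar_left[OF k'] m])
  have "(\<integral>l. g (l ** k) \<partial>haar_U2) = (\<integral>l. ?g (conj_transpose k ** conj_transpose l) \<partial>haar_U2)"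
    by (simp add: conj_transpose_mult conj_transpose_conj_transpose)
  also have "\<dots> = (\<integral>l. ?g (conj_transpose k ** l) \<partial>haar_U2)"
    by (rule haar_inverse[OF m'])
  also have "\<dots> = (\<integral>l. ?g l \<partial>haar_U2)" by (rule haar_left[OF k' m])
  also have "\<dots> = (\<integral>l. g l \<partial>haar_U2)" by (rule haar_inverse[OF g])
  finally show ?thesis .
qed

lemma measurable_haar_right: assumes "k \<in> U2" shows "(\<lambda>l. l ** k) \<in> haar_U2 \<rightarrow>\<^sub>M haar_U2"
proof -
  have "(\<lambda>l. l ** k) \<in> restrict_space borel U2 \<rightarrow>\<^sub>M restrict_space borel U2"
    using measurable_compose[OF _ measurable_mult_U2, of "\<lambda>x. (x, k)" "restrict_space borel U2"] assms
    by (simp add: space_restrict_space)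
  then show ?thesis by (simp cong: measurable_cong_sets add: sets_haar)
qed

lemma haar_conjugate:
  fixes g :: "complex^2^2 \<Rightarrow> complex"
  assumes k: "k \<in> U2" and g: "g \<in> borel_measurable haar_U2"
  shows "(\<integral>l. g (k ** l ** conj_transpose k) \<partial>haar_U2) = (\<integral>l. g l \<partial>haar_U2)"
proof -
  have k': "conj_transpose k \<in> U2" using k by (rule U2_conj_transpose)
  have "(\<lambda>l. g (l ** conj_transpose k)) \<in> borel_measurable haar_U2"
    by (rule measurable_compose[OF measurable_haar_right[OF k'] g])
  from haar_left[OF k this] haar_right[OF k' g] show ?thesis by simp
qed

lemma measurable_haar_continuous:
  fixes g :: "complex^2^2 \<Rightarrow> complex"
  assumes "continuous_on U2 g" shows "g \<in> borel_measurable haar_U2"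
  using borel_measurable_continuous_on_restrict[OF assms]
  by (simp cong: measurable_cong_sets add: sets_haar)

lemma compact_U2: "compact U2"
proof -
  have "norm k \<le> 2" if "k \<in> U2" for k
  proof -
    have "k ** conj_transpose k = mat 1" using that by (simp add: U2_def)
    then have e: "k$1$1 * cnj (k$1$1) + k$1$2 * cnj (k$1$2) = 1" "k$2$1 * cnj (k$2$1) + k$2$2 * cnj (k$2$2) = 1"
      by (simp_all add: mat2_eq_iff mmul2_nth mat2_nth conj_transpose_nth)
    have "complex_of_real ((norm (k$i))\<^sup>2) = 1" for i
      using e exhaust_2[of i] by (auto simp: norm_vec2 complex_norm_square simp del: of_real_power)
    then have "(norm (k$i))\<^sup>2 = 1" for i using of_real_eq_1_iff by blast
    then have "norm (k$i) = 1" for i by (metis abs_norm_cancel abs_square_eq_1)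
    then have "norm k = sqrt 2" by (simp add: norm_vec_def[of k] L2_set_def sum_2)
    then show ?thesis using sqrt2_less_2 by simp
  qed
  then have "bounded U2" by (auto simp: bounded_iff)
  then show ?thesis using closed_U2 by (simp add: compact_eq_bounded_closed)
qed

lemma integrable_haar_continuous:
  fixes g :: "complex^2^2 \<Rightarrow> complex"
  assumes "continuous_on U2 g" shows "integrable haar_U2 g"
proof -
  have "compact (g ` U2)" using assms compact_U2 by (rule compact_continuous_image)
  then obtain B where "\<forall>x\<in>g ` U2. cmod x \<le> B" using compact_imp_bounded bounded_iff by metis
  then show ?thesis
    by (intro finite_measure.integrable_const_bound[OF finite_measure_haar, of _ B] measurable_haar_continuous assms)
      (auto simp: space_haar)
qed

subsection \<open>Differentiation under the integral sign\<close>

lemma has_vector_derivative_iff_quotient: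
  fixes f :: "real \<Rightarrow> complex"
  shows "(f has_vector_derivative D) (at x) \<longleftrightarrow> ((\<lambda>h. (f (x + h) - f x) /\<^sub>R h) \<longlongrightarrow> D) (at 0)"
proof -
  have "(f has_vector_derivative D) (at x) \<longleftrightarrow> ((\<lambda>h. norm (f (x + h) - f x - h *\<^sub>R D) / norm h) \<longlongrightarrow> 0) (at 0)"
    by (simp add: has_vector_derivative_def has_derivative_at bounded_linear_scaleR_left)
  also have "\<dots> \<longleftrightarrow> ((\<lambda>h. norm ((f (x + h) - f x) /\<^sub>R h - D)) \<longlongrightarrow> 0) (at 0)"
  proof (rule filterlim_cong[OF refl refl])
    show "\<forall>\<^sub>F h in at 0. norm (f (x + h) - f x - h *\<^sub>R D) / norm h = norm ((f (x + h) - f x) /\<^sub>R h - D)"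
      unfolding eventually_at_filter
    proof (intro always_eventually allI impI)
      fix h :: real assume h: "h \<noteq> 0"
      have "(f (x + h) - f x) /\<^sub>R h - D = (f (x + h) - f x - h *\<^sub>R D) /\<^sub>R h"
        using h by (simp add: scaleR_diff_right)
      then show "norm (f (x + h) - f x - h *\<^sub>R D) / norm h = norm ((f (x + h) - f x) /\<^sub>R h - D)"
        by (simp add: divide_inverse mult.commute)
    qed
  qed
  also have "\<dots> \<longleftrightarrow> ((\<lambda>h. (f (x + h) - f x) /\<^sub>R h) \<longlongrightarrow> D) (at 0)"
    by (simp add: tendsto_norm_zero_iff LIM_zero_iff)
  finally show ?thesis .
qed

text \<open>Dominated convergence for difference quotients along sequences, with the majorant
  \<open>G\<close> supplied by the mean value inequality. Measurability of \<open>g' t0\<close>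
  comes out as that of a limit of measurable quotients.\<close>

lemma has_vector_derivative_integral:
  fixes g g' :: "real \<Rightarrow> 'a \<Rightarrow> complex"
  assumes \<delta>: "0 < \<delta>" and int: "\<And>t. \<bar>t - t0\<bar> < \<delta> \<Longrightarrow> integrable M (g t)"
    and der: "\<And>t x. \<bar>t - t0\<bar> < \<delta> \<Longrightarrow> x \<in> space M \<Longrightarrow> ((\<lambda>t. g t x) has_vector_derivative g' t x) (at t)"
    and bound: "\<And>t x. \<bar>t - t0\<bar> < \<delta> \<Longrightarrow> x \<in> space M \<Longrightarrow> cmod (g' t x) \<le> G x"
    and G: "integrable M G"
  shows "((\<lambda>t. \<integral>x. g t x \<partial>M) has_vector_derivative (\<integral>x. g' t0 x \<partial>M)) (at t0)"
  unfolding has_vector_derivative_iff_quotient tendsto_at_iff_sequentially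
proof (intro allI impI)
  fix X :: "nat \<Rightarrow> real" assume X: "\<forall>i. X i \<in> UNIV - {0}" "X \<longlonglongrightarrow> 0"
  \<comment> \<open>Set to 0 for the finitely many \<open>i\<close> at which \<open>X i\<close> is
    too large, so that measurability and the majorant hold for every \<open>i\<close>.\<close>
  define s where "s i x = (if \<bar>X i\<bar> < \<delta> then (g (t0 + X i) x - g t0 x) /\<^sub>R X i else 0)" for i x
  have ev: "\<forall>\<^sub>F i in sequentially. \<bar>X i\<bar> < \<delta>"
    using tendstoD[OF X(2) \<delta>] by (simp add: dist_real_def)
  have lim: "(\<lambda>i. s i x) \<longlonglongrightarrow> g' t0 x" if x: "x \<in> space M" for x
  proof -
    have "((\<lambda>h. (g (t0 + h) x - g t0 x) /\<^sub>R h) \<longlongrightarrow> g' t0 x) (at 0)"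
      using der[of t0 x] \<delta> x by (simp add: has_vector_derivative_iff_quotient)
    then have "(\<lambda>i. (g (t0 + X i) x - g t0 x) /\<^sub>R X i) \<longlonglongrightarrow> g' t0 x"
      using X unfolding tendsto_at_iff_sequentially comp_def by blast
    then show ?thesis
      by (rule Lim_transform_eventually) (use ev in eventually_elim, simp add: s_def)
  qed
  have sm: "s i \<in> borel_measurable M" for i
  proof (cases "\<bar>X i\<bar> < \<delta>")
    case True
    then show ?thesis using int[of "t0 + X i"] int[of t0] \<delta> unfolding s_def by auto
  next
    case False
    then show ?thesis unfolding s_def by simp
  qed
  have sb: "norm (s i x) \<le> G x" if x: "x \<in> space M" for i x
  proof (cases "\<bar>X i\<bar> < \<delta>")
    case True
    have "norm (g (t0 + X i) x - g t0 x) \<le> G x * norm (t0 + X i - t0)"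
    proof (rule differentiable_bound[of "ball t0 \<delta>"])
      fix t assume "t \<in> ball t0 \<delta>"
      then have t: "\<bar>t - t0\<bar> < \<delta>" by (simp add: dist_real_def abs_minus_commute)
      show "((\<lambda>t. g t x) has_derivative (\<lambda>h. h *\<^sub>R g' t x)) (at t within ball t0 \<delta>)"
        using der[OF t x] unfolding has_vector_derivative_def by (rule has_derivative_at_withinI)
      have "norm (h *\<^sub>R g' t x) \<le> G x * norm h" for h :: real
        using mult_right_mono[OF bound[OF t x], of "norm h"] by (simp add: mult.commute)
      then show "onorm (\<lambda>h. h *\<^sub>R g' t x) \<le> G x" by (rule onorm_le)
    qed (use True \<delta> in \<open>auto simp: dist_real_def\<close>)
    moreover have "norm (s i x) = norm (g (t0 + X i) x - g t0 x) / \<bar>X i\<bar>"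
      using True by (simp add: s_def divide_inverse mult.commute)
    moreover have "0 < \<bar>X i\<bar>" using X(1) by auto
    ultimately show ?thesis by (simp add: divide_le_eq)
  next
    case False
    then show ?thesis using order.trans[OF norm_ge_zero bound[of t0 x]] \<delta> x by (simp add: s_def)
  qed
  have m: "g' t0 \<in> borel_measurable M"
    by (rule borel_measurable_LIMSEQ_metric[OF sm lim])
  have "(\<lambda>i. \<integral>x. s i x \<partial>M) \<longlonglongrightarrow> (\<integral>x. g' t0 x \<partial>M)"
    by (rule integral_dominated_convergence[OF m sm G]) (use lim sb in auto)
  moreover have "\<forall>\<^sub>F i in sequentially. (\<integral>x. s i x \<partial>M) = ((\<integral>x. g (t0 + X i) x \<partial>M) - (\<integral>x. g t0 x \<partial>M)) /\<^sub>R X i"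
    using ev
  proof eventually_elim
    case (elim i)
    then have "integrable M (g (t0 + X i))" "integrable M (g t0)" using int \<delta> by auto
    then show ?case using elim by (simp add: s_def)
  qed
  ultimately show "((\<lambda>h. ((\<integral>x. g (t0 + h) x \<partial>M) - (\<integral>x. g t0 x \<partial>M)) /\<^sub>R h) \<circ> X) \<longlonglongrightarrow> (\<integral>x. g' t0 x \<partial>M)"
    unfolding comp_def by (rule Lim_transform_eventually)
qed

subsection \<open>Left-invariant derivatives\<close>

lemma smooth_times_linear:
  fixes F :: "'a::euclidean_space \<Rightarrow> complex"
  assumes l: "bounded_linear l" and F: "smooth F"
  shows "smooth (\<lambda>x. of_real (l x) * F x)"
proof -
  define C where "C H \<longleftrightarrow> smooth H \<or> (\<exists>l F. bounded_linear l \<and> smooth F \<and> H = (\<lambda>x. of_real (l x) * F x))"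
    for H :: "'a \<Rightarrow> complex"
  show ?thesis
  proof (rule smooth_lin_span[of C])
    show "lin_span C (\<lambda>x. of_real (l x) * F x)" by (rule lin_span_base) (use assms in \<open>auto simp: C_def\<close>)
    fix H assume "C H"
    then consider "smooth H" | l F where "bounded_linear l" "smooth F" "H = (\<lambda>x. of_real (l x) * F x)"
      unfolding C_def by blast
    then show "(\<forall>x. H differentiable at x) \<and> (\<forall>v. lin_span C (dir_deriv v H))"
    proof cases
      case 1
      have "lin_span C (dir_deriv v H)" for v
        by (rule lin_span_base) (use smooth_dir_deriv[OF 1] in \<open>auto simp: C_def\<close>)
      then show ?thesis using smooth_differentiable[OF 1] by blast
    next
      case 2
      have d: "(H has_derivative (\<lambda>v. of_real (l x) * dir_deriv v F x + of_real (l v) * F x)) (at x)" for x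
      proof -
        have "((\<lambda>x. complex_of_real (l x)) has_derivative (\<lambda>v. of_real (l v))) (at x)"
          by (intro has_derivative_of_real bounded_linear_imp_has_derivative 2)
        from has_derivative_mult[OF this smooth_has_derivative[OF 2(2)]] show ?thesis unfolding 2(3) .
      qed
      have "dir_deriv v H = (\<lambda>x. of_real (l x) * dir_deriv v F x + of_real (l v) * F x)" for v
        by (intro ext dir_deriv_eq d)
      moreover have "lin_span C (\<lambda>x. of_real (l x) * dir_deriv v F x + of_real (l v) * F x)" for v
      proof (rule lin_span_add)
        show "lin_span C (\<lambda>x. of_real (l x) * dir_deriv v F x)"
          by (rule lin_span_base) (use 2 smooth_dir_deriv[OF 2(2)] in \<open>auto simp: C_def\<close>)
        have "C F" using 2 by (auto simp: C_def)
        show "lin_span C (\<lambda>x. of_real (l v) * F x)" by (rule lin_span_cmult, rule lin_span_base, fact)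
      qed
      ultimately show ?thesis using differentiableI[OF d] by simp
    qed
  qed
qed

text \<open>The left-invariant vector field, continued to the ambient space by the same formula. It
  is linear in the base point, so its coefficients in \<open>left_deriv_basis\<close> are covered by
  \<open>smooth_times_linear\<close>.\<close>

definition left_field :: "motion \<Rightarrow> motion \<Rightarrow> motion" where
  "left_field X p = (fst p ** fst X, fst p *v snd X)"

lemma linear_left_field: "linear (left_field X)"
  unfolding left_field_def
  by (rule linearI) (simp_all add: prod_eq_iff mat2_eq_iff vec_eq_iff forall_2 mmul2_nth mvec2_nth algebra_simps)

lemma left_deriv_eq: "left_deriv X F p = frechet_derivative F (at p) (left_field X p)"
  by (cases p) (simp add: left_deriv_def left_field_def)

lemma left_deriv_dir_deriv: "left_deriv X F p = dir_deriv (left_field X p) F p"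
  by (simp add: left_deriv_eq dir_deriv_def)

lemma left_deriv_basis:
  assumes "smooth F"
  shows "left_deriv X F = (\<lambda>p. \<Sum>b\<in>Basis. of_real (left_field X p \<bullet> b) * dir_deriv b F p)"
proof
  fix p
  have lin: "linear (\<lambda>v. dir_deriv v F p)" using smooth_has_derivative[OF assms] has_derivative_linear by blast
  have "left_deriv X F p = dir_deriv (\<Sum>b\<in>Basis. (left_field X p \<bullet> b) *\<^sub>R b) F p"
    by (simp add: left_deriv_dir_deriv euclidean_representation)
  also have "\<dots> = (\<Sum>b\<in>Basis. (left_field X p \<bullet> b) *\<^sub>R dir_deriv b F p)"
    by (simp only: linear_sum[OF lin] linear_scale[OF lin])
  finally show "left_deriv X F p = (\<Sum>b\<in>Basis. of_real (left_field X p \<bullet> b) * dir_deriv b F p)"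
    by (simp add: scaleR_conv_of_real)
qed

lemma smooth_left_deriv: assumes "smooth F" shows "smooth (left_deriv X F)"
  unfolding left_deriv_basis[OF assms]
proof (intro smooth_sum smooth_times_linear smooth_dir_deriv assms)
  fix b
  show "bounded_linear (\<lambda>p. left_field X p \<bullet> b)"
    using linear_left_field[of X] by (intro bounded_linear_inner_left_comp) (simp add: linear_conv_bounded_linear)
qed

lemma left_deriv_add: "smooth F \<Longrightarrow> smooth G \<Longrightarrow> left_deriv X (\<lambda>p. F p + G p) = (\<lambda>p. left_deriv X F p + left_deriv X G p)"
  by (intro ext) (simp add: left_deriv_dir_deriv dir_deriv_add)

lemma left_deriv_cmult: "smooth F \<Longrightarrow> left_deriv X (\<lambda>p. c * F p) = (\<lambda>p. c * left_deriv X F p)"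
  by (intro ext) (simp add: left_deriv_dir_deriv dir_deriv_cmult)

lemma smooth_foldr: "smooth F \<Longrightarrow> smooth (foldr left_deriv Xs F)"
  by (induction Xs) (simp_all add: smooth_left_deriv)

lemma foldr_left_deriv_add:
  "smooth F \<Longrightarrow> smooth G \<Longrightarrow> foldr left_deriv Xs (\<lambda>p. F p + G p) = (\<lambda>p. foldr left_deriv Xs F p + foldr left_deriv Xs G p)"
  by (induction Xs) (simp_all add: left_deriv_add smooth_foldr)

lemma foldr_left_deriv_cmult:
  "smooth F \<Longrightarrow> foldr left_deriv Xs (\<lambda>p. c * F p) = (\<lambda>p. c * foldr left_deriv Xs F p)"
  by (induction Xs) (simp_all add: left_deriv_cmult smooth_foldr)

text \<open>The condition of \<open>schwartz_G\<close> for a smooth ambient representative. The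
  analysis is carried out for such \<open>F\<close>, whose left-invariant derivatives are again of
  this kind.\<close>

definition decaying :: "(motion \<Rightarrow> complex) \<Rightarrow> bool" where
  "decaying F \<longleftrightarrow> smooth F \<and> (\<forall>Xs N. set Xs \<subseteq> skew_hermitian \<times> UNIV \<longrightarrow>
     (\<exists>C. \<forall>k\<in>U2. \<forall>z. (1 + norm z) ^ N * cmod (foldr left_deriv Xs F (k, z)) \<le> C))"

lemma decaying_smooth: "decaying F \<Longrightarrow> smooth F"
  by (simp add: decaying_def)

lemma decaying_bound:
  assumes "decaying F"
  shows "\<exists>C\<ge>0. \<forall>k\<in>U2. \<forall>z. (1 + norm z) ^ N * cmod (F (k, z)) \<le> C"
proof -
  have "\<exists>C. \<forall>k\<in>U2. \<forall>z. (1 + norm z) ^ N * cmod (foldr left_deriv [] F (k, z)) \<le> C"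
    using assms unfolding decaying_def by (metis empty_iff empty_set subsetI)
  then obtain C where "\<forall>k\<in>U2. \<forall>z. (1 + norm z) ^ N * cmod (F (k, z)) \<le> C" by auto
  then show ?thesis by (intro exI[of _ "max 0 C"]) (auto simp: le_max_iff_disj)
qed

lemma decaying_left_deriv:
  assumes F: "decaying F" and X: "fst X \<in> skew_hermitian" shows "decaying (left_deriv X F)"
  unfolding decaying_def
proof (intro conjI allI impI)
  show "smooth (left_deriv X F)" using F by (simp add: decaying_def smooth_left_deriv)
  fix Xs N assume "set Xs \<subseteq> skew_hermitian \<times> (UNIV :: (complex^2) set)"
  then have "set (Xs @ [X]) \<subseteq> skew_hermitian \<times> UNIV" using X by (cases X) auto
  then have "\<exists>C. \<forall>k\<in>U2. \<forall>z. (1 + norm z) ^ N * cmod (foldr left_deriv (Xs @ [X]) F (k, z)) \<le> C"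
    using F unfolding decaying_def by blast
  then show "\<exists>C. \<forall>k\<in>U2. \<forall>z. (1 + norm z) ^ N * cmod (foldr left_deriv Xs (left_deriv X F) (k, z)) \<le> C" by simp
qed

lemma decaying_add:
  assumes F: "decaying F" and G: "decaying G" shows "decaying (\<lambda>p. F p + G p)"
  unfolding decaying_def
proof (intro conjI allI impI)
  have s: "smooth F" "smooth G" using F G by (auto simp: decaying_def)
  show "smooth (\<lambda>p. F p + G p)" by (intro smooth_add s)
  fix Xs N assume Xs: "set Xs \<subseteq> skew_hermitian \<times> (UNIV :: (complex^2) set)"
  obtain C where C: "\<forall>k\<in>U2. \<forall>z. (1 + norm z) ^ N * cmod (foldr left_deriv Xs F (k, z)) \<le> C"
    using F Xs unfolding decaying_def by blast
  obtain D where D: "\<forall>k\<in>U2. \<forall>z. (1 + norm z) ^ N * cmod (foldr left_deriv Xs G (k, z)) \<le> D"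
    using G Xs unfolding decaying_def by blast
  have "(1 + norm z) ^ N * cmod (foldr left_deriv Xs (\<lambda>p. F p + G p) (k, z)) \<le> C + D" if "k \<in> U2" for k z
  proof -
    have "(1 + norm z) ^ N * cmod (foldr left_deriv Xs F (k, z) + foldr left_deriv Xs G (k, z)) \<le>
        (1 + norm z) ^ N * (cmod (foldr left_deriv Xs F (k, z)) + cmod (foldr left_deriv Xs G (k, z)))"
      by (intro mult_left_mono norm_triangle_ineq) auto
    also have "\<dots> \<le> C + D" unfolding distrib_left using C D that by (intro add_mono) auto
    finally show ?thesis by (simp add: foldr_left_deriv_add s)
  qed
  then show "\<exists>C. \<forall>k\<in>U2. \<forall>z. (1 + norm z) ^ N * cmod (foldr left_deriv Xs (\<lambda>p. F p + G p) (k, z)) \<le> C" by blast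
qed

lemma decaying_cmult:
  assumes F: "decaying F" shows "decaying (\<lambda>p. c * F p)"
  unfolding decaying_def
proof (intro conjI allI impI)
  have s: "smooth F" using F by (auto simp: decaying_def)
  show "smooth (\<lambda>p. c * F p)" by (intro smooth_cmult s)
  fix Xs N assume Xs: "set Xs \<subseteq> skew_hermitian \<times> (UNIV :: (complex^2) set)"
  obtain C where C: "\<forall>k\<in>U2. \<forall>z. (1 + norm z) ^ N * cmod (foldr left_deriv Xs F (k, z)) \<le> C"
    using F Xs unfolding decaying_def by blast
  have "(1 + norm z) ^ N * cmod (foldr left_deriv Xs (\<lambda>p. c * F p) (k, z)) \<le> cmod c * C" if "k \<in> U2" for k z
    using mult_left_mono[OF C[rule_format, OF that, of z], of "cmod c"]
    by (simp add: foldr_left_deriv_cmult s norm_mult mult_ac)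
  then show "\<exists>C. \<forall>k\<in>U2. \<forall>z. (1 + norm z) ^ N * cmod (foldr left_deriv Xs (\<lambda>p. c * F p) (k, z)) \<le> C" by blast
qed

lemma continuous_on_slice:
  fixes z :: "complex^2"
  assumes "smooth F" shows "continuous_on S (\<lambda>k. F (k, z))"
  by (rule continuous_on_compose2[OF smooth_continuous[OF assms, of UNIV]]) (auto intro!: continuous_intros)

context admissible begin

lemma integrable_FT:
  fixes F :: "motion \<Rightarrow> complex"
  shows "smooth F \<Longrightarrow> integrable haar_U2 (\<lambda>k. F (k, z) * TU k a b)"
  by (intro integrable_haar_continuous continuous_on_mult continuous_on_slice[where F = F and z = z] continuous_on_TU)

lemma A_add: "smooth F \<Longrightarrow> smooth G \<Longrightarrow>
    A_transform m n (\<lambda>p. F p + G p) z a b = A_transform m n F z a b + A_transform m n G z a b"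
  by (simp add: A_transform_def distrib_right integrable_FT)

lemma A_cmult: "A_transform m n (\<lambda>p. c * F p) z a b = c * A_transform m n F z a b"
  by (simp add: A_transform_def mult.assoc)

lemma A_outside: assumes "n < a \<or> n < b" shows "A_transform m n F z a b = 0"
proof -
  have "(\<integral>k. F (k, z) * TU k a b \<partial>haar_U2) = (\<integral>k. 0 \<partial>haar_U2)"
    by (rule Bochner_Integration.integral_cong[OF refl]) (use assms in \<open>simp add: TU_outside space_haar\<close>)
  then show ?thesis by (simp add: A_transform_def)
qed

lemma A_bound:
  assumes "smooth F" "\<And>k. k \<in> U2 \<Longrightarrow> cmod (F (k, z)) \<le> B"
  shows "cmod (A_transform m n F z a b) \<le> B"
proof -
  have "cmod (A_transform m n F z a b) \<le> (\<integral>k. B \<partial>haar_U2)"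
    unfolding A_transform_def
  proof (rule order.trans[OF integral_norm_bound integral_mono[OF integrable_norm[OF integrable_FT[OF assms(1)]] finite_measure.integrable_const[OF finite_measure_haar]]])
    fix k assume "k \<in> space haar_U2"
    then have k: "k \<in> U2" by (simp add: space_haar)
    then have "cmod (F (k, z)) * cmod (TU k a b) \<le> cmod (F (k, z)) * 1" using norm_TU_le by (intro mult_left_mono) auto
    then show "cmod (F (k, z) * TU k a b) \<le> B" using assms(2)[OF k] by (simp add: norm_mult)
  qed
  then show ?thesis by (simp add: space_haar measure_haar)
qed

end

text \<open>
  The generators used below all satisfy \<open>X\<^sup>2 = -1\<close>, so that \<open>exp (t X) = cos t + (sin t) X\<close>.
\<close>

definition one_param :: "complex^2^2 \<Rightarrow> real \<Rightarrow> complex^2^2" where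
  "one_param X t = cos t *\<^sub>R mat 1 + sin t *\<^sub>R X"

definition generator :: "complex^2^2 \<Rightarrow> bool" where
  "generator X \<longleftrightarrow> X \<in> skew_hermitian \<and> X ** X = - mat 1"

lemma matrix_mult_linear: "linear (\<lambda>M :: complex^2^2. k ** M)" for k :: "complex^2^2"
  by (rule linearI) (simp_all add: mat2_eq_iff mmul2_nth algebra_simps)

lemma matrix_mult_linear_right: "linear (\<lambda>M :: complex^2^2. M ** k)" for k :: "complex^2^2"
  by (rule linearI) (simp_all add: mat2_eq_iff mmul2_nth algebra_simps)

lemma one_param_nth:
  "one_param X t $ i $ j = of_real (cos t) * (if i = j then 1 else 0) + of_real (sin t) * X $ i $ j"
  by (simp add: one_param_def mat2_nth scaleR_conv_of_real[where 'a = complex])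

lemma generator_entries:
  assumes "generator X"
  shows "X$1$1 * X$1$1 + X$1$2 * X$2$1 = -1" "X$1$1 * X$1$2 + X$1$2 * X$2$2 = 0"
    "X$2$1 * X$1$1 + X$2$2 * X$2$1 = 0" "X$2$1 * X$1$2 + X$2$2 * X$2$2 = -1"
  using assms by (simp_all add: generator_def mat2_eq_iff mmul2_nth mat2_nth)

lemma one_param_mult_minus:
  assumes X: "generator X" shows "one_param X t ** one_param X (- t) = mat 1"
proof -
  define c s where "c = complex_of_real (cos t)" and "s = complex_of_real (sin t)"
  have "c * c + s * s = complex_of_real ((cos t)\<^sup>2 + (sin t)\<^sup>2)" by (simp only: c_def s_def power2_eq_square of_real_add of_real_mult)
  then have cs: "c * c + s * s = 1" by simp
  have n: "one_param X t $ i $ j = c * (if i = j then 1 else 0) + s * X $ i $ j"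
    "one_param X (- t) $ i $ j = c * (if i = j then 1 else 0) - s * X $ i $ j" for i j
    by (simp_all add: one_param_nth c_def s_def)
  note e = generator_entries[OF X]
  have "(c + s * X$1$1) * (c - s * X$1$1) + s * X$1$2 * (- (s * X$2$1)) = 1" using e(1) cs by algebra
  moreover have "(c + s * X$1$1) * (- (s * X$1$2)) + s * X$1$2 * (c - s * X$2$2) = 0" using e(2) by algebra
  moreover have "s * X$2$1 * (c - s * X$1$1) + (c + s * X$2$2) * (- (s * X$2$1)) = 0" using e(3) by algebra
  moreover have "s * X$2$1 * (- (s * X$1$2)) + (c + s * X$2$2) * (c - s * X$2$2) = 1" using e(4) cs by algebra
  ultimately show ?thesis
    by (simp add: mat2_eq_iff mmul2_nth mat2_nth n)
qed

lemma conj_transpose_one_param: "generator X \<Longrightarrow> conj_transpose (one_param X t) = one_param X (- t)"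
proof -
  assume "generator X"
  then have "conj_transpose X = - X" by (simp add: generator_def skew_hermitian_def)
  then have "\<And>i j. cnj (X$j$i) = - X$i$j" by (metis conj_transpose_nth vector_uminus_component)
  then show ?thesis
    by (simp add: one_param_def mat2_eq_iff conj_transpose_nth mat2_nth)
qed

lemma one_param_U2: "generator X \<Longrightarrow> one_param X t \<in> U2"
  by (rule U2_I) (simp add: conj_transpose_one_param one_param_mult_minus)

lemma one_param_0: "one_param X 0 = mat 1"
  by (simp add: one_param_def)

lemma one_param_derivative:
  assumes "generator X"
  shows "(one_param X has_vector_derivative one_param X t ** X) (at t)"
proof -
  have "(one_param X has_vector_derivative (- sin t) *\<^sub>R mat 1 + cos t *\<^sub>R X) (at t)"
    unfolding one_param_def[abs_def]
    by (intro has_vector_derivative_add)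
      (auto intro!: has_vector_derivative_eq_rhs[OF has_vector_derivative_scaleR[OF _ has_vector_derivative_const]] DERIV_cos DERIV_sin
        simp: has_real_derivative_iff_has_vector_derivative[symmetric])
  moreover have "one_param X t ** X = (- sin t) *\<^sub>R mat 1 + cos t *\<^sub>R X"
  proof -
    have sR: "r *\<^sub>R x = of_real r * x" for r and x :: complex by (rule scaleR_conv_of_real)
    note e = generator_entries[OF assms]
    have "(c + s * X$1$1) * X$1$1 + s * X$1$2 * X$2$1 = c * X$1$1 - s" for c s using e(1) by algebra
    moreover have "(c + s * X$1$1) * X$1$2 + s * X$1$2 * X$2$2 = c * X$1$2" for c s using e(2) by algebra
    moreover have "s * X$2$1 * X$1$1 + (c + s * X$2$2) * X$2$1 = c * X$2$1" for c s using e(3) by algebra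
    moreover have "s * X$2$1 * X$1$2 + (c + s * X$2$2) * X$2$2 = c * X$2$2 - s" for c s using e(4) by algebra
    ultimately show ?thesis
      by (simp add: mat2_eq_iff mmul2_nth mat2_nth one_param_nth sR)
  qed
  ultimately show ?thesis by simp
qed

lemma left_deriv_along:
  assumes F: "smooth F" and X: "generator X"
  shows "((\<lambda>t. F (k ** one_param X t, z)) has_vector_derivative left_deriv (X, 0) F (k ** one_param X t, z)) (at t)"
proof -
  have bl: "bounded_linear (\<lambda>M :: complex^2^2. k ** M)" using matrix_mult_linear by (simp add: linear_conv_bounded_linear)
  have "((\<lambda>t. (k ** one_param X t, z)) has_vector_derivative (k ** (one_param X t ** X), 0)) (at t)"
    by (intro has_vector_derivative_Pair bounded_linear.has_vector_derivative[OF bl] one_param_derivative X has_vector_derivative_const)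
  then have "((\<lambda>t. (k ** one_param X t, z)) has_vector_derivative left_field (X, 0) (k ** one_param X t, z)) (at t)"
    by (simp add: left_field_def matrix_mul_assoc)
  from vector_derivative_diff_chain_within[OF this has_derivative_at_withinI[OF smooth_has_derivative[OF F]]]
  show ?thesis by (simp add: comp_def left_deriv_dir_deriv)
qed

context admissible begin

text \<open>Right translation by \<open>exp (t X)\<close> turns into right multiplication by \<open>TU (exp (- t X))\<close>.\<close>

lemma A_left_deriv:
  assumes F: "smooth F" and X: "generator X" and ab: "a \<le> n" "b \<le> n"
    and D: "\<And>c. c \<le> n \<Longrightarrow> ((\<lambda>t. TU (one_param X (- t)) c b) has_vector_derivative D c) (at 0)"
  shows "A_transform m n (left_deriv (X, 0) F) z a b = (\<Sum>c\<le>n. A_transform m n F z a c * D c)"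
proof -
  let ?E = "one_param X"
  have E: "?E t \<in> U2" for t by (rule one_param_U2[OF X])
  have cont: "continuous_on U2 (\<lambda>k. F (k ** ?E t, z) * TU k a b)" for t
  proof (intro continuous_on_mult continuous_on_TU continuous_on_compose2[OF smooth_continuous[OF F, of UNIV]])
    have "continuous_on U2 (\<lambda>k. k ** ?E t)"
      using matrix_mult_linear_right[of "?E t"] linear_continuous_on linear_conv_bounded_linear by blast
    then show "continuous_on U2 (\<lambda>k. (k ** ?E t, z))" by (intro continuous_intros)
  qed auto
  have "compact ((\<lambda>k. left_deriv (X, 0) F (k, z)) ` U2)"
    by (intro compact_continuous_image compact_U2 continuous_on_slice[where F = "left_deriv (X, 0) F" and z = z] smooth_left_deriv F)
  then obtain B where B: "B > 0" "\<forall>x\<in>(\<lambda>k. left_deriv (X, 0) F (k, z)) ` U2. cmod x \<le> B"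
    using compact_imp_bounded bounded_pos by metis
  have 1: "((\<lambda>t. \<integral>k. F (k ** ?E t, z) * TU k a b \<partial>haar_U2) has_vector_derivative
      (\<integral>k. left_deriv (X, 0) F (k ** ?E 0, z) * TU k a b \<partial>haar_U2)) (at 0)"
  proof (rule has_vector_derivative_integral[where \<delta> = 1 and G = "\<lambda>_. B"])
    show "integrable haar_U2 (\<lambda>k. F (k ** ?E t, z) * TU k a b)" for t
      by (rule integrable_haar_continuous[OF cont])
    show "((\<lambda>t. F (k ** ?E t, z) * TU k a b) has_vector_derivative left_deriv (X, 0) F (k ** ?E t, z) * TU k a b) (at t)" for t k
      by (intro has_vector_derivative_mult_left left_deriv_along F X)
    show "integrable haar_U2 (\<lambda>_. B)" by (rule finite_measure.integrable_const[OF finite_measure_haar])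
    fix t k assume "k \<in> space haar_U2"
    then have k: "k \<in> U2" by (simp add: space_haar)
    have "cmod (left_deriv (X, 0) F (k ** ?E t, z)) \<le> B" using B(2) U2_mult[OF k E] by blast
    then have "cmod (left_deriv (X, 0) F (k ** ?E t, z)) * cmod (TU k a b) \<le> B * 1"
      using norm_TU_le[OF k] B by (intro mult_mono) auto
    then show "cmod (left_deriv (X, 0) F (k ** ?E t, z) * TU k a b) \<le> B" by (simp add: norm_mult)
  qed simp
  have 2: "(\<integral>k. F (k ** ?E t, z) * TU k a b \<partial>haar_U2) = (\<Sum>c\<le>n. A_transform m n F z a c * TU (?E (- t)) c b)" for t
  proof -
    let ?g = "\<lambda>k. F (k, z) * TU (k ** ?E (- t)) a b"
    have "?E t ** ?E (- t) = mat 1" by (rule one_param_mult_minus[OF X])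
    then have i: "k ** ?E t ** ?E (- t) = k" for k by (simp flip: matrix_mul_assoc)
    have gs: "?g k = (\<Sum>c\<le>n. F (k, z) * TU k a c * TU (?E (- t)) c b)" if "k \<in> U2" for k
      using that ab by (simp add: TU_mult E sum_distrib_left mult_ac)
    have "?g \<in> borel_measurable haar_U2"
    proof (subst measurable_cong)
      show "(\<lambda>k. \<Sum>c\<le>n. F (k, z) * TU k a c * TU (?E (- t)) c b) \<in> borel_measurable haar_U2"
        by (intro borel_measurable_sum borel_measurable_times borel_measurable_const borel_measurable_integrable
            measurable_haar_continuous continuous_on_TU continuous_on_slice[where F = F and z = z] F)
    qed (use gs space_haar in auto)
    from haar_right[OF E this, of t] have "(\<integral>k. F (k ** ?E t, z) * TU k a b \<partial>haar_U2) = (\<integral>k. ?g k \<partial>haar_U2)"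
      by (simp add: i)
    also have "\<dots> = (\<integral>k. (\<Sum>c\<le>n. F (k, z) * TU k a c * TU (?E (- t)) c b) \<partial>haar_U2)"
      by (rule Bochner_Integration.integral_cong[OF refl]) (simp add: gs space_haar)
    also have "\<dots> = (\<Sum>c\<le>n. A_transform m n F z a c * TU (?E (- t)) c b)"
      unfolding A_transform_def by (subst Bochner_Integration.integral_sum) (auto intro!: integrable_mult_left integrable_FT F)
    finally show ?thesis .
  qed
  have "((\<lambda>t. \<integral>k. F (k ** ?E t, z) * TU k a b \<partial>haar_U2) has_vector_derivative (\<Sum>c\<le>n. A_transform m n F z a c * D c)) (at 0)"
    unfolding 2 by (intro has_vector_derivative_sum has_vector_derivative_mult_right D) simp
  from vector_derivative_unique_at[OF 1 this] show ?thesis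
    by (simp add: one_param_0 A_transform_def)
qed

end

subsection \<open>The Casimir element and decay in the representation parameters\<close>

text \<open>The choices \<open>\<gamma> = 1\<close> and \<open>\<gamma> = \<i>\<close>, together
  with \<open>gen_diag\<close> and \<open>mat \<i>\<close>, form a basis of the Lie algebra of
  \<open>U2\<close> whose elements all have square \<open>- mat 1\<close>.\<close>

definition gen_rot :: "complex \<Rightarrow> complex^2^2" where
  "gen_rot \<gamma> = vector [vector [0, \<gamma>], vector [- cnj \<gamma>, 0]]"

definition gen_diag :: "complex^2^2" where
  "gen_diag = vector [vector [\<i>, 0], vector [0, - \<i>]]"

lemma gen_rot_nth: "gen_rot \<gamma> $ 1 $ 1 = 0" "gen_rot \<gamma> $ 1 $ 2 = \<gamma>" "gen_rot \<gamma> $ 2 $ 1 = - cnj \<gamma>" "gen_rot \<gamma> $ 2 $ 2 = 0"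
  by (simp_all add: gen_rot_def)

lemma gen_diag_nth: "gen_diag $ 1 $ 1 = \<i>" "gen_diag $ 1 $ 2 = 0" "gen_diag $ 2 $ 1 = 0" "gen_diag $ 2 $ 2 = - \<i>"
  by (simp_all add: gen_diag_def)

lemma generator_rot: assumes "cmod \<gamma> = 1" shows "generator (gen_rot \<gamma>)"
proof -
  have "\<gamma> * cnj \<gamma> = 1" using assms by (simp flip: complex_norm_square)
  then show ?thesis
    by (simp add: generator_def skew_hermitian_def mat2_eq_iff mmul2_nth mat2_nth conj_transpose_nth gen_rot_nth mult.commute)
qed

lemma generator_diag: "generator gen_diag"
  by (simp add: generator_def skew_hermitian_def mat2_eq_iff mmul2_nth mat2_nth conj_transpose_nth gen_diag_nth)

lemma generator_scalar: "generator (mat \<i>)"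
  by (simp add: generator_def skew_hermitian_def mat2_eq_iff mmul2_nth mat2_nth conj_transpose_nth)

lemma det_one_param_rot: assumes "cmod \<gamma> = 1" shows "det (one_param (gen_rot \<gamma>) t) = 1"
proof -
  have g: "\<gamma> * cnj \<gamma> = 1" using assms by (simp flip: complex_norm_square)
  have "det (one_param (gen_rot \<gamma>) t) = of_real (cos t) * of_real (cos t) + of_real (sin t) * of_real (sin t) * (\<gamma> * cnj \<gamma>)"
    by (simp add: det_2 one_param_nth gen_rot_nth mult_ac)
  also have "\<dots> = of_real ((cos t)\<^sup>2 + (sin t)\<^sup>2)"
    by (simp only: g mult_1_right power2_eq_square of_real_add of_real_mult)
  finally show ?thesis by simp
qed

lemma det_one_param_diag: "det (one_param gen_diag t) = 1"
proof -
  have "det (one_param gen_diag t) = of_real (cos t) * of_real (cos t) + of_real (sin t) * of_real (sin t)"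
    by (simp add: det_2 one_param_nth gen_diag_nth algebra_simps)
  also have "\<dots> = of_real ((cos t)\<^sup>2 + (sin t)\<^sup>2)"
    by (simp only: power2_eq_square of_real_add of_real_mult)
  finally show ?thesis by simp
qed

lemma one_param_scalar: "one_param (mat \<i>) t = mat (cis t)"
  by (simp add: mat2_eq_iff one_param_nth mat2_nth complex_eq_iff)

section \<open>The infinitesimal representation on polynomials\<close>

lemma has_vector_derivative_power:
  fixes u :: "real \<Rightarrow> complex"
  assumes "(u has_vector_derivative u') (at t)"
  shows "((\<lambda>t. u t ^ k) has_vector_derivative of_nat k * u t ^ (k - 1) * u') (at t)"
proof -
  have "((\<lambda>x. x ^ k) has_field_derivative of_nat k * u t ^ (k - 1)) (at (u t))"
    by (auto intro!: derivative_eq_intros)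
  from field_vector_diff_chain_at[OF assms this] show ?thesis by (simp add: comp_def mult_ac)
qed

lemma one_param_mult_vec: "(one_param X t *v z) $ i = of_real (cos t) * z $ i + of_real (sin t) * (X *v z) $ i"
proof -
  have "i = 1 \<or> i = 2" by (rule exhaust_2)
  then show ?thesis by (auto simp: mvec2_nth one_param_nth algebra_simps)
qed

lemma one_param_mult_vec_derivative:
  "((\<lambda>t. (one_param X t *v z) $ i) has_vector_derivative (X *v (one_param X t *v z)) $ i) (at t)"
  if "generator X"
proof -
  have 1: "((\<lambda>t. complex_of_real (cos t)) has_vector_derivative of_real (- sin t)) (at t)"
    "((\<lambda>t. complex_of_real (sin t)) has_vector_derivative of_real (cos t)) (at t)"
    by (intro has_vector_derivative_of_real, auto simp: has_real_derivative_iff_has_vector_derivative[symmetric] intro!: derivative_eq_intros)+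
  have "((\<lambda>t. of_real (cos t) * z $ i + of_real (sin t) * (X *v z) $ i) has_vector_derivative
      of_real (- sin t) * z $ i + of_real (cos t) * (X *v z) $ i) (at t)"
    by (intro has_vector_derivative_add has_vector_derivative_mult_left 1)
  moreover have "(X *v (one_param X t *v z)) $ i = of_real (- sin t) * z $ i + of_real (cos t) * (X *v z) $ i"
  proof -
    have "X *v (X *v z) = - z"
      using that by (simp add: generator_def matrix_vector_mul_assoc) (simp add: vec_eq_iff forall_2 mvec2_nth mat2_nth)
    then have xx: "(X *v (X *v z)) $ i = - z $ i" by simp
    have "one_param X t *v z = cos t *\<^sub>R z + sin t *\<^sub>R (X *v z)"
      by (simp add: vec_eq_iff one_param_mult_vec scaleR_conv_of_real[where 'a = complex])
    then have "(X *v (one_param X t *v z)) $ i = of_real (cos t) * (X *v z) $ i + of_real (sin t) * (X *v (X *v z)) $ i"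
      using exhaust_2[of i] by (auto simp: mvec2_nth scaleR_conv_of_real[where 'a = complex] algebra_simps)
    then show ?thesis unfolding xx by simp
  qed
  ultimately show ?thesis by (simp add: one_param_mult_vec)
qed

text \<open>The derivative of \<open>basis_V n b\<close> at \<open>z\<close> in the direction
  \<open>v\<close>; where a truncated exponent such as \<open>b - 1\<close> would matter, its
  numerical factor is 0.\<close>

definition basis_V_deriv :: "nat \<Rightarrow> nat \<Rightarrow> complex^2 \<Rightarrow> complex^2 \<Rightarrow> complex" where
  "basis_V_deriv n b z v = of_real (sqrt (real (n choose b))) *
     (of_nat b * (z$1) ^ (b - 1) * v$1 * (z$2) ^ (n - b) + of_nat (n - b) * (z$1) ^ b * (z$2) ^ (n - b - 1) * v$2)"

text \<open>\<open>tau\<close> at \<open>one_param X (- t)\<close> substitutes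
  \<open>one_param X t *v z\<close> into the basis polynomials, so its derivative at 0 is the
  derivation along \<open>X *v z\<close>. The point evaluations at \<open>pt i\<close> then extract
  coordinates.\<close>

lemma tau_one_param_derivative:
  assumes X: "generator X" and bc: "b \<le> n" "c \<le> n"
    and D: "\<And>z. basis_V_deriv n b z (X *v z) = (\<Sum>c\<le>n. D c * basis_V n c z)"
  shows "((\<lambda>t. tau n (one_param X (- t)) c b) has_vector_derivative D c) (at 0)"
proof -
  have t: "tau n (one_param X (- t)) c b = (\<Sum>i\<le>n. coord_weight n c i * basis_V n b (one_param X t *v pt i))" for t
    using tau_eval[OF one_param_U2[OF X] bc(2), of "- t" b] conj_transpose_one_param[OF X, of "- t"] by simp
  have d: "((\<lambda>t. basis_V n b (one_param X t *v z)) has_vector_derivative basis_V_deriv n b z (X *v z)) (at 0)" for z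
  proof -
    note p = has_vector_derivative_power[OF one_param_mult_vec_derivative[OF X, of z _ 0]]
    have "((\<lambda>t. of_real (sqrt (real (n choose b))) * ((one_param X t *v z) $ 1 ^ b * (one_param X t *v z) $ 2 ^ (n - b))) has_vector_derivative
        of_real (sqrt (real (n choose b))) *
        ((one_param X 0 *v z) $ 1 ^ b * (of_nat (n - b) * (one_param X 0 *v z) $ 2 ^ (n - b - 1) * (X *v (one_param X 0 *v z)) $ 2)
        + of_nat b * (one_param X 0 *v z) $ 1 ^ (b - 1) * (X *v (one_param X 0 *v z)) $ 1 * (one_param X 0 *v z) $ 2 ^ (n - b))) (at 0)"
      by (intro has_vector_derivative_mult_right has_vector_derivative_mult p)
    then show ?thesis
      by (simp add: basis_V_def basis_V_deriv_def one_param_0 mult.assoc) (simp add: algebra_simps)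
  qed
  have "((\<lambda>t. tau n (one_param X (- t)) c b) has_vector_derivative (\<Sum>i\<le>n. coord_weight n c i * basis_V_deriv n b (pt i) (X *v pt i))) (at 0)"
    unfolding t by (intro has_vector_derivative_sum has_vector_derivative_mult_right d)
  moreover have "(\<Sum>i\<le>n. coord_weight n c i * basis_V_deriv n b (pt i) (X *v pt i)) = D c"
  proof -
    let ?D = "\<lambda>c. if c \<le> n then D c else 0"
    define p where "p = (\<lambda>z. \<Sum>c\<le>n. ?D c * basis_V n c z)"
    have p: "p \<in> hom_polys n" unfolding V_iff_coords p_def by (intro exI[of _ ?D]) auto
    have "coord_V n p = ?D" by (rule coord_V_eq) (auto simp: p_def)
    then have "D c = coord_V n p c" using bc by simp
    also have "\<dots> = (\<Sum>i\<le>n. coord_weight n c i * p (pt i))" by (rule coord_eval[OF p bc(2)])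
    also have "\<dots> = (\<Sum>i\<le>n. coord_weight n c i * basis_V_deriv n b (pt i) (X *v pt i))" by (simp add: D p_def)
    finally show ?thesis by simp
  qed
  ultimately show ?thesis by simp
qed

text \<open>The matrix element of the raising and lowering operators of su(2) between the indices
  \<open>b\<close> and \<open>b + 1\<close> in the orthonormal basis.\<close>

definition ladder :: "nat \<Rightarrow> nat \<Rightarrow> complex" where
  "ladder n b = of_real (sqrt (real (Suc b * (n - b))))"

lemma ladder_square: "ladder n b * ladder n b = of_nat (Suc b * (n - b))"
proof -
  have "ladder n b * ladder n b = complex_of_real (sqrt (real (Suc b * (n - b))) * sqrt (real (Suc b * (n - b))))"
    by (simp only: ladder_def of_real_mult)
  also have "\<dots> = of_real (real (Suc b * (n - b)))" by (subst real_sqrt_mult_self) simp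
  finally show ?thesis by simp
qed

lemma ladder_top: "n \<le> b \<Longrightarrow> ladder n b = 0"
  by (simp add: ladder_def)

lemma sqrt_binomial_step:
  "sqrt (real (n choose b)) * real (n - b) = sqrt (real (Suc b * (n - b))) * sqrt (real (n choose Suc b))"
  "sqrt (real (n choose Suc b)) * real (Suc b) = sqrt (real (Suc b * (n - b))) * sqrt (real (n choose b))"
proof -
  have e: "(n choose Suc b) * Suc b = (n choose b) * (n - b)"
    using binomial_absorb_comp[of n b] Suc_times_binomial_add by (metis binomial_absorption binomial_absorb_comp mult.commute)
  have "real (Suc b * (n - b)) * real (n choose Suc b) = real ((n choose Suc b) * Suc b) * real (n - b)"
    by (simp only: of_nat_mult mult_ac)
  also have "\<dots> = real (n choose b) * (real (n - b))\<^sup>2" unfolding e by (simp add: power2_eq_square)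
  finally have 1: "real (Suc b * (n - b)) * real (n choose Suc b) = real (n choose b) * (real (n - b))\<^sup>2" .
  show "sqrt (real (n choose b)) * real (n - b) = sqrt (real (Suc b * (n - b))) * sqrt (real (n choose Suc b))"
    unfolding real_sqrt_mult[symmetric] 1 by (simp add: real_sqrt_mult del: of_nat_Suc)
  have "real (Suc b * (n - b)) * real (n choose b) = real ((n choose b) * (n - b)) * real (Suc b)"
    by (simp only: of_nat_mult mult_ac)
  also have "\<dots> = real (n choose Suc b) * (real (Suc b))\<^sup>2" unfolding e[symmetric] by (simp only: of_nat_mult power2_eq_square mult_ac)
  finally have 2: "real (Suc b * (n - b)) * real (n choose b) = real (n choose Suc b) * (real (Suc b))\<^sup>2" .
  show "sqrt (real (n choose Suc b)) * real (Suc b) = sqrt (real (Suc b * (n - b))) * sqrt (real (n choose b))"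
    unfolding real_sqrt_mult[symmetric] 2 by (simp add: real_sqrt_mult del: of_nat_Suc)
qed

lemma raise_basis_V:
  assumes "b < n"
  shows "of_real (sqrt (real (n choose b))) * (of_nat (n - b) * (z$1) ^ b * (z$2) ^ (n - b - 1) * z$1) = ladder n b * basis_V n (Suc b) z"
proof -
  have "complex_of_real (sqrt (real (n choose b)) * real (n - b)) = of_real (sqrt (real (Suc b * (n - b))) * sqrt (real (n choose Suc b)))"
    by (simp only: sqrt_binomial_step)
  then have "complex_of_real (sqrt (real (n choose b))) * of_nat (n - b) = ladder n b * of_real (sqrt (real (n choose Suc b)))"
    by (simp only: of_real_mult ladder_def of_real_of_nat_eq)
  then show ?thesis by (simp add: basis_V_def mult.assoc[symmetric])
qed

lemma lower_basis_V:
  assumes "b < n"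
  shows "of_real (sqrt (real (n choose Suc b))) * (of_nat (Suc b) * (z$1) ^ b * z$2 * (z$2) ^ (n - Suc b)) = ladder n b * basis_V n b z"
proof -
  have "complex_of_real (sqrt (real (n choose Suc b)) * real (Suc b)) = of_real (sqrt (real (Suc b * (n - b))) * sqrt (real (n choose b)))"
    by (simp only: sqrt_binomial_step)
  then have 1: "complex_of_real (sqrt (real (n choose Suc b))) * of_nat (Suc b) = ladder n b * of_real (sqrt (real (n choose b)))"
    by (simp only: of_real_mult ladder_def of_real_of_nat_eq)
  have "n - b = Suc (n - Suc b)" using assms by simp
  then have 2: "z$2 * (z$2) ^ (n - Suc b) = (z$2) ^ (n - b)" by simp
  have "of_real (sqrt (real (n choose Suc b))) * (of_nat (Suc b) * (z$1) ^ b * z$2 * (z$2) ^ (n - Suc b)) =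
      (of_real (sqrt (real (n choose Suc b))) * of_nat (Suc b)) * (z$1) ^ b * (z$2 * (z$2) ^ (n - Suc b))"
    by (simp only: mult_ac)
  then show ?thesis unfolding 1 2 by (simp add: basis_V_def mult_ac)
qed

text \<open>The infinitesimal action of \<open>gen_rot \<gamma>\<close>: \<open>\<gamma>\<close>
  multiplies the lowering part and \<open>cnj \<gamma>\<close> the raising part, so complex
  combinations of \<open>\<gamma> = 1\<close> and \<open>\<gamma> = \<i>\<close> separate the
  two.\<close>

definition rot_matrix :: "nat \<Rightarrow> complex \<Rightarrow> nat \<Rightarrow> nat \<Rightarrow> complex" where
  "rot_matrix n \<gamma> c b = (if Suc c = b then \<gamma> * ladder n c else 0) - (if c = Suc b then cnj \<gamma> * ladder n b else 0)"

lemma rot_matrix: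
  assumes b: "b \<le> n"
  shows "basis_V_deriv n b z (gen_rot \<gamma> *v z) = (\<Sum>c\<le>n. rot_matrix n \<gamma> c b * basis_V n c z)"
proof -
  have 1: "(\<Sum>c\<le>n. (if Suc c = b then \<gamma> * ladder n c else 0) * basis_V n c z) =
      \<gamma> * (of_real (sqrt (real (n choose b))) * (of_nat b * (z$1) ^ (b - 1) * z$2 * (z$2) ^ (n - b)))"
  proof (cases b)
    case 0
    then show ?thesis by simp
  next
    case (Suc b')
    have "(\<Sum>c\<le>n. (if Suc c = b then \<gamma> * ladder n c else 0) * basis_V n c z) = (\<Sum>c\<le>n. if c = b' then \<gamma> * (ladder n b' * basis_V n b' z) else 0)"
      using Suc by (intro sum.cong) auto
    also have "\<dots> = \<gamma> * (ladder n b' * basis_V n b' z)" using Suc b by simp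
    finally show ?thesis using lower_basis_V[of b' n z] Suc b by simp
  qed
  have 2: "(\<Sum>c\<le>n. (if c = Suc b then cnj \<gamma> * ladder n b else 0) * basis_V n c z) =
      cnj \<gamma> * (of_real (sqrt (real (n choose b))) * (of_nat (n - b) * (z$1) ^ b * (z$2) ^ (n - b - 1) * z$1))"
  proof (cases "b < n")
    case True
    have "(\<Sum>c\<le>n. (if c = Suc b then cnj \<gamma> * ladder n b else 0) * basis_V n c z) = (\<Sum>c\<le>n. if c = Suc b then cnj \<gamma> * (ladder n b * basis_V n (Suc b) z) else 0)"
      by (intro sum.cong) auto
    also have "\<dots> = cnj \<gamma> * (ladder n b * basis_V n (Suc b) z)" using True by simp
    finally show ?thesis using raise_basis_V[OF True, of z] by simp
  next
    case False
    then have "b = n" using b by simp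
    then show ?thesis by (simp add: ladder_top)
  qed
  have "(\<Sum>c\<le>n. rot_matrix n \<gamma> c b * basis_V n c z) =
      (\<Sum>c\<le>n. (if Suc c = b then \<gamma> * ladder n c else 0) * basis_V n c z) - (\<Sum>c\<le>n. (if c = Suc b then cnj \<gamma> * ladder n b else 0) * basis_V n c z)"
    by (simp only: rot_matrix_def left_diff_distrib sum_subtractf)
  then show ?thesis unfolding 1 2
    by (simp add: basis_V_deriv_def mvec2_nth gen_rot_nth algebra_simps)
qed

lemma diag_matrix:
  assumes b: "b \<le> n"
  shows "basis_V_deriv n b z (gen_diag *v z) = (\<Sum>c\<le>n. (if c = b then \<i> * of_real (2 * real b - real n) else 0) * basis_V n c z)"
proof -
  have p: "of_nat k * x ^ (k - 1) * x = of_nat k * x ^ k" for k and x :: complex by (cases k) auto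
  have "basis_V_deriv n b z (gen_diag *v z) = of_real (sqrt (real (n choose b))) *
      (\<i> * (of_nat b * (z$1) ^ (b - 1) * z$1) * (z$2) ^ (n - b) - \<i> * (z$1) ^ b * (of_nat (n - b) * (z$2) ^ (n - b - 1) * z$2))"
    by (simp add: basis_V_deriv_def mvec2_nth gen_diag_nth algebra_simps)
  also have "\<dots> = (\<i> * (of_nat b - of_nat (n - b))) * basis_V n b z"
    unfolding p by (simp add: basis_V_def algebra_simps)
  also have "of_nat b - of_nat (n - b) = complex_of_real (2 * real b - real n)"
    using b by (simp add: of_nat_diff)
  also have "\<i> * complex_of_real (2 * real b - real n) * basis_V n b z = (\<Sum>c\<le>n. if c = b then \<i> * of_real (2 * real b - real n) * basis_V n b z else 0)"
    using b by simp
  also have "\<dots> = (\<Sum>c\<le>n. (if c = b then \<i> * of_real (2 * real b - real n) else 0) * basis_V n c z)"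
    by (intro sum.cong) auto
  finally show ?thesis .
qed

section \<open>Invariant differential operators and the Casimir element\<close>

definition D_rot :: "complex \<Rightarrow> (motion \<Rightarrow> complex) \<Rightarrow> motion \<Rightarrow> complex" where
  "D_rot \<gamma> = left_deriv (gen_rot \<gamma>, 0)"

text \<open>Here the \<open>cnj \<gamma>\<close> part of \<open>rot_matrix\<close> cancels, in
  \<open>D_raise\<close> the \<open>\<gamma>\<close> part. The names refer to the column index of
  \<open>A_transform\<close>, which is shifted down or up.\<close>

definition D_low :: "(motion \<Rightarrow> complex) \<Rightarrow> motion \<Rightarrow> complex" where
  "D_low F = (\<lambda>p. (1 / 2) * D_rot 1 F p + (- \<i> / 2) * D_rot \<i> F p)"

definition D_raise :: "(motion \<Rightarrow> complex) \<Rightarrow> motion \<Rightarrow> complex" where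
  "D_raise F = (\<lambda>p. (- 1 / 2) * D_rot 1 F p + (- \<i> / 2) * D_rot \<i> F p)"

definition D_diag :: "(motion \<Rightarrow> complex) \<Rightarrow> motion \<Rightarrow> complex" where
  "D_diag = left_deriv (gen_diag, 0)"

definition D_scalar :: "(motion \<Rightarrow> complex) \<Rightarrow> motion \<Rightarrow> complex" where
  "D_scalar = left_deriv (mat \<i>, 0)"

text \<open>The Casimir element of su(2) minus the square of the central direction plus the
  identity, normalised so as to act by \<open>(n + 1)^2 + m^2\<close>.\<close>

definition casimir :: "(motion \<Rightarrow> complex) \<Rightarrow> motion \<Rightarrow> complex" where
  "casimir F = (\<lambda>p. F p + (2 * D_low (D_raise F) p + (2 * D_raise (D_low F) p + ((-1) * D_diag (D_diag F) p + (-1) * D_scalar (D_scalar F) p))))"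

lemma generator_skew: "generator X \<Longrightarrow> fst (X, 0::complex^2) \<in> skew_hermitian"
  by (simp add: generator_def)

lemma decaying_D:
  assumes "decaying F"
  shows "cmod \<gamma> = 1 \<Longrightarrow> decaying (D_rot \<gamma> F)" "decaying (D_low F)" "decaying (D_raise F)" "decaying (D_diag F)" "decaying (D_scalar F)"
proof -
  show r: "cmod \<gamma> = 1 \<Longrightarrow> decaying (D_rot \<gamma> F)" for \<gamma>
    unfolding D_rot_def by (rule decaying_left_deriv[OF assms generator_skew[OF generator_rot]])
  show "decaying (D_low F)" "decaying (D_raise F)" unfolding D_low_def D_raise_def
    by (intro decaying_add decaying_cmult r; simp)+
  show "decaying (D_diag F)" "decaying (D_scalar F)" unfolding D_diag_def D_scalar_def
    by (rule decaying_left_deriv[OF assms generator_skew[OF generator_diag]] decaying_left_deriv[OF assms generator_skew[OF generator_scalar]])+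
qed

lemma decaying_casimir: "decaying F \<Longrightarrow> decaying (casimir F)"
  unfolding casimir_def by (intro decaying_add decaying_cmult decaying_D)

context admissible begin

lemma TU_one_param_rot:
  assumes "cmod \<gamma> = 1" "b \<le> n" "c \<le> n"
  shows "((\<lambda>t. TU (one_param (gen_rot \<gamma>) (- t)) c b) has_vector_derivative rot_matrix n \<gamma> c b) (at 0)"
proof -
  have X: "generator (gen_rot \<gamma>)" by (rule generator_rot[OF assms(1)])
  show ?thesis
    using tau_one_param_derivative[OF X assms(2,3) rot_matrix[OF assms(2)]]
    by (simp add: TU_det[OF one_param_U2[OF X]] det_one_param_rot[OF assms(1)])
qed

lemma A_rot:
  assumes F: "decaying F" and "cmod \<gamma> = 1" and ab: "a \<le> n" "b \<le> n"
  shows "A_transform m n (D_rot \<gamma> F) z a b =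
    (if b = 0 then 0 else \<gamma> * ladder n (b - 1) * A_transform m n F z a (b - 1)) - cnj \<gamma> * ladder n b * A_transform m n F z a (Suc b)"
proof -
  let ?A = "A_transform m n F z a"
  have "A_transform m n (D_rot \<gamma> F) z a b = (\<Sum>c\<le>n. ?A c * rot_matrix n \<gamma> c b)"
    unfolding D_rot_def
    by (rule A_left_deriv[OF decaying_smooth[OF F] generator_rot[OF assms(2)] ab TU_one_param_rot[OF assms(2) ab(2)]])
  also have "\<dots> = (\<Sum>c\<le>n. if Suc c = b then \<gamma> * ladder n c * ?A c else 0) - (\<Sum>c\<le>n. if c = Suc b then cnj \<gamma> * ladder n b * ?A (Suc b) else 0)"
    unfolding rot_matrix_def right_diff_distrib sum_subtractf by (intro arg_cong2[of _ _ _ _ "(-)"] sum.cong) auto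
  also have "(\<Sum>c\<le>n. if c = Suc b then cnj \<gamma> * ladder n b * ?A (Suc b) else 0) = cnj \<gamma> * ladder n b * ?A (Suc b)"
    using ab by (auto simp: ladder_top)
  also have "(\<Sum>c\<le>n. if Suc c = b then \<gamma> * ladder n c * ?A c else 0) = (if b = 0 then 0 else \<gamma> * ladder n (b - 1) * ?A (b - 1))"
  proof (cases b)
    case (Suc b')
    have "(\<Sum>c\<le>n. if Suc c = b then \<gamma> * ladder n c * ?A c else 0) = (\<Sum>c\<le>n. if c = b' then \<gamma> * ladder n b' * ?A b' else 0)"
      using Suc by (intro sum.cong) auto
    then show ?thesis using Suc ab by simp
  qed simp
  finally show ?thesis .
qed

lemma A_low:
  assumes F: "decaying F" and ab: "a \<le> n" "b \<le> n"
  shows "A_transform m n (D_low F) z a b = (if b = 0 then 0 else ladder n (b - 1) * A_transform m n F z a (b - 1))"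
proof -
  have s: "smooth (D_rot \<gamma> F)" if "cmod \<gamma> = 1" for \<gamma> using decaying_D(1)[OF F that] decaying_smooth by blast
  have "A_transform m n (D_low F) z a b = (1 / 2) * A_transform m n (D_rot 1 F) z a b + (- \<i> / 2) * A_transform m n (D_rot \<i> F) z a b"
    unfolding D_low_def by (simp only: A_add[OF smooth_cmult[OF s] smooth_cmult[OF s]] A_cmult norm_one norm_ii)
  then show ?thesis
    unfolding A_rot[OF F norm_one ab] A_rot[OF F norm_ii ab] by (cases "b = 0") (simp_all add: algebra_simps)
qed

lemma A_raise:
  assumes F: "decaying F" and ab: "a \<le> n" "b \<le> n"
  shows "A_transform m n (D_raise F) z a b = ladder n b * A_transform m n F z a (Suc b)"
proof -
  have s: "smooth (D_rot \<gamma> F)" if "cmod \<gamma> = 1" for \<gamma> using decaying_D(1)[OF F that] decaying_smooth by blast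
  have "A_transform m n (D_raise F) z a b = (- 1 / 2) * A_transform m n (D_rot 1 F) z a b + (- \<i> / 2) * A_transform m n (D_rot \<i> F) z a b"
    unfolding D_raise_def by (simp only: A_add[OF smooth_cmult[OF s] smooth_cmult[OF s]] A_cmult norm_one norm_ii)
  then show ?thesis
    unfolding A_rot[OF F norm_one ab] A_rot[OF F norm_ii ab] by (cases "b = 0") (simp_all add: algebra_simps)
qed

lemma A_diag:
  assumes F: "decaying F" and ab: "a \<le> n" "b \<le> n"
  shows "A_transform m n (D_diag F) z a b = \<i> * of_real (2 * real b - real n) * A_transform m n F z a b"
proof -
  have "A_transform m n (D_diag F) z a b = (\<Sum>c\<le>n. A_transform m n F z a c * (if c = b then \<i> * of_real (2 * real b - real n) else 0))"
    unfolding D_diag_def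
  proof (rule A_left_deriv[OF decaying_smooth[OF F] generator_diag ab])
    fix c assume c: "c \<le> n"
    show "((\<lambda>t. TU (one_param gen_diag (- t)) c b) has_vector_derivative (if c = b then \<i> * of_real (2 * real b - real n) else 0)) (at 0)"
      using tau_one_param_derivative[OF generator_diag ab(2) c diag_matrix[OF ab(2)]]
      by (simp add: TU_det[OF one_param_U2[OF generator_diag]] det_one_param_diag)
  qed
  also have "\<dots> = (\<Sum>c\<le>n. if c = b then \<i> * of_real (2 * real b - real n) * A_transform m n F z a b else 0)"
    by (intro sum.cong) auto
  finally show ?thesis using ab by simp
qed

lemma A_scalar:
  assumes F: "decaying F" and ab: "a \<le> n" "b \<le> n"
  shows "A_transform m n (D_scalar F) z a b = \<i> * of_int m * A_transform m n F z a b"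
proof -
  have "A_transform m n (D_scalar F) z a b = (\<Sum>c\<le>n. A_transform m n F z a c * (if c = b then \<i> * of_int m else 0))"
    unfolding D_scalar_def
  proof (rule A_left_deriv[OF decaying_smooth[OF F] generator_scalar ab])
    fix c assume c: "c \<le> n"
    have "mat 1 \<in> SU2" by (simp add: SU2_def U2_one)
    from tau_U2_eq[OF mn this] have "TU (one_param (mat \<i>) (- t)) c b = cis (of_int m * t) * (if c = b then 1 else 0)" for t
      using tau_one[OF c ab(2)] by (simp add: one_param_scalar)
    moreover have "((\<lambda>t. cis (of_int m * t) * (if c = b then 1 else 0)) has_vector_derivative (if c = b then \<i> * of_int m else 0)) (at 0)"
    proof -
      have "((\<lambda>t. cis (of_int m * t)) has_vector_derivative \<i> * of_int m) (at 0)"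
      proof -
        have "((\<lambda>t. cos (of_int m * t)) has_real_derivative 0) (at (0::real))"
          "((\<lambda>t. sin (of_int m * t)) has_real_derivative of_int m) (at (0::real))"
          by (auto intro!: derivative_eq_intros)
        note this[THEN has_vector_derivative_of_real]
        then have "((\<lambda>t. complex_of_real (cos (of_int m * t)) + \<i> * complex_of_real (sin (of_int m * t))) has_vector_derivative
            complex_of_real 0 + \<i> * complex_of_real (of_int m)) (at 0)"
          by (intro has_vector_derivative_add has_vector_derivative_mult_right)
        then show ?thesis by (simp add: complex_eq_iff cis.code Complex_eq)
      qed
      then show ?thesis by auto
    qed
    ultimately show "((\<lambda>t. TU (one_param (mat \<i>) (- t)) c b) has_vector_derivative (if c = b then \<i> * of_int m else 0)) (at 0)"
      by simp
  qed
  also have "\<dots> = (\<Sum>c\<le>n. if c = b then \<i> * of_int m * A_transform m n F z a b else 0)"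
    by (intro sum.cong) auto
  finally show ?thesis using ab by simp
qed

text \<open>The two mixed products of ladder operators give \<open>b * (n + 1 - b)\<close> and
  \<open>(b + 1) * (n - b)\<close>, the diagonal direction gives \<open>(2 * b - n)^2\<close>; in
  the combination the dependence on the column \<open>b\<close> cancels.\<close>

lemma A_casimir:
  assumes F: "decaying F" and ab: "a \<le> n" "b \<le> n"
  shows "A_transform m n (casimir F) z a b = of_real (1 + (real n)\<^sup>2 + 2 * real n + (real_of_int m)\<^sup>2) * A_transform m n F z a b"
proof -
  let ?A = "A_transform m n F z a b"
  note dec = decaying_D(2-)[OF F] decaying_D(2)[OF decaying_D(3)[OF F]] decaying_D(3)[OF decaying_D(2)[OF F]]
    decaying_D(4)[OF decaying_D(4)[OF F]] decaying_D(5)[OF decaying_D(5)[OF F]]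
  note s = dec[THEN decaying_smooth] decaying_smooth[OF F]
  have 1: "A_transform m n (D_low (D_raise F)) z a b = of_real (real (b * (n + 1 - b))) * ?A"
  proof (cases b)
    case (Suc b')
    have "A_transform m n (D_low (D_raise F)) z a b = (ladder n b' * ladder n b') * ?A"
      using ab Suc by (simp add: A_low[OF dec(2)] A_raise[OF F])
    then show ?thesis using Suc by (simp add: ladder_square)
  qed (use ab in \<open>simp add: A_low[OF dec(2)]\<close>)
  have 2: "A_transform m n (D_raise (D_low F)) z a b = of_real (real (Suc b * (n - b))) * ?A"
  proof (cases "b < n")
    case True
    have "A_transform m n (D_raise (D_low F)) z a b = (ladder n b * ladder n b) * ?A"
      using ab True by (simp add: A_raise[OF dec(1)] A_low[OF F])
    then show ?thesis by (simp add: ladder_square)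
  next
    case False
    then have "b = n" using ab by simp
    then show ?thesis using ab by (simp add: A_raise[OF dec(1)] ladder_top)
  qed
  have ii: "\<i> * x * (\<i> * x * y) = - (x * x) * y" for x y :: complex
  proof -
    have "\<i> * \<i> = -1" by simp
    then show ?thesis by algebra
  qed
  have 3: "A_transform m n (D_diag (D_diag F)) z a b = - of_real ((2 * real b - real n)\<^sup>2) * ?A"
    unfolding A_diag[OF dec(3) ab] A_diag[OF F ab] ii by (simp add: power2_eq_square)
  have 4: "A_transform m n (D_scalar (D_scalar F)) z a b = - of_real ((real_of_int m)\<^sup>2) * ?A"
    unfolding A_scalar[OF dec(4) ab] A_scalar[OF F ab] ii by (simp add: power2_eq_square)
  have "A_transform m n (casimir F) z a b = ?A + (2 * A_transform m n (D_low (D_raise F)) z a b + (2 * A_transform m n (D_raise (D_low F)) z a b +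
      ((-1) * A_transform m n (D_diag (D_diag F)) z a b + (-1) * A_transform m n (D_scalar (D_scalar F)) z a b)))"
    unfolding casimir_def by (simp only: A_add A_cmult smooth_add smooth_cmult s)
  also have "\<dots> = of_real (1 + 2 * real (b * (n + 1 - b)) + 2 * real (Suc b * (n - b)) + (2 * real b - real n)\<^sup>2 + (real_of_int m)\<^sup>2) * ?A"
    unfolding 1 2 3 4 by (simp only: of_real_add of_real_mult of_real_1 of_real_numeral) (simp add: algebra_simps)
  also have "1 + 2 * real (b * (n + 1 - b)) + 2 * real (Suc b * (n - b)) + (2 * real b - real n)\<^sup>2 + (real_of_int m)\<^sup>2 =
      1 + (real n)\<^sup>2 + 2 * real n + (real_of_int m)\<^sup>2"
  proof -
    have e: "real (b * (n + 1 - b)) = real b * (real n + 1 - real b)" "real (Suc b * (n - b)) = (real b + 1) * (real n - real b)"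
      unfolding of_nat_mult using ab by (simp_all add: of_nat_diff)
    show ?thesis unfolding e by (simp add: power2_eq_square algebra_simps)
  qed
  finally show ?thesis .
qed

lemma A_casimir_power:
  assumes "decaying F" "a \<le> n" "b \<le> n"
  shows "A_transform m n ((casimir ^^ r) F) z a b = of_real ((1 + (real n)\<^sup>2 + 2 * real n + (real_of_int m)\<^sup>2) ^ r) * A_transform m n F z a b"
proof -
  have d: "decaying ((casimir ^^ r) F)" for r by (induction r) (simp_all add: assms(1) decaying_casimir)
  show ?thesis
    by (induction r) (simp_all add: A_casimir[OF d assms(2,3)])
qed

end

text \<open>The bound for \<open>(casimir ^^ r) F\<close> does not involve \<open>m\<close> and
  \<open>n\<close>, and the \<open>r\<close>-th power of the eigenvalue divides it. With
  \<open>s = 1 + |m| + n\<close> one has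
  \<open>s \<le> s * s \<le> 3 * ((n + 1)^2 + m^2)\<close>.\<close>

lemma A_rapidly_decaying:
  assumes F: "decaying F"
  shows "\<exists>C\<ge>0. \<forall>(m, n)\<in>E_index. \<forall>a b z. (1 + norm z) ^ L * cmod (A_transform m n F z a b) \<le> C / (1 + \<bar>real_of_int m\<bar> + real n) ^ r"
proof -
  have "decaying ((casimir ^^ r) F)" by (induction r) (simp_all add: F decaying_casimir)
  note G = this
  from decaying_bound[OF G] obtain C where C: "C \<ge> 0" "\<forall>k\<in>U2. \<forall>z. (1 + norm z) ^ L * cmod ((casimir ^^ r) F (k, z)) \<le> C" by blast
  have "(1 + norm z) ^ L * cmod (A_transform m n F z a b) \<le> (3 ^ r * C) / (1 + \<bar>real_of_int m\<bar> + real n) ^ r"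
    if mn: "(m, n) \<in> E_index" for m n a b z
  proof -
    interpret admissible m n by unfold_locales (rule mn)
    let ?s = "1 + \<bar>real_of_int m\<bar> + real n" and ?e = "1 + (real n)\<^sup>2 + 2 * real n + (real_of_int m)\<^sup>2"
    have s: "1 \<le> ?s" by simp
    show ?thesis
    proof (cases "n < a \<or> n < b")
      case True
      then show ?thesis using C(1) s by (simp add: A_outside)
    next
      case False
      have w: "0 < (1 + norm z) ^ L" by (simp add: add_pos_nonneg)
      have "cmod (A_transform m n ((casimir ^^ r) F) z a b) \<le> C / (1 + norm z) ^ L"
        using C(2) w by (intro A_bound decaying_smooth[OF G]) (simp add: field_simps)
      then have "?e ^ r * cmod (A_transform m n F z a b) \<le> C / (1 + norm z) ^ L"
        using False by (simp add: A_casimir_power[OF F] norm_mult norm_power abs_of_nonneg flip: of_real_power of_real_add of_real_mult)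
      then have e: "?e ^ r * ((1 + norm z) ^ L * cmod (A_transform m n F z a b)) \<le> C"
        using w by (simp add: field_simps)
      have "?s * 1 \<le> ?s * ?s" using s by (intro mult_left_mono) auto
      also have "?s * ?s \<le> 3 * ?e"
      proof -
        have "(1 + M + N) * (1 + M + N) \<le> 3 * (1 + N\<^sup>2 + 2 * N + M\<^sup>2)" if "0 \<le> N" for M N :: real
        proof -
          have "3 * (1 + N\<^sup>2 + 2 * N + M\<^sup>2) - (1 + M + N) * (1 + M + N) = (1 - M)\<^sup>2 + (M - N)\<^sup>2 + 1 + N\<^sup>2 + 4 * N"
            by (simp add: power2_eq_square algebra_simps)
          moreover have "0 \<le> (1 - M)\<^sup>2 + (M - N)\<^sup>2 + 1 + N\<^sup>2 + 4 * N" using that by simp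
          ultimately show ?thesis by linarith
        qed
        from this[of "real n" "\<bar>real_of_int m\<bar>"] show ?thesis by simp
      qed
      finally have "?s ^ r \<le> (3 * ?e) ^ r" by (intro power_mono) auto
      then have "?s ^ r * ((1 + norm z) ^ L * cmod (A_transform m n F z a b)) \<le> (3 * ?e) ^ r * ((1 + norm z) ^ L * cmod (A_transform m n F z a b))"
        by (intro mult_right_mono) auto
      also have "\<dots> = 3 ^ r * (?e ^ r * ((1 + norm z) ^ L * cmod (A_transform m n F z a b)))" by (simp only: power_mult_distrib mult.assoc)
      also have "\<dots> \<le> 3 ^ r * C" using e by (intro mult_left_mono) auto
      finally have "?s ^ r * ((1 + norm z) ^ L * cmod (A_transform m n F z a b)) \<le> 3 ^ r * C" .
      moreover have "0 < ?s ^ r" using s by (intro zero_less_power) linarith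
      ultimately show ?thesis by (simp add: pos_le_divide_eq mult.commute)
    qed
  qed
  then show ?thesis using C(1) by (intro exI[of _ "3 ^ r * C"]) auto
qed

subsection \<open>Integrable weights\<close>

text \<open>The limit of \<open>arctan\<close> gives the integral over the half-line, and reflection
  gives the other half.\<close>

lemma nn_integral_cauchy_finite: "(\<integral>\<^sup>+x. ennreal (1 / (1 + x\<^sup>2)) \<partial>lborel) < \<infinity>"
proof -
  let ?f = "\<lambda>x::real. ennreal (1 / (1 + x\<^sup>2))"
  have nz: "1 + x\<^sup>2 \<noteq> 0" for x :: real by (metis add_pos_nonneg less_irrefl zero_le_power2 zero_less_one)
  have cont: "continuous_on UNIV (\<lambda>x::real. 1 / (1 + x\<^sup>2))"
    using nz by (intro continuous_intros) auto
  have half: "(\<integral>\<^sup>+x. ?f x * indicator {0..} x \<partial>lborel) = ennreal (pi / 2 - arctan 0)"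
  proof (rule nn_integral_FTC_atLeast)
    show "(\<lambda>x::real. 1 / (1 + x\<^sup>2)) \<in> borel_measurable borel" by (rule borel_measurable_continuous_onI[OF cont])
    show "DERIV arctan x :> 1 / (1 + x\<^sup>2)" for x using DERIV_arctan[of x] by (simp add: divide_inverse)
    show "(arctan \<longlongrightarrow> pi / 2) at_top" by (rule tendsto_arctan_at_top)
  qed simp
  have [measurable]: "?f \<in> borel_measurable borel"
    using borel_measurable_continuous_onI[OF cont] by measurable
  have "(\<integral>\<^sup>+x. ?f x * indicator {..0} x \<partial>lborel) = (\<integral>\<^sup>+x. ?f x * indicator {0..} x \<partial>lborel)"
    by (subst nn_integral_real_affine[where c = "-1" and t = 0]) (auto intro!: nn_integral_cong simp: indicator_def)
  moreover have "(\<integral>\<^sup>+x. ?f x \<partial>lborel) \<le> (\<integral>\<^sup>+x. ?f x * indicator {0..} x + ?f x * indicator {..0} x \<partial>lborel)"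
    by (intro nn_integral_mono) (auto simp: indicator_def)
  moreover have "(\<integral>\<^sup>+x. ?f x * indicator {0..} x + ?f x * indicator {..0} x \<partial>lborel) =
      (\<integral>\<^sup>+x. ?f x * indicator {0..} x \<partial>lborel) + (\<integral>\<^sup>+x. ?f x * indicator {..0} x \<partial>lborel)"
    by (rule nn_integral_add) auto
  ultimately have "(\<integral>\<^sup>+x. ?f x \<partial>lborel) \<le> ennreal (pi / 2 - arctan 0) + ennreal (pi / 2 - arctan 0)"
    by (simp only: half)
  also have "\<dots> < \<infinity>" by (simp flip: ennreal_plus)
  finally show ?thesis .
qed

text \<open>The exponent 8 is twice the real dimension 4: each factor \<open>(1 + norm z)^2\<close>
  dominates \<open>1 + x^2\<close> for one coordinate \<open>x\<close>, and integrability reduces to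
  the Cauchy density.\<close>

abbreviation wt :: "complex^2 \<Rightarrow> real" where
  "wt z \<equiv> 1 / (1 + norm z) ^ 8"

lemma integrable_wt: "integrable lborel wt"
proof (rule integrableI_bounded)
  have nz: "1 + norm z \<noteq> 0" for z :: "complex^2" by (metis add_pos_nonneg less_irrefl norm_ge_zero zero_less_one)
  have "continuous_on UNIV wt" using nz by (intro continuous_intros) auto
  then show "wt \<in> borel_measurable lborel" using borel_measurable_continuous_onI by simp
  have "(\<integral>\<^sup>+z. ennreal (norm (wt z)) \<partial>lborel) \<le> (\<integral>\<^sup>+z. (\<Prod>b\<in>(Basis::(complex^2) set). ennreal (1 / (1 + (z \<bullet> b)\<^sup>2))) \<partial>lborel)"
  proof (intro nn_integral_mono)
    fix z :: "complex^2"
    have "(\<Prod>b\<in>Basis. 1 + (z \<bullet> b)\<^sup>2) \<le> (\<Prod>b\<in>(Basis::(complex^2) set). (1 + norm z)\<^sup>2)"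
    proof (rule prod_mono, safe)
      fix b :: "complex^2" assume "b \<in> Basis"
      then have "\<bar>z \<bullet> b\<bar> \<le> norm z" by (rule Basis_le_norm)
      then have "(z \<bullet> b)\<^sup>2 \<le> (norm z)\<^sup>2" by (metis abs_ge_zero power2_abs power_mono)
      moreover have "(1 + norm z)\<^sup>2 = 1 + 2 * norm z + (norm z)\<^sup>2" by (simp add: power2_sum)
      ultimately show "1 + (z \<bullet> b)\<^sup>2 \<le> (1 + norm z)\<^sup>2" using norm_ge_zero[of z] by linarith
    qed simp
    also have "\<dots> = (1 + norm z) ^ 8" by (simp add: power_mult[symmetric])
    finally have "(\<Prod>b\<in>Basis. 1 + (z \<bullet> b)\<^sup>2) \<le> (1 + norm z) ^ 8" .
    moreover have "0 < (\<Prod>b\<in>(Basis::(complex^2) set). 1 + (z \<bullet> b)\<^sup>2)" by (intro prod_pos) (simp add: add_pos_nonneg)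
    ultimately have "wt z \<le> 1 / (\<Prod>b\<in>Basis. 1 + (z \<bullet> b)\<^sup>2)" by (intro divide_left_mono) (auto intro!: mult_pos_pos add_pos_nonneg)
    also have "\<dots> = (\<Prod>b\<in>Basis. 1 / (1 + (z \<bullet> b)\<^sup>2))" by (simp add: prod_dividef)
    finally have "ennreal (wt z) \<le> ennreal (\<Prod>b\<in>Basis. 1 / (1 + (z \<bullet> b)\<^sup>2))" by (rule ennreal_leI)
    then show "ennreal (norm (wt z)) \<le> (\<Prod>b\<in>Basis. ennreal (1 / (1 + (z \<bullet> b)\<^sup>2)))"
      by (subst prod_ennreal) auto
  qed
  also have "\<dots> = (\<Prod>b\<in>(Basis::(complex^2) set). (\<integral>\<^sup>+x. ennreal (1 / (1 + x\<^sup>2)) \<partial>lborel))"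
    by (rule nn_integral_lborel_prod) auto
  also have "\<dots> < \<infinity>" using nn_integral_cauchy_finite by (simp add: power_less_top_ennreal)
  finally show "(\<integral>\<^sup>+z. ennreal (norm (wt z)) \<partial>lborel) < \<infinity>" .
qed

definition wt_int :: real where
  "wt_int = (\<integral>z. wt z \<partial>lborel)"

lemma wt_int_nonneg: "0 \<le> wt_int"
  unfolding wt_int_def by (intro integral_nonneg_AE) auto

lemma integrable_wt_bound:
  fixes g :: "complex^2 \<Rightarrow> complex"
  assumes "g \<in> borel_measurable borel" "\<And>z. cmod (g z) \<le> C * wt z"
  shows "integrable lborel g" "cmod (\<integral>z. g z \<partial>lborel) \<le> C * wt_int"
proof -
  have i: "integrable lborel (\<lambda>z. C * wt z)" by (intro integrable_mult_right integrable_wt)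
  show g: "integrable lborel g"
    by (rule Bochner_Integration.integrable_bound[OF i]) (use assms(1) in \<open>auto intro!: AE_I2 order.trans[OF assms(2)] divide_right_mono\<close>)
  have "cmod (\<integral>z. g z \<partial>lborel) \<le> (\<integral>z. C * wt z \<partial>lborel)"
    by (rule order.trans[OF integral_norm_bound integral_mono[OF integrable_norm[OF g] i]]) (rule assms(2))
  then show "cmod (\<integral>z. g z \<partial>lborel) \<le> C * wt_int" by (simp only: wt_int_def integral_mult_right_zero)
qed

lemma wt_fubini:
  fixes g :: "complex^2 \<Rightarrow> 'b \<Rightarrow> complex"
  assumes N: "finite_measure N" and m: "case_prod g \<in> borel_measurable (borel \<Otimes>\<^sub>M N)"
    and b: "\<And>z y. y \<in> space N \<Longrightarrow> cmod (g z y) \<le> C * wt z"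
  shows "(\<integral>z. (\<integral>y. g z y \<partial>N) \<partial>lborel) = (\<integral>y. (\<integral>z. g z y \<partial>lborel) \<partial>N)"
proof -
  interpret N: finite_measure N by fact
  interpret pair_sigma_finite "lborel :: (complex^2) measure" N ..
  have m': "case_prod g \<in> borel_measurable (lborel \<Otimes>\<^sub>M N)" using m by (simp cong: measurable_cong_sets sets_pair_measure_cong)
  have mz: "g z \<in> borel_measurable N" for z using measurable_Pair2[OF m, of z] by simp
  have iz: "integrable N (g z)" for z
    by (rule N.integrable_const_bound[of _ "C * wt z"]) (use b mz in auto)
  have "integrable (lborel \<Otimes>\<^sub>M N) (case_prod g)"
  proof (rule Fubini_integrable[OF m'])
    show "AE z in lborel. integrable N (\<lambda>y. case_prod g (z, y))" using iz by simp
    have mm: "(\<lambda>z. \<integral>y. norm (case_prod g (z, y)) \<partial>N) \<in> borel_measurable lborel"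
      using N.borel_measurable_lebesgue_integral[of "\<lambda>z y. norm (case_prod g (z, y))" lborel] m' by simp
    show "integrable lborel (\<lambda>z. \<integral>y. norm (case_prod g (z, y)) \<partial>N)"
    proof (rule Bochner_Integration.integrable_bound[OF _ mm])
      show "integrable lborel (\<lambda>z. (C * measure N (space N)) * wt z)" by (intro integrable_mult_right integrable_wt)
      show "AE z in lborel. norm (\<integral>y. norm (case_prod g (z, y)) \<partial>N) \<le> norm ((C * measure N (space N)) * wt z)"
      proof (rule AE_I2)
        fix z :: "complex^2"
        have "norm (\<integral>y. norm (g z y) \<partial>N) = (\<integral>y. norm (g z y) \<partial>N)" by (simp add: integral_nonneg_AE)
        also have "\<dots> \<le> (\<integral>y. C * wt z \<partial>N)"
          by (rule integral_mono[OF integrable_norm[OF iz] N.integrable_const]) (rule b)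
        also have "\<dots> = (C * measure N (space N)) * wt z" by simp
        also have "\<dots> \<le> norm \<dots>" by (rule order.trans[OF abs_ge_self]) (simp only: real_norm_def order.refl)
        finally show "norm (\<integral>y. norm (case_prod g (z, y)) \<partial>N) \<le> norm ((C * measure N (space N)) * wt z)" by simp
      qed
    qed
  qed
  from Fubini_integral[OF this] show ?thesis by simp
qed

subsection \<open>Matrix functions on \<open>\<complex>\<^sup>2\<close>\<close>

lemma measurable_F_haar:
  fixes F :: "motion \<Rightarrow> complex"
  assumes "continuous_on UNIV F"
  shows "(\<lambda>(z, k). F (k, z)) \<in> borel_measurable (borel \<Otimes>\<^sub>M haar_U2)"
proof -
  have F: "F \<in> borel_measurable (borel \<Otimes>\<^sub>M borel)"
    unfolding borel_prod by (rule borel_measurable_continuous_onI[OF assms])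
  have i: "(\<lambda>k. k) \<in> haar_U2 \<rightarrow>\<^sub>M borel"
    by (simp cong: measurable_cong_sets add: sets_haar measurable_restrict_space1)
  have "(\<lambda>p. (snd p, fst p)) \<in> (borel :: (complex^2) measure) \<Otimes>\<^sub>M haar_U2 \<rightarrow>\<^sub>M borel \<Otimes>\<^sub>M borel"
    by (intro measurable_Pair measurable_compose[OF measurable_snd i]) simp
  from measurable_compose[OF this F] show ?thesis by (simp add: split_beta')
qed

lemma mprod_assoc: "mprod n (mprod n A B) C = mprod n A (mprod n B C)"
  unfolding mprod_def sum_distrib_left sum_distrib_right
  by (intro ext, subst sum.swap) (simp add: mult.assoc)

definition central_on_U2 :: "(motion \<Rightarrow> complex) \<Rightarrow> bool" where
  "central_on_U2 F \<longleftrightarrow> (\<forall>l\<in>U2. \<forall>k\<in>U2. \<forall>z. F (l ** k ** conj_transpose l, l *v z) = F (k, z))"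

context admissible begin

lemma measurable_TU: "(\<lambda>k. TU k a b) \<in> borel_measurable haar_U2"
  by (rule measurable_haar_continuous[OF continuous_on_TU])

lemma measurable_A_transform:
  assumes "smooth F" shows "(\<lambda>z. A_transform m n F z a b) \<in> borel_measurable borel"
proof -
  interpret finite_measure haar_U2 by (rule finite_measure_haar)
  have "(\<lambda>p. (case p of (z, k) \<Rightarrow> F (k, z)) * TU (snd p) a b) \<in> borel_measurable (borel \<Otimes>\<^sub>M haar_U2)"
    by (intro borel_measurable_times measurable_F_haar smooth_continuous assms measurable_compose[OF measurable_snd measurable_TU])
  then have "(\<lambda>(z, k). F (k, z) * TU k a b) \<in> borel_measurable (borel \<Otimes>\<^sub>M haar_U2)" by (simp add: split_beta')
  from borel_measurable_lebesgue_integral[OF this] show ?thesis by (simp add: A_transform_def)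
qed

lemma TU_mprod: "k \<in> U2 \<Longrightarrow> l \<in> U2 \<Longrightarrow> TU (k ** l) = mprod n (TU k) (TU l)"
proof (intro ext)
  fix a b assume kl: "k \<in> U2" "l \<in> U2"
  show "TU (k ** l) a b = mprod n (TU k) (TU l) a b"
  proof (cases "n < a \<or> n < b")
    case True
    then show ?thesis using kl by (auto simp: mprod_def TU_outside U2_mult)
  next
    case False
    then show ?thesis using kl by (simp add: mprod_def TU_mult)
  qed
qed

lemma TU_madjoint: assumes k: "k \<in> U2" shows "TU (conj_transpose k) = madjoint (TU k)"
proof (intro ext)
  fix a b
  show "TU (conj_transpose k) a b = madjoint (TU k) a b"
    by (cases "n < a \<or> n < b")
      (auto simp: madjoint_def TU_outside k U2_conj_transpose TU_adjoint)
qed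

lemma mprod_one_left: assumes "\<And>a b. n < a \<Longrightarrow> X a b = 0" shows "mprod n (TU (mat 1)) X = X"
proof (intro ext)
  fix a b
  show "mprod n (TU (mat 1)) X a b = X a b"
  proof (cases "a \<le> n")
    case True
    then have "mprod n (TU (mat 1)) X a b = (\<Sum>c\<le>n. if c = a then X a b else 0)"
      unfolding mprod_def by (intro sum.cong) (auto simp: TU_one)
    then show ?thesis using True by simp
  next
    case False
    then show ?thesis using assms by (simp add: mprod_def TU_outside U2_one)
  qed
qed

lemma mprod_one_right: assumes "\<And>a b. n < b \<Longrightarrow> X a b = 0" shows "mprod n X (TU (mat 1)) = X"
proof (intro ext)
  fix a b
  show "mprod n X (TU (mat 1)) a b = X a b"
  proof (cases "b \<le> n")
    case True
    then have "mprod n X (TU (mat 1)) a b = (\<Sum>c\<le>n. if c = b then X a b else 0)"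
      unfolding mprod_def by (intro sum.cong) (auto simp: TU_one)
    then show ?thesis using True by simp
  next
    case False
    then show ?thesis using assms by (simp add: mprod_def TU_outside U2_one)
  qed
qed

text \<open>Schur's lemma would identify \<open>chi_mat\<close> with the identity; only its commutation with \<open>TU\<close> is used.\<close>

definition chi_mat :: cmatrix where
  "chi_mat = (\<lambda>a b. of_nat (n + 1) * (\<integral>l. cnj (chi m n l) * TU l a b \<partial>haar_U2))"

text \<open>By \<open>A_K_component\<close> this is the matrix function of
  \<open>K_component m n F\<close>. As a product it inherits regularity and decay from
  \<open>F\<close>, and no smoothness of \<open>K_component\<close> has to be established.\<close>

definition AK :: "(motion \<Rightarrow> complex) \<Rightarrow> complex^2 \<Rightarrow> cmatrix" where
  "AK F z = mprod n (A_transform m n F z) chi_mat"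

lemma continuous_on_chi: "continuous_on U2 (\<lambda>l. chi m n l)"
  unfolding chi_def mtrace_def by (intro continuous_intros continuous_on_TU)

lemma norm_chi_le: "l \<in> U2 \<Longrightarrow> cmod (chi m n l) \<le> real (Suc n)"
proof -
  assume l: "l \<in> U2"
  have "cmod (chi m n l) \<le> (\<Sum>a\<le>n. 1)"
    unfolding chi_def mtrace_def by (rule order.trans[OF norm_sum sum_mono]) (rule norm_TU_le[OF l])
  then show ?thesis by simp
qed

lemma integrable_chi_TU: "integrable haar_U2 (\<lambda>l. cnj (chi m n l) * TU l a b)"
  by (intro integrable_haar_continuous continuous_on_mult continuous_on_cnj continuous_on_chi continuous_on_TU)

lemma norm_chi_mat: "cmod (chi_mat a b) \<le> real (Suc n) * real (Suc n)"
proof -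
  have "cmod (\<integral>l. cnj (chi m n l) * TU l a b \<partial>haar_U2) \<le> (\<integral>l. real (Suc n) \<partial>haar_U2)"
  proof (rule order.trans[OF integral_norm_bound integral_mono[OF integrable_norm[OF integrable_chi_TU] finite_measure.integrable_const[OF finite_measure_haar]]])
    fix l assume "l \<in> space haar_U2"
    then have l: "l \<in> U2" by (simp add: space_haar)
    show "cmod (cnj (chi m n l) * TU l a b) \<le> real (Suc n)"
      using mult_mono[OF norm_chi_le[OF l] norm_TU_le[OF l, of a b]] by (simp add: norm_mult)
  qed
  then have "cmod (\<integral>l. cnj (chi m n l) * TU l a b \<partial>haar_U2) \<le> real (Suc n)" by (simp add: space_haar measure_haar)
  then show ?thesis by (simp add: chi_mat_def norm_mult mult_left_mono del: of_nat_Suc)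
qed

lemma chi_mat_outside: assumes "n < a \<or> n < b" shows "chi_mat a b = 0"
proof -
  have "(\<integral>l. cnj (chi m n l) * TU l a b \<partial>haar_U2) = (\<integral>l. 0 \<partial>haar_U2)"
    by (rule Bochner_Integration.integral_cong[OF refl]) (use assms in \<open>simp add: TU_outside space_haar\<close>)
  then show ?thesis by (simp add: chi_mat_def)
qed

lemma mprod_TU_inverse:
  assumes "l \<in> U2"
  shows "mprod n (TU (conj_transpose l)) (TU l) = TU (mat 1)" "mprod n (TU l) (TU (conj_transpose l)) = TU (mat 1)"
  using assms U2_conj_transpose[OF assms] by (simp_all add: TU_mprod[symmetric]) (simp_all add: U2_def)

lemma mtrace_mprod_commute: "mtrace n (mprod n A B) = mtrace n (mprod n B A)"
  unfolding mtrace_def mprod_def by (subst sum.swap) (simp add: mult.commute)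

lemma chi_conjugate:
  assumes "l \<in> U2" "p \<in> U2" shows "chi m n (l ** p ** conj_transpose l) = chi m n p"
proof -
  have l: "conj_transpose l \<in> U2" using assms U2_conj_transpose by blast
  have "chi m n (l ** p ** conj_transpose l) = mtrace n (mprod n (mprod n (TU l) (TU p)) (TU (conj_transpose l)))"
    by (simp add: chi_def TU_mprod U2_mult assms l)
  also have "\<dots> = mtrace n (mprod n (mprod n (TU (conj_transpose l)) (TU l)) (TU p))"
    by (subst mtrace_mprod_commute) (simp add: mprod_assoc)
  also have "\<dots> = chi m n p"
    unfolding mprod_TU_inverse(1)[OF assms(1)] chi_def by (subst mprod_one_left) (simp_all add: TU_outside assms)
  finally show ?thesis .
qed

lemma mprod_integral:
  assumes "\<And>a b. integrable haar_U2 (\<lambda>k. g k a b)"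
  shows "(\<lambda>a b. \<integral>k. mprod n (mprod n P (g k)) Q a b \<partial>haar_U2) = mprod n (mprod n P (\<lambda>a b. \<integral>k. g k a b \<partial>haar_U2)) Q"
proof (intro ext)
  fix a b
  have i: "integrable haar_U2 (\<lambda>k. (\<Sum>d\<le>n. P a d * g k d c) * Q c b)" for c
    by (intro integrable_mult_left Bochner_Integration.integrable_sum integrable_mult_right assms)
  have "(\<integral>k. (\<Sum>c\<le>n. (\<Sum>d\<le>n. P a d * g k d c) * Q c b) \<partial>haar_U2) = (\<Sum>c\<le>n. (\<integral>k. (\<Sum>d\<le>n. P a d * g k d c) * Q c b \<partial>haar_U2))"
    by (rule Bochner_Integration.integral_sum) (rule i)
  also have "\<dots> = (\<Sum>c\<le>n. (\<Sum>d\<le>n. P a d * (\<integral>k. g k d c \<partial>haar_U2)) * Q c b)"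
  proof (intro sum.cong refl)
    fix c
    have "(\<integral>k. (\<Sum>d\<le>n. P a d * g k d c) \<partial>haar_U2) = (\<Sum>d\<le>n. P a d * (\<integral>k. g k d c \<partial>haar_U2))"
      by (subst Bochner_Integration.integral_sum) (auto intro!: integrable_mult_right assms simp: assms)
    then show "(\<integral>k. (\<Sum>d\<le>n. P a d * g k d c) * Q c b \<partial>haar_U2) = (\<Sum>d\<le>n. P a d * (\<integral>k. g k d c \<partial>haar_U2)) * Q c b"
      by simp
  qed
  finally show "(\<integral>k. mprod n (mprod n P (g k)) Q a b \<partial>haar_U2) = mprod n (mprod n P (\<lambda>a b. \<integral>k. g k a b \<partial>haar_U2)) Q a b"
    by (simp add: mprod_def)
qed

lemma mprod_scale: "mprod n (mprod n P (\<lambda>a b. c * X a b)) Q = (\<lambda>a b. c * mprod n (mprod n P X) Q a b)"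
  by (simp add: mprod_def sum_distrib_left sum_distrib_right mult_ac)

text \<open>The character is a class function and Haar measure is invariant under conjugation, so
  \<open>chi_mat\<close> commutes with every \<open>TU l\<close>.\<close>

lemma chi_mat_conjugate:
  assumes l: "l \<in> U2" shows "chi_mat = mprod n (mprod n (TU l) chi_mat) (TU (conj_transpose l))"
proof -
  have l': "conj_transpose l \<in> U2" using l U2_conj_transpose by blast
  have "(\<integral>p. cnj (chi m n p) * TU p a b \<partial>haar_U2) = (\<integral>p. mprod n (mprod n (TU l) (\<lambda>a b. cnj (chi m n p) * TU p a b)) (TU (conj_transpose l)) a b \<partial>haar_U2)" for a b
  proof -
    have "(\<integral>p. cnj (chi m n p) * TU p a b \<partial>haar_U2) = (\<integral>p. cnj (chi m n (l ** p ** conj_transpose l)) * TU (l ** p ** conj_transpose l) a b \<partial>haar_U2)"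
      by (rule haar_conjugate[OF l, symmetric]) (rule borel_measurable_integrable[OF integrable_chi_TU])
    also have "\<dots> = (\<integral>p. mprod n (mprod n (TU l) (\<lambda>a b. cnj (chi m n p) * TU p a b)) (TU (conj_transpose l)) a b \<partial>haar_U2)"
      by (rule Bochner_Integration.integral_cong[OF refl])
        (simp add: space_haar chi_conjugate[OF l] TU_mprod U2_mult l l' mprod_scale)
    finally show ?thesis .
  qed
  then have "(\<lambda>a b. \<integral>p. cnj (chi m n p) * TU p a b \<partial>haar_U2) = mprod n (mprod n (TU l) (\<lambda>a b. \<integral>p. cnj (chi m n p) * TU p a b \<partial>haar_U2)) (TU (conj_transpose l))"
    by (subst mprod_integral[OF integrable_chi_TU, symmetric]) (intro ext)
  from arg_cong[OF this, of "\<lambda>X a b. of_nat (n + 1) * X a b"]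
  show ?thesis unfolding chi_mat_def mprod_scale .
qed

text \<open>Replace \<open>k\<close> by its conjugate under \<open>l\<close>: centrality removes
  \<open>l\<close> from the argument of \<open>F\<close>, and multiplicativity of \<open>TU\<close>
  turns it into a conjugation of the matrix.\<close>

lemma A_conjugate:
  assumes F: "smooth F" "central_on_U2 F" and l: "l \<in> U2"
  shows "A_transform m n F (l *v z) = mprod n (mprod n (TU l) (A_transform m n F z)) (TU (conj_transpose l))"
proof -
  have l': "conj_transpose l \<in> U2" using l U2_conj_transpose by blast
  have "A_transform m n F (l *v z) a b = (\<integral>k. mprod n (mprod n (TU l) (\<lambda>a b. F (k, z) * TU k a b)) (TU (conj_transpose l)) a b \<partial>haar_U2)" for a b
  proof -
    have "A_transform m n F (l *v z) a b = (\<integral>k. F (l ** k ** conj_transpose l, l *v z) * TU (l ** k ** conj_transpose l) a b \<partial>haar_U2)"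
      unfolding A_transform_def by (rule haar_conjugate[OF l, symmetric]) (rule borel_measurable_integrable[OF integrable_FT[OF F(1)]])
    also have "\<dots> = (\<integral>k. mprod n (mprod n (TU l) (\<lambda>a b. F (k, z) * TU k a b)) (TU (conj_transpose l)) a b \<partial>haar_U2)"
    proof (rule Bochner_Integration.integral_cong[OF refl])
      fix k assume "k \<in> space haar_U2"
      then have k: "k \<in> U2" by (simp add: space_haar)
      have "F (l ** k ** conj_transpose l, l *v z) = F (k, z)" using F(2) l k unfolding central_on_U2_def by blast
      then show "F (l ** k ** conj_transpose l, l *v z) * TU (l ** k ** conj_transpose l) a b =
          mprod n (mprod n (TU l) (\<lambda>a b. F (k, z) * TU k a b)) (TU (conj_transpose l)) a b"
        by (simp add: TU_mprod U2_mult l l' k mprod_scale)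
    qed
    finally show ?thesis .
  qed
  then show ?thesis
    unfolding A_transform_def[of m n F z] by (subst mprod_integral[OF integrable_FT[OF F(1)], symmetric]) (intro ext)
qed

lemma AK_conjugate:
  assumes F: "smooth F" "central_on_U2 F" and l: "l \<in> U2"
  shows "AK F (l *v z) = mprod n (mprod n (TU l) (AK F z)) (TU (conj_transpose l))"
proof -
  let ?T = "TU l" and ?S = "TU (conj_transpose l)" and ?A = "A_transform m n F z"
  have "AK F (l *v z) = mprod n (mprod n (mprod n ?T ?A) ?S) (mprod n (mprod n ?T chi_mat) ?S)"
    unfolding AK_def A_conjugate[OF F l] using chi_mat_conjugate[OF l] by (rule arg_cong)
  also have "\<dots> = mprod n ?T (mprod n ?A (mprod n (mprod n ?S ?T) (mprod n chi_mat ?S)))"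
    by (simp only: mprod_assoc)
  also have "mprod n (mprod n ?S ?T) (mprod n chi_mat ?S) = mprod n chi_mat ?S"
    unfolding mprod_TU_inverse(1)[OF l] by (rule mprod_one_left) (simp add: mprod_def chi_mat_outside)
  finally show ?thesis by (simp only: AK_def mprod_assoc)
qed

lemma AK_outside: "n < a \<or> n < b \<Longrightarrow> AK F z a b = 0"
  by (auto simp: AK_def mprod_def A_outside chi_mat_outside)

lemma measurable_AK: "smooth F \<Longrightarrow> (\<lambda>z. AK F z a b) \<in> borel_measurable borel"
  unfolding AK_def mprod_def by (intro borel_measurable_sum borel_measurable_times measurable_A_transform borel_measurable_const)

text \<open>After exchanging the two Haar integrals and replacing \<open>k\<close> by
  \<open>k ** l\<close>, multiplicativity of \<open>TU\<close> splits the double integral into the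
  transform of \<open>F\<close> and the integral defining \<open>chi_mat\<close>.\<close>

lemma A_K_component:
  assumes F: "smooth F"
  shows "A_transform m n (K_component m n F) z = AK F z"
proof (intro ext)
  fix a b
  interpret H: finite_measure haar_U2 by (rule finite_measure_haar)
  interpret pair_sigma_finite haar_U2 haar_U2 ..
  interpret HH: finite_measure "haar_U2 \<Otimes>\<^sub>M haar_U2" by (rule finite_measure_pair_measure[OF finite_measure_haar finite_measure_haar])
  let ?g = "\<lambda>k l. F (k ** conj_transpose l, z) * cnj (chi m n l) * TU k a b"
  have Fz: "(\<lambda>k. F (k, z)) \<in> borel_measurable haar_U2"
    by (rule measurable_haar_continuous[OF continuous_on_slice[OF F]])
  have mult: "(\<lambda>p. fst p ** conj_transpose (snd p)) \<in> haar_U2 \<Otimes>\<^sub>M haar_U2 \<rightarrow>\<^sub>M haar_U2"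
  proof -
    have "(\<lambda>(k, l). k ** l) \<in> haar_U2 \<Otimes>\<^sub>M haar_U2 \<rightarrow>\<^sub>M haar_U2"
      using measurable_mult_U2 by (simp cong: measurable_cong_sets sets_pair_measure_cong add: sets_haar)
    moreover have "(\<lambda>p. (fst p, conj_transpose (snd p))) \<in> haar_U2 \<Otimes>\<^sub>M haar_U2 \<rightarrow>\<^sub>M haar_U2 \<Otimes>\<^sub>M haar_U2"
      by (intro measurable_Pair measurable_fst measurable_compose[OF measurable_snd measurable_haar_conj_transpose])
    ultimately show ?thesis using measurable_compose by fastforce
  qed
  have cm: "(\<lambda>l. cnj (chi m n l)) \<in> borel_measurable haar_U2"
    by (rule measurable_haar_continuous[OF continuous_on_cnj[OF continuous_on_chi]])
  have gm: "(\<lambda>p. ?g (fst p) (snd p)) \<in> borel_measurable (haar_U2 \<Otimes>\<^sub>M haar_U2)"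
    by (intro borel_measurable_times measurable_compose[OF mult Fz] measurable_compose[OF measurable_snd cm] measurable_compose[OF measurable_fst measurable_TU])
  have "compact ((\<lambda>k. F (k, z)) ` U2)" by (intro compact_continuous_image compact_U2 continuous_on_slice F)
  then obtain B where B: "B > 0" "\<forall>x\<in>(\<lambda>k. F (k, z)) ` U2. cmod x \<le> B" using compact_imp_bounded bounded_pos by metis
  have gi: "integrable (haar_U2 \<Otimes>\<^sub>M haar_U2) (case_prod ?g)"
  proof (rule HH.integrable_const_bound[of _ "B * real (Suc n) * 1"])
    show "AE p in haar_U2 \<Otimes>\<^sub>M haar_U2. norm (case_prod ?g p) \<le> B * real (Suc n) * 1"
    proof (rule AE_I2)
      fix p assume "p \<in> space (haar_U2 \<Otimes>\<^sub>M haar_U2)"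
      then obtain k l where p: "p = (k, l)" "k \<in> U2" "l \<in> U2" by (auto simp: space_pair_measure space_haar)
      have "cmod (F (k ** conj_transpose l, z)) \<le> B" using B(2) U2_mult[OF p(2) U2_conj_transpose[OF p(3)]] by blast
      then have "cmod (F (k ** conj_transpose l, z)) * cmod (cnj (chi m n l)) * cmod (TU k a b) \<le> B * real (Suc n) * 1"
        using norm_chi_le[OF p(3)] norm_TU_le[OF p(2)] B by (intro mult_mono) auto
      then show "norm (case_prod ?g p) \<le> B * real (Suc n) * 1" by (simp add: p norm_mult)
    qed
    show "case_prod ?g \<in> borel_measurable (haar_U2 \<Otimes>\<^sub>M haar_U2)" using gm by (simp add: split_beta')
  qed
  have "A_transform m n (K_component m n F) z a b = (\<integral>k. of_nat (n + 1) * (\<integral>l. ?g k l \<partial>haar_U2) \<partial>haar_U2)"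
    unfolding A_transform_def K_component_def case_prod_conv
  proof (rule Bochner_Integration.integral_cong[OF refl])
    fix k
    have "(\<integral>l. F (k ** matrix_inv l, z) * cnj (chi m n l) \<partial>haar_U2) * TU k a b = (\<integral>l. F (k ** matrix_inv l, z) * cnj (chi m n l) * TU k a b \<partial>haar_U2)"
      by simp
    also have "\<dots> = (\<integral>l. ?g k l \<partial>haar_U2)"
      by (rule Bochner_Integration.integral_cong[OF refl]) (simp add: space_haar U2_matrix_inv)
    finally show "of_nat (n + 1) * (\<integral>l. F (k ** matrix_inv l, z) * cnj (chi m n l) \<partial>haar_U2) * TU k a b = of_nat (n + 1) * (\<integral>l. ?g k l \<partial>haar_U2)"
      by (simp only: mult.assoc)
  qed
  also have "\<dots> = of_nat (n + 1) * (\<integral>k. (\<integral>l. ?g k l \<partial>haar_U2) \<partial>haar_U2)" by simp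
  also have "(\<integral>k. (\<integral>l. ?g k l \<partial>haar_U2) \<partial>haar_U2) = (\<integral>l. (\<integral>k. ?g k l \<partial>haar_U2) \<partial>haar_U2)"
    by (rule Fubini_integral[OF gi, symmetric])
  also have "\<dots> = (\<integral>l. (\<Sum>c\<le>n. A_transform m n F z a c * (cnj (chi m n l) * TU l c b)) \<partial>haar_U2)"
  proof (rule Bochner_Integration.integral_cong[OF refl])
    fix l assume "l \<in> space haar_U2"
    then have l: "l \<in> U2" "conj_transpose l \<in> U2" by (simp_all add: space_haar U2_conj_transpose)
    have ll: "k ** l ** conj_transpose l = k" for k using l by (simp add: U2_def flip: matrix_mul_assoc)
    have TUl: "TU (k ** l) a b = (\<Sum>c\<le>n. TU k a c * TU l c b)" if "k \<in> U2" for k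
      using that l by (simp add: TU_mprod mprod_def)
    have hm: "(\<lambda>k. F (k ** conj_transpose l, z) * TU k a b) \<in> borel_measurable haar_U2"
      by (intro borel_measurable_times measurable_compose[OF measurable_haar_right[OF l(2)] Fz] measurable_TU)
    have "(\<integral>k. ?g k l \<partial>haar_U2) = cnj (chi m n l) * (\<integral>k. F (k ** conj_transpose l, z) * TU k a b \<partial>haar_U2)"
      by (subst integral_mult_right_zero[symmetric]) (simp add: mult_ac)
    also have "(\<integral>k. F (k ** conj_transpose l, z) * TU k a b \<partial>haar_U2) = (\<integral>k. F (k, z) * TU (k ** l) a b \<partial>haar_U2)"
      using haar_right[OF l(1) hm] by (simp add: ll)
    also have "\<dots> = (\<integral>k. (\<Sum>c\<le>n. F (k, z) * TU k a c * TU l c b) \<partial>haar_U2)"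
      by (rule Bochner_Integration.integral_cong[OF refl]) (simp add: space_haar TUl sum_distrib_left mult.assoc)
    also have "\<dots> = (\<Sum>c\<le>n. A_transform m n F z a c * TU l c b)"
      unfolding A_transform_def by (subst Bochner_Integration.integral_sum) (auto intro!: integrable_mult_left integrable_FT F)
    finally show "(\<integral>k. ?g k l \<partial>haar_U2) = (\<Sum>c\<le>n. A_transform m n F z a c * (cnj (chi m n l) * TU l c b))"
      by (simp add: sum_distrib_left mult_ac)
  qed
  also have "\<dots> = (\<Sum>c\<le>n. A_transform m n F z a c * (\<integral>l. cnj (chi m n l) * TU l c b \<partial>haar_U2))"
    by (subst Bochner_Integration.integral_sum) (auto intro!: integrable_mult_right integrable_chi_TU)
  finally show "A_transform m n (K_component m n F) z a b = AK F z a b"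
    by (simp add: AK_def mprod_def chi_mat_def sum_distrib_left mult_ac)
qed

end

text \<open>Of the three extra powers, one pays for the \<open>n + 1\<close> summands of the matrix
  product and two for the bound \<open>norm_chi_mat\<close>.\<close>

lemma AK_rapidly_decaying:
  assumes F: "decaying F"
  shows "\<exists>C\<ge>0. \<forall>(m, n)\<in>E_index. \<forall>a b z. (1 + norm z) ^ L * cmod (admissible.AK m n F z a b) \<le> C / (1 + \<bar>real_of_int m\<bar> + real n) ^ r"
proof -
  obtain C where C: "C \<ge> 0" and CA: "\<forall>(m, n)\<in>E_index. \<forall>a b z. (1 + norm z) ^ L * cmod (A_transform m n F z a b) \<le> C / (1 + \<bar>real_of_int m\<bar> + real n) ^ (r + 3)"
    using A_rapidly_decaying[OF F, of L "r + 3"] by blast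
  have "(1 + norm z) ^ L * cmod (admissible.AK m n F z a b) \<le> C / (1 + \<bar>real_of_int m\<bar> + real n) ^ r"
    if mn: "(m, n) \<in> E_index" for m n a b z
  proof -
    interpret admissible m n by unfold_locales (rule mn)
    let ?s = "1 + \<bar>real_of_int m\<bar> + real n"
    have s: "real (Suc n) \<le> ?s" "0 < ?s" by (simp_all add: add_pos_nonneg)
    have "(1 + norm z) ^ L * cmod (AK F z a b) \<le> (1 + norm z) ^ L * (\<Sum>c\<le>n. cmod (A_transform m n F z a c) * cmod (chi_mat c b))"
      unfolding AK_def mprod_def by (intro mult_left_mono order.trans[OF norm_sum]) (auto simp: norm_mult)
    also have "\<dots> = (\<Sum>c\<le>n. ((1 + norm z) ^ L * cmod (A_transform m n F z a c)) * cmod (chi_mat c b))"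
      by (simp add: sum_distrib_left mult.assoc)
    also have "\<dots> \<le> (\<Sum>c\<le>n. (C / ?s ^ (r + 3)) * (?s * ?s))"
    proof (intro sum_mono mult_mono)
      fix c
      show "(1 + norm z) ^ L * cmod (A_transform m n F z a c) \<le> C / ?s ^ (r + 3)"
        using bspec[OF CA mn] by simp
      have "real (Suc n) * real (Suc n) \<le> ?s * ?s" using s by (intro mult_mono) auto
      then show "cmod (chi_mat c b) \<le> ?s * ?s" using norm_chi_mat[of c b] by linarith
    qed (use C s in auto)
    also have "\<dots> = real (Suc n) * ((C / ?s ^ (r + 3)) * (?s * ?s))" by simp
    also have "\<dots> \<le> ?s * ((C / ?s ^ (r + 3)) * (?s * ?s))" using s C by (intro mult_right_mono) auto
    also have "\<dots> = C / ?s ^ r"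
    proof -
      have "x * ((C / x ^ (r + 3)) * (x * x)) = C / x ^ r" if "0 < x" for x :: real
        using that by (simp add: power_add power3_eq_cube)
      then show ?thesis using s(2) .
    qed
    finally show ?thesis .
  qed
  then show ?thesis using C by (intro exI[of _ C]) auto
qed

subsection \<open>The transform as an integral of a diagonal entry\<close>

text \<open>Made total with values in \<open>U2\<close>: \<open>sphere_measure\<close> is a measure
  on the whole space, and \<open>k_sph \<zeta>\<close> is unitary only for unit vectors, that is,
  almost everywhere.\<close>

definition k_sphere :: "complex^2 \<Rightarrow> complex^2^2" where
  "k_sphere \<zeta> = (if norm \<zeta> = 1 then k_sph \<zeta> else mat 1)"

lemma k_sphere_U2: "k_sphere \<zeta> \<in> U2" "conj_transpose (k_sphere \<zeta>) \<in> U2"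
  using k_sph_SU2[of \<zeta>] U2_conj_transpose by (auto simp: k_sphere_def SU2_def U2_one)

lemma measurable_k_sphere: "k_sphere \<in> borel \<rightarrow>\<^sub>M restrict_space borel U2"
proof (rule measurable_U2I)
  have "k_sph \<in> borel_measurable borel" by (rule borel_measurable_continuous_onI[OF continuous_on_k_sph])
  then show "k_sphere \<in> borel_measurable borel" unfolding k_sphere_def[abs_def] by measurable
qed (rule k_sphere_U2)

lemma measurable_mvec:
  "(\<lambda>p. fst p *v snd p) \<in> (borel :: (complex^2^2) measure) \<Otimes>\<^sub>M (borel :: (complex^2) measure) \<rightarrow>\<^sub>M borel"
proof -
  have "continuous_on UNIV (\<lambda>p. fst p *v snd p :: complex^2)"
    unfolding matrix_vector_mult_def by (intro continuous_intros)
  then show ?thesis unfolding borel_prod by (rule borel_measurable_continuous_onI)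
qed

lemma norm_U2_vec: "k \<in> U2 \<Longrightarrow> norm (k *v z) = norm z"
  using U2_orthogonal_transformation orthogonal_transformation_norm by blast

lemma integral_U2_vec:
  fixes g :: "complex^2 \<Rightarrow> complex"
  assumes "k \<in> U2" "g \<in> borel_measurable borel"
  shows "(\<integral>z. g (k *v z) \<partial>lborel) = (\<integral>z. g z \<partial>lborel)"
proof -
  have "(\<lambda>z. k *v z) \<in> borel_measurable borel"
    by (intro borel_measurable_continuous_onI linear_continuous_on)
      (use orthogonal_transformation_linear[OF U2_orthogonal_transformation[OF assms(1)]] in \<open>simp add: linear_conv_bounded_linear\<close>)
  then have "integral\<^sup>L (distr lborel borel (\<lambda>z. k *v z)) g = (\<integral>z. g (k *v z) \<partial>lborel)"
    by (intro integral_distr) (use assms in auto)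
  then show ?thesis by (simp add: lborel_distr_isometry[OF U2_orthogonal_transformation[OF assms(1)]])
qed

text \<open>The second column of \<open>k_sph \<zeta>\<close> is \<open>\<zeta>\<close>, so this
  unitary matrix takes the second basis vector to \<open>\<zeta>\<close> while preserving the inner
  product.\<close>

lemma k_sphere_inner: "norm \<zeta> = 1 \<Longrightarrow> (k_sphere \<zeta> *v w) \<bullet> \<zeta> = Re (w$2)"
proof -
  assume n: "norm \<zeta> = 1"
  then have "(Re (\<zeta>$1))\<^sup>2 + (Im (\<zeta>$1))\<^sup>2 + ((Re (\<zeta>$2))\<^sup>2 + (Im (\<zeta>$2))\<^sup>2) = 1"
    using norm_vec2[of \<zeta>] by (simp add: cmod_power2)
  moreover have "(k_sphere \<zeta> *v w) \<bullet> \<zeta> = Re (w$2) * ((Re (\<zeta>$1))\<^sup>2 + (Im (\<zeta>$1))\<^sup>2 + ((Re (\<zeta>$2))\<^sup>2 + (Im (\<zeta>$2))\<^sup>2))"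
    using n by (simp add: k_sphere_def inner_vec_def sum_2 mvec2_nth k_sph_def inner_complex_def power2_eq_square algebra_simps)
  ultimately show ?thesis by simp
qed

lemma sets_sphere_measure: "sets sphere_measure = sets borel"
  by (simp add: sphere_measure_def)

lemma sphere_measurable_normalize: "(\<lambda>z. z /\<^sub>R norm z) \<in> (unit_ball_measure :: (complex^2) measure) \<rightarrow>\<^sub>M borel"
  by (simp cong: measurable_cong_sets add: sets_unit_ball_measure)

lemma finite_measure_sphere: "finite_measure sphere_measure"
proof -
  have "finite_measure (unit_ball_measure :: (complex^2) measure)"
    by (rule finite_measureI) (simp add: emeasure_unit_ball_measure)
  then show ?thesis
    unfolding sphere_measure_def unit_ball_measure_def[symmetric]
    by (rule finite_measure.finite_measure_distr) (rule sphere_measurable_normalize)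
qed

lemma AE_sphere: "AE \<zeta> in sphere_measure. norm \<zeta> = 1"
proof -
  have "AE z in unit_ball_measure. norm ((z :: complex^2) /\<^sub>R norm z) = 1"
    using AE_unit_ball_measure by eventually_elim simp
  then show ?thesis
    unfolding sphere_measure_def unit_ball_measure_def[symmetric]
    by (subst AE_distr_iff[OF sphere_measurable_normalize]) auto
qed

lemma measure_sphere: "measure sphere_measure (space sphere_measure) = 1"
proof -
  have "emeasure sphere_measure UNIV = emeasure (unit_ball_measure :: (complex^2) measure) UNIV"
    unfolding sphere_measure_def unit_ball_measure_def[symmetric]
    by (subst emeasure_distr[OF sphere_measurable_normalize]) auto
  then show ?thesis by (simp add: measure_def sphere_measure_def emeasure_unit_ball_measure)
qed

lemma Re2_le_norm: "\<bar>Re (w$2)\<bar> \<le> norm (w :: complex^2)"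
  using abs_Re_le_cmod[of "w$2"] Finite_Cartesian_Product.norm_nth_le[of w 2] by linarith

lemma matrix_inv_k_sph:
  assumes "\<zeta> \<noteq> 0"
  shows "matrix_inv (k_sph \<zeta>) = (1 / (norm \<zeta>)\<^sup>2) *\<^sub>R conj_transpose (k_sph \<zeta>)"
proof -
  define r where "r = 1 / (norm \<zeta>)\<^sup>2"
  let ?B = "r *\<^sub>R conj_transpose (k_sph \<zeta>)" and ?k = "k_sph \<zeta>"
  have n: "complex_of_real ((norm \<zeta>)\<^sup>2) = \<zeta>$1 * cnj (\<zeta>$1) + \<zeta>$2 * cnj (\<zeta>$2)"
    unfolding norm_vec2 by (simp only: of_real_add complex_norm_square)
  have r: "of_real r * (\<zeta>$1 * cnj (\<zeta>$1) + \<zeta>$2 * cnj (\<zeta>$2)) = 1"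
    unfolding r_def n[symmetric] of_real_mult[symmetric] using assms by simp
  then have kB: "?k ** ?B = mat 1"
    by (simp add: mat2_eq_iff mmul2_nth conj_transpose_nth k_sph_def mat2_nth scaleR_conv_of_real[where 'a = complex] algebra_simps)
  then have Bk: "?B ** ?k = mat 1" by (simp only: matrix_left_right_inverse)
  show ?thesis
    unfolding matrix_inv_def r_def[symmetric]
  proof (rule some_equality)
    show "?k ** ?B = mat 1 \<and> ?B ** ?k = mat 1" using kB Bk by blast
    fix B assume B: "?k ** B = mat 1 \<and> B ** ?k = mat 1"
    have "B = (B ** ?k) ** ?B" unfolding matrix_mul_assoc[symmetric] kB by simp
    then show "B = ?B" using B by simp
  qed
qed

text \<open>The integrand of \<open>Phi\<close> involves \<open>k_sph \<zeta>\<close> for all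
  \<open>\<zeta>\<close>, also off the sphere, where \<open>matrix_inv\<close> is a multiple of the
  adjoint. The explicit formula settles every \<open>\<zeta>\<close> except 0, which is split
  off.\<close>

lemma measurable_tau_k_sph: "(\<lambda>\<zeta>. tau n (k_sph \<zeta>) a b) \<in> borel_measurable borel"
proof (cases "a \<le> n \<and> b \<le> n")
  case True
  let ?B = "\<lambda>i (\<zeta>::complex^2). of_real (sqrt (real (n choose b))) *
      (of_real (1 / (norm \<zeta>)\<^sup>2) * (\<zeta>$2 * of_nat i - \<zeta>$1)) ^ b *
      (of_real (1 / (norm \<zeta>)\<^sup>2) * (cnj (\<zeta>$1) * of_nat i + cnj (\<zeta>$2))) ^ (n - b)"
  have eq: "tau n (k_sph \<zeta>) a b = (if \<zeta> = 0 then tau n (k_sph 0) a b else (\<Sum>i\<le>n. coord_weight n a i * ?B i \<zeta>))" for \<zeta>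
  proof (cases "\<zeta> = 0")
    case t: False
    have "tau n (k_sph \<zeta>) a b = (\<Sum>i\<le>n. coord_weight n a i * basis_V n b (matrix_inv (k_sph \<zeta>) *v pt i))"
      unfolding tau_def using coord_eval[OF tau_act_V conjunct1[OF True], of "k_sph \<zeta>" b] t by (simp add: tau_act_def)
    moreover have "(matrix_inv (k_sph \<zeta>) *v pt i) $ 1 = of_real (1 / (norm \<zeta>)\<^sup>2) * (\<zeta>$2 * of_nat i - \<zeta>$1)"
      "(matrix_inv (k_sph \<zeta>) *v pt i) $ 2 = of_real (1 / (norm \<zeta>)\<^sup>2) * (cnj (\<zeta>$1) * of_nat i + cnj (\<zeta>$2))" for i
      using t by (simp_all add: matrix_inv_k_sph mvec2_nth conj_transpose_nth scaleR_conv_of_real[where 'a = complex])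
        (simp_all add: k_sph_def diff_divide_distrib add_divide_distrib)
    ultimately show ?thesis using t by (simp only: basis_V_def) simp
  qed simp
  have Bm: "(\<lambda>\<zeta>. ?B i \<zeta>) \<in> borel_measurable borel" for i
  proof -
    have "(\<lambda>\<zeta>::complex^2. \<zeta>$2 * of_nat i - \<zeta>$1) \<in> borel_measurable borel"
       "(\<lambda>\<zeta>::complex^2. cnj (\<zeta>$1) * of_nat i + cnj (\<zeta>$2)) \<in> borel_measurable borel"
      by (intro borel_measurable_continuous_onI continuous_intros)+
    moreover have "(\<lambda>\<zeta>::complex^2. complex_of_real (1 / (norm \<zeta>)\<^sup>2)) \<in> borel_measurable borel" by measurable
    ultimately show ?thesis by (intro borel_measurable_times borel_measurable_power borel_measurable_const)
  qed
  have "(\<lambda>\<zeta>. if \<zeta> = 0 then tau n (k_sph 0) a b else (\<Sum>i\<le>n. coord_weight n a i * ?B i \<zeta>)) \<in> borel_measurable borel"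
    by (intro measurable_If borel_measurable_sum borel_measurable_times[OF borel_measurable_const Bm] borel_measurable_const) simp
  then show ?thesis by (subst ext[OF eq])
qed (auto simp: tau_outside not_le)

context admissible begin

lemma AK_weighted:
  assumes "decaying F"
  shows "\<exists>C\<ge>0. \<forall>a b z. (1 + norm z) ^ q * cmod (AK F z a b) \<le> C * wt z"
proof -
  obtain C where C: "C \<ge> 0" and CA: "\<forall>(m, n)\<in>E_index. \<forall>a b z. (1 + norm z) ^ (q + 8) * cmod (admissible.AK m n F z a b) \<le> C / (1 + \<bar>real_of_int m\<bar> + real n) ^ 0"
    using AK_rapidly_decaying[OF assms, of "q + 8" 0] by blast
  have "(1 + norm z) ^ q * cmod (AK F z a b) \<le> C * wt z" for a b z
  proof -
    have "1 + norm z > 0" by (simp add: add_pos_nonneg)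
    moreover have "(1 + norm z) ^ (q + 8) * cmod (AK F z a b) \<le> C" using bspec[OF CA mn] by simp
    ultimately show ?thesis by (simp add: field_simps power_add)
  qed
  then show ?thesis using C by blast
qed

lemma G_transform_eq:
  assumes F: "decaying F" "central_on_U2 F" and f: "\<And>z. A_transform m n f z = AK F z" and j: "j \<le> n"
  shows "G_transform m n f \<xi> j = (\<integral>w. cis (sqrt \<xi> * Re (w$2)) * AK F w j j \<partial>lborel)"
proof -
  have sF: "smooth F" by (rule decaying_smooth[OF F(1)])
  interpret S: finite_measure sphere_measure by (rule finite_measure_sphere)
  let ?P = "\<lambda>\<zeta>. mprod n (mprod n (TU (k_sphere \<zeta>)) (E_diag j)) (TU (conj_transpose (k_sphere \<zeta>)))"
  let ?e = "\<lambda>z \<zeta>. cis (sqrt \<xi> * (z \<bullet> \<zeta>))"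
  have P: "?P \<zeta> a b = TU (k_sphere \<zeta>) a j * TU (conj_transpose (k_sphere \<zeta>)) j b" for \<zeta> a b
  proof -
    have "mprod n (TU (k_sphere \<zeta>)) (E_diag j) a c = (if c = j then TU (k_sphere \<zeta>) a j else 0)" for c
    proof -
      have "mprod n (TU (k_sphere \<zeta>)) (E_diag j) a c = (\<Sum>d\<le>n. if d = j then (if c = j then TU (k_sphere \<zeta>) a j else 0) else 0)"
        unfolding mprod_def E_diag_def by (intro sum.cong) auto
      then show ?thesis using j by simp
    qed
    then have "?P \<zeta> a b = (\<Sum>c\<le>n. if c = j then TU (k_sphere \<zeta>) a j * TU (conj_transpose (k_sphere \<zeta>)) j b else 0)"
      unfolding mprod_def[of n "mprod n (TU (k_sphere \<zeta>)) (E_diag j)"] by (intro sum.cong) auto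
    then show ?thesis using j by simp
  qed
  have mks: "(\<lambda>\<zeta>. TU (k_sphere \<zeta>) a b) \<in> borel_measurable sphere_measure" "(\<lambda>\<zeta>. TU (conj_transpose (k_sphere \<zeta>)) a b) \<in> borel_measurable sphere_measure" for a b
  proof -
    have k: "k_sphere \<in> sphere_measure \<rightarrow>\<^sub>M haar_U2" using measurable_k_sphere by (simp cong: measurable_cong_sets add: sets_haar sets_sphere_measure)
    show "(\<lambda>\<zeta>. TU (k_sphere \<zeta>) a b) \<in> borel_measurable sphere_measure" by (rule measurable_compose[OF k measurable_TU])
    show "(\<lambda>\<zeta>. TU (conj_transpose (k_sphere \<zeta>)) a b) \<in> borel_measurable sphere_measure"
      by (rule measurable_compose[OF measurable_compose[OF k measurable_haar_conj_transpose] measurable_TU])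
  qed
  have me: "?e z \<in> borel_measurable sphere_measure" for z
  proof -
    have "continuous_on UNIV (?e z)" by (intro continuous_intros)
    from borel_measurable_continuous_onI[OF this] show ?thesis by (simp cong: measurable_cong_sets add: sets_sphere_measure)
  qed
  have Pi: "integrable sphere_measure (\<lambda>\<zeta>. ?e z \<zeta> * ?P \<zeta> a b)" for z a b
  proof (rule S.integrable_const_bound[of _ 1])
    have "cmod (TU (k_sphere \<zeta>) a j) * cmod (TU (conj_transpose (k_sphere \<zeta>)) j b) \<le> 1 * 1" for \<zeta>
      by (intro mult_mono norm_TU_le k_sphere_U2) auto
    then show "AE \<zeta> in sphere_measure. norm (?e z \<zeta> * ?P \<zeta> a b) \<le> 1" by (simp add: P norm_mult)
    show "(\<lambda>\<zeta>. ?e z \<zeta> * ?P \<zeta> a b) \<in> borel_measurable sphere_measure"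
      unfolding P by (intro borel_measurable_times me mks)
  qed
  have Phi: "Phi n \<xi> j (- z) a b = of_nat (n + 1) * (\<integral>\<zeta>. ?e z \<zeta> * ?P \<zeta> a b \<partial>sphere_measure)" for z a b
  proof -
    have "(\<integral>\<zeta>. cis (- (sqrt \<xi> * (- z \<bullet> \<zeta>))) * mprod n (mprod n (tau n (k_sph \<zeta>)) (E_diag j)) (madjoint (tau n (k_sph \<zeta>))) a b \<partial>sphere_measure)
        = (\<integral>\<zeta>. ?e z \<zeta> * ?P \<zeta> a b \<partial>sphere_measure)"
    proof (rule integral_cong_AE)
      show *: "(\<lambda>\<zeta>. ?e z \<zeta> * ?P \<zeta> a b) \<in> borel_measurable sphere_measure" by (rule borel_measurable_integrable[OF Pi])
      have ksph: "TU (k_sphere \<zeta>) = tau n (k_sph \<zeta>)" "TU (conj_transpose (k_sphere \<zeta>)) = madjoint (tau n (k_sph \<zeta>))" if "norm \<zeta> = 1" for \<zeta>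
      proof -
        show *: "TU (k_sphere \<zeta>) = tau n (k_sph \<zeta>)"
          using that k_sph_SU2[of \<zeta>] by (intro ext) (simp add: k_sphere_def TU_det SU2_def)
        show "TU (conj_transpose (k_sphere \<zeta>)) = madjoint (tau n (k_sph \<zeta>))"
          by (simp add: TU_madjoint k_sphere_U2 *)
      qed
      show "AE \<zeta> in sphere_measure. cis (- (sqrt \<xi> * (- z \<bullet> \<zeta>))) * mprod n (mprod n (tau n (k_sph \<zeta>)) (E_diag j)) (madjoint (tau n (k_sph \<zeta>))) a b = ?e z \<zeta> * ?P \<zeta> a b"
        using AE_sphere by eventually_elim (simp add: ksph)
      show "(\<lambda>\<zeta>. cis (- (sqrt \<xi> * (- z \<bullet> \<zeta>))) * mprod n (mprod n (tau n (k_sph \<zeta>)) (E_diag j)) (madjoint (tau n (k_sph \<zeta>))) a b) \<in> borel_measurable sphere_measure"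
      proof -
        have [measurable]: "(\<lambda>\<zeta>. tau n (k_sph \<zeta>) c d) \<in> borel_measurable sphere_measure" for c d
          using measurable_tau_k_sph by (simp cong: measurable_cong_sets add: sets_sphere_measure)
        have [measurable]: "(\<lambda>\<zeta>. cis (- (sqrt \<xi> * (- z \<bullet> \<zeta>)))) \<in> borel_measurable sphere_measure" using me[of z] by simp
        have [measurable]: "(\<lambda>\<zeta>. cnj (tau n (k_sph \<zeta>) c d)) \<in> borel_measurable sphere_measure" for c d
          by (rule measurable_compose[OF _ borel_measurable_continuous_onI[OF continuous_on_cnj[OF continuous_on_id]]]) simp
        show ?thesis unfolding mprod_def madjoint_def by measurable
      qed
    qed
    then show ?thesis by (simp add: Phi_def)
  qed
  \<comment> \<open>Cyclicity of the trace moves the conjugation onto \<open>AK\<close>, where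
    equivariance makes it a rotation of the argument; \<open>E_diag j\<close> selects the diagonal
    entry.\<close>
  have tr: "mtrace n (mprod n (AK F z) (?P \<zeta>)) = AK F (conj_transpose (k_sphere \<zeta>) *v z) j j" for z \<zeta>
  proof -
    let ?T = "TU (k_sphere \<zeta>)" and ?S = "TU (conj_transpose (k_sphere \<zeta>))"
    have "mtrace n (mprod n (AK F z) (?P \<zeta>)) = mtrace n (mprod n (mprod n (mprod n (AK F z) ?T) (E_diag j)) ?S)"
      by (simp only: mprod_assoc)
    also have "\<dots> = mtrace n (mprod n (mprod n (mprod n ?S (AK F z)) ?T) (E_diag j))"
      by (subst mtrace_mprod_commute) (simp only: mprod_assoc)
    also have "mprod n (mprod n ?S (AK F z)) ?T = AK F (conj_transpose (k_sphere \<zeta>) *v z)"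
      using AK_conjugate[OF sF F(2) k_sphere_U2(2)[of \<zeta>], of z] by (simp add: conj_transpose_conj_transpose)
    also have "mtrace n (mprod n (AK F (conj_transpose (k_sphere \<zeta>) *v z)) (E_diag j)) = (\<Sum>a\<le>n. if a = j then AK F (conj_transpose (k_sphere \<zeta>) *v z) j j else 0)"
    proof -
      have "(\<Sum>l\<le>n. X l * (if l = j \<and> a = j then 1 else 0)) = (if a = j then X j else 0)" for X :: "nat \<Rightarrow> complex" and a
      proof -
        have "(\<Sum>l\<le>n. X l * (if l = j \<and> a = j then 1 else 0)) = (\<Sum>l\<le>n. if l = j then (if a = j then X j else 0) else 0)"
          by (intro sum.cong) auto
        then show ?thesis using j by simp
      qed
      then show ?thesis unfolding mtrace_def mprod_def E_diag_def by (intro sum.cong) auto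
    qed
    finally show ?thesis using j by simp
  qed
  have inner: "mtrace n (mprod n (A_transform m n f z) (Phi n \<xi> j (- z))) =
      of_nat (n + 1) * (\<integral>\<zeta>. ?e z \<zeta> * AK F (conj_transpose (k_sphere \<zeta>) *v z) j j \<partial>sphere_measure)" for z
  proof -
    have "(\<integral>\<zeta>. ?e z \<zeta> * AK F (conj_transpose (k_sphere \<zeta>) *v z) j j \<partial>sphere_measure) =
        (\<integral>\<zeta>. (\<Sum>a\<le>n. \<Sum>b\<le>n. AK F z a b * (?e z \<zeta> * ?P \<zeta> b a)) \<partial>sphere_measure)"
      unfolding tr[symmetric] mtrace_def mprod_def[of n "AK F z"] by (simp add: sum_distrib_left mult_ac)
    also have "\<dots> = (\<Sum>a\<le>n. (\<integral>\<zeta>. (\<Sum>b\<le>n. AK F z a b * (?e z \<zeta> * ?P \<zeta> b a)) \<partial>sphere_measure))"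
      by (rule Bochner_Integration.integral_sum) (intro Bochner_Integration.integrable_sum integrable_mult_right Pi)
    also have "\<dots> = (\<Sum>a\<le>n. \<Sum>b\<le>n. AK F z a b * (\<integral>\<zeta>. ?e z \<zeta> * ?P \<zeta> b a \<partial>sphere_measure))"
      by (rule sum.cong[OF refl], subst Bochner_Integration.integral_sum) (simp_all only: integral_mult_right_zero, intro integrable_mult_right Pi)
    finally have *: "(\<integral>\<zeta>. ?e z \<zeta> * AK F (conj_transpose (k_sphere \<zeta>) *v z) j j \<partial>sphere_measure) = (\<Sum>a\<le>n. \<Sum>b\<le>n. AK F z a b * (\<integral>\<zeta>. ?e z \<zeta> * ?P \<zeta> b a \<partial>sphere_measure))" .
    show ?thesis
      unfolding * f mtrace_def mprod_def[of n "AK F z"] Phi by (simp add: sum_distrib_left mult_ac del: of_nat_Suc of_nat_add)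
  qed
  obtain C where C: "C \<ge> 0" "\<And>a b z. (1 + norm z) ^ 0 * cmod (AK F z a b) \<le> C * wt z" using AK_weighted[OF F(1), of 0] by blast
  have mAK: "(\<lambda>p. AK F (conj_transpose (k_sphere (snd p)) *v fst p) j j) \<in> borel_measurable (borel \<Otimes>\<^sub>M sphere_measure)"
  proof -
    have k: "(\<lambda>\<zeta>. conj_transpose (k_sphere \<zeta>)) \<in> sphere_measure \<rightarrow>\<^sub>M borel"
      using measurable_compose[OF measurable_compose[OF measurable_k_sphere measurable_conj_transpose_U2] measurable_restrict_space1[OF measurable_ident]]
      by (simp cong: measurable_cong_sets add: sets_sphere_measure)
    have "(\<lambda>p. (conj_transpose (k_sphere (snd p)), fst p)) \<in> borel \<Otimes>\<^sub>M sphere_measure \<rightarrow>\<^sub>M borel \<Otimes>\<^sub>M borel"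
      by (intro measurable_Pair measurable_compose[OF measurable_snd k] measurable_fst)
    from measurable_compose[OF measurable_compose[OF this measurable_mvec] measurable_AK[OF sF]]
    show ?thesis by simp
  qed
  have mee: "(\<lambda>p. ?e (fst p) (snd p)) \<in> borel_measurable (borel \<Otimes>\<^sub>M sphere_measure)"
  proof -
    have "continuous_on UNIV (\<lambda>p :: (complex^2) \<times> (complex^2). ?e (fst p) (snd p))" by (intro continuous_intros)
    from borel_measurable_continuous_onI[OF this] have "(\<lambda>p :: (complex^2) \<times> (complex^2). ?e (fst p) (snd p)) \<in> borel_measurable (borel \<Otimes>\<^sub>M borel)" unfolding borel_prod .
    then show ?thesis by (simp cong: measurable_cong_sets sets_pair_measure_cong add: sets_sphere_measure)
  qed
  have "G_transform m n f \<xi> j = (\<integral>z. (\<integral>\<zeta>. ?e z \<zeta> * AK F (conj_transpose (k_sphere \<zeta>) *v z) j j \<partial>sphere_measure) \<partial>lborel)"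
    unfolding G_transform_def inner by (simp del: of_nat_Suc of_nat_add)
  also have "\<dots> = (\<integral>\<zeta>. (\<integral>z. ?e z \<zeta> * AK F (conj_transpose (k_sphere \<zeta>) *v z) j j \<partial>lborel) \<partial>sphere_measure)"
  proof (rule wt_fubini[OF finite_measure_sphere, where C = C])
    show "(\<lambda>(z, \<zeta>). ?e z \<zeta> * AK F (conj_transpose (k_sphere \<zeta>) *v z) j j) \<in> borel_measurable (borel \<Otimes>\<^sub>M sphere_measure)"
      unfolding split_beta' by (intro borel_measurable_times mee mAK)
    show "cmod (?e z \<zeta> * AK F (conj_transpose (k_sphere \<zeta>) *v z) j j) \<le> C * wt z" for z \<zeta>
      using C(2)[of "conj_transpose (k_sphere \<zeta>) *v z" j j] by (simp add: norm_mult norm_U2_vec k_sphere_U2)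
  qed
  also have "\<dots> = (\<integral>\<zeta>. (\<integral>w. cis (sqrt \<xi> * Re (w$2)) * AK F w j j \<partial>lborel) \<partial>sphere_measure)"
  proof (rule integral_cong_AE)
    show "AE \<zeta> in sphere_measure. (\<integral>z. ?e z \<zeta> * AK F (conj_transpose (k_sphere \<zeta>) *v z) j j \<partial>lborel) = (\<integral>w. cis (sqrt \<xi> * Re (w$2)) * AK F w j j \<partial>lborel)"
      using AE_sphere
    proof eventually_elim
      fix \<zeta> :: "complex^2" assume n: "norm \<zeta> = 1"
      have "(\<lambda>z. ?e z \<zeta> * AK F (conj_transpose (k_sphere \<zeta>) *v z) j j) \<in> borel_measurable borel"
        using measurable_Pair1[OF borel_measurable_times[OF mee mAK], of \<zeta>] by (simp add: sphere_measure_def)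
      \<comment> \<open>Under \<open>z = k_sphere \<zeta> *v w\<close> the phase becomes a function
        of \<open>Re (w$2)\<close>, and the inner integral no longer depends on
        \<open>\<zeta>\<close>.\<close>
      from integral_U2_vec[OF k_sphere_U2(1) this, of \<zeta>]
      show "(\<integral>z. ?e z \<zeta> * AK F (conj_transpose (k_sphere \<zeta>) *v z) j j \<partial>lborel) = (\<integral>w. cis (sqrt \<xi> * Re (w$2)) * AK F w j j \<partial>lborel)"
        using k_sphere_U2(1)[of \<zeta>] by (simp add: k_sphere_inner[OF n] matrix_vector_mul_assoc U2_def)
    qed
    show "(\<lambda>\<zeta>. \<integral>z. ?e z \<zeta> * AK F (conj_transpose (k_sphere \<zeta>) *v z) j j \<partial>lborel) \<in> borel_measurable sphere_measure"
    proof -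
      have sw: "(\<lambda>p. (snd p, fst p)) \<in> sphere_measure \<Otimes>\<^sub>M lborel \<rightarrow>\<^sub>M borel \<Otimes>\<^sub>M sphere_measure" by measurable
      show ?thesis
        using lborel.borel_measurable_lebesgue_integral[of "\<lambda>\<zeta> z. ?e z \<zeta> * AK F (conj_transpose (k_sphere \<zeta>) *v z) j j" sphere_measure]
          measurable_compose[OF sw borel_measurable_times[OF mee mAK]] by (simp add: split_beta')
    qed
  qed simp
  also have "\<dots> = (\<integral>w. cis (sqrt \<xi> * Re (w$2)) * AK F w j j \<partial>lborel)" by (simp add: measure_sphere)
  finally show ?thesis .
qed

lemma TU_scalar:
  assumes "cmod c = 1" shows "TU (mat c) a b = ((c\<^sup>2) powi ((int n - m) div 2) * cnj c ^ n) * TU (mat 1) a b"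
proof -
  have "mat c = (mat c :: complex^2^2) ** mat 1" by simp
  moreover have "tau n (mat c ** mat 1) a b = cnj c ^ n * tau n (mat 1) a b" by (rule tau_scalar[OF assms U2_one])
  ultimately show ?thesis
    using mat_unit_U2[OF assms] by (simp add: TU_det U2_one det_2 mat2_nth power2_eq_square)
qed

text \<open>Scalar matrices are represented by scalars of modulus one, which cancel under
  conjugation.\<close>

lemma AK_phase:
  assumes F: "smooth F" "central_on_U2 F" and c: "cmod c = 1"
  shows "AK F (mat c *v w) = AK F w"
proof -
  let ?s = "(int n - m) div 2"
  have c': "cmod (cnj c) = 1" using c by simp
  define x where "x d = (d\<^sup>2) powi ?s * cnj d ^ n" for d
  have cc: "c * cnj c = 1" using c by (simp add: complex_norm_square[symmetric])
  have "x c * x (cnj c) = ((c * cnj c)\<^sup>2) powi ?s * (c * cnj c) ^ n"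
    unfolding power_mult_distrib power_int_mult_distrib by (simp add: x_def mult_ac)
  then have x1: "x c * x (cnj c) = 1" by (simp add: cc)
  have T: "TU (mat d) = (\<lambda>a b. x d * TU (mat 1) a b)" if "cmod d = 1" for d
    using TU_scalar[OF that] unfolding x_def by (intro ext)
  have "AK F (mat c *v w) = mprod n (mprod n (\<lambda>a b. x c * TU (mat 1) a b) (AK F w)) (\<lambda>a b. x (cnj c) * TU (mat 1) a b)"
    using AK_conjugate[OF F mat_unit_U2[OF c], of w] unfolding conj_transpose_mat T[OF c] T[OF c'] .
  also have "\<dots> = (\<lambda>a b. (x c * x (cnj c)) * mprod n (mprod n (TU (mat 1)) (AK F w)) (TU (mat 1)) a b)"
    by (simp add: mprod_def sum_distrib_left sum_distrib_right mult_ac)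
  also have "\<dots> = AK F w"
    by (simp add: x1 mprod_one_left mprod_one_right AK_outside)
  finally show ?thesis .
qed

lemma integrable_bounded_AK:
  assumes F: "decaying F" and g: "g \<in> borel_measurable borel" "\<And>w. cmod (g w) \<le> B * (1 + norm w) ^ q"
  shows "integrable lborel (\<lambda>w. g w * AK F w a b)"
proof -
  obtain C where C: "C \<ge> 0" "\<And>a b z. (1 + norm z) ^ q * cmod (AK F z a b) \<le> C * wt z" using AK_weighted[OF F, of q] by blast
  have B: "0 \<le> B" using order.trans[OF norm_ge_zero g(2)[of 0]] by simp
  show ?thesis
  proof (rule integrable_wt_bound(1)[where C = "B * C"])
    show "(\<lambda>w. g w * AK F w a b) \<in> borel_measurable borel"
      by (intro borel_measurable_times g(1) measurable_AK decaying_smooth F)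
    fix w
    have "cmod (g w * AK F w a b) \<le> (B * (1 + norm w) ^ q) * cmod (AK F w a b)"
      unfolding norm_mult by (intro mult_right_mono g(2)) simp
    also have "\<dots> = B * ((1 + norm w) ^ q * cmod (AK F w a b))" by simp
    also have "\<dots> \<le> B * (C * wt w)" by (intro mult_left_mono C B)
    finally show "cmod (g w * AK F w a b) \<le> (B * C) * wt w" by simp
  qed
qed

text \<open>By \<open>AK_phase\<close> with the phase \<open>- 1\<close> the matrix function is
  even, so the sine part integrates to 0.\<close>

lemma integral_cis_AK:
  assumes F: "decaying F" "central_on_U2 F"
  shows "(\<integral>w. cis (y * Re (w$2)) * AK F w a b \<partial>lborel) = (\<integral>w. of_real (cos (y * Re (w$2))) * AK F w a b \<partial>lborel)"
proof -
  have sF: "smooth F" by (rule decaying_smooth[OF F(1)])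
  have m: "(\<lambda>w::complex^2. of_real (cos (y * Re (w$2))) :: complex) \<in> borel_measurable borel"
     "(\<lambda>w::complex^2. of_real (sin (y * Re (w$2))) :: complex) \<in> borel_measurable borel"
    by (intro borel_measurable_continuous_onI continuous_intros)+
  have i: "integrable lborel (\<lambda>w. of_real (cos (y * Re (w$2))) * AK F w a b)" "integrable lborel (\<lambda>w. of_real (sin (y * Re (w$2))) * AK F w a b)"
    by (rule integrable_bounded_AK[OF F(1), of _ 1 0], use m in auto)+
  let ?g = "\<lambda>w. of_real (sin (y * Re (w$2))) * AK F w a b"
  have "(\<integral>w. ?g w \<partial>lborel) = (\<integral>w. ?g (mat (- 1) *v w) \<partial>lborel)"
    by (rule integral_U2_vec[symmetric]) (auto intro!: mat_unit_U2 borel_measurable_times m measurable_AK sF)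
  also have "\<dots> = (\<integral>w. - ?g w \<partial>lborel)"
  proof (rule Bochner_Integration.integral_cong[OF refl])
    fix w :: "complex^2"
    have "(mat (- 1) *v w) $ 2 = - w$2" by (simp add: mvec2_nth mat2_nth)
    then show "?g (mat (- 1) *v w) = - ?g w" using AK_phase[OF sF F(2), of "- 1" w] by simp
  qed
  also have "\<dots> = - (\<integral>w. ?g w \<partial>lborel)" by simp
  finally have z: "(\<integral>w. ?g w \<partial>lborel) = 0" by simp
  have "(\<integral>w. cis (y * Re (w$2)) * AK F w a b \<partial>lborel) = (\<integral>w. of_real (cos (y * Re (w$2))) * AK F w a b + \<i> * ?g w \<partial>lborel)"
    by (rule Bochner_Integration.integral_cong[OF refl]) (simp add: complex_eq_iff)
  also have "\<dots> = (\<integral>w. of_real (cos (y * Re (w$2))) * AK F w a b \<partial>lborel) + (\<integral>w. \<i> * ?g w \<partial>lborel)"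
    by (rule Bochner_Integration.integral_add) (auto intro!: i integrable_mult_right)
  also have "(\<integral>w. \<i> * ?g w \<partial>lborel) = 0" unfolding integral_mult_right_zero z by simp
  finally show ?thesis by simp
qed

end

subsection \<open>The function \<open>cos (sqrt s)\<close>\<close>

text \<open>Taylor coefficients of the \<open>k\<close>-th derivative of the entire function with
  terms \<open>(-1) ^ i * s ^ i / fact (2 * i)\<close>, which is \<open>cos (sqrt s)\<close> for
  \<open>s \<ge> 0\<close>.\<close>

definition cos_sqrt_series_coeff :: "nat \<Rightarrow> nat \<Rightarrow> real" where
  "cos_sqrt_series_coeff k i = (-1) ^ (i + k) * fact (i + k) / (fact (2 * (i + k)) * fact i)"

definition cos_sqrt_series :: "nat \<Rightarrow> real \<Rightarrow> real" where
  "cos_sqrt_series k s = (\<Sum>i. cos_sqrt_series_coeff k i * s ^ i)"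

lemma summable_cos_sqrt_series: "summable (\<lambda>i. cos_sqrt_series_coeff k i * y ^ i)"
proof (rule summable_comparison_test)
  show "summable (\<lambda>i. inverse (fact i) * \<bar>y\<bar> ^ i)" by (rule summable_exp)
  have "norm (cos_sqrt_series_coeff k i * y ^ i) \<le> inverse (fact i) * \<bar>y\<bar> ^ i" for i
  proof -
    have "(fact (i + k) :: real) \<le> fact (2 * (i + k))" by (rule fact_mono) simp
    then have "fact (i + k) / fact (2 * (i + k)) \<le> (1::real)" by simp
    then have "(fact (i + k) / fact (2 * (i + k))) * (inverse (fact i) * \<bar>y\<bar> ^ i) \<le> 1 * (inverse (fact i) * \<bar>y\<bar> ^ i)"
      by (intro mult_right_mono) auto
    then show ?thesis by (simp add: cos_sqrt_series_coeff_def abs_mult power_abs divide_inverse mult_ac)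
  qed
  then show "\<exists>N. \<forall>i\<ge>N. norm (cos_sqrt_series_coeff k i * y ^ i) \<le> inverse (fact i) * \<bar>y\<bar> ^ i" by blast
qed

lemma cos_sqrt_series_coeff_Suc: "real (Suc i) * cos_sqrt_series_coeff k (Suc i) = cos_sqrt_series_coeff (Suc k) i"
proof -
  have "Suc i + k = i + Suc k" by simp
  then show ?thesis by (simp only: cos_sqrt_series_coeff_def fact_Suc[of i]) simp
qed

lemma cos_sqrt_series_derivative: "(cos_sqrt_series k has_real_derivative cos_sqrt_series (Suc k) s) (at s)"
proof -
  have "diffs (cos_sqrt_series_coeff k) = cos_sqrt_series_coeff (Suc k)" by (simp only: diffs_def cos_sqrt_series_coeff_Suc)
  then show ?thesis
    using termdiffs_strong_converges_everywhere[OF summable_cos_sqrt_series, of k s] by (simp only: cos_sqrt_series_def[abs_def])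
qed

lemma cos_sqrt_series_0: assumes "0 \<le> s" shows "cos_sqrt_series 0 s = cos (sqrt s)"
proof -
  have "(-1) ^ i / fact (2 * i) * sqrt s ^ (2 * i) = cos_sqrt_series_coeff 0 i * s ^ i" for i
    using assms by (simp add: cos_sqrt_series_coeff_def power_mult)
  then have "(\<lambda>i. cos_sqrt_series_coeff 0 i * s ^ i) sums cos (sqrt s)" using cos_paired[of "sqrt s"] by (simp only:)
  then show ?thesis by (simp add: cos_sqrt_series_def sums_iff)
qed

text \<open>The equation \<open>4 * s * y'' + 2 * y' + y = 0\<close> differentiated \<open>k\<close>
  times, verified on power series coefficients.\<close>

lemma cos_sqrt_series_ode: "4 * s * cos_sqrt_series (Suc (Suc k)) s + real (4 * k + 2) * cos_sqrt_series (Suc k) s + cos_sqrt_series k s = 0"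
proof -
  have S: "(\<lambda>i. cos_sqrt_series_coeff l i * s ^ i) sums cos_sqrt_series l s" for l
    unfolding cos_sqrt_series_def using summable_cos_sqrt_series by (rule summable_sums)
  have "(\<lambda>i. real (Suc i) * cos_sqrt_series_coeff (Suc k) (Suc i) * s ^ Suc i) sums (s * cos_sqrt_series (Suc (Suc k)) s)"
    using sums_mult[OF S[of "Suc (Suc k)"], of s] unfolding cos_sqrt_series_coeff_Suc by (simp add: mult_ac)
  from sums_Suc[of "\<lambda>i. real i * cos_sqrt_series_coeff (Suc k) i * s ^ i", OF this]
  have A: "(\<lambda>i. real i * cos_sqrt_series_coeff (Suc k) i * s ^ i) sums (s * cos_sqrt_series (Suc (Suc k)) s)" by simp
  have coeff: "(4 * real i + real (4 * k + 2)) * cos_sqrt_series_coeff (Suc k) i + cos_sqrt_series_coeff k i = 0" for i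
  proof -
    define N where "N = i + k"
    have f: "fact (2 * Suc N) = (2 * real N + 2) * (2 * real N + 1) * fact (2 * N)"
      by (simp add: algebra_simps)
    have nz: "2 * real N + 2 \<noteq> 0" "2 * real N + 1 \<noteq> 0" by linarith+
    have "cos_sqrt_series_coeff (Suc k) i = - ((-1) ^ N * ((real N + 1) * fact N) / (((2 * real N + 2) * (2 * real N + 1) * fact (2 * N)) * fact i))"
      unfolding cos_sqrt_series_coeff_def f[symmetric] N_def by (simp add: ac_simps)
    moreover have "cos_sqrt_series_coeff k i = (-1) ^ N * fact N / (fact (2 * N) * fact i)" by (simp add: cos_sqrt_series_coeff_def N_def)
    moreover have "4 * real i + real (4 * k + 2) = 2 * (2 * real N + 1)" by (simp add: N_def)
    moreover have "2 * (2 * x + 1) * (- (s * ((x + 1) * f) / (((2 * x + 2) * (2 * x + 1) * g) * h))) + s * f / (g * h) = 0"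
      if "2 * x + 2 \<noteq> 0" "2 * x + 1 \<noteq> 0" "g \<noteq> 0" "h \<noteq> 0" for x s f g h :: real
    proof -
      have "s * ((x + 1) * f) / (((2 * x + 2) * (2 * x + 1) * g) * h) = (s * f / (g * h)) * ((x + 1) / ((2 * x + 2) * (2 * x + 1)))" by (simp add: ac_simps)
      also have "(x + 1) / ((2 * x + 2) * (2 * x + 1)) = 1 / (2 * (2 * x + 1))" using that(1,2) by (simp add: divide_simps) (simp add: algebra_simps)
      finally show ?thesis using that(2) by simp
    qed
    ultimately show ?thesis using nz by (simp only:) simp
  qed
  have "(\<lambda>i. 4 * (real i * cos_sqrt_series_coeff (Suc k) i * s ^ i) + real (4 * k + 2) * (cos_sqrt_series_coeff (Suc k) i * s ^ i) + cos_sqrt_series_coeff k i * s ^ i)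
      sums (4 * (s * cos_sqrt_series (Suc (Suc k)) s) + real (4 * k + 2) * cos_sqrt_series (Suc k) s + cos_sqrt_series k s)"
    by (intro sums_add sums_mult A S)
  moreover have "4 * (real i * cos_sqrt_series_coeff (Suc k) i * s ^ i) + real (4 * k + 2) * (cos_sqrt_series_coeff (Suc k) i * s ^ i) + cos_sqrt_series_coeff k i * s ^ i
      = ((4 * real i + real (4 * k + 2)) * cos_sqrt_series_coeff (Suc k) i + cos_sqrt_series_coeff k i) * s ^ i" for i
    by (simp only: distrib_right mult.assoc)
  ultimately have "(\<lambda>i. 0) sums (4 * (s * cos_sqrt_series (Suc (Suc k)) s) + real (4 * k + 2) * cos_sqrt_series (Suc k) s + cos_sqrt_series k s)"
    by (simp only: coeff mult_zero_left)
  then show ?thesis using sums_unique2 sums_zero by (simp only: mult.assoc) blast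
qed

text \<open>The differential equation makes \<open>(cos_sqrt_series k s)\<^sup>2 + 4 s (cos_sqrt_series (k + 1) s)\<^sup>2\<close> nonincreasing for \<open>s \<ge> 0\<close>.\<close>

lemma cos_sqrt_series_bound: assumes "0 \<le> s" shows "\<bar>cos_sqrt_series k s\<bar> \<le> \<bar>cos_sqrt_series k 0\<bar>"
proof -
  let ?E = "\<lambda>s. (cos_sqrt_series k s)\<^sup>2 + 4 * s * (cos_sqrt_series (Suc k) s)\<^sup>2"
  have "?E s \<le> ?E 0"
  proof (rule DERIV_nonpos_imp_nonincreasing[OF assms])
    fix x assume "0 \<le> x" "x \<le> s"
    let ?a = "cos_sqrt_series k x" and ?b = "cos_sqrt_series (Suc k) x" and ?c = "cos_sqrt_series (Suc (Suc k)) x"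
    have "(?E has_real_derivative 2 * ?a * ?b + (4 * ?b\<^sup>2 + 4 * x * (2 * ?b * ?c))) (at x)"
      by (auto intro!: derivative_eq_intros cos_sqrt_series_derivative simp: power2_eq_square)
    moreover have "2 * ?a * ?b + (4 * ?b\<^sup>2 + 4 * x * (2 * ?b * ?c)) = - 8 * real k * ?b\<^sup>2"
    proof -
      have a: "?a = - (4 * x * ?c) - real (4 * k + 2) * ?b" using cos_sqrt_series_ode[of x k] by linarith
      show ?thesis unfolding a by (simp add: algebra_simps power2_eq_square)
    qed
    ultimately show "\<exists>y. (?E has_real_derivative y) (at x) \<and> y \<le> 0" by force
  qed
  moreover have "0 \<le> 4 * s * (cos_sqrt_series (Suc k) s)\<^sup>2" using assms by simp
  ultimately have "(cos_sqrt_series k s)\<^sup>2 \<le> (cos_sqrt_series k 0)\<^sup>2" by simp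
  then show ?thesis by (rule abs_le_square_iff[THEN iffD2])
qed

text \<open>A smooth continuation of \<open>cos (sqrt t)\<close> to \<open>t < 0\<close> with bounded derivatives; the power series itself grows
  exponentially there.\<close>

definition cos_sqrt :: "real \<Rightarrow> complex" where
  "cos_sqrt t = smooth_step (1 * t + 1) * of_real (cos_sqrt_series 0 t)"

lemma cos_sqrt_series_complex:
  "sm UNIV (\<lambda>t. complex_of_real (cos_sqrt_series 0 t))" "(dv ^^ k) (\<lambda>t. complex_of_real (cos_sqrt_series 0 t)) t = of_real (cos_sqrt_series k t)"
proof -
  have "((\<lambda>t. complex_of_real (cos_sqrt_series k t)) has_vector_derivative of_real (cos_sqrt_series (Suc k) t)) (at t)" for k t
    using cos_sqrt_series_derivative[of k t] by (intro has_vector_derivative_of_real) (simp add: has_real_derivative_iff_has_vector_derivative)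
  from sm_tower[of UNIV "\<lambda>k t. complex_of_real (cos_sqrt_series k t)", OF open_UNIV this]
  show "sm UNIV (\<lambda>t. complex_of_real (cos_sqrt_series 0 t))" "(dv ^^ k) (\<lambda>t. complex_of_real (cos_sqrt_series 0 t)) t = of_real (cos_sqrt_series k t)" by auto
qed

lemma sm_cos_sqrt: "sm UNIV cos_sqrt"
  unfolding cos_sqrt_def[abs_def] by (intro sm_mult sm_affine smooth_step open_UNIV cos_sqrt_series_complex)

lemma cos_sqrt_cos_sqrt_series: "0 \<le> t \<Longrightarrow> cos_sqrt t = of_real (cos_sqrt_series 0 t)"
  by (simp add: cos_sqrt_def smooth_step)

lemma cos_sqrt_eq: "0 \<le> t \<Longrightarrow> cos_sqrt t = of_real (cos (sqrt t))"
  by (simp add: cos_sqrt_cos_sqrt_series cos_sqrt_series_0)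

lemma cos_sqrt_bounded: "\<exists>B\<ge>0. \<forall>t. cmod ((dv ^^ k) cos_sqrt t) \<le> B"
proof -
  have "compact ((dv ^^ k) cos_sqrt ` {-1..0})"
    using sm_cos_sqrt by (intro compact_continuous_image continuous_on_dvn) (auto intro: sm_subset)
  then obtain B where B: "B > 0" "\<forall>x\<in>(dv ^^ k) cos_sqrt ` {-1..0}. cmod x \<le> B" using compact_imp_bounded bounded_pos by metis
  have "cmod ((dv ^^ k) cos_sqrt t) \<le> B + \<bar>cos_sqrt_series k 0\<bar>" for t
  proof -
    consider "t < -1" | "-1 \<le> t" "t \<le> 0" | "0 < t" by linarith
    then show ?thesis
    proof cases
      case 1
      have "(dv ^^ k) cos_sqrt t = (dv ^^ k) (\<lambda>_. 0) t"
        by (rule dvn_cong[of "{..<-1}"]) (use 1 in \<open>auto simp: cos_sqrt_def smooth_step\<close>)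
      moreover have "(dv ^^ k) (\<lambda>_::real. 0 :: complex) t = 0"
        using sm_tower(2)[of UNIV "\<lambda>_ _. 0 :: complex" t k] by simp
      ultimately show ?thesis using B by simp
    next
      case 2
      then have "(dv ^^ k) cos_sqrt t \<in> (dv ^^ k) cos_sqrt ` {-1..0}" by (intro imageI) simp
      from bspec[OF B(2) this] show ?thesis by linarith
    next
      case 3
      have "(dv ^^ k) cos_sqrt t = (dv ^^ k) (\<lambda>t. complex_of_real (cos_sqrt_series 0 t)) t"
        by (rule dvn_cong[of "{0<..}"]) (use 3 in \<open>auto simp: cos_sqrt_cos_sqrt_series\<close>)
      then show ?thesis using B cos_sqrt_series_bound[of t k] 3 by (simp add: cos_sqrt_series_complex)
    qed
  qed
  then show ?thesis using B by (intro exI[of _ "B + \<bar>cos_sqrt_series k 0\<bar>"]) auto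
qed

subsection \<open>The radial functions\<close>

context admissible begin

text \<open>The \<open>k\<close>-th derivative in \<open>\<xi>\<close> of the transform at index
  \<open>j\<close>, written as an integral. With \<open>cos_sqrt\<close> in place of the cosine it
  makes sense and is smooth for all real \<open>\<xi>\<close>, also across 0.\<close>

definition radial :: "(motion \<Rightarrow> complex) \<Rightarrow> nat \<Rightarrow> nat \<Rightarrow> real \<Rightarrow> complex" where
  "radial F j k \<xi> = (\<integral>w. (dv ^^ k) cos_sqrt (\<xi> * (Re (w$2))\<^sup>2) * of_real ((Re (w$2)) ^ (2 * k)) * AK F w j j \<partial>lborel)"

lemma measurable_radial_factor:
  "(\<lambda>w::complex^2. (dv ^^ k) cos_sqrt (\<xi> * (Re (w$2))\<^sup>2) * of_real ((Re (w$2)) ^ (2 * k))) \<in> borel_measurable borel"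
  by (intro borel_measurable_continuous_onI continuous_intros continuous_on_compose2[OF continuous_on_dvn[OF sm_cos_sqrt]]) auto

lemma radial_factor_bound:
  assumes "\<And>t. cmod ((dv ^^ k) cos_sqrt t) \<le> B"
  shows "cmod ((dv ^^ k) cos_sqrt (\<xi> * (Re (w$2))\<^sup>2) * of_real ((Re (w$2)) ^ (2 * k))) \<le> B * (1 + norm (w :: complex^2)) ^ (2 * k)"
proof -
  have "\<bar>Re (w$2)\<bar> ^ (2 * k) \<le> (1 + norm w) ^ (2 * k)" by (intro power_mono) (use Re2_le_norm[of w] in auto)
  then show ?thesis
    unfolding norm_mult norm_of_real power_abs by (intro mult_mono assms order.trans[OF norm_ge_zero assms]) auto
qed

lemma radial_derivative:
  assumes F: "decaying F"
  shows "(radial F j k has_vector_derivative radial F j (Suc k) \<xi>) (at \<xi>)"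
proof -
  obtain B where B: "B \<ge> 0" "\<And>t. cmod ((dv ^^ Suc k) cos_sqrt t) \<le> B" using cos_sqrt_bounded by blast
  obtain B' where B': "B' \<ge> 0" "\<And>t. cmod ((dv ^^ k) cos_sqrt t) \<le> B'" using cos_sqrt_bounded by blast
  obtain C where C: "C \<ge> 0" "\<And>a b z. (1 + norm z) ^ (2 * Suc k) * cmod (AK F z a b) \<le> C * wt z" using AK_weighted[OF F, of "2 * Suc k"] by blast
  show ?thesis
    unfolding radial_def[abs_def]
  proof (rule has_vector_derivative_integral[where \<delta> = 1 and G = "\<lambda>w. B * C * wt w"])
    show "integrable lborel (\<lambda>w. (dv ^^ k) cos_sqrt (t * (Re (w$2))\<^sup>2) * of_real ((Re (w$2)) ^ (2 * k)) * AK F w j j)" for t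
      by (rule integrable_bounded_AK[OF F measurable_radial_factor radial_factor_bound[OF B'(2)]])
    show "integrable lborel (\<lambda>w. B * C * wt w)" by (intro integrable_mult_right integrable_wt)
    fix t and w :: "complex^2"
    let ?x = "Re (w$2)"
    have "((\<lambda>t. t * ?x\<^sup>2) has_vector_derivative ?x\<^sup>2) (at t)"
      by (auto simp: has_real_derivative_iff_has_vector_derivative[symmetric] intro!: derivative_eq_intros)
    from vector_diff_chain_at[OF this sm_derivative[OF sm_cos_sqrt, of "t * ?x\<^sup>2" k]]
    have "((\<lambda>t. (dv ^^ k) cos_sqrt (t * ?x\<^sup>2)) has_vector_derivative ?x\<^sup>2 *\<^sub>R (dv ^^ Suc k) cos_sqrt (t * ?x\<^sup>2)) (at t)"
      by (simp add: comp_def)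
    then have "((\<lambda>t. (dv ^^ k) cos_sqrt (t * ?x\<^sup>2) * (of_real (?x ^ (2 * k)) * AK F w j j)) has_vector_derivative
        (?x\<^sup>2 *\<^sub>R (dv ^^ Suc k) cos_sqrt (t * ?x\<^sup>2)) * (of_real (?x ^ (2 * k)) * AK F w j j)) (at t)"
      by (rule has_vector_derivative_mult_left)
    moreover have "(?x\<^sup>2 *\<^sub>R (dv ^^ Suc k) cos_sqrt (t * ?x\<^sup>2)) * (of_real (?x ^ (2 * k)) * AK F w j j) =
        (dv ^^ Suc k) cos_sqrt (t * ?x\<^sup>2) * of_real (?x ^ (2 * Suc k)) * AK F w j j"
      by (simp add: scaleR_conv_of_real power_add power2_eq_square mult_ac)
    ultimately show "((\<lambda>t. (dv ^^ k) cos_sqrt (t * ?x\<^sup>2) * of_real (?x ^ (2 * k)) * AK F w j j) has_vector_derivative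
        (dv ^^ Suc k) cos_sqrt (t * ?x\<^sup>2) * of_real (?x ^ (2 * Suc k)) * AK F w j j) (at t)"
      by (simp only: mult.assoc)
    have "cmod ((dv ^^ Suc k) cos_sqrt (t * ?x\<^sup>2) * of_real (?x ^ (2 * Suc k)) * AK F w j j) \<le> B * (1 + norm w) ^ (2 * Suc k) * cmod (AK F w j j)"
      unfolding norm_mult[of _ "AK F w j j"] by (intro mult_right_mono radial_factor_bound B) simp
    also have "\<dots> \<le> B * (C * wt w)" unfolding mult.assoc by (intro mult_left_mono C B)
    finally show "cmod ((dv ^^ Suc k) cos_sqrt (t * ?x\<^sup>2) * of_real (?x ^ (2 * Suc k)) * AK F w j j) \<le> B * C * wt w" by simp
  qed simp
qed

lemma
  assumes F: "decaying F"
  shows sm_radial: "sm UNIV (radial F j 0)" and dvn_radial: "(dv ^^ k) (radial F j 0) \<xi> = radial F j k \<xi>"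
  using sm_tower[of UNIV "radial F j", OF open_UNIV radial_derivative[OF F]] by auto

lemma radial_0:
  assumes "0 \<le> \<xi>"
  shows "radial F j 0 \<xi> = (\<integral>w. of_real (cos (sqrt \<xi> * Re (w$2))) * AK F w j j \<partial>lborel)"
proof -
  have "cos_sqrt (\<xi> * (Re (w$2))\<^sup>2) = of_real (cos (sqrt \<xi> * Re (w$2)))" for w :: "complex^2"
    using assms by (simp add: cos_sqrt_eq real_sqrt_mult abs_if)
  then show ?thesis by (simp add: radial_def)
qed

lemma radial_G_transform:
  assumes "decaying F" "central_on_U2 F" "\<And>z. A_transform m n f z = AK F z" "j \<le> n" "0 \<le> \<xi>"
  shows "G_transform m n f \<xi> j = radial F j 0 \<xi>"
  using assms by (simp add: G_transform_eq integral_cis_AK radial_0)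

end

text \<open>All derivatives of \<open>cos_sqrt\<close> are bounded, so the decay of
  \<open>AK\<close> has to cover the factor of degree \<open>2 * k\<close> in \<open>w\<close>, and
  8 further powers for integrability.\<close>

lemma radial_rapidly_decaying:
  assumes F: "decaying F"
  shows "\<exists>C\<ge>0. \<forall>(m, n)\<in>E_index. \<forall>j t. cmod (admissible.radial m n F j k t) \<le> C / (1 + \<bar>real_of_int m\<bar> + real n) ^ r"
proof -
  obtain B where B: "B \<ge> 0" "\<And>t. cmod ((dv ^^ k) cos_sqrt t) \<le> B" using cos_sqrt_bounded by blast
  obtain C where C: "C \<ge> 0" and CA: "\<forall>(m, n)\<in>E_index. \<forall>a b z. (1 + norm z) ^ (2 * k + 8) * cmod (admissible.AK m n F z a b) \<le> C / (1 + \<bar>real_of_int m\<bar> + real n) ^ r"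
    using AK_rapidly_decaying[OF F, of "2 * k + 8" r] by blast
  have "cmod (admissible.radial m n F j k t) \<le> (B * C * wt_int) / (1 + \<bar>real_of_int m\<bar> + real n) ^ r"
    if mn: "(m, n) \<in> E_index" for m n j t
  proof -
    interpret admissible m n by unfold_locales (rule mn)
    let ?s = "(1 + \<bar>real_of_int m\<bar> + real n) ^ r"
    have "cmod (radial F j k t) \<le> (B * C / ?s) * wt_int"
      unfolding radial_def
    proof (rule integrable_wt_bound(2))
      show "(\<lambda>w. (dv ^^ k) cos_sqrt (t * (Re (w$2))\<^sup>2) * of_real ((Re (w$2)) ^ (2 * k)) * AK F w j j) \<in> borel_measurable borel"
        by (intro borel_measurable_times measurable_radial_factor measurable_AK decaying_smooth F)
      fix w :: "complex^2"
      have p: "0 < 1 + norm w" by (simp add: add_pos_nonneg)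
      have "(1 + norm w) ^ (2 * k + 8) * cmod (AK F w j j) \<le> C / ?s" using bspec[OF CA mn] by simp
      then have *: "(1 + norm w) ^ (2 * k) * cmod (AK F w j j) \<le> (C / ?s) * wt w"
        using p unfolding power_add by (simp add: pos_le_divide_eq mult_ac)
      have "cmod ((dv ^^ k) cos_sqrt (t * (Re (w$2))\<^sup>2) * of_real ((Re (w$2)) ^ (2 * k)) * AK F w j j) \<le> B * (1 + norm w) ^ (2 * k) * cmod (AK F w j j)"
        unfolding norm_mult[of _ "AK F w j j"] by (intro mult_right_mono radial_factor_bound B) simp
      also have "\<dots> \<le> B * ((C / ?s) * wt w)" unfolding mult.assoc by (intro mult_left_mono * B)
      finally show "cmod ((dv ^^ k) cos_sqrt (t * (Re (w$2))\<^sup>2) * of_real ((Re (w$2)) ^ (2 * k)) * AK F w j j) \<le> (B * C / ?s) * wt w" by simp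
    qed
    then show ?thesis by simp
  qed
  moreover have "0 \<le> B * C * wt_int" using B C wt_int_nonneg by simp
  ultimately show ?thesis by (intro exI[of _ "B * C * wt_int"]) auto
qed

subsection \<open>The Laplacian in the second variable\<close>

lemma slice_derivative:
  assumes F: "smooth F"
  shows "((\<lambda>t. F (k, w + t *\<^sub>R (k *v b))) has_vector_derivative left_deriv (0, b) F (k, w + t *\<^sub>R (k *v b))) (at t)"
proof -
  have "((\<lambda>t. (k, w + t *\<^sub>R (k *v b))) has_vector_derivative (0, k *v b)) (at t)"
    by (auto intro!: has_vector_derivative_Pair has_vector_derivative_const derivative_eq_intros simp: has_vector_derivative_def)
  moreover have "(0, k *v b) = left_field (0, b) (k, w + t *\<^sub>R (k *v b))" by (simp add: left_field_def)
  ultimately have "((\<lambda>t. (k, w + t *\<^sub>R (k *v b))) has_vector_derivative left_field (0, b) (k, w + t *\<^sub>R (k *v b))) (at t)" by simp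
  from vector_derivative_diff_chain_within[OF this has_derivative_at_withinI[OF smooth_has_derivative[OF F]]]
  show ?thesis by (simp add: comp_def left_deriv_dir_deriv)
qed

lemma skew_0: "0 \<in> skew_hermitian"
  by (simp add: skew_hermitian_def mat2_eq_iff conj_transpose_nth)

lemma decaying_slice:
  assumes "decaying F"
  shows "\<exists>C\<ge>0. \<forall>k\<in>U2. \<forall>z. cmod (F (k, z)) \<le> C * wt z"
proof -
  obtain C where C: "C \<ge> 0" "\<forall>k\<in>U2. \<forall>z. (1 + norm z) ^ 8 * cmod (F (k, z)) \<le> C" using decaying_bound[OF assms] by blast
  have "cmod (F (k, z)) \<le> C * wt z" if k: "k \<in> U2" for k z
  proof -
    have "0 < 1 + norm z" by (simp add: add_pos_nonneg)
    then have "0 < (1 + norm z) ^ 8" by simp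
    moreover have "(1 + norm z) ^ 8 * cmod (F (k, z)) \<le> C" using C(2) k by blast
    ultimately show ?thesis by (simp add: pos_le_divide_eq mult.commute)
  qed
  then show ?thesis using C(1) by blast
qed

lemma measurable_slice: "smooth F \<Longrightarrow> (\<lambda>z. F (k, z)) \<in> borel_measurable borel"
  by (rule borel_measurable_continuous_onI, rule continuous_on_compose2[OF smooth_continuous[where S = UNIV]])
    (auto intro!: continuous_intros)

lemma integrable_slice:
  fixes \<phi> :: "real \<Rightarrow> real"
  assumes F: "decaying F" and k: "k \<in> U2" and \<phi>: "continuous_on UNIV \<phi>" "\<And>x. \<bar>\<phi> x\<bar> \<le> B"
  shows "integrable lborel (\<lambda>w. of_real (\<phi> (Re (w$2))) * F (k, w))"
proof -
  obtain C where C: "C \<ge> 0" "\<forall>k\<in>U2. \<forall>z. cmod (F (k, z)) \<le> C * wt z" using decaying_slice[OF F] by blast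
  have B: "0 \<le> B" using order.trans[OF abs_ge_zero \<phi>(2)] .
  show ?thesis
  proof (rule integrable_wt_bound(1))
    show "(\<lambda>w. of_real (\<phi> (Re (w$2))) * F (k, w)) \<in> borel_measurable borel"
      by (intro borel_measurable_times measurable_slice decaying_smooth F borel_measurable_continuous_onI
          continuous_on_of_real continuous_on_compose2[OF \<phi>(1)] continuous_intros) auto
    fix w :: "complex^2"
    have "\<bar>\<phi> (Re (w$2))\<bar> * cmod (F (k, w)) \<le> B * (C * wt w)" by (intro mult_mono \<phi> B) (use C k in auto)
    then show "cmod (of_real (\<phi> (Re (w$2))) * F (k, w)) \<le> (B * C) * wt w" by (simp add: norm_mult)
  qed
qed

lemma integral_translate:
  fixes g :: "complex^2 \<Rightarrow> complex"
  assumes "g \<in> borel_measurable borel"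
  shows "(\<integral>w. g (v + w) \<partial>lborel) = (\<integral>w. g w \<partial>lborel)"
proof -
  have "integral\<^sup>L (distr lborel borel ((+) v)) g = (\<integral>w. g (v + w) \<partial>lborel)"
    by (intro integral_distr) (use assms in auto)
  then show ?thesis by (simp add: lborel_distr_plus)
qed

text \<open>\<open>1 + norm w\<close> is at most \<open>(1 + r) * (1 + norm (w + u))\<close>. Hence
  bounded translates share an integrable majorant, as differentiation under the integral
  requires.\<close>

lemma wt_translate:
  assumes "norm u \<le> r" shows "wt (w + u) \<le> (1 + r) ^ 8 * wt w"
proof -
  have r: "0 \<le> r" using order.trans[OF norm_ge_zero assms] .
  have p: "0 < 1 + norm w" "0 < 1 + norm (w + u)" by (simp_all add: add_pos_nonneg)
  have "norm w \<le> norm (w + u) + norm u" using norm_triangle_ineq4[of "w + u" u] by simp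
  moreover have "0 \<le> r * norm (w + u)" using r by simp
  ultimately have "1 + norm w \<le> (1 + r) * (1 + norm (w + u))" using assms by (simp add: algebra_simps)
  then have "(1 + norm w) ^ 8 \<le> ((1 + r) * (1 + norm (w + u))) ^ 8" by (intro power_mono) (use p in auto)
  then show ?thesis using p by (simp add: power_mult_distrib divide_simps mult.commute)
qed

text \<open>The integral of \<open>\<phi> (Re (w$2)) * F (k, w)\<close> is unchanged when
  \<open>w\<close> is translated by a multiple of \<open>k *v b\<close>. Differentiating this at 0
  gives the identity, with no boundary terms to discuss.\<close>

lemma integration_by_parts:
  fixes \<phi> \<phi>' :: "real \<Rightarrow> real"
  assumes F: "decaying F" and k: "k \<in> U2"
    and \<phi>: "\<And>x. (\<phi> has_real_derivative \<phi>' x) (at x)" "continuous_on UNIV \<phi>'" "\<And>x. \<bar>\<phi> x\<bar> \<le> B" "\<And>x. \<bar>\<phi>' x\<bar> \<le> B"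
  shows "(\<integral>w. of_real (\<phi> (Re (w$2))) * left_deriv (0, b) F (k, w) \<partial>lborel) =
    - of_real (Re ((k *v b)$2)) * (\<integral>w. of_real (\<phi>' (Re (w$2))) * F (k, w) \<partial>lborel)"
proof -
  let ?v = "k *v b" and ?L = "left_deriv (0, b) F"
  let ?c = "Re (?v$2)"
  have L: "decaying ?L" by (rule decaying_left_deriv[OF F]) (simp add: skew_0)
  have c\<phi>: "continuous_on UNIV \<phi>" using \<phi>(1) by (meson DERIV_continuous continuous_at_imp_continuous_on)
  obtain C where C: "C \<ge> 0" "\<forall>k\<in>U2. \<forall>z. cmod (F (k, z)) \<le> C * wt z" using decaying_slice[OF F] by blast
  obtain D where D: "D \<ge> 0" "\<forall>k\<in>U2. \<forall>z. cmod (?L (k, z)) \<le> D * wt z" using decaying_slice[OF L] by blast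
  have B: "0 \<le> B" using order.trans[OF abs_ge_zero \<phi>(3)] .
  let ?g = "\<lambda>w. complex_of_real (\<phi> (Re (w$2))) * F (k, w)"
  let ?g' = "\<lambda>w. complex_of_real (\<phi> (Re (w$2))) * ?L (k, w) + of_real ?c * (of_real (\<phi>' (Re (w$2))) * F (k, w))"
  have gi: "integrable lborel ?g" by (rule integrable_slice[OF F k c\<phi> \<phi>(3)])
  then have gm: "?g \<in> borel_measurable borel" by (simp add: borel_measurable_integrable)
  have tr: "(\<integral>w. ?g (w + t *\<^sub>R ?v) \<partial>lborel) = (\<integral>w. ?g w \<partial>lborel)" for t
    using integral_translate[OF gm, of "t *\<^sub>R ?v"] by (simp only: add.commute)
  let ?K = "(B * D + \<bar>?c\<bar> * (B * C)) * (1 + norm ?v) ^ 8"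
  have d1: "((\<lambda>t. \<integral>w. ?g (w + t *\<^sub>R ?v) \<partial>lborel) has_vector_derivative (\<integral>w. ?g' (w + 0 *\<^sub>R ?v) \<partial>lborel)) (at 0)"
  proof (rule has_vector_derivative_integral[where \<delta> = 1 and G = "\<lambda>w. ?K * wt w"])
    show "integrable lborel (\<lambda>w. ?K * wt w)" by (intro integrable_mult_right integrable_wt)
    fix t :: real assume t: "\<bar>t - 0\<bar> < 1"
    have "integrable (distr lborel borel ((+) (t *\<^sub>R ?v))) ?g" using gi by (simp add: lborel_distr_plus)
    then have "integrable lborel (\<lambda>w. ?g (t *\<^sub>R ?v + w))" by (subst (asm) integrable_distr_eq) (use gm in auto)
    then show "integrable lborel (\<lambda>w. ?g (w + t *\<^sub>R ?v))" by (simp only: add.commute)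
    fix w :: "complex^2"
    let ?wt = "w + t *\<^sub>R ?v"
    have "((\<lambda>t. \<phi> (Re ((w + t *\<^sub>R ?v)$2))) has_real_derivative \<phi>' (Re (?wt$2)) * ?c) (at t)"
      by (rule DERIV_chain2[OF \<phi>(1)]) (auto intro!: derivative_eq_intros)
    then have "((\<lambda>t. complex_of_real (\<phi> (Re ((w + t *\<^sub>R ?v)$2)))) has_vector_derivative of_real (\<phi>' (Re (?wt$2)) * ?c)) (at t)"
      by (intro has_vector_derivative_of_real) (simp add: has_real_derivative_iff_has_vector_derivative)
    from has_vector_derivative_mult[OF this slice_derivative[OF decaying_smooth[OF F]]]
    show "((\<lambda>t. ?g (w + t *\<^sub>R ?v)) has_vector_derivative ?g' ?wt) (at t)" by (simp add: mult_ac)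
    have "cmod (?g' ?wt) \<le> \<bar>\<phi> (Re (?wt$2))\<bar> * cmod (?L (k, ?wt)) + \<bar>?c\<bar> * (\<bar>\<phi>' (Re (?wt$2))\<bar> * cmod (F (k, ?wt)))"
      by (rule order.trans[OF norm_triangle_ineq]) (simp add: norm_mult)
    also have "\<dots> \<le> B * (D * wt ?wt) + \<bar>?c\<bar> * (B * (C * wt ?wt))"
      by (intro add_mono mult_mono \<phi> B) (use C D k in auto)
    also have "\<dots> = (B * D + \<bar>?c\<bar> * (B * C)) * wt ?wt" by (simp add: algebra_simps add_divide_distrib)
    also have "\<dots> \<le> (B * D + \<bar>?c\<bar> * (B * C)) * ((1 + norm ?v) ^ 8 * wt w)"
    proof (intro mult_left_mono wt_translate)
      show "norm (t *\<^sub>R ?v) \<le> norm ?v" using t mult_right_mono[of "\<bar>t\<bar>" 1 "norm ?v"] by simp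
    qed (use B C D in auto)
    finally show "cmod (?g' ?wt) \<le> ?K * wt w" by (simp only: mult.assoc)
  qed simp
  have d2: "((\<lambda>t::real. \<integral>w. ?g w \<partial>lborel) has_vector_derivative 0) (at 0)" by (rule has_vector_derivative_const)
  have z: "(\<integral>w. ?g' w \<partial>lborel) = 0" using vector_derivative_unique_at[OF d1[unfolded tr] d2] by simp
  have "(\<integral>w. ?g' w \<partial>lborel) = (\<integral>w. of_real (\<phi> (Re (w$2))) * ?L (k, w) \<partial>lborel) + (\<integral>w. of_real ?c * (of_real (\<phi>' (Re (w$2))) * F (k, w)) \<partial>lborel)"
    by (intro Bochner_Integration.integral_add integrable_mult_right integrable_slice[OF L k c\<phi> \<phi>(3)] integrable_slice[OF F k \<phi>(2,4)])
  then have "(\<integral>w. of_real (\<phi> (Re (w$2))) * ?L (k, w) \<partial>lborel) + of_real ?c * (\<integral>w. of_real (\<phi>' (Re (w$2))) * F (k, w) \<partial>lborel) = 0"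
    unfolding integral_mult_right_zero using z by simp
  then show ?thesis by (simp add: add_eq_0_iff2)
qed

text \<open>At \<open>(k, z)\<close> the field \<open>(0, b)\<close> points along
  \<open>k *v b\<close>, and these vectors form an orthonormal basis; so for fixed \<open>k\<close>
  in \<open>U2\<close> this is minus the Euclidean Laplacian in \<open>z\<close>. In terms of
  left-invariant derivatives it visibly preserves \<open>decaying\<close>.\<close>

definition neg_laplacian :: "(motion \<Rightarrow> complex) \<Rightarrow> motion \<Rightarrow> complex" where
  "neg_laplacian F = (\<lambda>p. \<Sum>b\<in>Basis. (-1) * left_deriv (0, b) (left_deriv (0, b) F) p)"

lemma decaying_sum:
  assumes "decaying F0" "finite A" "\<And>b. b \<in> A \<Longrightarrow> decaying (G b)"
  shows "decaying (\<lambda>p. \<Sum>b\<in>A. G b p)"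
  using assms(2,3)
proof (induction A rule: finite_induct)
  case empty
  then show ?case using decaying_cmult[OF assms(1), of 0] by simp
next
  case (insert b A)
  then show ?case using decaying_add[of "G b" "\<lambda>p. \<Sum>b\<in>A. G b p"] by simp
qed

lemma decaying_left2: "decaying F \<Longrightarrow> decaying (left_deriv (0, b) F)"
  by (rule decaying_left_deriv) (simp_all add: skew_0)

lemma decaying_neg_laplacian: assumes "decaying F" shows "decaying (neg_laplacian F)"
  unfolding neg_laplacian_def
  by (rule decaying_sum[OF assms finite_Basis]) (intro decaying_cmult decaying_left2 assms)

text \<open>Parseval for the unit vector \<open>conj_transpose k *v e\<close>, where
  \<open>e\<close> is the second basis vector.\<close>

lemma sum_second_row: assumes k: "k \<in> U2" shows "(\<Sum>b\<in>Basis. (Re ((k *v b)$2))\<^sup>2) = 1"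
proof -
  define e :: "complex^2" where "e = axis 2 1"
  let ?c = "conj_transpose k *v e"
  have kc: "k *v ?c = e" using k by (simp add: U2_def matrix_vector_mul_assoc)
  have Re2: "Re (x$2) = x \<bullet> e" for x :: "complex^2" by (simp add: e_def inner_axis)
  have ot: "(k *v x) \<bullet> (k *v y) = x \<bullet> y" for x y :: "complex^2"
    using U2_orthogonal_transformation[OF k] by (simp add: orthogonal_transformation_def)
  have "(Re ((k *v b)$2))\<^sup>2 = (?c \<bullet> b) * (?c \<bullet> b)" for b
    unfolding Re2 using ot[of b ?c] unfolding kc by (simp add: power2_eq_square inner_commute)
  then have "(\<Sum>b\<in>Basis. (Re ((k *v b)$2))\<^sup>2) = ?c \<bullet> ?c" by (simp add: euclidean_inner[of ?c ?c])
  also have "\<dots> = (norm ?c)\<^sup>2" by (simp add: power2_norm_eq_inner)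
  also have "norm ?c = norm e" by (rule norm_U2_vec[OF U2_conj_transpose[OF k]])
  finally show ?thesis by (simp add: e_def)
qed

lemma neg_laplacian_cosine:
  assumes F: "decaying F" and k: "k \<in> U2"
  shows "(\<integral>w. of_real (cos (y * Re (w$2))) * neg_laplacian F (k, w) \<partial>lborel) = of_real (y\<^sup>2) * (\<integral>w. of_real (cos (y * Re (w$2))) * F (k, w) \<partial>lborel)"
proof -
  let ?I = "\<integral>w. of_real (cos (y * Re (w$2))) * F (k, w) \<partial>lborel"
  let ?c = "\<lambda>b. Re ((k *v b)$2)"
  let ?B = "1 + \<bar>y\<bar> + \<bar>y * y\<bar>"
  have sb: "\<bar>y * sin x\<bar> \<le> \<bar>y\<bar>" "\<bar>(y * y) * cos x\<bar> \<le> \<bar>y * y\<bar>" "\<bar>cos x\<bar> \<le> 1" for x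
    using abs_sin_le_one[of x] abs_cos_le_one[of x] by (auto simp: abs_mult intro!: mult_left_le)
  have ge: "0 \<le> \<bar>y\<bar>" "0 \<le> \<bar>y * y\<bar>" by simp_all
  have b: "\<bar>cos (y * x)\<bar> \<le> ?B" "\<bar>- (y * sin (y * x))\<bar> \<le> ?B" "\<bar>- ((y * y) * cos (y * x))\<bar> \<le> ?B" for x
    using sb[of "y * x"] ge unfolding abs_minus_cancel by linarith+
  have c: "continuous_on UNIV (\<lambda>x. - (y * sin (y * x)))" "continuous_on UNIV (\<lambda>x. - ((y * y) * cos (y * x)))" "continuous_on UNIV (\<lambda>x. cos (y * x))"
    by (intro continuous_intros)+
  have d: "((\<lambda>x. cos (y * x)) has_real_derivative - (y * sin (y * x))) (at x)"
    "((\<lambda>x. - (y * sin (y * x))) has_real_derivative - ((y * y) * cos (y * x))) (at x)" for x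
    by (auto intro!: derivative_eq_intros)
  have one: "(\<integral>w. of_real (cos (y * Re (w$2))) * left_deriv (0, b) (left_deriv (0, b) F) (k, w) \<partial>lborel) = - of_real ((?c b)\<^sup>2 * y\<^sup>2) * ?I" for b
  proof -
    have "(\<integral>w. of_real (- ((y * y) * cos (y * Re (w$2)))) * F (k, w) \<partial>lborel) = (\<integral>w. - of_real (y * y) * (of_real (cos (y * Re (w$2))) * F (k, w)) \<partial>lborel)"
      by (rule Bochner_Integration.integral_cong[OF refl]) simp
    then have e: "(\<integral>w. of_real (- ((y * y) * cos (y * Re (w$2)))) * F (k, w) \<partial>lborel) = - of_real (y * y) * ?I"
      by (simp only: integral_mult_right_zero)
    show ?thesis
      unfolding integration_by_parts[OF decaying_left2[OF F] k d(1) c(1) b(1,2), of b b] integration_by_parts[OF F k d(2) c(2) b(2,3), of b] e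
      by (simp add: power2_eq_square mult_ac)
  qed
  have "(\<integral>w. of_real (cos (y * Re (w$2))) * neg_laplacian F (k, w) \<partial>lborel) =
      (\<integral>w. (\<Sum>b\<in>Basis. (-1) * (of_real (cos (y * Re (w$2))) * left_deriv (0, b) (left_deriv (0, b) F) (k, w))) \<partial>lborel)"
    by (simp only: neg_laplacian_def sum_distrib_left mult.left_commute)
  also have "\<dots> = (\<Sum>b\<in>Basis. (\<integral>w. (-1) * (of_real (cos (y * Re (w$2))) * left_deriv (0, b) (left_deriv (0, b) F) (k, w)) \<partial>lborel))"
    by (intro Bochner_Integration.integral_sum integrable_mult_right integrable_slice[OF _ k c(3) b(1)] decaying_left2 F)
  also have "\<dots> = (\<Sum>b\<in>Basis. of_real ((?c b)\<^sup>2) * (of_real (y\<^sup>2) * ?I))"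
    unfolding integral_mult_right_zero one by (simp add: mult.assoc)
  also have "\<dots> = of_real (\<Sum>b\<in>Basis. (?c b)\<^sup>2) * (of_real (y\<^sup>2) * ?I)" by (simp only: of_real_sum sum_distrib_right)
  finally show ?thesis unfolding sum_second_row[OF k] by simp
qed

context admissible begin

text \<open>Reduces integrals of the transform to integrals over \<open>w\<close> for fixed
  \<open>k\<close>, where integration by parts is available; \<open>cosine_AK\<close> carries the
  constant factor \<open>chi_mat\<close> along.\<close>

lemma cosine_A_swap:
  assumes F: "decaying F"
  shows "(\<integral>w. of_real (cos (y * Re (w$2))) * A_transform m n F w a b \<partial>lborel) =
    (\<integral>k. (\<integral>w. of_real (cos (y * Re (w$2))) * F (k, w) \<partial>lborel) * TU k a b \<partial>haar_U2)"
proof -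
  obtain C where C: "C \<ge> 0" "\<forall>k\<in>U2. \<forall>z. cmod (F (k, z)) \<le> C * wt z" using decaying_slice[OF F] by blast
  have "(\<integral>w. of_real (cos (y * Re (w$2))) * A_transform m n F w a b \<partial>lborel) = (\<integral>w. (\<integral>k. of_real (cos (y * Re (w$2))) * (F (k, w) * TU k a b) \<partial>haar_U2) \<partial>lborel)"
    by (simp only: A_transform_def integral_mult_right_zero)
  also have "\<dots> = (\<integral>k. (\<integral>w. of_real (cos (y * Re (w$2))) * (F (k, w) * TU k a b) \<partial>lborel) \<partial>haar_U2)"
  proof (rule wt_fubini[OF finite_measure_haar, where C = C])
    have "(\<lambda>p. complex_of_real (cos (y * Re (fst p $ 2))) * ((case p of (z, k) \<Rightarrow> F (k, z)) * TU (snd p) a b)) \<in> borel_measurable ((borel :: (complex^2) measure) \<Otimes>\<^sub>M haar_U2)"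
      by (intro borel_measurable_times measurable_F_haar smooth_continuous decaying_smooth F measurable_compose[OF measurable_snd measurable_TU]
          measurable_compose[OF measurable_fst borel_measurable_continuous_onI] continuous_intros)
    then show "(\<lambda>(w, k). of_real (cos (y * Re (w$2))) * (F (k, w) * TU k a b)) \<in> borel_measurable (borel \<Otimes>\<^sub>M haar_U2)" by (simp add: split_beta')
    fix z :: "complex^2" and k assume "k \<in> space haar_U2"
    then have k: "k \<in> U2" by (simp add: space_haar)
    have "\<bar>cos (y * Re (z$2))\<bar> * (cmod (F (k, z)) * cmod (TU k a b)) \<le> 1 * ((C * wt z) * 1)"
      using C k by (intro mult_mono norm_TU_le) auto
    then show "cmod (of_real (cos (y * Re (z$2))) * (F (k, z) * TU k a b)) \<le> C * wt z" by (simp add: norm_mult)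
  qed
  also have "\<dots> = (\<integral>k. (\<integral>w. of_real (cos (y * Re (w$2))) * F (k, w) \<partial>lborel) * TU k a b \<partial>haar_U2)"
    by (simp only: mult.assoc[symmetric] integral_mult_left_zero)
  finally show ?thesis .
qed

lemma cosine_A_laplacian:
  assumes F: "decaying F"
  shows "(\<integral>w. of_real (cos (y * Re (w$2))) * A_transform m n (neg_laplacian F) w a b \<partial>lborel) =
    of_real (y\<^sup>2) * (\<integral>w. of_real (cos (y * Re (w$2))) * A_transform m n F w a b \<partial>lborel)"
proof -
  have "(\<integral>k. (\<integral>w. of_real (cos (y * Re (w$2))) * neg_laplacian F (k, w) \<partial>lborel) * TU k a b \<partial>haar_U2) =
      (\<integral>k. of_real (y\<^sup>2) * ((\<integral>w. of_real (cos (y * Re (w$2))) * F (k, w) \<partial>lborel) * TU k a b) \<partial>haar_U2)"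
    by (rule Bochner_Integration.integral_cong[OF refl]) (simp add: neg_laplacian_cosine[OF F] space_haar mult.assoc)
  then show ?thesis unfolding cosine_A_swap[OF F] cosine_A_swap[OF decaying_neg_laplacian[OF F]] by (simp only: integral_mult_right_zero)
qed

lemma cosine_AK:
  assumes F: "decaying F"
  shows "(\<integral>w. of_real (cos (y * Re (w$2))) * AK F w a b \<partial>lborel) =
    (\<Sum>c\<le>n. (\<integral>w. of_real (cos (y * Re (w$2))) * A_transform m n F w a c \<partial>lborel) * chi_mat c b)"
proof -
  obtain C where C: "C \<ge> 0" "\<forall>k\<in>U2. \<forall>z. cmod (F (k, z)) \<le> C * wt z" using decaying_slice[OF F] by blast
  have i: "integrable lborel (\<lambda>w. of_real (cos (y * Re (w$2))) * A_transform m n F w a c)" for c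
  proof (rule integrable_wt_bound(1)[where C = C])
    show "(\<lambda>w. of_real (cos (y * Re (w$2))) * A_transform m n F w a c) \<in> borel_measurable borel"
      by (intro borel_measurable_times measurable_A_transform decaying_smooth F borel_measurable_continuous_onI continuous_intros)
    fix w :: "complex^2"
    have "cmod (A_transform m n F w a c) \<le> C * wt w" by (rule A_bound[OF decaying_smooth[OF F]]) (use C in auto)
    then have "\<bar>cos (y * Re (w$2))\<bar> * cmod (A_transform m n F w a c) \<le> 1 * (C * wt w)" using C by (intro mult_mono) auto
    then show "cmod (of_real (cos (y * Re (w$2))) * A_transform m n F w a c) \<le> C * wt w" by (simp add: norm_mult)
  qed
  have "(\<integral>w. of_real (cos (y * Re (w$2))) * AK F w a b \<partial>lborel) = (\<integral>w. (\<Sum>c\<le>n. (of_real (cos (y * Re (w$2))) * A_transform m n F w a c) * chi_mat c b) \<partial>lborel)"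
    by (simp add: AK_def mprod_def sum_distrib_left mult.assoc)
  also have "\<dots> = (\<Sum>c\<le>n. (\<integral>w. (of_real (cos (y * Re (w$2))) * A_transform m n F w a c) * chi_mat c b \<partial>lborel))"
    by (intro Bochner_Integration.integral_sum integrable_mult_left i)
  finally show ?thesis by (simp only: integral_mult_left_zero)
qed

section \<open>Decay in the radial variable\<close>

lemma radial_laplacian_0:
  assumes F: "decaying F" and "0 \<le> \<xi>"
  shows "radial (neg_laplacian F) j 0 \<xi> = of_real \<xi> * radial F j 0 \<xi>"
  using assms by (simp add: radial_0 cosine_AK[OF F] cosine_AK[OF decaying_neg_laplacian[OF F]] cosine_A_laplacian[OF F] sum_distrib_left mult.assoc)

text \<open>The \<open>k\<close>-fold derivative of the identity for \<open>k = 0\<close>. That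
  identity holds for \<open>\<xi> \<ge> 0\<close>, so it is differentiated on the open
  half-line.\<close>

lemma radial_laplacian:
  assumes F: "decaying F" and "0 < \<xi>"
  shows "radial (neg_laplacian F) j k \<xi> = of_real \<xi> * radial F j k \<xi> + of_nat k * radial F j (k - 1) \<xi>"
proof -
  have "(dv ^^ k) (radial (neg_laplacian F) j 0) \<xi> = (dv ^^ k) (\<lambda>t. of_real t * radial F j 0 t) \<xi>"
    by (rule dvn_cong[of "{0<..}"]) (use assms radial_laplacian_0[OF F] in auto)
  then show ?thesis
    unfolding dvn_times_id[OF sm_radial[OF F]] dvn_radial[OF F] dvn_radial[OF decaying_neg_laplacian[OF F]] .
qed

end

text \<open>A factor \<open>t\<close> is exchanged for an application of
  \<open>neg_laplacian\<close> and a derivative of one order less; the induction on \<open>p\<close>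
  therefore runs over all \<open>F\<close> and \<open>k\<close>.\<close>

lemma radial_weighted:
  "decaying F \<Longrightarrow> \<exists>C\<ge>0. \<forall>(m, n)\<in>E_index. \<forall>j. \<forall>t\<ge>0. t ^ p * cmod (admissible.radial m n F j k t) \<le> C / (1 + \<bar>real_of_int m\<bar> + real n) ^ r"
proof (induction p arbitrary: F k)
  case 0
  then obtain C where "C \<ge> 0" "\<forall>(m, n)\<in>E_index. \<forall>j t. cmod (admissible.radial m n F j k t) \<le> C / (1 + \<bar>real_of_int m\<bar> + real n) ^ r"
    using radial_rapidly_decaying[of F k r] by blast
  then show ?case by (intro exI[of _ C]) auto
next
  case (Suc p)
  obtain C where C: "C \<ge> 0" "\<forall>(m, n)\<in>E_index. \<forall>j. \<forall>t\<ge>0. t ^ p * cmod (admissible.radial m n (neg_laplacian F) j k t) \<le> C / (1 + \<bar>real_of_int m\<bar> + real n) ^ r"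
    using Suc.IH[OF decaying_neg_laplacian[OF Suc.prems], of k] by blast
  obtain D where D: "D \<ge> 0" "\<forall>(m, n)\<in>E_index. \<forall>j. \<forall>t\<ge>0. t ^ p * cmod (admissible.radial m n F j (k - 1) t) \<le> D / (1 + \<bar>real_of_int m\<bar> + real n) ^ r"
    using Suc.IH[OF Suc.prems, of "k - 1"] by blast
  have "t ^ Suc p * cmod (admissible.radial m n F j k t) \<le> (C + real k * D) / (1 + \<bar>real_of_int m\<bar> + real n) ^ r"
    if mn: "(m, n) \<in> E_index" and t: "0 \<le> t" for m n j t
  proof (cases "t = 0")
    case True
    then show ?thesis using C D by simp
  next
    case False
    interpret admissible m n by unfold_locales (rule mn)
    let ?s = "(1 + \<bar>real_of_int m\<bar> + real n) ^ r"
    have "of_real t * radial F j k t = radial (neg_laplacian F) j k t - of_nat k * radial F j (k - 1) t"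
      using radial_laplacian[OF Suc.prems, of t j k] t False by simp
    then have "t * cmod (radial F j k t) = cmod (radial (neg_laplacian F) j k t - of_nat k * radial F j (k - 1) t)"
      using t by (metis abs_of_nonneg norm_mult norm_of_real)
    also have "\<dots> \<le> cmod (radial (neg_laplacian F) j k t) + real k * cmod (radial F j (k - 1) t)"
      by (rule order.trans[OF norm_triangle_ineq4]) (simp add: norm_mult)
    finally have "t ^ p * (t * cmod (radial F j k t)) \<le> t ^ p * (cmod (radial (neg_laplacian F) j k t) + real k * cmod (radial F j (k - 1) t))"
      using t by (intro mult_left_mono) auto
    also have "\<dots> = t ^ p * cmod (radial (neg_laplacian F) j k t) + real k * (t ^ p * cmod (radial F j (k - 1) t))"
      by (simp add: algebra_simps)
    also have "\<dots> \<le> C / ?s + real k * (D / ?s)"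
      using bspec[OF C(2) mn] bspec[OF D(2) mn] t by (intro add_mono mult_left_mono) auto
    finally show ?thesis by (simp add: add_divide_distrib mult_ac)
  qed
  moreover have "0 \<le> C + real k * D" using C D by simp
  ultimately show ?case by (intro exI[of _ "C + real k * D"]) auto
qed

lemma radial_schwartz:
  assumes F: "decaying F"
  shows "\<exists>C. \<forall>(m, n)\<in>E_index. \<forall>j. \<forall>t\<ge>0. (1 + t) ^ p * cmod (admissible.radial m n F j k t) \<le> C / (1 + \<bar>real_of_int m\<bar> + real n) ^ r"
proof -
  obtain C where C: "C \<ge> 0" "\<forall>(m, n)\<in>E_index. \<forall>j. \<forall>t\<ge>0. t ^ 0 * cmod (admissible.radial m n F j k t) \<le> C / (1 + \<bar>real_of_int m\<bar> + real n) ^ r"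
    using radial_weighted[OF F] by blast
  obtain D where D: "D \<ge> 0" "\<forall>(m, n)\<in>E_index. \<forall>j. \<forall>t\<ge>0. t ^ p * cmod (admissible.radial m n F j k t) \<le> D / (1 + \<bar>real_of_int m\<bar> + real n) ^ r"
    using radial_weighted[OF F] by blast
  have "(1 + t) ^ p * cmod (admissible.radial m n F j k t) \<le> (2 ^ p * (C + D)) / (1 + \<bar>real_of_int m\<bar> + real n) ^ r"
    if mn: "(m, n) \<in> E_index" and t: "0 \<le> t" for m n j t
  proof -
    let ?s = "(1 + \<bar>real_of_int m\<bar> + real n) ^ r" and ?h = "cmod (admissible.radial m n F j k t)"
    have "(1 + t) ^ p \<le> (2 * max 1 t) ^ p" using t by (intro power_mono) auto
    also have "\<dots> \<le> 2 ^ p * (1 + t ^ p)" using t by (auto simp: power_mult_distrib max_def)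
    finally have "(1 + t) ^ p * ?h \<le> 2 ^ p * (1 + t ^ p) * ?h" by (intro mult_right_mono) auto
    also have "\<dots> = 2 ^ p * (t ^ 0 * ?h + t ^ p * ?h)" by (simp add: algebra_simps)
    also have "\<dots> \<le> 2 ^ p * (C / ?s + D / ?s)"
      using bspec[OF C(2) mn] bspec[OF D(2) mn] t by (intro mult_left_mono add_mono) auto
    finally show ?thesis by (simp add: add_divide_distrib[symmetric])
  qed
  then show ?thesis by (intro exI[of _ "2 ^ p * (C + D)"]) auto
qed

subsection \<open>Moments of the matrix function\<close>

text \<open>Monomials without \<open>cnj (w$1)\<close>: up to constants, the family is closed under
  the complex derivation of \<open>dmonom_combination\<close>, which trades a factor
  \<open>w$2\<close> for \<open>w$1\<close>.\<close>

definition cmonom :: "nat \<Rightarrow> nat \<Rightarrow> nat \<Rightarrow> complex^2 \<Rightarrow> complex" where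
  "cmonom i e c w = (w$1) ^ i * (w$2) ^ e * cnj (w$2) ^ c"

definition dmonom :: "nat \<Rightarrow> nat \<Rightarrow> nat \<Rightarrow> complex^2 \<Rightarrow> complex^2 \<Rightarrow> complex" where
  "dmonom i e c w v = of_nat i * (w$1) ^ (i - 1) * v$1 * ((w$2) ^ e * cnj (w$2) ^ c)
     + (w$1) ^ i * (of_nat e * (w$2) ^ (e - 1) * v$2 * cnj (w$2) ^ c + (w$2) ^ e * (of_nat c * cnj (w$2) ^ (c - 1) * cnj (v$2)))"

lemma measurable_monom: "cmonom i e c \<in> borel_measurable borel"
  unfolding cmonom_def[abs_def] by (intro borel_measurable_continuous_onI continuous_intros)

lemma monom_derivative:
  assumes X: "generator X"
  shows "((\<lambda>t. cmonom i e c (one_param X t *v w)) has_vector_derivative dmonom i e c (one_param X t *v w) (X *v (one_param X t *v w))) (at t)"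
proof -
  note d = one_param_mult_vec_derivative[OF X, where z = w and t = t]
  have dc: "((\<lambda>t. cnj ((one_param X t *v w) $ 2)) has_vector_derivative cnj ((X *v (one_param X t *v w)) $ 2)) (at t)"
    by (rule bounded_linear.has_vector_derivative[OF bounded_linear_cnj d])
  have "((\<lambda>t. (one_param X t *v w) $ 1 ^ i * ((one_param X t *v w) $ 2 ^ e * cnj ((one_param X t *v w) $ 2) ^ c)) has_vector_derivative
      dmonom i e c (one_param X t *v w) (X *v (one_param X t *v w))) (at t)"
    by (rule has_vector_derivative_eq_rhs, (rule has_vector_derivative_mult has_vector_derivative_power d dc)+)
      (simp add: dmonom_def algebra_simps)
  then show ?thesis by (simp add: cmonom_def mult.assoc)
qed

lemma norm_component: "cmod ((w :: complex^2) $ i) \<le> norm w"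
  by (rule Finite_Cartesian_Product.norm_nth_le)

lemma norm_monom_le: "cmod (cmonom i e c w) \<le> (1 + norm w) ^ (i + e + c)"
proof -
  have "cmod (w $ i) \<le> 1 + norm w" for i using norm_component[of w i] by linarith
  then have "cmod (w$1) ^ i * cmod (w$2) ^ e * cmod (w$2) ^ c \<le> (1 + norm w) ^ i * (1 + norm w) ^ e * (1 + norm w) ^ c"
    by (intro mult_mono power_mono) auto
  then show ?thesis by (simp add: cmonom_def norm_mult norm_power power_add)
qed

lemma norm_dmonom_le:
  assumes v: "\<And>i. cmod (v $ i) \<le> norm w"
  shows "cmod (dmonom i e c w v) \<le> real (i + e + c) * (1 + norm w) ^ (i + e + c)"
proof -
  let ?N = "1 + norm w"
  have w: "cmod (w $ i) \<le> ?N" and v': "cmod (v $ i) \<le> ?N" for i using norm_component[of w i] v[of i] by linarith+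
  have drop: "real a * cmod (w $ i) ^ (a - 1) * cmod (v $ i) \<le> real a * ?N ^ a" for a i
  proof (cases a)
    case (Suc b)
    have "cmod (w $ i) ^ b * cmod (v $ i) \<le> ?N ^ b * ?N" using w v' by (intro mult_mono power_mono) auto
    then show ?thesis using Suc mult_left_mono[of "cmod (w $ i) ^ b * cmod (v $ i)" "?N ^ b * ?N" "real (Suc b)"] by (simp add: mult_ac)
  qed simp
  have pw: "cmod (w $ i) ^ a \<le> ?N ^ a" for a i using w by (intro power_mono) auto
  have "cmod (dmonom i e c w v) \<le> real i * cmod (w$1) ^ (i - 1) * cmod (v$1) * (cmod (w$2) ^ e * cmod (w$2) ^ c)
     + cmod (w$1) ^ i * (real e * cmod (w$2) ^ (e - 1) * cmod (v$2) * cmod (w$2) ^ c + cmod (w$2) ^ e * (real c * cmod (w$2) ^ (c - 1) * cmod (v$2)))"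
    unfolding dmonom_def
    by (intro order.trans[OF norm_triangle_ineq] add_mono, simp add: norm_mult norm_power,
        simp only: norm_mult, intro mult_mono order.trans[OF norm_triangle_ineq] add_mono) (simp_all add: norm_mult norm_power)
  also have "\<dots> \<le> real i * ?N ^ i * (?N ^ e * ?N ^ c) + ?N ^ i * (real e * ?N ^ e * ?N ^ c + ?N ^ e * (real c * ?N ^ c))"
    by (intro add_mono mult_mono drop pw) (auto intro!: mult_nonneg_nonneg add_nonneg_nonneg)
  also have "\<dots> = real (i + e + c) * ?N ^ (i + e + c)" by (simp add: power_add algebra_simps)
  finally show ?thesis .
qed

lemma gen_rot_mult_vec: "(gen_rot \<gamma> *v w) $ 1 = \<gamma> * w$2" "(gen_rot \<gamma> *v w) $ 2 = - cnj \<gamma> * w$1"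
  by (simp_all add: mvec2_nth gen_rot_nth)

lemma norm_gen_rot_mult_vec: "cmod \<gamma> = 1 \<Longrightarrow> cmod ((gen_rot \<gamma> *v w) $ i) \<le> norm w"
  using exhaust_2[of i] norm_component[of w 1] norm_component[of w 2] by (auto simp: gen_rot_mult_vec norm_mult)

text \<open>The combination of the directions \<open>1\<close> and \<open>\<i>\<close> that is linear over the complex numbers kills the derivatives
  of \<open>w$1\<close> and \<open>cnj (w$2)\<close>.\<close>

lemma dmonom_combination:
  "(1 / 2) * dmonom i e c w (gen_rot 1 *v w) + (\<i> / 2) * dmonom i e c w (gen_rot \<i> *v w) = - of_nat e * cmonom (Suc i) (e - 1) c w"
proof -
  have "\<i> * (\<i> * x) = - x" for x :: complex by (simp flip: mult.assoc)
  then show ?thesis by (simp add: dmonom_def cmonom_def gen_rot_mult_vec algebra_simps)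
qed

lemma fdiff_cmult: "(fdiff ^^ k) (\<lambda>j. c * y j) i = c * (fdiff ^^ k) y i" for c :: complex
  by (induction k arbitrary: i) (simp_all add: fdiff_def algebra_simps)

context admissible begin

definition moment :: "(motion \<Rightarrow> complex) \<Rightarrow> (complex^2 \<Rightarrow> complex) \<Rightarrow> cmatrix" where
  "moment F q = (\<lambda>a b. \<integral>w. q w * AK F w a b \<partial>lborel)"

lemma moment_monom_integrable:
  assumes F: "decaying F" shows "integrable lborel (\<lambda>w. cmonom i e c w * AK F w a b)"
  by (rule integrable_bounded_AK[OF F measurable_monom, of _ _ _ 1 "i + e + c"]) (use norm_monom_le in simp)

text \<open>\<open>AK\<close> is invariant under phases, so a weight that acquires a factor other
  than 1 integrates to 0.\<close>

lemma moment_phase: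
  assumes F: "smooth F" "central_on_U2 F" and c: "cmod c = 1" and q: "q \<in> borel_measurable borel"
    and \<kappa>: "\<And>w. q (mat c *v w) = \<kappa> * q w" "\<kappa> \<noteq> 1"
  shows "moment F q a b = 0"
proof -
  have "moment F q a b = (\<integral>w. q (mat c *v w) * AK F (mat c *v w) a b \<partial>lborel)"
    unfolding moment_def
    by (rule integral_U2_vec[OF mat_unit_U2[OF c], symmetric]) (intro borel_measurable_times q measurable_AK F)
  also have "\<dots> = (\<integral>w. \<kappa> * (q w * AK F w a b) \<partial>lborel)" by (simp only: \<kappa>(1) AK_phase[OF F c] mult.assoc)
  also have "\<dots> = \<kappa> * moment F q a b" by (simp only: moment_def integral_mult_right_zero)
  finally show ?thesis using \<kappa>(2) by simp
qed

text \<open>Write \<open>Re (w$2)\<close> as half the sum of \<open>w$2\<close> and its conjugate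
  and expand; by \<open>moment_phase\<close> the balanced monomial alone survives.\<close>

lemma moment_Re_power:
  assumes F: "decaying F" "central_on_U2 F"
  shows "moment F (\<lambda>w. of_real ((Re (w$2)) ^ (2 * k))) a b = (of_nat (2 * k choose k) / 2 ^ (2 * k)) * moment F (cmonom 0 k k) a b"
proof -
  have zero: "moment F (cmonom 0 l (2 * k - l)) a b = 0" if l: "l \<le> 2 * k" "l \<noteq> k" for l
  proof (rule moment_phase[OF decaying_smooth[OF F(1)] F(2) _ measurable_monom])
    define d where "d = 2 * real l - 2 * real k"
    \<comment> \<open>Chosen so that the monomial with exponents \<open>l\<close> and
      \<open>2 * k - l\<close>, whose difference is \<open>d\<close>, is multiplied by
      \<open>cis pi = - 1\<close>.\<close>
    define c where "c = cis (pi / d)"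
    have d: "d \<noteq> 0" using l by (simp add: d_def)
    have c1: "c ^ l = cis (real l * (pi / d))" unfolding c_def by (rule Complex.DeMoivre)
    have c2: "cnj c ^ (2 * k - l) = cis (real (2 * k - l) * (- (pi / d)))" unfolding c_def cis_cnj by (rule Complex.DeMoivre)
    have "c ^ l * cnj c ^ (2 * k - l) = cis (pi * (real l - real (2 * k - l)) / d)"
      unfolding c1 c2 cis_mult by (rule arg_cong[where f = cis]) (simp add: diff_divide_distrib algebra_simps)
    also have "real l - real (2 * k - l) = d" using l by (simp add: d_def of_nat_diff)
    finally have cc: "c ^ l * cnj c ^ (2 * k - l) = - 1" using d by (simp add: cis_pi)
    show "cmod c = 1" by (simp add: c_def)
    show "cmonom 0 l (2 * k - l) (mat c *v w) = (- 1) * cmonom 0 l (2 * k - l) w" for w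
    proof -
      have "cmonom 0 l (2 * k - l) (mat c *v w) = (c ^ l * cnj c ^ (2 * k - l)) * cmonom 0 l (2 * k - l) w"
        by (simp add: cmonom_def mvec2_nth mat2_nth power_mult_distrib)
      then show ?thesis unfolding cc .
    qed
  qed simp
  have "complex_of_real ((Re (w$2)) ^ (2 * k)) = (\<Sum>l\<le>2 * k. (of_nat (2 * k choose l) / 2 ^ (2 * k)) * cmonom 0 l (2 * k - l) w)" for w :: "complex^2"
  proof -
    have "complex_of_real (Re (w$2)) = (w$2 + cnj (w$2)) / 2" by (simp add: complex_add_cnj)
    then have "complex_of_real ((Re (w$2)) ^ (2 * k)) = (w$2 + cnj (w$2)) ^ (2 * k) / 2 ^ (2 * k)" by (simp only: of_real_power power_divide)
    also have "\<dots> = (\<Sum>l\<le>2 * k. of_nat (2 * k choose l) * (w$2) ^ l * cnj (w$2) ^ (2 * k - l)) / 2 ^ (2 * k)"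
      by (simp only: binomial_ring)
    finally show ?thesis by (simp add: cmonom_def sum_divide_distrib mult.assoc)
  qed
  then have "moment F (\<lambda>w. of_real ((Re (w$2)) ^ (2 * k))) a b =
      (\<integral>w. (\<Sum>l\<le>2 * k. (of_nat (2 * k choose l) / 2 ^ (2 * k)) * (cmonom 0 l (2 * k - l) w * AK F w a b)) \<partial>lborel)"
    by (simp only: moment_def sum_distrib_right mult.assoc)
  also have "\<dots> = (\<Sum>l\<le>2 * k. (of_nat (2 * k choose l) / 2 ^ (2 * k)) * moment F (cmonom 0 l (2 * k - l)) a b)"
    unfolding moment_def
    by (subst Bochner_Integration.integral_sum) (intro integrable_mult_right moment_monom_integrable F, simp only: integral_mult_right_zero)
  also have "\<dots> = (\<Sum>l\<le>2 * k. if l = k then (of_nat (2 * k choose k) / 2 ^ (2 * k)) * moment F (cmonom 0 k k) a b else 0)"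
    by (intro sum.cong refl) (use zero in auto)
  finally show ?thesis by simp
qed

text \<open>Infinitesimal equivariance: rotating the argument of the monomial conjugates the moment
  matrix, and the derivative of a conjugation is a commutator.\<close>

lemma moment_rot:
  assumes F: "decaying F" "central_on_U2 F" and \<gamma>: "cmod \<gamma> = 1" and ab: "a \<le> n" "b \<le> n"
  shows "(\<integral>w. dmonom i e c w (gen_rot \<gamma> *v w) * AK F w a b \<partial>lborel) =
    (\<Sum>d\<le>n. rot_matrix n \<gamma> a d * moment F (cmonom i e c) d b) - (\<Sum>d\<le>n. moment F (cmonom i e c) a d * rot_matrix n \<gamma> d b)"
proof -
  let ?X = "gen_rot \<gamma>" and ?M = "moment F (cmonom i e c)"
  have sF: "smooth F" by (rule decaying_smooth[OF F(1)])
  have X: "generator ?X" by (rule generator_rot[OF \<gamma>])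
  have E: "one_param ?X t \<in> U2" for t by (rule one_param_U2[OF X])
  let ?I = "\<lambda>t a b. \<integral>w. cmonom i e c (one_param ?X t *v w) * AK F w a b \<partial>lborel"
  have mo: "(\<lambda>w. cmonom i e c (one_param ?X t *v w)) \<in> borel_measurable borel" for t
  proof -
    have "(\<lambda>w. one_param ?X t *v w) \<in> borel_measurable borel"
      by (intro borel_measurable_continuous_onI linear_continuous_on)
        (use orthogonal_transformation_linear[OF U2_orthogonal_transformation[OF E]] in \<open>simp add: linear_conv_bounded_linear\<close>)
    from measurable_compose[OF this measurable_monom] show ?thesis .
  qed
  have mob: "cmod (cmonom i e c (one_param ?X t *v w)) \<le> 1 * (1 + norm w) ^ (i + e + c)" for t w
    using norm_monom_le[of i e c "one_param ?X t *v w"] by (simp add: norm_U2_vec[OF E])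
  have I: "?I t a b = mprod n (mprod n (TU (one_param ?X (- t))) ?M) (TU (one_param ?X t)) a b" for t a b
  proof -
    let ?l = "one_param ?X (- t)"
    have ct: "conj_transpose ?l = one_param ?X t" using conj_transpose_one_param[OF X, of "- t"] by simp
    have inv: "one_param ?X t *v (?l *v w) = w" for w
      by (simp add: matrix_vector_mul_assoc one_param_mult_minus[OF X])
    have "?I t a b = (\<integral>w. cmonom i e c (one_param ?X t *v (?l *v w)) * AK F (?l *v w) a b \<partial>lborel)"
      by (rule integral_U2_vec[OF E, symmetric]) (intro borel_measurable_times mo measurable_AK sF)
    also have "\<dots> = (\<integral>w. (\<Sum>d\<le>n. \<Sum>g\<le>n. TU ?l a g * (cmonom i e c w * AK F w g d) * TU (one_param ?X t) d b) \<partial>lborel)"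
      unfolding inv AK_conjugate[OF sF F(2) E] ct
      by (simp add: mprod_def sum_distrib_left sum_distrib_right mult_ac)
    also have "\<dots> = (\<Sum>d\<le>n. (\<integral>w. (\<Sum>g\<le>n. TU ?l a g * (cmonom i e c w * AK F w g d) * TU (one_param ?X t) d b) \<partial>lborel))"
      by (intro Bochner_Integration.integral_sum Bochner_Integration.integrable_sum integrable_mult_left integrable_mult_right moment_monom_integrable F)
    also have "\<dots> = (\<Sum>d\<le>n. \<Sum>g\<le>n. (\<integral>w. TU ?l a g * (cmonom i e c w * AK F w g d) * TU (one_param ?X t) d b \<partial>lborel))"
      by (intro sum.cong refl Bochner_Integration.integral_sum integrable_mult_left integrable_mult_right moment_monom_integrable F)
    finally show ?thesis by (simp add: mprod_def moment_def sum_distrib_right)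
  qed
  \<comment> \<open>Multiplying by one of the conjugating factors moves it to the other side, so
    that only products of two factors have to be differentiated.\<close>
  have key: "(\<Sum>d\<le>n. ?I t a d * TU (one_param ?X (- t)) d b) = (\<Sum>d\<le>n. TU (one_param ?X (- t)) a d * ?M d b)" for t
  proof -
    have "(\<Sum>d\<le>n. ?I t a d * TU (one_param ?X (- t)) d b) = mprod n (mprod n (mprod n (TU (one_param ?X (- t))) ?M) (TU (one_param ?X t))) (TU (one_param ?X (- t))) a b"
      by (simp only: I mprod_def[of n "mprod n (mprod n (TU (one_param ?X (- t))) ?M) (TU (one_param ?X t))"])
    also have "\<dots> = mprod n (mprod n (TU (one_param ?X (- t))) ?M) (TU (mat 1)) a b"
      by (simp only: mprod_assoc TU_mprod[OF E E, symmetric] one_param_mult_minus[OF X])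
    also have "\<dots> = mprod n (TU (one_param ?X (- t))) ?M a b"
      by (subst mprod_one_right) (simp_all add: mprod_def moment_def AK_outside)
    finally show ?thesis by (simp add: mprod_def)
  qed
  let ?q = "i + e + c"
  obtain C where C: "C \<ge> 0" "\<And>a b z. (1 + norm z) ^ ?q * cmod (AK F z a b) \<le> C * wt z" using AK_weighted[OF F(1), of ?q] by blast
  have dI: "((\<lambda>t. ?I t a d) has_vector_derivative
      (\<integral>w. dmonom i e c (one_param ?X 0 *v w) (?X *v (one_param ?X 0 *v w)) * AK F w a d \<partial>lborel)) (at 0)" for d
  proof (rule has_vector_derivative_integral[where \<delta> = 1 and G = "\<lambda>w. real ?q * C * wt w"])
    show "integrable lborel (\<lambda>w. cmonom i e c (one_param ?X t *v w) * AK F w a d)" for t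
      by (rule integrable_bounded_AK[OF F(1) mo mob])
    show "integrable lborel (\<lambda>w. real ?q * C * wt w)" by (intro integrable_mult_right integrable_wt)
    fix t and w :: "complex^2"
    show "((\<lambda>t. cmonom i e c (one_param ?X t *v w) * AK F w a d) has_vector_derivative
        dmonom i e c (one_param ?X t *v w) (?X *v (one_param ?X t *v w)) * AK F w a d) (at t)"
      by (intro has_vector_derivative_mult_left monom_derivative X)
    have "cmod (dmonom i e c (one_param ?X t *v w) (?X *v (one_param ?X t *v w))) \<le> real ?q * (1 + norm w) ^ ?q"
      using norm_dmonom_le[OF norm_gen_rot_mult_vec[OF \<gamma>], of i e c "one_param ?X t *v w"] by (simp add: norm_U2_vec[OF E])
    then have "cmod (dmonom i e c (one_param ?X t *v w) (?X *v (one_param ?X t *v w)) * AK F w a d) \<le> (real ?q * (1 + norm w) ^ ?q) * cmod (AK F w a d)"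
      unfolding norm_mult by (rule mult_right_mono) simp
    also have "\<dots> \<le> real ?q * (C * wt w)" unfolding mult.assoc by (intro mult_left_mono C) simp
    finally show "cmod (dmonom i e c (one_param ?X t *v w) (?X *v (one_param ?X t *v w)) * AK F w a d) \<le> real ?q * C * wt w" by (simp only: mult.assoc)
  qed simp
  let ?D = "\<lambda>d. \<integral>w. dmonom i e c w (?X *v w) * AK F w a d \<partial>lborel"
  have I0: "?I 0 a d = ?M a d" for d by (simp add: one_param_0 moment_def)
  have T0: "TU (one_param ?X (- 0)) d b = (if d = b then 1 else 0)" if "d \<le> n" for d using that ab by (simp add: one_param_0 TU_one)
  have "((\<lambda>t. \<Sum>d\<le>n. ?I t a d * TU (one_param ?X (- t)) d b) has_vector_derivative
      (\<Sum>d\<le>n. ?I 0 a d * rot_matrix n \<gamma> d b + ?D d * TU (one_param ?X (- 0)) d b)) (at 0)"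
  proof (rule has_vector_derivative_sum)
    fix d assume "d \<in> {..n}"
    then show "((\<lambda>t. ?I t a d * TU (one_param ?X (- t)) d b) has_vector_derivative
        ?I 0 a d * rot_matrix n \<gamma> d b + ?D d * TU (one_param ?X (- 0)) d b) (at 0)"
      using has_vector_derivative_mult[OF dI[of d] TU_one_param_rot[OF \<gamma> ab(2), of d]] by (simp add: one_param_0)
  qed
  moreover have "((\<lambda>t. \<Sum>d\<le>n. TU (one_param ?X (- t)) a d * ?M d b) has_vector_derivative (\<Sum>d\<le>n. rot_matrix n \<gamma> a d * ?M d b)) (at 0)"
    by (intro has_vector_derivative_sum has_vector_derivative_mult_left TU_one_param_rot \<gamma> ab) auto
  ultimately have "(\<Sum>d\<le>n. ?I 0 a d * rot_matrix n \<gamma> d b + ?D d * TU (one_param ?X (- 0)) d b) = (\<Sum>d\<le>n. rot_matrix n \<gamma> a d * ?M d b)"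
    unfolding key by (rule vector_derivative_unique_at)
  moreover have "(\<Sum>d\<le>n. ?I 0 a d * rot_matrix n \<gamma> d b + ?D d * TU (one_param ?X (- 0)) d b) = (\<Sum>d\<le>n. ?M a d * rot_matrix n \<gamma> d b) + ?D b"
  proof -
    have "(\<Sum>d\<le>n. ?D d * TU (one_param ?X (- 0)) d b) = (\<Sum>d\<le>n. if d = b then ?D b else 0)"
      by (rule sum.cong[OF refl]) (use T0 in auto)
    also have "\<dots> = ?D b" using ab by simp
    finally show ?thesis by (simp only: sum.distrib I0)
  qed
  ultimately show ?thesis by (simp add: algebra_simps)
qed

lemma rot_matrix_combination:
  "(1 / 2) * rot_matrix n 1 x y + (\<i> / 2) * rot_matrix n \<i> x y = - (if x = Suc y then ladder n y else 0)"
proof -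
  have "\<i> * (\<i> * z) = - z" for z :: complex by (simp flip: mult.assoc)
  then show ?thesis by (simp add: rot_matrix_def algebra_simps)
qed

text \<open>The complex combination of \<open>moment_rot\<close> for \<open>\<gamma> = 1\<close> and
  \<open>\<gamma> = \<i>\<close>: a commutator with the raising operator on one side, the derivation
  of \<open>dmonom_combination\<close> on the other.\<close>

lemma moment_raise:
  assumes F: "decaying F" "central_on_U2 F" and ab: "Suc a \<le> n" "b \<le> n"
  shows "of_nat e * moment F (cmonom (Suc i) (e - 1) c) (Suc a) b =
    ladder n a * moment F (cmonom i e c) a b - ladder n b * moment F (cmonom i e c) (Suc a) (Suc b)"
proof -
  let ?M = "moment F (cmonom i e c)" and ?q = "i + e + c"
  let ?D = "\<lambda>\<gamma>. \<integral>w. dmonom i e c w (gen_rot \<gamma> *v w) * AK F w (Suc a) b \<partial>lborel"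
  have di: "integrable lborel (\<lambda>w. dmonom i e c w (gen_rot \<gamma> *v w) * AK F w (Suc a) b)" if \<gamma>: "cmod \<gamma> = 1" for \<gamma>
  proof (rule integrable_bounded_AK[OF F(1)])
    show "(\<lambda>w. dmonom i e c w (gen_rot \<gamma> *v w)) \<in> borel_measurable borel"
      unfolding dmonom_def gen_rot_mult_vec by (intro borel_measurable_continuous_onI continuous_intros)
    show "cmod (dmonom i e c w (gen_rot \<gamma> *v w)) \<le> real ?q * (1 + norm w) ^ ?q" for w
      by (rule norm_dmonom_le[OF norm_gen_rot_mult_vec[OF \<gamma>]])
  qed
  have "- of_nat e * moment F (cmonom (Suc i) (e - 1) c) (Suc a) b = (\<integral>w. - of_nat e * (cmonom (Suc i) (e - 1) c w * AK F w (Suc a) b) \<partial>lborel)"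
    by (simp only: moment_def integral_mult_right_zero)
  also have "\<dots> = (\<integral>w. (1 / 2) * (dmonom i e c w (gen_rot 1 *v w) * AK F w (Suc a) b) + (\<i> / 2) * (dmonom i e c w (gen_rot \<i> *v w) * AK F w (Suc a) b) \<partial>lborel)"
    by (simp only: mult.assoc[symmetric] distrib_right[symmetric] dmonom_combination)
  also have "\<dots> = (1 / 2) * ?D 1 + (\<i> / 2) * ?D \<i>"
    unfolding integral_mult_right_zero[symmetric]
    by (rule Bochner_Integration.integral_add; intro integrable_mult_right di; simp)
  also have "\<dots> = (\<Sum>d\<le>n. ((1 / 2) * rot_matrix n 1 (Suc a) d + (\<i> / 2) * rot_matrix n \<i> (Suc a) d) * ?M d b)
      - (\<Sum>d\<le>n. ?M (Suc a) d * ((1 / 2) * rot_matrix n 1 d b + (\<i> / 2) * rot_matrix n \<i> d b))"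
  proof -
    have 1: "?D 1 = (\<Sum>d\<le>n. rot_matrix n 1 (Suc a) d * ?M d b) - (\<Sum>d\<le>n. ?M (Suc a) d * rot_matrix n 1 d b)"
      and 2: "?D \<i> = (\<Sum>d\<le>n. rot_matrix n \<i> (Suc a) d * ?M d b) - (\<Sum>d\<le>n. ?M (Suc a) d * rot_matrix n \<i> d b)"
      by (rule moment_rot[OF F _ ab]; simp)+
    show ?thesis unfolding 1 2 by (simp add: right_diff_distrib sum_distrib_left distrib_right distrib_left sum.distrib mult_ac)
  qed
  also have "\<dots> = (\<Sum>d\<le>n. if d = a then - ladder n a * ?M a b else 0) - (\<Sum>d\<le>n. if d = Suc b then - ladder n b * ?M (Suc a) (Suc b) else 0)"
    unfolding rot_matrix_combination by (intro arg_cong2[of _ _ _ _ minus] sum.cong refl) auto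
  \<comment> \<open>For \<open>b = n\<close> the second sum is empty, in agreement with
    \<open>ladder n n = 0\<close>.\<close>
  also have "\<dots> = - ladder n a * ?M a b + ladder n b * ?M (Suc a) (Suc b)"
    using ab by (auto simp: ladder_top)
  finally have *: "- of_nat e * moment F (cmonom (Suc i) (e - 1) c) (Suc a) b = - ladder n a * ?M a b + ladder n b * ?M (Suc a) (Suc b)" .
  then have "- (of_nat e * moment F (cmonom (Suc i) (e - 1) c) (Suc a) b) = - (ladder n a * ?M a b - ladder n b * ?M (Suc a) (Suc b))" by simp
  then show ?thesis by (simp only: neg_equal_iff_equal)
qed

text \<open>Iteration of \<open>moment_raise\<close> along subdiagonals. Both terms on its right
  complete the same product of ladder factors, so that plain differences of the diagonal
  remain.\<close>

lemma moment_differences: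
  assumes F: "decaying F" "central_on_U2 F"
  shows "i \<le> Suc k \<Longrightarrow> b + i \<le> n \<Longrightarrow> (\<Prod>l<i. of_nat (k - l)) * moment F (cmonom i (k - i) k) (b + i) b =
    (-1) ^ i * (\<Prod>l<i. ladder n (b + l)) * (fdiff ^^ i) (\<lambda>j. moment F (cmonom 0 k k) j j) b"
proof (induction i arbitrary: b)
  case (Suc i)
  let ?m = "\<lambda>b. moment F (cmonom i (k - i) k) (b + i) b" and ?f = "(fdiff ^^ i) (\<lambda>j. moment F (cmonom 0 k k) j j)"
  let ?P = "\<Prod>l<i. of_nat (k - l) :: complex" and ?L = "\<lambda>b. \<Prod>l<i. ladder n (b + l)"
  have s: "of_nat (k - i) * moment F (cmonom (Suc i) (k - Suc i) k) (b + Suc i) b = ladder n (b + i) * ?m b - ladder n b * ?m (Suc b)"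
    using moment_raise[OF F, of "b + i" b "k - i" i k] Suc.prems by simp
  have L: "ladder n b * ?L (Suc b) = (\<Prod>l<Suc i. ladder n (b + l))"
    unfolding prod.lessThan_Suc_shift by simp
  have L': "ladder n (b + i) * ?L b = (\<Prod>l<Suc i. ladder n (b + l))" by simp
  have "(\<Prod>l<Suc i. of_nat (k - l)) * moment F (cmonom (Suc i) (k - Suc i) k) (b + Suc i) b
      = ladder n (b + i) * (?P * ?m b) - ladder n b * (?P * ?m (Suc b))"
    unfolding prod.lessThan_Suc mult.assoc s by (simp add: algebra_simps)
  also have "\<dots> = (-1) ^ i * (ladder n (b + i) * ?L b) * ?f b - (-1) ^ i * (ladder n b * ?L (Suc b)) * ?f (Suc b)"
    using Suc.IH[of b] Suc.IH[of "Suc b"] Suc.prems by (simp add: mult_ac)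
  also have "\<dots> = (-1) ^ Suc i * (\<Prod>l<Suc i. ladder n (b + l)) * (?f (Suc b) - ?f b)"
    unfolding L L' by (simp add: algebra_simps)
  also have "?f (Suc b) - ?f b = (fdiff ^^ Suc i) (\<lambda>j. moment F (cmonom 0 k k) j j) b"
    by (simp add: fdiff_def[of ?f])
  finally show ?case .
qed simp

text \<open>After \<open>k + 1\<close> steps the product on the left of
  \<open>moment_differences\<close> contains the factor \<open>k - k = 0\<close>, while the ladder
  factors on the right are nonzero because their indices stay below \<open>n\<close>.\<close>

lemma radial_compatible:
  assumes F: "decaying F" "central_on_U2 F" and i: "i + Suc k \<le> n"
  shows "(fdiff ^^ Suc k) (\<lambda>j. (dv ^^ k) (radial F j 0) 0) i = 0"
proof -
  let ?\<mu> = "\<lambda>j. moment F (cmonom 0 k k) j j"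
  have "(\<Prod>l<Suc k. of_nat (k - l)) = (0 :: complex)" by simp
  then have "(\<Prod>l<Suc k. ladder n (i + l)) * (fdiff ^^ Suc k) ?\<mu> i = 0"
    using moment_differences[OF F, of "Suc k" k i] i by (simp del: funpow.simps)
  moreover have "ladder n (i + l) \<noteq> 0" if "l < Suc k" for l
  proof -
    have "Suc (i + l) * (n - (i + l)) \<noteq> 0" using that i by simp
    then show ?thesis unfolding ladder_def of_real_eq_0_iff real_sqrt_eq_0_iff of_nat_eq_0_iff .
  qed
  ultimately have 0: "(fdiff ^^ Suc k) ?\<mu> i = 0" by (simp del: funpow.simps prod.lessThan_Suc)
  have "(dv ^^ k) (radial F j 0) 0 = ((dv ^^ k) cos_sqrt 0 * (of_nat (2 * k choose k) / 2 ^ (2 * k))) * ?\<mu> j" for j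
  proof -
    have "(dv ^^ k) (radial F j 0) 0 = (dv ^^ k) cos_sqrt 0 * moment F (\<lambda>w. of_real ((Re (w$2)) ^ (2 * k))) j j"
      unfolding dvn_radial[OF F(1)] radial_def moment_def by (simp only: mult_zero_left mult.assoc integral_mult_right_zero)
    then show ?thesis by (simp only: moment_Re_power[OF F] mult.assoc)
  qed
  then show ?thesis by (simp only: fdiff_cmult 0 mult_zero_right)
qed

end

theorem proposition8p8:
  fixes f :: "motion \<Rightarrow> complex" and N :: nat
  assumes "f \<in> schwartz_G_central"
  shows "\<exists>u :: int \<Rightarrow> nat \<Rightarrow> real \<times> real \<Rightarrow> complex.
    (\<forall>(m, n)\<in>E_index. schwartz_extension n (G_transform m n (K_component m n f)) (u m n)) \<and>
    rapidly_decaying (\<lambda>m n. schwartz_norm N (u m n))"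
proof -
  have "f \<in> schwartz_G" and central: "K_central f" using assms by (simp_all add: schwartz_G_central_def)
  then obtain F where Ff: "\<And>k z. k \<in> U2 \<Longrightarrow> F (k, z) = f (k, z)" and F: "decaying F"
    unfolding schwartz_G_def decaying_def by blast
  have F2: "central_on_U2 F"
    unfolding central_on_U2_def
  proof (intro ballI allI)
    fix l k z assume lk: "l \<in> U2" "k \<in> U2"
    then have "f (l ** k ** conj_transpose l, l *v z) = f (k, z)"
      using central U2_matrix_inv[OF lk(1)] unfolding K_central_def by metis
    then show "F (l ** k ** conj_transpose l, l *v z) = F (k, z)"
      using lk by (simp add: Ff U2_mult U2_conj_transpose)
  qed
  \<comment> \<open>\<open>F\<close> and \<open>f\<close> agree over \<open>U2\<close>, which
    carries the Haar measure, so for \<open>k\<close> in \<open>U2\<close> the integrals see the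
    same values.\<close>
  have K: "K_component m n f (k, z) = K_component m n F (k, z)" if "k \<in> U2" for m n k z
  proof -
    have "(\<integral>l. f (k ** matrix_inv l, z) * cnj (chi m n l) \<partial>haar_U2) = (\<integral>l. F (k ** matrix_inv l, z) * cnj (chi m n l) \<partial>haar_U2)"
      by (rule Bochner_Integration.integral_cong[OF refl])
        (use that in \<open>simp add: space_haar Ff U2_matrix_inv U2_mult U2_conj_transpose\<close>)
    then show ?thesis by (simp add: K_component_def)
  qed
  have A: "A_transform m n (K_component m n f) z = A_transform m n (K_component m n F) z" for m n z
    unfolding A_transform_def
    by (intro ext Bochner_Integration.integral_cong refl) (simp add: space_haar K)
  \<comment> \<open>The value 0 off \<open>E_index\<close> is a default:
    \<open>schwartz_extension_family\<close> asks for smoothness for all \<open>m\<close> and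
    \<open>n\<close>.\<close>
  define h where "h m n j = (if (m, n) \<in> E_index then admissible.radial m n F j 0 else (\<lambda>_. 0))" for m n j
  have adm: "admissible m n" if "(m, n) \<in> E_index" for m n using that by unfold_locales
  have h: "h m n j = admissible.radial m n F j 0" if "(m, n) \<in> E_index" for m n j using that by (simp add: h_def)
  have "sm UNIV (h m n j)" for m n j
    using admissible.sm_radial[OF adm F] sm_const[OF open_UNIV] by (simp add: h_def)
  moreover have "\<exists>C. \<forall>(m, n)\<in>E_index. \<forall>j\<le>n. \<forall>t\<ge>0. (1 + t) ^ p * cmod ((dv ^^ k) (h m n j) t) \<le> C / (1 + \<bar>real_of_int m\<bar> + real n) ^ r" for k p r
  proof -
    obtain C where C: "\<forall>(m, n)\<in>E_index. \<forall>j. \<forall>t\<ge>0. (1 + t) ^ p * cmod (admissible.radial m n F j k t) \<le> C / (1 + \<bar>real_of_int m\<bar> + real n) ^ r"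
      using radial_schwartz[OF F] by blast
    have "(1 + t) ^ p * cmod ((dv ^^ k) (h m n j) t) \<le> C / (1 + \<bar>real_of_int m\<bar> + real n) ^ r"
      if mn: "(m, n) \<in> E_index" and "0 \<le> t" for m n j t
      using bspec[OF C mn] that by (simp add: h[OF mn] admissible.dvn_radial[OF adm[OF mn] F])
    then show ?thesis by (intro exI[of _ C]) auto
  qed
  moreover have "(fdiff ^^ Suc k) (\<lambda>j. (dv ^^ k) (h m n j) 0) i = 0" if mn: "(m, n) \<in> E_index" and i: "i + Suc k \<le> n" for m n k i
    unfolding h[OF mn] by (rule admissible.radial_compatible[OF adm[OF mn] F F2 i])
  ultimately obtain u where u: "\<forall>(m, n)\<in>E_index. u m n \<in> schwartz_R2 \<and> (\<forall>j\<le>n. \<forall>t\<ge>0. u m n (t, slope n j * t) = h m n j t)"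
      "rapidly_decaying (\<lambda>m n. schwartz_norm N (u m n))"
    using schwartz_extension_family[of h N] by blast
  have "schwartz_extension n (G_transform m n (K_component m n f)) (u m n)" if mn: "(m, n) \<in> E_index" for m n
  proof -
    interpret admissible m n by (rule adm[OF mn])
    have um: "u m n \<in> schwartz_R2" "\<And>j t. j \<le> n \<Longrightarrow> 0 \<le> t \<Longrightarrow> u m n (t, slope n j * t) = h m n j t"
      using bspec[OF u(1) mn] by auto
    have "G_transform m n (K_component m n f) t j = h m n j t" if "j \<le> n" "0 \<le> t" for j t
      unfolding h[OF mn] using that
      by (intro radial_G_transform F F2) (simp_all add: A A_K_component[OF decaying_smooth[OF F]])
    moreover have "- real n + 2 * real j = slope n j" for j by (simp add: slope_def)
    ultimately show ?thesis using um by (simp add: schwartz_extension_def)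
  qed
  then show ?thesis using u(2) by (intro exI[of _ u]) auto
qed


end
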